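(* Let $R$ be a principal ideal domain with field of fractions $K$, let $N\geq 1$, and let $\phi:\mathbb{P}^N\to\mathbb{P}^N$ be a morphism defined over $K$. Then $\phi$ has a model $\Psi:\mathbb{A}^{N+1}\to\mathbb{A}^{N+1}$ whose coefficients lie in $R$ and which is $\mathfrak{p}$-minimal for every nonzero prime ideal $\mathfrak{p}$ of $R$.
   Context: A morphism $\phi:\mathbb{P}^N\to\mathbb{P}^N$ over a field $F$ can be written $\phi(x_0:\dots:x_N)=(\Phi_0(\mathbf{x}):\dots:\Phi_N(\mathbf{x}))$ where $\Phi=(\Phi_0,\dots,\Phi_N):\mathbb{A}^{N+1}\to\mathbb{A}^{N+1}$ consists of forms of a common degree $d\geq1$ over $F$ with $\Phi(\mathbf{a})\neq\mathbf{0}$ for all $\mathbf{a}\in\mathbb{A}^{N+1}(\bar F)\setminus\{\mathbf 0\}$, equivalently $\mathrm{Res}(\Phi)\neq 0$, where $\mathrm{Res}(\Phi)$ is the (Macaulay) resultant of $\Phi_0,\dots,\Phi_N$, a homogeneous integral polynomial in the coefficients of the $\Phi_n$. Such $\Phi$ is called a homogeneous lift of $\phi$; it is unique up to a nonzero scalar in $F$. A model for $\phi$ over $F$ is a map $\Psi=A\circ\Phi\circ A^{-1}$ where $\Phi$ is a homogeneous lift of $\phi$ and $A\in\mathrm{GL}_{N+1}(F)$. For a nonzero prime $\mathfrak{p}$ of $R$, let $K_\mathfrak{p}$ be the completion of $K$ for the $\mathfrak{p}$-adic valuation $\mathrm{ord}_\mathfrak{p}$ and $R_\mathfrak{p}$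 its valuation ring. A model $\Psi$ of $\phi$ over $K_\mathfrak{p}$ is $\mathfrak{p}$-integral if all coefficients of all $\Psi_n$ lie in $R_\mathfrak{p}$; a $\mathfrak{p}$-integral model $\Psi$ is $\mathfrak{p}$-minimal if $\mathrm{ord}_\mathfrak{p}(\mathrm{Res}(\Psi))$ is minimal among all $\mathfrak{p}$-integral models of $\phi$ over $K_\mathfrak{p}$. *)

theory Defs
  imports
    "HOL-Algebra.Algebraic_Closure"
    "HOL-Algebra.Ideal_Product"
    "HOL-Algebra.IntRing"
    "HOL-Library.Poly_Mapping"
    "HOL-Library.Multiset_Order"
    "HOL-Library.Product_Lexorder"
    "HOL-Library.Extended_Real"
    "Jordan_Normal_Form.Determinant"
begin

section \<open>Polynomials over a ring\<close>

text \<open>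
  As in \<^theory>\<open>HOL-Algebra.Indexed_Polynomials\<close>, monomials are multisets of indeterminates
  (so \<^term>\<open>size\<close> is the degree and \<open>+\<close> is multiplication of monomials) and a polynomial is its
  coefficient function. The record below supplies the product, which is missing there.
\<close>

definition mpoly_ring :: "('k, 'm) ring_scheme \<Rightarrow> ('v multiset \<Rightarrow> 'k) ring" where
  "mpoly_ring F =
    \<lparr> carrier = {p. (\<forall>m. p m \<in> carrier F) \<and> finite {m. p m \<noteq> \<zero>\<^bsub>F\<^esub>}},
      monoid.mult = (\<lambda>p q m. \<Oplus>\<^bsub>F\<^esub> a \<in> {a. a \<subseteq># m}. p a \<otimes>\<^bsub>F\<^esub> q (m - a)),
      one = ring.indexed_const F \<one>\<^bsub>F\<^esub>,
      ring.zero = ring.indexed_const F \<zero>\<^bsub>F\<^esub>,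
      add = ring.indexed_padd F \<rparr>"

text \<open>The value of \<open>p \<in> F[x]\<close> at a point \<open>a\<close> with coordinates in \<open>S\<close>, where \<open>\<sigma> : F \<rightarrow> S\<close>.\<close>

definition mpoly_eval ::
  "('k, 'm) ring_scheme \<Rightarrow> ('s, 'n) ring_scheme \<Rightarrow> ('k \<Rightarrow> 's) \<Rightarrow> ('v multiset \<Rightarrow> 'k) \<Rightarrow> ('v \<Rightarrow> 's) \<Rightarrow> 's"
  where
  "mpoly_eval F S \<sigma> p a =
    (\<Oplus>\<^bsub>S\<^esub> m \<in> {m. p m \<noteq> \<zero>\<^bsub>F\<^esub>}.
       \<sigma> (p m) \<otimes>\<^bsub>S\<^esub> (\<Otimes>\<^bsub>S\<^esub> v \<in> set_mset m. a v [^]\<^bsub>S\<^esub> count m v))"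

definition monomials :: "nat \<Rightarrow> nat \<Rightarrow> nat multiset set" where
  "monomials N d = {m. set_mset m \<subseteq> {..N} \<and> size m = d}"

definition forms :: "('k, 'm) ring_scheme \<Rightarrow> nat \<Rightarrow> nat \<Rightarrow> (nat multiset \<Rightarrow> 'k) set" where
  "forms F N d = {p \<in> carrier (mpoly_ring F). \<forall>m. p m \<noteq> \<zero>\<^bsub>F\<^esub> \<longrightarrow> m \<in> monomials N d}"


section \<open>Polynomial maps of affine space and morphisms of projective space\<close>

text \<open>
  A polynomial map \<open>\<bbbA>\<^sup>N\<^sup>+\<^sup>1 \<rightarrow> \<bbbA>\<^sup>N\<^sup>+\<^sup>1\<close> is the tuple of its components, indexed by \<open>{..N}\<close>
  and \<^term>\<open>undefined\<close> elsewhere, so that equality of tuples is equality of maps.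
\<close>

type_synonym 'k poly_map = "nat \<Rightarrow> nat multiset \<Rightarrow> 'k"

definition compose_map :: "('k, 'm) ring_scheme \<Rightarrow> nat \<Rightarrow> 'k poly_map \<Rightarrow> 'k poly_map \<Rightarrow> 'k poly_map"
  where
  "compose_map F N \<Phi> \<Psi> = (\<lambda>i\<in>{..N}. mpoly_eval F (mpoly_ring F) (ring.indexed_const F) (\<Phi> i) \<Psi>)"

definition linear_map :: "('k, 'm) ring_scheme \<Rightarrow> nat \<Rightarrow> (nat \<Rightarrow> nat \<Rightarrow> 'k) \<Rightarrow> 'k poly_map" where
  "linear_map F N A = (\<lambda>i\<in>{..N}. \<lambda>m. \<Oplus>\<^bsub>F\<^esub> j \<in> {..N}. if m = {#j#} then A i j else \<zero>\<^bsub>F\<^esub>)"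

definition scale_map :: "('k, 'm) ring_scheme \<Rightarrow> nat \<Rightarrow> 'k \<Rightarrow> 'k poly_map \<Rightarrow> 'k poly_map" where
  "scale_map F N c \<Phi> = (\<lambda>i\<in>{..N}. \<lambda>m. c \<otimes>\<^bsub>F\<^esub> \<Phi> i m)"

definition map_coeffs :: "nat \<Rightarrow> ('k \<Rightarrow> 'l) \<Rightarrow> 'k poly_map \<Rightarrow> 'l poly_map" where
  "map_coeffs N \<iota> \<Phi> = (\<lambda>i\<in>{..N}. \<lambda>m. \<iota> (\<Phi> i m))"

definition inverse_matrices ::
  "('k, 'm) ring_scheme \<Rightarrow> nat \<Rightarrow> (nat \<Rightarrow> nat \<Rightarrow> 'k) \<Rightarrow> (nat \<Rightarrow> nat \<Rightarrow> 'k) \<Rightarrow> bool" where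
  "inverse_matrices F N A B \<longleftrightarrow>
    (\<forall>i\<le>N. \<forall>j\<le>N. A i j \<in> carrier F \<and> B i j \<in> carrier F \<and>
       (\<Oplus>\<^bsub>F\<^esub> k \<in> {..N}. A i k \<otimes>\<^bsub>F\<^esub> B k j) = (if i = j then \<one>\<^bsub>F\<^esub> else \<zero>\<^bsub>F\<^esub>) \<and>
       (\<Oplus>\<^bsub>F\<^esub> k \<in> {..N}. B i k \<otimes>\<^bsub>F\<^esub> A k j) = (if i = j then \<one>\<^bsub>F\<^esub> else \<zero>\<^bsub>F\<^esub>))"

text \<open>
  \<^term>\<open>field.alg_closure F\<close> contains \<open>F\<close> through the embedding \<^term>\<open>ring.indexed_const F\<close>.
\<close>

definition nondegenerate :: "('k, 'm) ring_scheme \<Rightarrow> nat \<Rightarrow> nat \<Rightarrow> 'k poly_map \<Rightarrow> bool" where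
  "nondegenerate F N d \<Phi> \<longleftrightarrow>
    \<Phi> \<in> {..N} \<rightarrow>\<^sub>E forms F N d \<and>
    (\<forall>a \<in> {..N} \<rightarrow> carrier (field.alg_closure F).
       (\<exists>i\<le>N. a i \<noteq> \<zero>\<^bsub>field.alg_closure F\<^esub>) \<longrightarrow>
       (\<exists>i\<le>N. mpoly_eval F (field.alg_closure F) (ring.indexed_const F) (\<Phi> i) a
                \<noteq> \<zero>\<^bsub>field.alg_closure F\<^esub>))"

text \<open>
  A morphism \<open>\<bbbP>\<^sup>N \<rightarrow> \<bbbP>\<^sup>N\<close> over \<open>F\<close> given by forms of degree \<open>d\<close> is represented by the set of its
  homogeneous lifts over \<open>F\<close>, that is, by a nondegenerate tuple of forms up to a nonzero scalar
  of \<open>F\<close>. Over an extension \<open>\<iota> : F \<rightarrow> L\<close> the same morphism has the \<open>L\<^sup>*\<close>-multiples as its lifts.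
\<close>

definition proj_morphisms :: "('k, 'm) ring_scheme \<Rightarrow> nat \<Rightarrow> nat \<Rightarrow> 'k poly_map set set" where
  "proj_morphisms F N d =
    {{scale_map F N c \<Phi> | c. c \<in> carrier F - {\<zero>\<^bsub>F\<^esub>}} | \<Phi>. nondegenerate F N d \<Phi>}"

definition base_change ::
  "('l, 'm) ring_scheme \<Rightarrow> nat \<Rightarrow> ('k \<Rightarrow> 'l) \<Rightarrow> 'k poly_map set \<Rightarrow> 'l poly_map set" where
  "base_change L N \<iota> \<phi> =
    {scale_map L N c (map_coeffs N \<iota> \<Phi>) | c \<Phi>. c \<in> carrier L - {\<zero>\<^bsub>L\<^esub>} \<and> \<Phi> \<in> \<phi>}"

definition is_model ::
  "('k, 'm) ring_scheme \<Rightarrow> nat \<Rightarrow> 'k poly_map set \<Rightarrow> 'k poly_map \<Rightarrow> bool" where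
  "is_model F N \<phi> \<Psi> \<longleftrightarrow>
    (\<exists>\<Phi> \<in> \<phi>. \<exists>A B. inverse_matrices F N A B \<and>
       \<Psi> = compose_map F N (linear_map F N A) (compose_map F N \<Phi> (linear_map F N B)))"


section \<open>The Macaulay resultant\<close>

text \<open>
  \<open>\<int>[u]\<close> for the indeterminates \<open>u\<^sub>i\<^sub>,\<^sub>m\<close> standing for the coefficient of the monomial \<open>m\<close> in the
  \<open>i\<close>-th form.
\<close>

type_synonym generic_poly = "(nat \<times> nat multiset) multiset \<Rightarrow>\<^sub>0 int"

text \<open>
  The Macaulay matrix is the matrix of
  \<open>(G\<^sub>0, \<dots>, G\<^sub>N) \<mapsto> G\<^sub>0 \<Phi>\<^sub>0 + \<dots> + G\<^sub>N \<Phi>\<^sub>N\<close> for the generic forms \<open>\<Phi>\<^sub>i\<close> of degree \<open>d\<close>, landing in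
  the forms of the critical degree \<open>(N + 1)(d - 1) + 1 = N (d - 1) + d\<close>: the row of
  \<open>(i, m)\<close> lists the coefficients of \<open>m \<Phi>\<^sub>i\<close>. Its maximal minors have as many rows as there are
  monomials of the critical degree.
\<close>

definition macaulay_entry :: "nat \<times> nat multiset \<Rightarrow> nat multiset \<Rightarrow> generic_poly" where
  "macaulay_entry = (\<lambda>(i, m) n. if m \<subseteq># n then Poly_Mapping.single {#(i, n - m)#} 1 else 0)"

definition macaulay_minors :: "nat \<Rightarrow> nat \<Rightarrow> generic_poly set" where
  "macaulay_minors N d =
    {det (mat (length cs) (length cs) (\<lambda>(r, c). macaulay_entry (rs ! r) (cs ! c))) | rs cs.
       distinct cs \<and> set cs = monomials N (N * (d - 1) + d) \<and>
       length rs = length cs \<and> set rs \<subseteq> {..N} \<times> monomials N (N * (d - 1))}"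

definition generic_eval ::
  "('k, 'm) ring_scheme \<Rightarrow> generic_poly \<Rightarrow> 'k poly_map \<Rightarrow> 'k" where
  "generic_eval F q \<Phi> =
    mpoly_eval \<Z> F (\<lambda>k. [k] \<cdot>\<^bsub>F\<^esub> \<one>\<^bsub>F\<^esub>) (Poly_Mapping.lookup q) (\<lambda>(i, m). \<Phi> i m)"

definition total_degree :: "generic_poly \<Rightarrow> nat" where
  "total_degree q = Max (insert 0 (size ` Poly_Mapping.keys q))"

text \<open>
  Macaulay's definition: the resultant is the highest common factor in \<open>\<int>[u]\<close> of the maximal
  minors, that is, the common factor of highest degree, with sign fixed by
  \<open>Res(x\<^sub>0\<^sup>d, \<dots>, x\<^sub>N\<^sup>d) = 1\<close>. Some maximal minor is \<open>1\<close> at \<open>(x\<^sub>0\<^sup>d, \<dots>, x\<^sub>N\<^sup>d)\<close>, so every common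
  factor is \<open>1\<close> or \<open>-1\<close> there; since \<open>\<int>[u]\<close> is factorial, a common factor of highest degree is
  then a greatest common divisor and is unique up to sign.
\<close>

definition macaulay_resultant :: "nat \<Rightarrow> nat \<Rightarrow> generic_poly" where
  "macaulay_resultant N d =
    (let is_factor = (\<lambda>g. \<forall>D \<in> macaulay_minors N d. g dvd D) in
     SOME g. is_factor g \<and> (\<forall>h. is_factor h \<longrightarrow> total_degree h \<le> total_degree g) \<and>
       generic_eval \<Z> g (\<lambda>i m. if m = replicate_mset d i then 1 else 0) = 1)"

definition Res :: "('k, 'm) ring_scheme \<Rightarrow> nat \<Rightarrow> nat \<Rightarrow> 'k poly_map \<Rightarrow> 'k" where
  "Res F N d \<Phi> = generic_eval F (macaulay_resultant N d) \<Phi>"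


section \<open>Adic valuations and completions\<close>

text \<open>
  Here \<open>R\<close> is a subring of the field \<open>K\<close> with field of fractions \<open>K\<close>, and \<open>P\<close> is a nonzero prime
  ideal of \<open>R\<close>. Valuations take values in \<^typ>\<open>ereal\<close>, with \<open>ord 0 = \<infinity>\<close>.
\<close>

definition ring_ord :: "('a, 'm) ring_scheme \<Rightarrow> 'a set \<Rightarrow> 'a \<Rightarrow> nat" where
  "ring_ord R P a = (GREATEST n. a \<in> (ideal_prod R P ^^ n) (carrier R))"

definition ord_at :: "'a ring \<Rightarrow> 'a set \<Rightarrow> 'a set \<Rightarrow> 'a \<Rightarrow> ereal" where
  "ord_at K R P x =
    (if x = \<zero>\<^bsub>K\<^esub> then \<infinity> else
     (THE k. \<exists>a \<in> R - {\<zero>\<^bsub>K\<^esub>}. \<exists>b \<in> R - {\<zero>\<^bsub>K\<^esub>}. x = a \<otimes>\<^bsub>K\<^esub> inv\<^bsub>K\<^esub> b \<and>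
        k = ereal (real (ring_ord (K\<lparr>carrier := R\<rparr>) P a) - real (ring_ord (K\<lparr>carrier := R\<rparr>) P b))))"

definition cauchy_ring :: "'a ring \<Rightarrow> ('a \<Rightarrow> ereal) \<Rightarrow> (nat \<Rightarrow> 'a) ring" where
  "cauchy_ring K v =
    \<lparr> carrier = {s. (\<forall>n. s n \<in> carrier K) \<and>
        (\<forall>C::nat. \<exists>n\<^sub>0. \<forall>m\<ge>n\<^sub>0. \<forall>n\<ge>n\<^sub>0. ereal (real C) \<le> v (s m \<ominus>\<^bsub>K\<^esub> s n))},
      monoid.mult = (\<lambda>s t n. s n \<otimes>\<^bsub>K\<^esub> t n),
      one = (\<lambda>n. \<one>\<^bsub>K\<^esub>),
      ring.zero = (\<lambda>n. \<zero>\<^bsub>K\<^esub>),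
      add = (\<lambda>s t n. s n \<oplus>\<^bsub>K\<^esub> t n) \<rparr>"

definition null_seqs :: "'a ring \<Rightarrow> ('a \<Rightarrow> ereal) \<Rightarrow> (nat \<Rightarrow> 'a) set" where
  "null_seqs K v = {s \<in> carrier (cauchy_ring K v). (\<lambda>n. v (s n)) \<longlonglongrightarrow> \<infinity>}"

definition completion :: "'a ring \<Rightarrow> ('a \<Rightarrow> ereal) \<Rightarrow> (nat \<Rightarrow> 'a) set ring" where
  "completion K v = cauchy_ring K v Quot null_seqs K v"

definition to_completion :: "'a ring \<Rightarrow> ('a \<Rightarrow> ereal) \<Rightarrow> 'a \<Rightarrow> (nat \<Rightarrow> 'a) set" where
  "to_completion K v x = null_seqs K v +>\<^bsub>cauchy_ring K v\<^esub> (\<lambda>n. x)"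

definition completion_ord :: "('a \<Rightarrow> ereal) \<Rightarrow> (nat \<Rightarrow> 'a) set \<Rightarrow> ereal" where
  "completion_ord v \<xi> = (THE l. \<forall>s \<in> \<xi>. (\<lambda>n. v (s n)) \<longlonglongrightarrow> l)"

definition valuation_ring :: "'a ring \<Rightarrow> ('a \<Rightarrow> ereal) \<Rightarrow> (nat \<Rightarrow> 'a) set set" where
  "valuation_ring K v = {\<xi> \<in> carrier (completion K v). 0 \<le> completion_ord v \<xi>}"


section \<open>Minimal models\<close>

definition integral_model ::
  "'a ring \<Rightarrow> ('a \<Rightarrow> ereal) \<Rightarrow> nat \<Rightarrow> 'a poly_map set \<Rightarrow> (nat \<Rightarrow> 'a) set poly_map \<Rightarrow> bool" where
  "integral_model K v N \<phi> \<Psi> \<longleftrightarrow>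
    is_model (completion K v) N (base_change (completion K v) N (to_completion K v) \<phi>) \<Psi> \<and>
    (\<forall>i\<le>N. \<forall>m. \<Psi> i m \<in> valuation_ring K v)"

definition minimal_model ::
  "'a ring \<Rightarrow> ('a \<Rightarrow> ereal) \<Rightarrow> nat \<Rightarrow> nat \<Rightarrow> 'a poly_map set \<Rightarrow> (nat \<Rightarrow> 'a) set poly_map \<Rightarrow> bool" where
  "minimal_model K v N d \<phi> \<Psi> \<longleftrightarrow>
    integral_model K v N \<phi> \<Psi> \<and>
    (\<forall>\<Psi>'. integral_model K v N \<phi> \<Psi>' \<longrightarrow>
       completion_ord v (Res (completion K v) N d \<Psi>) \<le> completion_ord v (Res (completion K v) N d \<Psi>'))"

end

theory Submission
  imports Defs
begin

text \<open>
  A change of coordinates by an elementary matrix does not change the resultant: it preserves the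
  ideal generated by the maximal minors, hence the common factor of highest degree up to sign.
  Diagonal changes and scalings multiply the resultant by a power of the entry or scalar.
  Among the models with coefficients in \<open>R\<close>, the noetherian property yields one, \<open>\<Psi>\<close>, whose
  resultant generates a maximal ideal. Let \<open>\<Psi>'\<close> be an integral model over \<open>K\<^sub>P\<close>, where \<open>P = (\<pi>)\<close>.
  Every invertible matrix over \<open>K\<^sub>P\<close> is a product of one over \<open>R\<^sub>P\<close> and one over \<open>R[1/\<pi>]\<close>, because
  \<open>K\<^sub>P = R[1/\<pi>] + R\<^sub>P\<close> and \<open>K\<^sub>P\<^sup>*\<close> is generated by \<open>\<pi>\<close> and the units of \<open>R\<^sub>P\<close>. So, up to
  \<open>R\<^sub>P\<close>-equivalence, \<open>\<Psi>'\<close> comes from \<open>\<Psi>\<close> by a matrix and a scalar over \<open>R[1/\<pi>]\<close>; the result has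
  coefficients in \<open>R[1/\<pi>] \<inter> R\<^sub>P = R\<close> and a resultant that differs from that of \<open>\<Psi>\<close> by a
  power of \<open>\<pi>\<close>. By maximality of the ideal this power is nonnegative.
\<close>

section \<open>Polynomial rings\<close>

text \<open>Local minimal models are not glued: a local competitor is carried to a competitor over
  \<open>R\<close>, and what is compared is a single principal ideal of \<open>R\<close>.

  The obstacle is the resultant, which is given only as a common factor of highest degree of the
  maximal minors. From this definition neither its degree nor its behaviour under a general matrix
  is immediate. The proof therefore uses only what a factor inherits from a product: divisibility,
  weighted homogeneity and the set of variables that occur. This gives invariance under one
  elementary matrix at a time, and powers with unspecified exponents for diagonal matrices and
  scalars. That is enough, because the diagonal entries and scalars in question are units of the
  valuation ring or powers of \<open>\<pi>\<close>.

  For the same reason the factorisation of a matrix over the completion is never written down.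
  Instead a statement about models is carried backwards through elementary row and column
  operations, and the resultant is followed at each of them.\<close>

lemma finite_submsets: "finite {a. a \<subseteq># m}"
proof (induction m)
  case (add x m)
  have "{a. a \<subseteq># add_mset x m} \<subseteq> {a. a \<subseteq># m} \<union> add_mset x ` {a. a \<subseteq># m}"
  proof
    fix a assume "a \<in> {a. a \<subseteq># add_mset x m}"
    then have a: "a \<subseteq># add_mset x m" by simp
    show "a \<in> {a. a \<subseteq># m} \<union> add_mset x ` {a. a \<subseteq># m}"
    proof (cases "x \<in># a")
      case True
      then obtain b where b: "a = add_mset x b" by (metis mset_add)
      with a have "b \<subseteq># m" by simp
      with b show ?thesis by auto
    next
      case False
      then have "a \<subseteq># m"
        using a unfolding subseteq_mset_def
        by (metis count_add_mset count_eq_zero_iff le0)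
      then show ?thesis by simp
    qed
  qed
  then show ?case by (rule finite_subset) (use add in simp)
qed simp

lemma diff_diff_submset: "a \<subseteq># m \<Longrightarrow> m - (m - a) = (a :: 'b multiset)"
  by (simp add: multiset_eq_iff subseteq_mset_def)

text \<open>The term c x^a. Terms generate the polynomial ring additively and
  \<open>indexed_const\<close> is the case of the empty monomial, so identities can be checked on
  terms.\<close>

definition term_poly :: "('k, 'm) ring_scheme \<Rightarrow> 'k \<Rightarrow> 'v multiset \<Rightarrow> 'v multiset \<Rightarrow> 'k" where
  "term_poly F c a = (\<lambda>m. if m = a then c else \<zero>\<^bsub>F\<^esub>)"

lemma term_poly_apply [simp]: "term_poly F c a a = c"
  by (simp add: term_poly_def)

context cring
begin

abbreviation MP where "MP \<equiv> mpoly_ring R"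

lemma MP_carrier: "p \<in> carrier MP \<longleftrightarrow> (\<forall>m. p m \<in> carrier R) \<and> finite {m. p m \<noteq> \<zero>}"
  by (simp add: mpoly_ring_def)

lemma MP_coeff: "p \<in> carrier MP \<Longrightarrow> p m \<in> carrier R"
  by (simp add: MP_carrier)

lemma MP_finite: "p \<in> carrier MP \<Longrightarrow> finite {m. p m \<noteq> \<zero>}"
  by (simp add: MP_carrier)

lemma MP_mult: "(p \<otimes>\<^bsub>MP\<^esub> q) m = (\<Oplus> a \<in> {a. a \<subseteq># m}. p a \<otimes> q (m - a))"
  by (simp add: mpoly_ring_def)

lemma MP_add: "(p \<oplus>\<^bsub>MP\<^esub> q) m = p m \<oplus> q m"
  by (simp add: mpoly_ring_def indexed_padd_def)

lemma MP_zero: "\<zero>\<^bsub>MP\<^esub> = (\<lambda>m. \<zero>)"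
  by (simp add: mpoly_ring_def indexed_const_def)

lemma indexed_const_eq_term_poly: "indexed_const c = term_poly R c {#}"
  by (simp add: indexed_const_def term_poly_def)

lemma MP_one: "\<one>\<^bsub>MP\<^esub> = term_poly R \<one> {#}"
  by (simp add: mpoly_ring_def indexed_const_eq_term_poly)

lemma term_poly_closed [simp, intro]: "c \<in> carrier R \<Longrightarrow> term_poly R c a \<in> carrier MP"
  using finite_subset[of "{m. term_poly R c a m \<noteq> \<zero>}" "{a}"] by (auto simp: MP_carrier term_poly_def)

lemma MP_zero_closed: "\<zero>\<^bsub>MP\<^esub> \<in> carrier MP"
  by (simp add: MP_carrier MP_zero)

lemma MP_add_closed: "p \<in> carrier MP \<Longrightarrow> q \<in> carrier MP \<Longrightarrow> p \<oplus>\<^bsub>MP\<^esub> q \<in> carrier MP"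
  unfolding MP_carrier MP_add
  by (auto intro!: finite_subset[of "{m. p m \<oplus> q m \<noteq> \<zero>}" "{m. p m \<noteq> \<zero>} \<union> {m. q m \<noteq> \<zero>}"])

lemma MP_mult_coeff_closed:
  "p \<in> carrier MP \<Longrightarrow> q \<in> carrier MP \<Longrightarrow> (p \<otimes>\<^bsub>MP\<^esub> q) m \<in> carrier R"
  unfolding MP_mult by (intro finsum_closed) (auto simp: MP_coeff)

text \<open>Serves twice: it bounds the support of a product, and it makes the degrees of forms add
  up.\<close>

lemma MP_mult_supp:
  assumes "p \<in> carrier MP" "q \<in> carrier MP" "(p \<otimes>\<^bsub>MP\<^esub> q) m \<noteq> \<zero>"
  shows "\<exists>a b. p a \<noteq> \<zero> \<and> q b \<noteq> \<zero> \<and> m = a + b"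
proof (rule ccontr)
  assume *: "\<not> ?thesis"
  have "(p \<otimes>\<^bsub>MP\<^esub> q) m = \<zero>"
    unfolding MP_mult
  proof (rule add.finprod_one_eqI)
    fix a assume "a \<in> {a. a \<subseteq># m}"
    then have "m = a + (m - a)" by simp
    with * have "p a = \<zero> \<or> q (m - a) = \<zero>" by blast
    then show "p a \<otimes> q (m - a) = \<zero>" using assms by (auto intro!: l_null r_null MP_coeff)
  qed
  with assms(3) show False by simp
qed

lemma MP_mult_closed: "p \<in> carrier MP \<Longrightarrow> q \<in> carrier MP \<Longrightarrow> p \<otimes>\<^bsub>MP\<^esub> q \<in> carrier MP"
proof -
  assume p: "p \<in> carrier MP" and q: "q \<in> carrier MP"
  have "{m. (p \<otimes>\<^bsub>MP\<^esub> q) m \<noteq> \<zero>} \<subseteq> (\<lambda>(a, b). a + b) ` ({m. p m \<noteq> \<zero>} \<times> {m. q m \<noteq> \<zero>})"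
    using MP_mult_supp[OF p q] by fastforce
  then have "finite {m. (p \<otimes>\<^bsub>MP\<^esub> q) m \<noteq> \<zero>}"
    by (rule finite_subset) (use MP_finite[OF p] MP_finite[OF q] in simp)
  then show ?thesis using MP_mult_coeff_closed[OF p q] by (simp add: MP_carrier)
qed

lemma term_poly_mult:
  assumes "c \<in> carrier R" "q \<in> carrier MP"
  shows "(term_poly R c a \<otimes>\<^bsub>MP\<^esub> q) m = (if a \<subseteq># m then c \<otimes> q (m - a) else \<zero>)"
proof (cases "a \<subseteq># m")
  case True
  have "(term_poly R c a \<otimes>\<^bsub>MP\<^esub> q) m
      = (\<Oplus> b \<in> {b. b \<subseteq># m}. if a = b then c \<otimes> q (m - b) else \<zero>)"
    unfolding MP_mult using assms by (intro finsum_cong') (auto simp: term_poly_def MP_coeff)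
  also have "\<dots> = c \<otimes> q (m - a)"
    using assms True by (intro finsum_singleton) (auto simp: finite_submsets MP_coeff)
  finally show ?thesis using True by simp
next
  case False
  then show ?thesis unfolding MP_mult using assms
    by (auto intro!: add.finprod_one_eqI simp: term_poly_def MP_coeff)
qed

lemma term_poly_mult_term_poly:
  assumes "c \<in> carrier R" "c' \<in> carrier R"
  shows "term_poly R c a \<otimes>\<^bsub>MP\<^esub> term_poly R c' a' = term_poly R (c \<otimes> c') (a + a')"
proof
  fix m
  show "(term_poly R c a \<otimes>\<^bsub>MP\<^esub> term_poly R c' a') m = term_poly R (c \<otimes> c') (a + a') m"
    using assms by (subst term_poly_mult[OF _ term_poly_closed]) (auto simp: term_poly_def)
qed

lemma term_poly_zero: "term_poly R \<zero> a = \<zero>\<^bsub>MP\<^esub>"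
  by (auto simp: term_poly_def MP_zero)

text \<open>The induction runs over a finite set that contains the support, so that deleting the
  coefficient at one point leads to a smaller set whether or not it was zero.\<close>

lemma MP_induct_mono [consumes 1, case_names zero add]:
  assumes "p \<in> carrier MP"
    and zero: "P \<zero>\<^bsub>MP\<^esub>"
    and add: "\<And>p c a. \<lbrakk>p \<in> carrier MP; P p; c \<in> carrier R\<rbrakk> \<Longrightarrow> P (term_poly R c a \<oplus>\<^bsub>MP\<^esub> p)"
  shows "P p"
proof -
  have "finite S \<Longrightarrow> \<forall>p. p \<in> carrier MP \<and> {m. p m \<noteq> \<zero>} \<subseteq> S \<longrightarrow> P p" for S
  proof (induction S rule: finite_induct)
    case empty
    then show ?case using zero by (auto simp: MP_zero fun_eq_iff)
  next
    case (insert a S)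
    show ?case
    proof (intro allI impI)
      fix p assume p: "p \<in> carrier MP \<and> {m. p m \<noteq> \<zero>} \<subseteq> insert a S"
      define q where "q = p(a := \<zero>)"
      have q: "q \<in> carrier MP"
        using p unfolding MP_carrier
        by (auto simp: q_def elim!: finite_subset[rotated])
      have "{m. q m \<noteq> \<zero>} \<subseteq> S" using p unfolding q_def by auto
      then have "P q" using insert.IH q by blast
      moreover have "p = term_poly R (p a) a \<oplus>\<^bsub>MP\<^esub> q"
        using p by (auto simp: fun_eq_iff MP_add term_poly_def q_def MP_coeff)
      ultimately show "P p" using add[OF q _ MP_coeff, of p a] p by metis
    qed
  qed
  with MP_finite[OF assms(1)] assms(1) show ?thesis by blast
qed

lemma MP_l_distr:
  assumes "p \<in> carrier MP" "q \<in> carrier MP" "r \<in> carrier MP"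
  shows "(p \<oplus>\<^bsub>MP\<^esub> q) \<otimes>\<^bsub>MP\<^esub> r = p \<otimes>\<^bsub>MP\<^esub> r \<oplus>\<^bsub>MP\<^esub> q \<otimes>\<^bsub>MP\<^esub> r"
proof
  fix m
  have "((p \<oplus>\<^bsub>MP\<^esub> q) \<otimes>\<^bsub>MP\<^esub> r) m
     = (\<Oplus> a \<in> {a. a \<subseteq># m}. p a \<otimes> r (m - a) \<oplus> q a \<otimes> r (m - a))"
    unfolding MP_mult using assms
    by (intro finsum_cong') (auto simp: MP_add MP_coeff intro!: l_distr)
  also have "\<dots> = (p \<otimes>\<^bsub>MP\<^esub> r \<oplus>\<^bsub>MP\<^esub> q \<otimes>\<^bsub>MP\<^esub> r) m"
    unfolding MP_mult MP_add using assms by (intro finsum_addf) (auto simp: MP_coeff)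
  finally show "((p \<oplus>\<^bsub>MP\<^esub> q) \<otimes>\<^bsub>MP\<^esub> r) m = (p \<otimes>\<^bsub>MP\<^esub> r \<oplus>\<^bsub>MP\<^esub> q \<otimes>\<^bsub>MP\<^esub> r) m" .
qed

text \<open>The reflection \<open>a \<mapsto> m - a\<close> permutes the divisors of
  \<open>m\<close> and exchanges the roles of the two factors in each summand.\<close>

lemma MP_m_comm:
  assumes "p \<in> carrier MP" "q \<in> carrier MP"
  shows "p \<otimes>\<^bsub>MP\<^esub> q = q \<otimes>\<^bsub>MP\<^esub> p"
proof
  fix m :: "'c multiset"
  have inj: "inj_on (\<lambda>a. m - a) {a. a \<subseteq># m}"
    by (rule inj_onI) (metis mem_Collect_eq diff_diff_submset)
  have im: "(\<lambda>a. m - a) ` {a. a \<subseteq># m} = {a. a \<subseteq># m}"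
  proof -
    have "x \<in> (\<lambda>a. m - a) ` {a. a \<subseteq># m}" if "x \<subseteq># m" for x
      using that by (intro image_eqI[of _ _ "m - x"]) (auto simp: diff_diff_submset)
    then show ?thesis by auto
  qed
  have "(p \<otimes>\<^bsub>MP\<^esub> q) m = (\<Oplus> a \<in> (\<lambda>a. m - a) ` {a. a \<subseteq># m}. p a \<otimes> q (m - a))"
    unfolding im MP_mult ..
  also have "\<dots> = (\<Oplus> a \<in> {a. a \<subseteq># m}. p (m - a) \<otimes> q (m - (m - a)))"
    using assms by (intro finsum_reindex inj) (auto simp: MP_coeff)
  also have "\<dots> = (\<Oplus> a \<in> {a. a \<subseteq># m}. q a \<otimes> p (m - a))"
    using assms by (intro finsum_cong') (auto simp: diff_diff_submset MP_coeff intro: m_comm)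
  finally show "(p \<otimes>\<^bsub>MP\<^esub> q) m = (q \<otimes>\<^bsub>MP\<^esub> p) m" unfolding MP_mult .
qed

lemma MP_r_distr:
  assumes "p \<in> carrier MP" "q \<in> carrier MP" "r \<in> carrier MP"
  shows "r \<otimes>\<^bsub>MP\<^esub> (p \<oplus>\<^bsub>MP\<^esub> q) = r \<otimes>\<^bsub>MP\<^esub> p \<oplus>\<^bsub>MP\<^esub> r \<otimes>\<^bsub>MP\<^esub> q"
  using assms by (simp add: MP_m_comm[of r] MP_l_distr MP_add_closed)

lemma MP_zero_mult: "p \<in> carrier MP \<Longrightarrow> \<zero>\<^bsub>MP\<^esub> \<otimes>\<^bsub>MP\<^esub> p = \<zero>\<^bsub>MP\<^esub>"
  unfolding term_poly_zero[of "{#}", symmetric]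
  by (auto simp: fun_eq_iff term_poly_mult MP_coeff) (auto simp: term_poly_def)

text \<open>Both sides are additive in \<open>p\<close> and in \<open>q\<close>, so two nested
  inductions reduce the law to two terms acting on \<open>r\<close>, where multiplication by a term
  scales and shifts coefficients.\<close>

lemma MP_assoc:
  assumes "p \<in> carrier MP" "q \<in> carrier MP" "r \<in> carrier MP"
  shows "p \<otimes>\<^bsub>MP\<^esub> q \<otimes>\<^bsub>MP\<^esub> r = p \<otimes>\<^bsub>MP\<^esub> (q \<otimes>\<^bsub>MP\<^esub> r)"
  using assms(1)
proof (induction p rule: MP_induct_mono)
  case zero
  then show ?case using assms by (simp add: MP_zero_mult MP_mult_closed)
next
  case (add p c a)
  have "term_poly R c a \<otimes>\<^bsub>MP\<^esub> q \<otimes>\<^bsub>MP\<^esub> r = term_poly R c a \<otimes>\<^bsub>MP\<^esub> (q \<otimes>\<^bsub>MP\<^esub> r)"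
    using assms(2)
  proof (induction q rule: MP_induct_mono)
    case zero
    then show ?case using assms add
      by (simp add: MP_zero_mult MP_mult_closed MP_m_comm[of "term_poly R c a"] MP_zero_closed)
  next
    case (add q c' a')
    have "term_poly R c a \<otimes>\<^bsub>MP\<^esub> term_poly R c' a' \<otimes>\<^bsub>MP\<^esub> r
        = term_poly R c a \<otimes>\<^bsub>MP\<^esub> (term_poly R c' a' \<otimes>\<^bsub>MP\<^esub> r)"
    proof
      fix m
      show "(term_poly R c a \<otimes>\<^bsub>MP\<^esub> term_poly R c' a' \<otimes>\<^bsub>MP\<^esub> r) m
          = (term_poly R c a \<otimes>\<^bsub>MP\<^esub> (term_poly R c' a' \<otimes>\<^bsub>MP\<^esub> r)) m"
      \<comment> \<open>\<open>a + a'\<close> divides \<open>m\<close> exactly if \<open>a\<close>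
        divides \<open>m\<close> and \<open>a'\<close> divides the quotient; otherwise both
        coefficients vanish.\<close>
      proof (cases "a \<subseteq># m \<and> a' \<subseteq># m - a")
        case True
        then have "a + a' \<subseteq># m" "m - (a + a') = m - a - a'"
          by (metis subset_mset.add_le_cancel_left subset_mset.add_diff_inverse) simp
        then show ?thesis using True assms add.hyps \<open>c \<in> carrier R\<close>
          by (simp add: term_poly_mult_term_poly term_poly_mult MP_mult_closed m_assoc MP_coeff)
      next
        case False
        then have "\<not> a + a' \<subseteq># m"
          by (metis mset_subset_eq_add_left subset_mset.order_trans subset_mset.le_diff_conv2
              add.commute)
        then show ?thesis using False assms add.hyps \<open>c \<in> carrier R\<close>
          by (auto simp: term_poly_mult_term_poly term_poly_mult MP_mult_closed)
      qed
    qed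
    then show ?case using add assms \<open>c \<in> carrier R\<close>
      by (simp add: MP_l_distr MP_r_distr MP_mult_closed MP_add_closed)
  qed
  then show ?case using add assms by (simp add: MP_l_distr MP_mult_closed)
qed

lemma MP_cring: "cring MP"
proof (intro cringI abelian_groupI comm_monoidI)
  fix p :: "'c multiset \<Rightarrow> 'a" assume p: "p \<in> carrier MP"
  then have "(\<lambda>m. \<ominus> p m) \<in> carrier MP"
    by (auto simp: MP_carrier intro!: finite_subset[of "{m. \<ominus> p m \<noteq> \<zero>}" "{m. p m \<noteq> \<zero>}"])
  moreover have "(\<lambda>m. \<ominus> p m) \<oplus>\<^bsub>MP\<^esub> p = \<zero>\<^bsub>MP\<^esub>"
    using p by (auto simp: fun_eq_iff MP_add MP_zero MP_coeff l_neg)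
  ultimately show "\<exists>q\<in>carrier MP. q \<oplus>\<^bsub>MP\<^esub> p = \<zero>\<^bsub>MP\<^esub>" by blast
next
  fix p :: "'c multiset \<Rightarrow> 'a" assume "p \<in> carrier MP"
  then show "\<one>\<^bsub>MP\<^esub> \<otimes>\<^bsub>MP\<^esub> p = p" by (simp add: fun_eq_iff MP_one term_poly_mult MP_coeff)
next
  fix p q :: "'c multiset \<Rightarrow> 'a" assume "p \<in> carrier MP" "q \<in> carrier MP"
  then show "p \<oplus>\<^bsub>MP\<^esub> q = q \<oplus>\<^bsub>MP\<^esub> p"
    by (auto simp: fun_eq_iff MP_add MP_coeff intro!: a_comm)
next
  fix p q r :: "'c multiset \<Rightarrow> 'a"
  assume "p \<in> carrier MP" "q \<in> carrier MP" "r \<in> carrier MP"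
  then show "p \<oplus>\<^bsub>MP\<^esub> q \<oplus>\<^bsub>MP\<^esub> r = p \<oplus>\<^bsub>MP\<^esub> (q \<oplus>\<^bsub>MP\<^esub> r)"
    by (auto simp: fun_eq_iff MP_add MP_coeff intro!: a_assoc)
next
  fix p :: "'c multiset \<Rightarrow> 'a" assume "p \<in> carrier MP"
  then show "\<zero>\<^bsub>MP\<^esub> \<oplus>\<^bsub>MP\<^esub> p = p" by (simp add: fun_eq_iff MP_add MP_zero MP_coeff)
qed (fact MP_add_closed MP_zero_closed MP_mult_closed MP_assoc MP_l_distr MP_m_comm
    | simp add: MP_one)+

lemma MP_finsum:
  assumes "finite I" "\<And>i. i \<in> I \<Longrightarrow> p i \<in> carrier MP"
  shows "finsum MP p I m = (\<Oplus>i\<in>I. p i m)"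
proof -
  interpret M: cring MP by (rule MP_cring)
  from assms show ?thesis
  proof (induction I rule: finite_induct)
    case empty
    then show ?case by (simp add: MP_zero)
  next
    case (insert i I)
    have "finsum MP p (insert i I) = p i \<oplus>\<^bsub>MP\<^esub> finsum MP p I"
      using insert by (intro M.finsum_insert) auto
    moreover have "(\<Oplus>i\<in>insert i I. p i m) = p i m \<oplus> (\<Oplus>i\<in>I. p i m)"
      using insert by (intro finsum_insert) (auto simp: MP_coeff)
    ultimately show ?case using insert by (simp add: MP_add)
  qed
qed

lemma term_poly_add_mset:
  assumes "c \<in> carrier R"
  shows "term_poly R c (add_mset v a) = term_poly R \<one> {#v#} \<otimes>\<^bsub>MP\<^esub> term_poly R c a"
  using assms by (subst term_poly_mult_term_poly) auto

text \<open>Constants and variables generate the polynomial ring as a ring: a term is its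
  coefficient multiplied by one variable at a time.\<close>

lemma MP_induct [consumes 1, case_names const var add mult]:
  assumes "p \<in> carrier MP"
    and const: "\<And>c. c \<in> carrier R \<Longrightarrow> P (term_poly R c {#})"
    and var: "\<And>v. P (term_poly R \<one> {#v#})"
    and add: "\<And>p q. \<lbrakk>p \<in> carrier MP; q \<in> carrier MP; P p; P q\<rbrakk> \<Longrightarrow> P (p \<oplus>\<^bsub>MP\<^esub> q)"
    and mult: "\<And>p q. \<lbrakk>p \<in> carrier MP; q \<in> carrier MP; P p; P q\<rbrakk> \<Longrightarrow> P (p \<otimes>\<^bsub>MP\<^esub> q)"
  shows "P p"
proof -
  have m: "P (term_poly R c a)" if "c \<in> carrier R" for c a
  proof (induction a)
    case empty
    show ?case by (rule const[OF that])
  next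
    case (add v a)
    show ?case unfolding term_poly_add_mset[OF that]
      by (rule mult[OF _ _ var add]) (use that in auto)
  qed
  show ?thesis using assms(1)
  proof (induction p rule: MP_induct_mono)
    case zero
    show ?case using m[OF zero_closed, of "{#}"] unfolding term_poly_zero .
  next
    case (add p c a)
    then show ?case by (intro assms(4) m term_poly_closed)
  qed
qed

text \<open>Uniqueness in the universal property. It reduces identities between substitutions to
  constants and single variables.\<close>

lemma MP_hom_unique:
  assumes "f \<in> Ring.ring_hom MP S" "g \<in> Ring.ring_hom MP S" "p \<in> carrier MP"
    and "\<And>c. c \<in> carrier R \<Longrightarrow> f (term_poly R c {#}) = g (term_poly R c {#})"
    and "\<And>v. f (term_poly R \<one> {#v#}) = g (term_poly R \<one> {#v#})"
  shows "f p = g p"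
  using assms(3)
  by (induction p rule: MP_induct)
    (simp_all add: assms ring_hom_mult[OF assms(1)] ring_hom_mult[OF assms(2)]
      ring_hom_add[OF assms(1)] ring_hom_add[OF assms(2)])

end

section \<open>Evaluation\<close>

definition mon_eval :: "('s, 'n) ring_scheme \<Rightarrow> 'v multiset \<Rightarrow> ('v \<Rightarrow> 's) \<Rightarrow> 's" where
  "mon_eval S m a = (\<Otimes>\<^bsub>S\<^esub> v \<in> set_mset m. a v [^]\<^bsub>S\<^esub> count m v)"

context cring
begin

lemma mon_eval_superset:
  assumes "\<And>v. a v \<in> carrier R" "finite V" "set_mset m \<subseteq> V"
  shows "mon_eval R m a = (\<Otimes> v \<in> V. a v [^] count m v)"
  unfolding mon_eval_def using assms
  by (intro finprod_mono_neutral_cong_left) (auto simp: not_in_iff)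

lemma mon_eval_closed: "(\<And>v. v \<in># m \<Longrightarrow> a v \<in> carrier R) \<Longrightarrow> mon_eval R m a \<in> carrier R"
  unfolding mon_eval_def by (intro finprod_closed) auto

lemma mon_eval_empty [simp]: "mon_eval R {#} a = \<one>"
  by (simp add: mon_eval_def)

lemma mon_eval_single: "a v \<in> carrier R \<Longrightarrow> mon_eval R {#v#} a = a v"
  by (simp add: mon_eval_def)

lemma mon_eval_add:
  assumes "\<And>v. a v \<in> carrier R"
  shows "mon_eval R (m + m') a = mon_eval R m a \<otimes> mon_eval R m' a"
proof -
  let ?V = "set_mset m \<union> set_mset m'"
  have "mon_eval R (m + m') a = (\<Otimes> v \<in> ?V. a v [^] count m v \<otimes> a v [^] count m' v)"
    unfolding mon_eval_def by (intro finprod_cong') (auto simp: assms nat_pow_mult)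
  also have "\<dots> = mon_eval R m a \<otimes> mon_eval R m' a"
    using assms by (simp add: mon_eval_superset[of a ?V])
  finally show ?thesis .
qed

end

text \<open>The point \<open>a\<close> has coordinates in \<open>S\<close> at every variable of the
  type, so that evaluation is a homomorphism on all polynomials. Points that are meaningful only on
  \<open>{..N}\<close> are extended by zero before this locale is applied.\<close>

locale mpoly_hom = R: cring R + S: cring S for R (structure) and S (structure) +
  fixes \<sigma> and a
  assumes \<sigma>: "\<sigma> \<in> Ring.ring_hom R S" and a: "\<And>v. a v \<in> carrier S"
begin

abbreviation ev where "ev p \<equiv> mpoly_eval R S \<sigma> p a"

lemma \<sigma>_closed [simp, intro]: "c \<in> carrier R \<Longrightarrow> \<sigma> c \<in> carrier S"
  using \<sigma> ring_hom_closed by metis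

lemma \<sigma>_zero [simp]: "\<sigma> \<zero>\<^bsub>R\<^esub> = \<zero>\<^bsub>S\<^esub>"
  using ring_hom_zero[OF \<sigma>] R.ring_axioms S.ring_axioms by blast

lemma mon_eval_S: "mon_eval S m a \<in> carrier S"
  using a by (intro S.mon_eval_closed)

text \<open>Lets several polynomials be evaluated over one common finite set of monomials.\<close>

lemma ev_superset:
  assumes "p \<in> carrier (mpoly_ring R)" "finite V" "{m. p m \<noteq> \<zero>\<^bsub>R\<^esub>} \<subseteq> V"
  shows "ev p = (\<Oplus>\<^bsub>S\<^esub> m \<in> V. \<sigma> (p m) \<otimes>\<^bsub>S\<^esub> mon_eval S m a)"
  unfolding mpoly_eval_def mon_eval_def[symmetric] using assms
  by (intro S.add.finprod_mono_neutral_cong_left) (auto simp: mon_eval_S R.MP_coeff)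

lemma ev_closed: "p \<in> carrier (mpoly_ring R) \<Longrightarrow> ev p \<in> carrier S"
  unfolding mpoly_eval_def mon_eval_def[symmetric]
  by (intro S.finsum_closed) (auto simp: mon_eval_S R.MP_coeff)

lemma ev_add:
  assumes p: "p \<in> carrier (mpoly_ring R)" and q: "q \<in> carrier (mpoly_ring R)"
  shows "ev (p \<oplus>\<^bsub>mpoly_ring R\<^esub> q) = ev p \<oplus>\<^bsub>S\<^esub> ev q"
proof -
  let ?V = "{m. p m \<noteq> \<zero>\<^bsub>R\<^esub>} \<union> {m. q m \<noteq> \<zero>\<^bsub>R\<^esub>}"
  have V: "finite ?V" using R.MP_finite p q by blast
  have "ev (p \<oplus>\<^bsub>mpoly_ring R\<^esub> q)
      = (\<Oplus>\<^bsub>S\<^esub> m \<in> ?V. \<sigma> ((p \<oplus>\<^bsub>mpoly_ring R\<^esub> q) m) \<otimes>\<^bsub>S\<^esub> mon_eval S m a)"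
    using V R.MP_add_closed[OF p q] by (intro ev_superset) (auto simp: R.MP_add)
  also have "\<dots> = (\<Oplus>\<^bsub>S\<^esub> m \<in> ?V. \<sigma> (p m) \<otimes>\<^bsub>S\<^esub> mon_eval S m a \<oplus>\<^bsub>S\<^esub> \<sigma> (q m) \<otimes>\<^bsub>S\<^esub> mon_eval S m a)"
    using p q by (intro S.finsum_cong')
      (auto simp: R.MP_add R.MP_coeff mon_eval_S ring_hom_add[OF \<sigma>] intro!: S.l_distr)
  also have "\<dots> = ev p \<oplus>\<^bsub>S\<^esub> ev q"
    using p q V
    by (subst S.finsum_addf) (auto simp: R.MP_coeff mon_eval_S ev_superset[of _ ?V])
  finally show ?thesis .
qed

lemma ev_term_poly:
  assumes "c \<in> carrier R"
  shows "ev (term_poly R c m) = \<sigma> c \<otimes>\<^bsub>S\<^esub> mon_eval S m a"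
proof -
  have "ev (term_poly R c m) = (\<Oplus>\<^bsub>S\<^esub> m' \<in> {m}. \<sigma> (term_poly R c m m') \<otimes>\<^bsub>S\<^esub> mon_eval S m' a)"
    using assms by (intro ev_superset) (auto simp: term_poly_def[of R c m] R.term_poly_closed[unfolded term_poly_def])
  then show ?thesis using assms by (simp add: mon_eval_S)
qed

lemma ev_zero: "ev \<zero>\<^bsub>mpoly_ring R\<^esub> = \<zero>\<^bsub>S\<^esub>"
  by (simp add: mpoly_eval_def R.MP_zero)

text \<open>Additivity in both factors reduces the claim to two terms, where it follows from the
  multiplicativity of \<open>\<sigma>\<close> and of the values of monomials.\<close>

lemma ev_mult:
  assumes "p \<in> carrier (mpoly_ring R)" and "q \<in> carrier (mpoly_ring R)"
  shows "ev (p \<otimes>\<^bsub>mpoly_ring R\<^esub> q) = ev p \<otimes>\<^bsub>S\<^esub> ev q"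
  using assms(1)
proof (induction p rule: R.MP_induct_mono)
  case zero
  then show ?case using assms by (simp add: R.MP_zero_mult ev_zero ev_closed)
next
  case (add p c m)
  have "ev (term_poly R c m \<otimes>\<^bsub>mpoly_ring R\<^esub> q) = ev (term_poly R c m) \<otimes>\<^bsub>S\<^esub> ev q"
    using assms(2)
  proof (induction q rule: R.MP_induct_mono)
    case zero
    then show ?case using add
      by (simp add: R.MP_zero_mult R.MP_m_comm[of "term_poly R c m"] R.MP_zero_closed ev_zero ev_closed)
  next
    case (add q c' m')
    have "ev (term_poly R c m \<otimes>\<^bsub>mpoly_ring R\<^esub> term_poly R c' m') = ev (term_poly R c m) \<otimes>\<^bsub>S\<^esub> ev (term_poly R c' m')"
      using add \<open>c \<in> carrier R\<close>
      by (simp add: R.term_poly_mult_term_poly ev_term_poly S.mon_eval_add[OF a] ring_hom_mult[OF \<sigma>]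
          mon_eval_S S.m_ac)
    then show ?case using add \<open>c \<in> carrier R\<close>
      by (simp add: R.MP_r_distr R.MP_mult_closed ev_add S.r_distr ev_closed)
  qed
  then show ?case using add assms
    by (simp add: R.MP_l_distr R.MP_mult_closed ev_add S.l_distr ev_closed)
qed

lemma ev_const: "c \<in> carrier R \<Longrightarrow> ev (term_poly R c {#}) = \<sigma> c"
  by (simp add: ev_term_poly)

lemma ev_var: "ev (term_poly R \<one>\<^bsub>R\<^esub> {#v#}) = a v"
  using a by (simp add: ev_term_poly ring_hom_one[OF \<sigma>] S.mon_eval_single)

lemma ev_hom: "ev \<in> Ring.ring_hom (mpoly_ring R) S"
  by (rule ring_hom_memI)
    (auto simp: ev_closed ev_mult ev_add R.MP_one ev_const ring_hom_one[OF \<sigma>])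

end

text \<open>Allows a point that is meaningful only at the variables occurring in \<open>p\<close>,
  such as a map that is \<open>undefined\<close> beyond \<open>N\<close>, to be exchanged for a
  total one.\<close>

lemma mpoly_eval_cong:
  assumes "cring S" "\<And>m. p m \<noteq> \<zero>\<^bsub>R\<^esub> \<Longrightarrow> \<sigma> (p m) \<in> carrier S"
    and "\<And>m v. p m \<noteq> \<zero>\<^bsub>R\<^esub> \<Longrightarrow> v \<in># m \<Longrightarrow> a v = b v \<and> b v \<in> carrier S"
  shows "mpoly_eval R S \<sigma> p a = mpoly_eval R S \<sigma> p b"
proof -
  interpret S: cring S by fact
  have *: "mon_eval S m b \<in> carrier S" "mon_eval S m a = mon_eval S m b" if "p m \<noteq> \<zero>\<^bsub>R\<^esub>" for m
    using assms(3)[OF that] unfolding mon_eval_def by (auto intro!: S.finprod_cong')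
  then show ?thesis unfolding mpoly_eval_def mon_eval_def[symmetric] using assms(2)
    by (intro S.finsum_cong') auto
qed

section \<open>Linear changes of coordinates\<close>

lemma (in abelian_monoid) finsum_swap:
  assumes "finite I" "finite J" "\<And>i j. i \<in> I \<Longrightarrow> j \<in> J \<Longrightarrow> f i j \<in> carrier G"
  shows "(\<Oplus>i\<in>I. \<Oplus>j\<in>J. f i j) = (\<Oplus>j\<in>J. \<Oplus>i\<in>I. f i j)"
  using assms(1,3)
proof (induction I rule: finite_induct)
  case (insert i I)
  have "(\<Oplus>i\<in>insert i I. \<Oplus>j\<in>J. f i j) = (\<Oplus>j\<in>J. f i j) \<oplus> (\<Oplus>j\<in>J. \<Oplus>i\<in>I. f i j)"
    using insert by (subst finsum_insert) auto
  also have "\<dots> = (\<Oplus>j\<in>J. f i j \<oplus> (\<Oplus>i\<in>I. f i j))"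
    using insert by (subst finsum_addf) auto
  also have "\<dots> = (\<Oplus>j\<in>J. \<Oplus>i\<in>insert i I. f i j)"
    using insert by (intro finsum_cong') (auto intro!: finsum_insert[symmetric])
  finally show ?case .
qed simp

lemma ring_hom_cringI:
  "cring R \<Longrightarrow> cring S \<Longrightarrow> h \<in> Ring.ring_hom R S \<Longrightarrow> ring_hom_cring R S h"
  by (simp add: ring_hom_cring_def ring_hom_cring_axioms_def)

definition matc :: "('k, 'm) ring_scheme \<Rightarrow> nat \<Rightarrow> (nat \<Rightarrow> nat \<Rightarrow> 'k) \<Rightarrow> bool" where
  "matc F N A \<longleftrightarrow> (\<forall>i\<le>N. \<forall>j\<le>N. A i j \<in> carrier F)"

definition mm :: "('k, 'm) ring_scheme \<Rightarrow> nat \<Rightarrow> (nat \<Rightarrow> nat \<Rightarrow> 'k) \<Rightarrow> (nat \<Rightarrow> nat \<Rightarrow> 'k) \<Rightarrow> nat \<Rightarrow> nat \<Rightarrow> 'k" where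
  "mm F N A B = (\<lambda>i j. \<Oplus>\<^bsub>F\<^esub> k \<in> {..N}. A i k \<otimes>\<^bsub>F\<^esub> B k j)"

definition idm :: "('k, 'm) ring_scheme \<Rightarrow> nat \<Rightarrow> nat \<Rightarrow> 'k" where
  "idm F = (\<lambda>i j. if i = j then \<one>\<^bsub>F\<^esub> else \<zero>\<^bsub>F\<^esub>)"

text \<open>Matrices are functions on all pairs of naturals, while products and inverses are
  specified only on indices up to \<open>N\<close>; hence they are compared only there.\<close>

definition eqm :: "nat \<Rightarrow> (nat \<Rightarrow> nat \<Rightarrow> 'k) \<Rightarrow> (nat \<Rightarrow> nat \<Rightarrow> 'k) \<Rightarrow> bool" where
  "eqm N A B \<longleftrightarrow> (\<forall>i\<le>N. \<forall>j\<le>N. A i j = B i j)"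

lemma inverse_matrices_iff:
  "inverse_matrices F N A B \<longleftrightarrow>
    matc F N A \<and> matc F N B \<and> eqm N (mm F N A B) (idm F) \<and> eqm N (mm F N B A) (idm F)"
  unfolding inverse_matrices_def matc_def eqm_def mm_def idm_def by blast

lemma inverse_matrices_sym: "inverse_matrices F N A B \<Longrightarrow> inverse_matrices F N B A"
  unfolding inverse_matrices_iff by blast

text \<open>Precomposition with a linear map. The value zero beyond \<open>N\<close> makes it an
  endomorphism of the polynomial ring in all variables; on forms it agrees with the composition in
  \<open>compose_map\<close>.\<close>

definition subst_lin ::
  "('k, 'm) ring_scheme \<Rightarrow> nat \<Rightarrow> (nat \<Rightarrow> nat \<Rightarrow> 'k) \<Rightarrow> (nat multiset \<Rightarrow> 'k) \<Rightarrow> nat multiset \<Rightarrow> 'k" where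
  "subst_lin F N A p = mpoly_eval F (mpoly_ring F) (ring.indexed_const F) p
     (\<lambda>v. if v \<le> N then linear_map F N A v else \<zero>\<^bsub>mpoly_ring F\<^esub>)"

text \<open>The operation in \<open>is_model\<close>. The inverse is a separate argument, so that
  the laws of composition hold for arbitrary pairs of matrices and inverses enter only through
  \<open>inverse_matrices\<close>.\<close>

definition conj_map ::
  "('k, 'm) ring_scheme \<Rightarrow> nat \<Rightarrow> (nat \<Rightarrow> nat \<Rightarrow> 'k) \<Rightarrow> (nat \<Rightarrow> nat \<Rightarrow> 'k) \<Rightarrow> 'k poly_map \<Rightarrow> 'k poly_map" where
  "conj_map F N A B \<Phi> =
     compose_map F N (linear_map F N A) (compose_map F N \<Phi> (linear_map F N B))"

definition fmaps :: "('k, 'm) ring_scheme \<Rightarrow> nat \<Rightarrow> nat \<Rightarrow> 'k poly_map set" where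
  "fmaps F N d = {..N} \<rightarrow>\<^sub>E forms F N d"

section \<open>Matrix algebra and the action of matrices on polynomial maps\<close>

context cring
begin

lemma mm_closed: "matc R N A \<Longrightarrow> matc R N B \<Longrightarrow> matc R N (mm R N A B)"
  unfolding matc_def mm_def by (auto intro!: finsum_closed)

lemma idm_closed: "matc R N (idm R)"
  by (simp add: matc_def idm_def)

lemma mm_cong: "eqm N A A' \<Longrightarrow> eqm N B B' \<Longrightarrow> matc R N A \<Longrightarrow> matc R N B \<Longrightarrow> eqm N (mm R N A B) (mm R N A' B')"
  unfolding matc_def eqm_def mm_def by (auto intro!: finsum_cong')

lemma mm_assoc:
  assumes "matc R N A" "matc R N B" "matc R N C"
  shows "eqm N (mm R N (mm R N A B) C) (mm R N A (mm R N B C))"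
  unfolding eqm_def
proof (intro allI impI)
  fix i j assume ij: "i \<le> N" "j \<le> N"
  have c: "A i k \<in> carrier R" "B k l \<in> carrier R" "C l j \<in> carrier R" if "k \<le> N" "l \<le> N" for k l
    using assms ij that by (auto simp: matc_def)
  have "mm R N (mm R N A B) C i j = (\<Oplus>l\<in>{..N}. \<Oplus>k\<in>{..N}. A i k \<otimes> B k l \<otimes> C l j)"
    unfolding mm_def using c by (intro finsum_cong' finsum_ldistr) auto
  also have "\<dots> = (\<Oplus>k\<in>{..N}. \<Oplus>l\<in>{..N}. A i k \<otimes> B k l \<otimes> C l j)"
    using c by (intro finsum_swap) auto
  also have "\<dots> = (\<Oplus>k\<in>{..N}. \<Oplus>l\<in>{..N}. A i k \<otimes> (B k l \<otimes> C l j))"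
    using c by (intro finsum_cong') (auto intro!: m_assoc finsum_closed)
  also have "\<dots> = mm R N A (mm R N B C) i j"
    unfolding mm_def using c by (intro finsum_cong' finsum_rdistr[symmetric]) auto
  finally show "mm R N (mm R N A B) C i j = mm R N A (mm R N B C) i j" .
qed

lemma mm_idm_left: "matc R N A \<Longrightarrow> eqm N (mm R N (idm R) A) A"
  unfolding eqm_def
proof (intro allI impI)
  fix i j assume "matc R N A" "i \<le> N" "j \<le> N"
  then have c: "A k j \<in> carrier R" if "k \<le> N" for k using that by (auto simp: matc_def)
  have "mm R N (idm R) A i j = (\<Oplus>k\<in>{..N}. if i = k then A k j else \<zero>)"
    unfolding mm_def idm_def using c by (intro finsum_cong') auto
  also have "\<dots> = A i j" using c \<open>i \<le> N\<close> by (intro finsum_singleton) auto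
  finally show "mm R N (idm R) A i j = A i j" .
qed

lemma inverse_matrices_idm: "inverse_matrices R N (idm R) (idm R)"
  unfolding inverse_matrices_iff by (auto simp: idm_closed mm_idm_left)

lemma inverse_matrices_mm:
  assumes "inverse_matrices R N A B" "inverse_matrices R N C D"
  shows "inverse_matrices R N (mm R N A C) (mm R N D B)"
proof -
  have *: "eqm N (mm R N (mm R N A C) (mm R N D B)) (idm R)"
    if "inverse_matrices R N A B" "inverse_matrices R N C D" for A B C D
  proof -
    have c: "matc R N A" "matc R N B" "matc R N C" "matc R N D"
      and AB: "eqm N (mm R N A B) (idm R)" and CD: "eqm N (mm R N C D) (idm R)"
      using that by (auto simp: inverse_matrices_iff)
    have 1: "eqm N (mm R N (mm R N A C) (mm R N D B)) (mm R N A (mm R N C (mm R N D B)))"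
      by (intro mm_assoc mm_closed c)
    have 2: "eqm N (mm R N (mm R N C D) B) (mm R N C (mm R N D B))"
      by (intro mm_assoc c)
    have 3: "eqm N (mm R N (mm R N C D) B) (mm R N (idm R) B)"
      by (intro mm_cong mm_closed c CD) (simp add: eqm_def)
    have 4: "eqm N (mm R N C (mm R N D B)) B"
      using 2 3 mm_idm_left[OF c(2)] by (simp add: eqm_def)
    have 5: "eqm N (mm R N A (mm R N C (mm R N D B))) (mm R N A B)"
      by (intro mm_cong mm_closed c 4) (simp add: eqm_def)
    show ?thesis using 1 5 AB by (simp add: eqm_def)
  qed
  show ?thesis unfolding inverse_matrices_iff
    using *[OF assms] *[OF inverse_matrices_sym[OF assms(2)] inverse_matrices_sym[OF assms(1)]]
      assms by (auto simp: inverse_matrices_iff mm_closed)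
qed

lemma indexed_const_hom: "indexed_const \<in> Ring.ring_hom R MP"
  by (rule ring_hom_memI)
    (auto simp: indexed_const_eq_term_poly term_poly_mult_term_poly MP_one,
     auto simp: fun_eq_iff MP_add term_poly_def)

lemma linear_map_eq:
  assumes "matc R N A" "i \<le> N"
  shows "linear_map R N A i = (\<Oplus>\<^bsub>MP\<^esub>j\<in>{..N}. term_poly R (A i j) {#j#})"
proof
  fix m
  have "(\<Oplus>\<^bsub>MP\<^esub>j\<in>{..N}. term_poly R (A i j) {#j#}) m = (\<Oplus>j\<in>{..N}. term_poly R (A i j) {#j#} m)"
    using assms by (intro MP_finsum) (auto simp: matc_def)
  then show "linear_map R N A i m = (\<Oplus>\<^bsub>MP\<^esub>j\<in>{..N}. term_poly R (A i j) {#j#}) m"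
    using assms by (simp add: linear_map_def term_poly_def)
qed

lemma linear_map_closed:
  assumes "matc R N A" "i \<le> N"
  shows "linear_map R N A i \<in> carrier MP"
proof -
  interpret M: cring MP by (rule MP_cring)
  show ?thesis unfolding linear_map_eq[OF assms]
    using assms by (intro M.finsum_closed) (auto simp: matc_def)
qed

lemma subst_lin_mpoly_hom:
  assumes "matc R N A"
  shows "mpoly_hom R MP indexed_const (\<lambda>v. if v \<le> N then linear_map R N A v else \<zero>\<^bsub>MP\<^esub>)"
proof -
  interpret M: cring MP by (rule MP_cring)
  show ?thesis
    by unfold_locales (auto simp: indexed_const_hom linear_map_closed[OF assms])
qed

lemma subst_lin_hom: "matc R N A \<Longrightarrow> subst_lin R N A \<in> Ring.ring_hom MP MP"
  using mpoly_hom.ev_hom[OF subst_lin_mpoly_hom] unfolding subst_lin_def .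

lemma subst_lin_closed: "matc R N A \<Longrightarrow> p \<in> carrier MP \<Longrightarrow> subst_lin R N A p \<in> carrier MP"
  using ring_hom_closed[OF subst_lin_hom] .

lemma subst_lin_const:
  "matc R N A \<Longrightarrow> c \<in> carrier R \<Longrightarrow> subst_lin R N A (term_poly R c {#}) = term_poly R c {#}"
  using mpoly_hom.ev_const[OF subst_lin_mpoly_hom] unfolding subst_lin_def
  by (simp add: indexed_const_eq_term_poly)

lemma subst_lin_var:
  "matc R N A \<Longrightarrow> subst_lin R N A (term_poly R \<one> {#v#}) =
    (if v \<le> N then linear_map R N A v else \<zero>\<^bsub>MP\<^esub>)"
  using mpoly_hom.ev_var[OF subst_lin_mpoly_hom] unfolding subst_lin_def .

lemma subst_lin_smult:
  assumes "matc R N A" "c \<in> carrier R" "p \<in> carrier MP"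
  shows "subst_lin R N A (term_poly R c {#} \<otimes>\<^bsub>MP\<^esub> p) = term_poly R c {#} \<otimes>\<^bsub>MP\<^esub> subst_lin R N A p"
  using ring_hom_mult[OF subst_lin_hom[OF assms(1)]] assms by (simp add: subst_lin_const)

lemma subst_lin_finsum:
  assumes "matc R N A" "finite I" "\<And>i. i \<in> I \<Longrightarrow> p i \<in> carrier MP"
  shows "subst_lin R N A (finsum MP p I) = (\<Oplus>\<^bsub>MP\<^esub>i\<in>I. subst_lin R N A (p i))"
proof -
  interpret ring_hom_cring MP MP "subst_lin R N A"
    by (intro ring_hom_cringI MP_cring subst_lin_hom assms)
  show ?thesis using hom_finsum[of p I] assms by (auto simp: comp_def)
qed

lemma forms_carrier: "p \<in> forms R N d \<Longrightarrow> p \<in> carrier MP"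
  by (simp add: forms_def)

lemma forms_vars: "p \<in> forms R N d \<Longrightarrow> p m \<noteq> \<zero> \<Longrightarrow> v \<in># m \<Longrightarrow> v \<le> N"
  by (auto simp: forms_def monomials_def)

lemma fmaps_form: "\<Phi> \<in> fmaps R N d \<Longrightarrow> i \<le> N \<Longrightarrow> \<Phi> i \<in> forms R N d"
  by (auto simp: fmaps_def)

lemma subst_lin_eval:
  assumes "p \<in> forms R N d" "matc R N A"
  shows "mpoly_eval R MP indexed_const p (linear_map R N A) = subst_lin R N A p"
  unfolding subst_lin_def using forms_vars[OF assms(1)] linear_map_closed[OF assms(2)]
    forms_carrier[OF assms(1)]
  by (intro mpoly_eval_cong MP_cring) (auto simp: indexed_const_eq_term_poly MP_coeff)

lemma form_add: "p \<in> forms R N d \<Longrightarrow> q \<in> forms R N d \<Longrightarrow> p \<oplus>\<^bsub>MP\<^esub> q \<in> forms R N d"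
  unfolding forms_def by (auto simp: MP_add_closed MP_add) (metis l_zero zero_closed)+

lemma form_zero: "\<zero>\<^bsub>MP\<^esub> \<in> forms R N d"
  by (simp add: forms_def MP_zero_closed) (simp add: MP_zero)

lemma form_finsum:
  assumes "finite I" "\<And>i. i \<in> I \<Longrightarrow> p i \<in> forms R N d"
  shows "finsum MP p I \<in> forms R N d"
proof -
  interpret M: cring MP by (rule MP_cring)
  from assms show ?thesis
  proof (induction I rule: finite_induct)
    case empty
    then show ?case by (simp add: form_zero)
  next
    case (insert i I)
    have "finsum MP p (insert i I) = p i \<oplus>\<^bsub>MP\<^esub> finsum MP p I"
      using insert.hyps insert.prems forms_carrier by (intro M.finsum_insert) blast+
    then show ?case using insert by (simp add: form_add)
  qed
qed

lemma form_mult: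
  assumes "p \<in> forms R N d" "q \<in> forms R N e"
  shows "p \<otimes>\<^bsub>MP\<^esub> q \<in> forms R N (d + e)"
proof -
  have "m \<in> monomials N (d + e)" if m: "(p \<otimes>\<^bsub>MP\<^esub> q) m \<noteq> \<zero>" for m
  proof -
    obtain a b where "p a \<noteq> \<zero>" "q b \<noteq> \<zero>" "m = a + b"
      using MP_mult_supp[OF _ _ m] assms forms_carrier by blast
    then show ?thesis using assms by (auto simp: forms_def monomials_def)
  qed
  then show ?thesis using assms by (auto simp: forms_def MP_mult_closed)
qed

lemma form_term: "c \<in> carrier R \<Longrightarrow> m \<in> monomials N d \<Longrightarrow> term_poly R c m \<in> forms R N d"
  by (auto simp: forms_def term_poly_closed) (auto simp: term_poly_def split: if_splits)

lemma form_smult: "c \<in> carrier R \<Longrightarrow> p \<in> forms R N d \<Longrightarrow> term_poly R c {#} \<otimes>\<^bsub>MP\<^esub> p \<in> forms R N d"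
  using form_mult[of "term_poly R c {#}" N 0 p d] by (auto simp: form_term monomials_def)

lemma form_linear_map: "matc R N A \<Longrightarrow> i \<le> N \<Longrightarrow> linear_map R N A i \<in> forms R N 1"
  by (subst linear_map_eq) (auto intro!: form_finsum form_term simp: matc_def monomials_def)

lemma term_poly_eq_finsum:
  assumes "p \<in> carrier MP"
  shows "p = (\<Oplus>\<^bsub>MP\<^esub>m\<in>{m. p m \<noteq> \<zero>}. term_poly R (p m) m)"
proof
  fix m
  have fin: "finite {m. p m \<noteq> \<zero>}" using assms by (rule MP_finite)
  have "(\<Oplus>\<^bsub>MP\<^esub>m\<in>{m. p m \<noteq> \<zero>}. term_poly R (p m) m) m
      = (\<Oplus>n\<in>{m. p m \<noteq> \<zero>}. if m = n then p n else \<zero>)"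
    using assms fin by (subst MP_finsum[OF fin term_poly_closed])
      (auto simp: MP_coeff, auto simp: MP_coeff term_poly_def intro!: finsum_cong')
  also have "\<dots> = p m"
  proof (cases "p m = \<zero>")
    case True
    then show ?thesis by (auto intro!: add.finprod_one_eqI)
  next
    case False
    then show ?thesis using fin assms by (intro finsum_singleton) (auto simp: MP_coeff)
  qed
  finally show "p m = (\<Oplus>\<^bsub>MP\<^esub>m\<in>{m. p m \<noteq> \<zero>}. term_poly R (p m) m) m" ..
qed

text \<open>Each variable of the monomial is replaced by a linear form, so the degree is kept factor
  by factor.\<close>

lemma subst_lin_term_form:
  assumes "matc R N A" "c \<in> carrier R" "set_mset m \<subseteq> {..N}"
  shows "subst_lin R N A (term_poly R c m) \<in> forms R N (size m)"
  using assms(3)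
proof (induction m)
  case empty
  then show ?case using assms by (auto simp: subst_lin_const intro!: form_term simp: monomials_def)
next
  case (add v m)
  have "subst_lin R N A (term_poly R c (add_mset v m))
      = linear_map R N A v \<otimes>\<^bsub>MP\<^esub> subst_lin R N A (term_poly R c m)"
    using add.prems assms ring_hom_mult[OF subst_lin_hom[OF assms(1)]]
    unfolding term_poly_add_mset[OF assms(2)] by (simp add: subst_lin_var)
  then show ?case
    using form_mult[OF form_linear_map[OF assms(1)] add.IH, of v] add.prems by simp
qed

lemma subst_lin_form:
  assumes "matc R N A" "p \<in> forms R N d"
  shows "subst_lin R N A p \<in> forms R N d"
proof -
  have p: "p \<in> carrier MP" using assms forms_carrier by blast
  have fin: "finite {m. p m \<noteq> \<zero>}" by (rule MP_finite[OF p])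
  have "subst_lin R N A (\<Oplus>\<^bsub>MP\<^esub>m\<in>{m. p m \<noteq> \<zero>}. term_poly R (p m) m)
      = (\<Oplus>\<^bsub>MP\<^esub>m\<in>{m. p m \<noteq> \<zero>}. subst_lin R N A (term_poly R (p m) m))"
    using p fin by (intro subst_lin_finsum assms) (auto simp: MP_coeff)
  also have "\<dots> \<in> forms R N d"
  proof (rule form_finsum[OF fin])
    fix m assume "m \<in> {m. p m \<noteq> \<zero>}"
    then have "m \<in> monomials N d" using assms by (auto simp: forms_def)
    then show "subst_lin R N A (term_poly R (p m) m) \<in> forms R N d"
      using subst_lin_term_form[OF assms(1) MP_coeff[OF p], of m] by (auto simp: monomials_def)
  qed
  finally show ?thesis using term_poly_eq_finsum[OF p] by simp
qed

lemma compose_subst: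
  assumes "\<Phi> \<in> fmaps R N d" "matc R N B"
  shows "compose_map R N \<Phi> (linear_map R N B) = (\<lambda>i\<in>{..N}. subst_lin R N B (\<Phi> i))"
  using assms unfolding compose_map_def
  by (auto simp: fun_eq_iff restrict_def subst_lin_eval[OF fmaps_form])

lemma mpoly_eval_linear_map:
  assumes "matc R N A" "\<And>j. j \<le> N \<Longrightarrow> \<Psi> j \<in> carrier MP" "i \<le> N"
  shows "mpoly_eval R MP indexed_const (linear_map R N A i) \<Psi>
    = (\<Oplus>\<^bsub>MP\<^esub>j\<in>{..N}. term_poly R (A i j) {#} \<otimes>\<^bsub>MP\<^esub> \<Psi> j)"
proof -
  interpret M: cring MP by (rule MP_cring)
  define a where "a = (\<lambda>j. if j \<le> N then \<Psi> j else \<zero>\<^bsub>MP\<^esub>)"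
  interpret h: mpoly_hom R MP indexed_const a
    using assms by unfold_locales (auto simp: indexed_const_hom a_def)
  have "mpoly_eval R MP indexed_const (linear_map R N A i) \<Psi> = h.ev (linear_map R N A i)"
    using forms_vars[OF form_linear_map[OF assms(1,3)]] assms linear_map_closed[OF assms(1,3)]
    by (intro mpoly_eval_cong MP_cring) (auto simp: a_def indexed_const_eq_term_poly MP_coeff)
  also have "\<dots> = (\<Oplus>\<^bsub>MP\<^esub>j\<in>{..N}. h.ev (term_poly R (A i j) {#j#}))"
  proof -
    interpret g: ring_hom_cring MP MP h.ev
      by (intro ring_hom_cringI MP_cring h.ev_hom)
    show ?thesis unfolding linear_map_eq[OF assms(1,3)]
      using assms by (subst g.hom_finsum) (auto simp: matc_def comp_def)
  qed
  also have "\<dots> = (\<Oplus>\<^bsub>MP\<^esub>j\<in>{..N}. term_poly R (A i j) {#} \<otimes>\<^bsub>MP\<^esub> \<Psi> j)"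
  proof (intro M.finsum_cong')
    fix j assume "j \<in> {..N}"
    then have "A i j \<in> carrier R" "a j = \<Psi> j" "\<Psi> j \<in> carrier MP"
      using assms by (auto simp: a_def matc_def)
    then show "h.ev (term_poly R (A i j) {#j#}) = term_poly R (A i j) {#} \<otimes>\<^bsub>MP\<^esub> \<Psi> j"
      using M.mon_eval_single[of a j] by (simp add: h.ev_term_poly indexed_const_eq_term_poly)
  qed (use assms in \<open>auto simp: matc_def\<close>)
  finally show ?thesis .
qed

text \<open>The working formula: rows of \<open>A\<close> combine the forms after the substitution
  by \<open>B\<close>. The composition, scaling and diagonal laws are computed from it.\<close>

lemma conj_map_eq:
  assumes "\<Phi> \<in> fmaps R N d" "matc R N A" "matc R N B" "i \<le> N"
  shows "conj_map R N A B \<Phi> i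
    = (\<Oplus>\<^bsub>MP\<^esub>j\<in>{..N}. term_poly R (A i j) {#} \<otimes>\<^bsub>MP\<^esub> subst_lin R N B (\<Phi> j))"
proof -
  interpret M: cring MP by (rule MP_cring)
  have "conj_map R N A B \<Phi> i = mpoly_eval R MP indexed_const (linear_map R N A i)
     (\<lambda>i\<in>{..N}. subst_lin R N B (\<Phi> i))"
    using assms(4) unfolding conj_map_def compose_subst[OF assms(1,3)] by (simp add: compose_map_def)
  also have "\<dots> = (\<Oplus>\<^bsub>MP\<^esub>j\<in>{..N}. term_poly R (A i j) {#} \<otimes>\<^bsub>MP\<^esub> (\<lambda>i\<in>{..N}. subst_lin R N B (\<Phi> i)) j)"
    using assms forms_carrier[OF fmaps_form]
    by (intro mpoly_eval_linear_map) (auto simp: subst_lin_closed)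
  also have "\<dots> = (\<Oplus>\<^bsub>MP\<^esub>j\<in>{..N}. term_poly R (A i j) {#} \<otimes>\<^bsub>MP\<^esub> subst_lin R N B (\<Phi> j))"
    using assms forms_carrier[OF fmaps_form]
    by (intro M.finsum_cong') (auto simp: subst_lin_closed matc_def)
  finally show ?thesis .
qed

lemma conj_map_undefined: "\<not> i \<le> N \<Longrightarrow> conj_map R N A B \<Phi> i = undefined"
  by (simp add: conj_map_def compose_map_def)

lemma conj_map_fmaps:
  assumes "\<Phi> \<in> fmaps R N d" "matc R N A" "matc R N B"
  shows "conj_map R N A B \<Phi> \<in> fmaps R N d"
  unfolding fmaps_def
proof
  fix i assume "i \<in> {..N}"
  then have i: "i \<le> N" by simp
  show "conj_map R N A B \<Phi> i \<in> forms R N d"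
    unfolding conj_map_eq[OF assms i] using assms i
    by (intro form_finsum form_smult subst_lin_form fmaps_form) (auto simp: matc_def)
qed (simp add: conj_map_undefined)

end

section \<open>Composition laws of the action\<close>

context cring
begin

lemma subst_lin_linear_map:
  assumes "matc R N A" "matc R N C" "v \<le> N"
  shows "subst_lin R N A (linear_map R N C v) = linear_map R N (mm R N C A) v"
proof
  fix m
  interpret M: cring MP by (rule MP_cring)
  have c: "A j k \<in> carrier R" "C v j \<in> carrier R" if "j \<le> N" "k \<le> N" for j k
    using assms that by (auto simp: matc_def)
  have 1: "subst_lin R N A (term_poly R (C v j) {#j#}) = (\<Oplus>\<^bsub>MP\<^esub>k\<in>{..N}. term_poly R (C v j \<otimes> A j k) {#k#})"
    if j: "j \<le> N" for j
  proof -
    have "subst_lin R N A (term_poly R (C v j) {#j#})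
        = linear_map R N A j \<otimes>\<^bsub>MP\<^esub> term_poly R (C v j) {#}"
      using c j assms ring_hom_mult[OF subst_lin_hom[OF assms(1)]]
        term_poly_add_mset[of "C v j" j "{#}"]
      by (simp add: subst_lin_var subst_lin_const)
    also have "\<dots> = term_poly R (C v j) {#} \<otimes>\<^bsub>MP\<^esub> linear_map R N A j"
      using c j assms by (intro M.m_comm) (auto simp: linear_map_closed)
    also have "\<dots> = (\<Oplus>\<^bsub>MP\<^esub>k\<in>{..N}. term_poly R (C v j) {#} \<otimes>\<^bsub>MP\<^esub> term_poly R (A j k) {#k#})"
      unfolding linear_map_eq[OF assms(1) j] using c j by (intro M.finsum_rdistr) auto
    also have "\<dots> = (\<Oplus>\<^bsub>MP\<^esub>k\<in>{..N}. term_poly R (C v j \<otimes> A j k) {#k#})"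
      using c j by (intro M.finsum_cong') (auto simp: term_poly_mult_term_poly)
    finally show ?thesis .
  qed
  have "subst_lin R N A (linear_map R N C v)
      = (\<Oplus>\<^bsub>MP\<^esub>j\<in>{..N}. subst_lin R N A (term_poly R (C v j) {#j#}))"
    unfolding linear_map_eq[OF assms(2,3)] using assms c by (intro subst_lin_finsum) auto
  also have "\<dots> = (\<Oplus>\<^bsub>MP\<^esub>j\<in>{..N}. \<Oplus>\<^bsub>MP\<^esub>k\<in>{..N}. term_poly R (C v j \<otimes> A j k) {#k#})"
    using c by (intro M.finsum_cong') (auto simp: 1 intro!: M.finsum_closed)
  also have "\<dots> = (\<Oplus>\<^bsub>MP\<^esub>k\<in>{..N}. \<Oplus>\<^bsub>MP\<^esub>j\<in>{..N}. term_poly R (C v j \<otimes> A j k) {#k#})"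
    using c by (intro M.finsum_swap) auto
  also have "\<dots> = (\<Oplus>\<^bsub>MP\<^esub>k\<in>{..N}. term_poly R (mm R N C A v k) {#k#})"
  proof (intro M.finsum_cong')
    fix k assume k: "k \<in> {..N}"
    show "(\<Oplus>\<^bsub>MP\<^esub>j\<in>{..N}. term_poly R (C v j \<otimes> A j k) {#k#}) = term_poly R (mm R N C A v k) {#k#}"
    proof
      fix m
      have "(\<Oplus>\<^bsub>MP\<^esub>j\<in>{..N}. term_poly R (C v j \<otimes> A j k) {#k#}) m
          = (\<Oplus>j\<in>{..N}. term_poly R (C v j \<otimes> A j k) {#k#} m)"
        using c k by (intro MP_finsum) auto
      then show "(\<Oplus>\<^bsub>MP\<^esub>j\<in>{..N}. term_poly R (C v j \<otimes> A j k) {#k#}) m = term_poly R (mm R N C A v k) {#k#} m"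
        by (simp add: term_poly_def mm_def)
    qed
  qed (use mm_closed[OF assms(2,1)] assms(3) in \<open>auto simp: matc_def\<close>)
  also have "\<dots> = linear_map R N (mm R N C A) v"
    using assms by (intro linear_map_eq[symmetric] mm_closed)
  finally show "subst_lin R N A (linear_map R N C v) m = linear_map R N (mm R N C A) v m" by simp
qed

text \<open>Both sides are homomorphisms, so variables suffice. Substitution reverses the order:
  putting \<open>A\<close> into the linear forms of \<open>C\<close> gives the linear forms of the
  product \<open>C A\<close>.\<close>

lemma subst_lin_subst_lin:
  assumes "matc R N A" "matc R N C" "p \<in> carrier MP"
  shows "subst_lin R N A (subst_lin R N C p) = subst_lin R N (mm R N C A) p"
proof -
  have "(subst_lin R N A \<circ> subst_lin R N C) p = subst_lin R N (mm R N C A) p"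
  proof (rule MP_hom_unique[where f = "subst_lin R N A \<circ> subst_lin R N C" and g = "subst_lin R N (mm R N C A)"
        and S = MP, OF _ _ assms(3)])
    show "subst_lin R N A \<circ> subst_lin R N C \<in> Ring.ring_hom MP MP"
      using subst_lin_hom assms by (intro ring_hom_trans)
    show "subst_lin R N (mm R N C A) \<in> Ring.ring_hom MP MP"
      using assms by (intro subst_lin_hom mm_closed)
    fix v
    have "subst_lin R N A \<zero>\<^bsub>MP\<^esub> = \<zero>\<^bsub>MP\<^esub>"
      using ring_hom_zero[OF subst_lin_hom[OF assms(1)]] cring.axioms(1)[OF MP_cring] by blast
    then show "(subst_lin R N A \<circ> subst_lin R N C) (term_poly R \<one> {#v#}) = subst_lin R N (mm R N C A) (term_poly R \<one> {#v#})"
      using assms by (simp add: subst_lin_var mm_closed subst_lin_linear_map)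
  qed (use assms in \<open>auto simp: subst_lin_const mm_closed\<close>)
  then show ?thesis by simp
qed

lemma linear_map_cong: "eqm N A B \<Longrightarrow> matc R N B \<Longrightarrow> linear_map R N A = linear_map R N B"
  by (auto simp: linear_map_def eqm_def matc_def fun_eq_iff restrict_def intro!: finsum_cong')

lemma conj_map_cong:
  "eqm N A A' \<Longrightarrow> eqm N B B' \<Longrightarrow> matc R N A' \<Longrightarrow> matc R N B' \<Longrightarrow>
    conj_map R N A B \<Phi> = conj_map R N A' B' \<Phi>"
  unfolding conj_map_def by (simp add: linear_map_cong[of N A A'] linear_map_cong[of N B B'])

lemma term_poly_const_finsum:
  assumes "finite I" "\<And>i. i \<in> I \<Longrightarrow> c i \<in> carrier R"
  shows "term_poly R (finsum R c I) {#} = (\<Oplus>\<^bsub>MP\<^esub>i\<in>I. term_poly R (c i) {#})"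
proof
  fix m
  have "(\<Oplus>\<^bsub>MP\<^esub>i\<in>I. term_poly R (c i) {#}) m = (\<Oplus>i\<in>I. term_poly R (c i) {#} m)"
    using assms by (intro MP_finsum) auto
  then show "term_poly R (finsum R c I) {#} m = (\<Oplus>\<^bsub>MP\<^esub>i\<in>I. term_poly R (c i) {#}) m"
    by (simp add: term_poly_def)
qed

text \<open>The entries of the outer matrix \<open>A\<close> and of \<open>C\<close> are constants
  for the substitutions, so the double sum can be exchanged and regrouped into the entries of
  \<open>A C\<close>.\<close>

lemma conj_map_conj_map:
  assumes "\<Phi> \<in> fmaps R N d" "matc R N A" "matc R N B" "matc R N C" "matc R N D"
  shows "conj_map R N A B (conj_map R N C D \<Phi>) = conj_map R N (mm R N A C) (mm R N D B) \<Phi>"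
proof
  fix i
  interpret M: cring MP by (rule MP_cring)
  show "conj_map R N A B (conj_map R N C D \<Phi>) i = conj_map R N (mm R N A C) (mm R N D B) \<Phi> i"
  proof (cases "i \<le> N")
    case True
    define P where "P k = subst_lin R N (mm R N D B) (\<Phi> k)" for k
    have P: "P k \<in> carrier MP" if "k \<le> N" for k
      using that assms forms_carrier[OF fmaps_form] by (auto simp: P_def intro!: subst_lin_closed mm_closed)
    have c: "A i j \<in> carrier R" "C j k \<in> carrier R" if "j \<le> N" "k \<le> N" for j k
      using assms that True by (auto simp: matc_def)
    have S: "subst_lin R N D (\<Phi> k) \<in> carrier MP" if "k \<le> N" for k
      using that assms forms_carrier[OF fmaps_form] by (intro subst_lin_closed)
    have 1: "subst_lin R N B (conj_map R N C D \<Phi> j) = (\<Oplus>\<^bsub>MP\<^esub>k\<in>{..N}. term_poly R (C j k) {#} \<otimes>\<^bsub>MP\<^esub> P k)"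
      if j: "j \<le> N" for j
    proof -
      have "subst_lin R N B (conj_map R N C D \<Phi> j)
        = (\<Oplus>\<^bsub>MP\<^esub>k\<in>{..N}. subst_lin R N B (term_poly R (C j k) {#} \<otimes>\<^bsub>MP\<^esub> subst_lin R N D (\<Phi> k)))"
        unfolding conj_map_eq[OF assms(1,4,5) j] using c j S assms by (intro subst_lin_finsum) auto
      also have "\<dots> = (\<Oplus>\<^bsub>MP\<^esub>k\<in>{..N}. term_poly R (C j k) {#} \<otimes>\<^bsub>MP\<^esub> P k)"
        using c j S assms P forms_carrier[OF fmaps_form[OF assms(1)]]
        by (intro M.finsum_cong') (auto simp: subst_lin_smult subst_lin_subst_lin P_def)
      finally show ?thesis .
    qed
    have "conj_map R N A B (conj_map R N C D \<Phi>) i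
        = (\<Oplus>\<^bsub>MP\<^esub>j\<in>{..N}. term_poly R (A i j) {#} \<otimes>\<^bsub>MP\<^esub> subst_lin R N B (conj_map R N C D \<Phi> j))"
      by (rule conj_map_eq[OF conj_map_fmaps]) (use assms True in auto)
    also have "\<dots> = (\<Oplus>\<^bsub>MP\<^esub>j\<in>{..N}. \<Oplus>\<^bsub>MP\<^esub>k\<in>{..N}. term_poly R (A i j) {#} \<otimes>\<^bsub>MP\<^esub> (term_poly R (C j k) {#} \<otimes>\<^bsub>MP\<^esub> P k))"
      using c P by (intro M.finsum_cong') (auto simp: 1 M.finsum_rdistr intro!: M.finsum_closed)
    also have "\<dots> = (\<Oplus>\<^bsub>MP\<^esub>k\<in>{..N}. \<Oplus>\<^bsub>MP\<^esub>j\<in>{..N}. term_poly R (A i j) {#} \<otimes>\<^bsub>MP\<^esub> (term_poly R (C j k) {#} \<otimes>\<^bsub>MP\<^esub> P k))"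
      using c P by (intro M.finsum_swap) auto
    also have "\<dots> = (\<Oplus>\<^bsub>MP\<^esub>k\<in>{..N}. \<Oplus>\<^bsub>MP\<^esub>j\<in>{..N}. term_poly R (A i j \<otimes> C j k) {#} \<otimes>\<^bsub>MP\<^esub> P k)"
      using c P by (intro M.finsum_cong' M.finsum_closed)
        (auto simp: M.m_assoc[symmetric] term_poly_mult_term_poly intro!: M.finsum_closed)
    also have "\<dots> = (\<Oplus>\<^bsub>MP\<^esub>k\<in>{..N}. term_poly R (mm R N A C i k) {#} \<otimes>\<^bsub>MP\<^esub> P k)"
    proof (intro M.finsum_cong')
      fix k assume k: "k \<in> {..N}"
      show "(\<Oplus>\<^bsub>MP\<^esub>j\<in>{..N}. term_poly R (A i j \<otimes> C j k) {#} \<otimes>\<^bsub>MP\<^esub> P k)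
          = term_poly R (mm R N A C i k) {#} \<otimes>\<^bsub>MP\<^esub> P k"
        unfolding mm_def using c P k
        by (subst term_poly_const_finsum) (auto intro!: M.finsum_ldistr[symmetric])
    qed (use P mm_closed[OF assms(2,4)] True in \<open>auto simp: matc_def\<close>)
    also have "\<dots> = conj_map R N (mm R N A C) (mm R N D B) \<Phi> i"
      unfolding P_def by (rule conj_map_eq[symmetric]) (use assms True in \<open>auto intro: mm_closed\<close>)
    finally show ?thesis .
  qed (simp add: conj_map_undefined)
qed

text \<open>Stated for forms, because \<open>subst_lin\<close> sends the variables beyond
  \<open>N\<close> to zero.\<close>

lemma subst_lin_idm:
  assumes "p \<in> forms R N d"
  shows "subst_lin R N (idm R) p = p"
proof -
  have p: "p \<in> carrier MP" using assms forms_carrier by blast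
  have lin: "linear_map R N (idm R) v = term_poly R \<one> {#v#}" if "v \<le> N" for v
  proof
    fix m
    have "linear_map R N (idm R) v m = (\<Oplus>j\<in>{..N}. if v = j then term_poly R \<one> {#j#} m else \<zero>)"
      using that unfolding linear_map_def idm_def term_poly_def by (auto intro!: finsum_cong')
    also have "\<dots> = term_poly R \<one> {#v#} m"
      using that by (intro finsum_singleton) (auto simp: term_poly_def)
    finally show "linear_map R N (idm R) v m = term_poly R \<one> {#v#} m" .
  qed
  interpret M: cring MP by (rule MP_cring)
  interpret h: mpoly_hom R MP indexed_const "\<lambda>v. term_poly R \<one> {#v#}"
    by unfold_locales (auto simp: indexed_const_hom)
  have "subst_lin R N (idm R) p = h.ev p"
    unfolding subst_lin_def using forms_vars[OF assms] p
    by (intro mpoly_eval_cong MP_cring) (auto simp: indexed_const_eq_term_poly MP_coeff lin)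
  also have "\<dots> = id p"
  proof (rule MP_hom_unique[OF h.ev_hom id_ring_hom p])
    show "h.ev (term_poly R c {#}) = id (term_poly R c {#})" if "c \<in> carrier R" for c
      using h.ev_const[OF that] by (simp add: indexed_const_eq_term_poly)
  qed (simp add: h.ev_var)
  finally show ?thesis by simp
qed

lemma conj_map_idm:
  assumes "\<Phi> \<in> fmaps R N d"
  shows "conj_map R N (idm R) (idm R) \<Phi> = \<Phi>"
proof
  fix i
  interpret M: cring MP by (rule MP_cring)
  show "conj_map R N (idm R) (idm R) \<Phi> i = \<Phi> i"
  proof (cases "i \<le> N")
    case True
    note c = forms_carrier[OF fmaps_form[OF assms]]
    have "conj_map R N (idm R) (idm R) \<Phi> i
        = (\<Oplus>\<^bsub>MP\<^esub>j\<in>{..N}. term_poly R (idm R i j) {#} \<otimes>\<^bsub>MP\<^esub> subst_lin R N (idm R) (\<Phi> j))"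
      by (rule conj_map_eq[OF assms idm_closed idm_closed True])
    also have "\<dots> = (\<Oplus>\<^bsub>MP\<^esub>j\<in>{..N}. if i = j then \<Phi> j else \<zero>\<^bsub>MP\<^esub>)"
    proof (intro M.finsum_cong')
      fix j assume "j \<in> {..N}"
      then show "term_poly R (idm R i j) {#} \<otimes>\<^bsub>MP\<^esub> subst_lin R N (idm R) (\<Phi> j) = (if i = j then \<Phi> j else \<zero>\<^bsub>MP\<^esub>)"
        using c[of j]
        by (auto simp: subst_lin_idm[OF fmaps_form[OF assms]])
          (auto simp: idm_def MP_one[symmetric] term_poly_zero)
    qed (use c in auto)
    also have "\<dots> = \<Phi> i" using c True by (intro M.finsum_singleton) auto
    finally show ?thesis .
  next
    case False
    then show ?thesis using assms by (auto simp: conj_map_undefined fmaps_def PiE_def extensional_def)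
  qed
qed

lemma scale_map_eq: "c \<in> carrier R \<Longrightarrow> \<Phi> \<in> fmaps R N d \<Longrightarrow> i \<le> N \<Longrightarrow>
   scale_map R N c \<Phi> i = term_poly R c {#} \<otimes>\<^bsub>MP\<^esub> \<Phi> i"
  using forms_carrier[OF fmaps_form] by (auto simp: scale_map_def fun_eq_iff term_poly_mult)

lemma scale_map_fmaps: "c \<in> carrier R \<Longrightarrow> \<Phi> \<in> fmaps R N d \<Longrightarrow> scale_map R N c \<Phi> \<in> fmaps R N d"
proof -
  assume *: "c \<in> carrier R" "\<Phi> \<in> fmaps R N d"
  show ?thesis unfolding fmaps_def
  proof
    fix i assume i: "i \<in> {..N}"
    then show "scale_map R N c \<Phi> i \<in> forms R N d"
      using scale_map_eq[OF *] form_smult[OF *(1) fmaps_form[OF *(2)]] by simp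
  qed (simp add: scale_map_def)
qed

lemma scale_map_scale_map:
  "c \<in> carrier R \<Longrightarrow> c' \<in> carrier R \<Longrightarrow> \<Phi> \<in> fmaps R N d \<Longrightarrow>
    scale_map R N c (scale_map R N c' \<Phi>) = scale_map R N (c \<otimes> c') \<Phi>"
  using MP_coeff[OF forms_carrier[OF fmaps_form]]
  by (auto simp: scale_map_def fun_eq_iff m_assoc restrict_def)

lemma scale_map_one: "\<Phi> \<in> fmaps R N d \<Longrightarrow> scale_map R N \<one> \<Phi> = \<Phi>"
proof
  fix i assume *: "\<Phi> \<in> fmaps R N d"
  show "scale_map R N \<one> \<Phi> i = \<Phi> i"
    using MP_coeff[OF forms_carrier[OF fmaps_form[OF *]]] *
    by (cases "i \<le> N") (auto simp: scale_map_def fun_eq_iff fmaps_def PiE_def extensional_def)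
qed

lemma conj_map_scale:
  assumes "\<Phi> \<in> fmaps R N d" "matc R N A" "matc R N B" "c \<in> carrier R"
  shows "conj_map R N A B (scale_map R N c \<Phi>) = scale_map R N c (conj_map R N A B \<Phi>)"
proof
  fix i
  interpret M: cring MP by (rule MP_cring)
  show "conj_map R N A B (scale_map R N c \<Phi>) i = scale_map R N c (conj_map R N A B \<Phi>) i"
  proof (cases "i \<le> N")
    case True
    have S: "subst_lin R N B (\<Phi> k) \<in> carrier MP" if "k \<le> N" for k
      using that assms forms_carrier[OF fmaps_form] by (intro subst_lin_closed)
    have a: "A i k \<in> carrier R" if "k \<le> N" for k using assms that True by (auto simp: matc_def)
    have "conj_map R N A B (scale_map R N c \<Phi>) i
       = (\<Oplus>\<^bsub>MP\<^esub>j\<in>{..N}. term_poly R (A i j) {#} \<otimes>\<^bsub>MP\<^esub> subst_lin R N B (scale_map R N c \<Phi> j))"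
      by (rule conj_map_eq[OF scale_map_fmaps]) (use assms True in auto)
    also have "\<dots> = (\<Oplus>\<^bsub>MP\<^esub>j\<in>{..N}. term_poly R c {#} \<otimes>\<^bsub>MP\<^esub> (term_poly R (A i j) {#} \<otimes>\<^bsub>MP\<^esub> subst_lin R N B (\<Phi> j)))"
      using S a assms forms_carrier[OF fmaps_form[OF assms(1)]]
      by (intro M.finsum_cong') (auto simp: scale_map_eq subst_lin_smult intro!: M.m_lcomm)
    also have "\<dots> = term_poly R c {#} \<otimes>\<^bsub>MP\<^esub> conj_map R N A B \<Phi> i"
      unfolding conj_map_eq[OF assms(1-3) True]
      using S a assms by (intro M.finsum_rdistr[symmetric]) auto
    finally show ?thesis using scale_map_eq[OF assms(4) conj_map_fmaps[OF assms(1-3)] True] by simp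
  qed (simp add: conj_map_undefined scale_map_def)
qed

end

section \<open>Base change of polynomial maps along a ring homomorphism\<close>

context ring_hom_cring
begin

lemma map_poly_closed: "p \<in> carrier R.MP \<Longrightarrow> (\<lambda>m. h (p m)) \<in> carrier S.MP"
  unfolding R.MP_carrier S.MP_carrier
  by (auto elim!: finite_subset[rotated])

lemma map_poly_term_poly: "(\<lambda>m. h (term_poly R c a m)) = term_poly S (h c) a"
  by (auto simp: term_poly_def)

lemma map_poly_hom: "(\<lambda>p m. h (p m)) \<in> Ring.ring_hom R.MP S.MP"
proof (rule ring_hom_memI)
  fix p q :: "'e multiset \<Rightarrow> 'a" assume pq: "p \<in> carrier R.MP" "q \<in> carrier R.MP"
  show "(\<lambda>m. h ((p \<otimes>\<^bsub>R.MP\<^esub> q) m)) = (\<lambda>m. h (p m)) \<otimes>\<^bsub>S.MP\<^esub> (\<lambda>m. h (q m))"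
  proof
    fix m
    show "h ((p \<otimes>\<^bsub>R.MP\<^esub> q) m) = ((\<lambda>m. h (p m)) \<otimes>\<^bsub>S.MP\<^esub> (\<lambda>m. h (q m))) m"
      unfolding R.MP_mult S.MP_mult using pq
      by (subst hom_finsum) (auto simp: R.MP_coeff intro!: S.finsum_cong')
  qed
  show "(\<lambda>m. h ((p \<oplus>\<^bsub>R.MP\<^esub> q) m)) = (\<lambda>m. h (p m)) \<oplus>\<^bsub>S.MP\<^esub> (\<lambda>m. h (q m))"
    using pq by (auto simp: R.MP_add S.MP_add R.MP_coeff fun_eq_iff)
qed (auto simp: map_poly_closed R.MP_one S.MP_one map_poly_term_poly)

lemma map_poly_form: "p \<in> forms R N d \<Longrightarrow> (\<lambda>m. h (p m)) \<in> forms S N d"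
  by (auto simp: forms_def map_poly_closed) (metis hom_zero)

lemma map_coeffs_fmaps: "\<Phi> \<in> fmaps R N d \<Longrightarrow> map_coeffs N h \<Phi> \<in> fmaps S N d"
  by (auto simp: fmaps_def map_coeffs_def intro!: map_poly_form)

lemma matc_map: "matc R N A \<Longrightarrow> matc S N (\<lambda>i j. h (A i j))"
  by (auto simp: matc_def)

lemma mm_map:
  assumes "matc R N A" "matc R N B" "i \<le> N" "j \<le> N"
  shows "mm S N (\<lambda>i j. h (A i j)) (\<lambda>i j. h (B i j)) i j = h (mm R N A B i j)"
  unfolding mm_def using assms
  by (subst hom_finsum) (auto simp: matc_def comp_def intro!: S.finsum_cong')

lemma inverse_matrices_map:
  assumes "inverse_matrices R N A B"
  shows "inverse_matrices S N (\<lambda>i j. h (A i j)) (\<lambda>i j. h (B i j))"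
  using assms unfolding inverse_matrices_iff
  by (auto simp: matc_map eqm_def mm_map idm_def)

lemma map_linear_map:
  assumes "matc R N A" "i \<le> N"
  shows "(\<lambda>m. h (linear_map R N A i m)) = linear_map S N (\<lambda>i j. h (A i j)) i"
proof
  fix m
  show "h (linear_map R N A i m) = linear_map S N (\<lambda>i j. h (A i j)) i m"
    using assms unfolding linear_map_def
    by (simp, subst hom_finsum) (auto simp: matc_def comp_def intro!: S.finsum_cong')
qed

text \<open>Both sides are homomorphisms out of the polynomial ring, and they agree on constants and
  variables.\<close>

lemma map_subst_lin:
  assumes "matc R N A" "p \<in> carrier R.MP"
  shows "(\<lambda>m. h (subst_lin R N A p m)) = subst_lin S N (\<lambda>i j. h (A i j)) (\<lambda>m. h (p m))"
proof -
  let ?f = "(\<lambda>p m. h (p m)) \<circ> subst_lin R N A"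
  let ?g = "subst_lin S N (\<lambda>i j. h (A i j)) \<circ> (\<lambda>p m. h (p m))"
  note mA = matc_map[OF assms(1)]
  have "?f p = ?g p"
  proof (rule R.MP_hom_unique[where f = ?f and g = ?g and S = S.MP, OF _ _ assms(2)])
    show "?f \<in> Ring.ring_hom R.MP S.MP"
      by (rule ring_hom_trans[OF R.subst_lin_hom[OF assms(1)] map_poly_hom])
    show "?g \<in> Ring.ring_hom R.MP S.MP"
      by (rule ring_hom_trans[OF map_poly_hom S.subst_lin_hom[OF mA]])
    show "?f (term_poly R c {#}) = ?g (term_poly R c {#})" if "c \<in> carrier R" for c
      using that assms mA by (simp add: R.subst_lin_const S.subst_lin_const map_poly_term_poly)
    show "?f (term_poly R \<one>\<^bsub>R\<^esub> {#v#}) = ?g (term_poly R \<one>\<^bsub>R\<^esub> {#v#})" for v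
      using assms mA
      by (simp add: R.subst_lin_var S.subst_lin_var map_poly_term_poly map_linear_map)
        (simp add: R.MP_zero S.MP_zero)
  qed
  then show ?thesis by simp
qed

text \<open>Used for three homomorphisms: the inclusion of a subring, the embedding into the
  completion, and the specialisation of generic coefficients.\<close>

lemma map_conj_map:
  assumes "\<Phi> \<in> fmaps R N d" "matc R N A" "matc R N B"
  shows "map_coeffs N h (conj_map R N A B \<Phi>)
    = conj_map S N (\<lambda>i j. h (A i j)) (\<lambda>i j. h (B i j)) (map_coeffs N h \<Phi>)"
proof
  fix i
  interpret M: cring S.MP by (rule S.MP_cring)
  interpret mh: ring_hom_cring R.MP S.MP "\<lambda>p m. h (p m)"
    by (intro ring_hom_cringI R.MP_cring S.MP_cring map_poly_hom)
  show "map_coeffs N h (conj_map R N A B \<Phi>) i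
    = conj_map S N (\<lambda>i j. h (A i j)) (\<lambda>i j. h (B i j)) (map_coeffs N h \<Phi>) i"
  proof (cases "i \<le> N")
    case True
    note c = R.forms_carrier[OF R.fmaps_form[OF assms(1)]]
    have a: "A i j \<in> carrier R" if "j \<le> N" for j using assms that True by (auto simp: matc_def)
    have "(\<lambda>m. h (conj_map R N A B \<Phi> i m))
      = (\<Oplus>\<^bsub>S.MP\<^esub>j\<in>{..N}. (\<lambda>m. h ((term_poly R (A i j) {#} \<otimes>\<^bsub>R.MP\<^esub> subst_lin R N B (\<Phi> j)) m)))"
      unfolding R.conj_map_eq[OF assms True] using a c assms
      by (subst mh.hom_finsum) (auto simp: comp_def R.subst_lin_closed)
    also have "\<dots> = (\<Oplus>\<^bsub>S.MP\<^esub>j\<in>{..N}. term_poly S (h (A i j)) {#} \<otimes>\<^bsub>S.MP\<^esub>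
        subst_lin S N (\<lambda>i j. h (B i j)) (map_coeffs N h \<Phi> j))"
    proof (intro M.finsum_cong')
      fix j assume j: "j \<in> {..N}"
      have "(\<lambda>m. h ((term_poly R (A i j) {#} \<otimes>\<^bsub>R.MP\<^esub> subst_lin R N B (\<Phi> j)) m))
        = (\<lambda>m. h (term_poly R (A i j) {#} m)) \<otimes>\<^bsub>S.MP\<^esub> (\<lambda>m. h (subst_lin R N B (\<Phi> j) m))"
        using a c assms j by (intro mh.hom_mult R.subst_lin_closed) auto
      then show "(\<lambda>m. h ((term_poly R (A i j) {#} \<otimes>\<^bsub>R.MP\<^esub> subst_lin R N B (\<Phi> j)) m))
        = term_poly S (h (A i j)) {#} \<otimes>\<^bsub>S.MP\<^esub> subst_lin S N (\<lambda>i j. h (B i j)) (map_coeffs N h \<Phi> j)"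
        using j c assms by (simp add: map_poly_term_poly map_subst_lin map_coeffs_def)
    qed (use a c assms S.forms_carrier[OF S.fmaps_form[OF map_coeffs_fmaps[OF assms(1)]]] in
          \<open>auto intro!: M.m_closed S.subst_lin_closed matc_map\<close>)
    also have "\<dots> = conj_map S N (\<lambda>i j. h (A i j)) (\<lambda>i j. h (B i j)) (map_coeffs N h \<Phi>) i"
      using assms True by (intro S.conj_map_eq[symmetric, OF map_coeffs_fmaps] matc_map)
    finally show ?thesis using True by (simp add: map_coeffs_def)
  qed (simp add: map_coeffs_def S.conj_map_undefined)
qed

lemma map_scale_map:
  assumes "\<Phi> \<in> fmaps R N d" "c \<in> carrier R"
  shows "map_coeffs N h (scale_map R N c \<Phi>) = scale_map S N (h c) (map_coeffs N h \<Phi>)"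
  using assms R.MP_coeff[OF R.forms_carrier[OF R.fmaps_form[OF assms(1)]]]
  by (auto simp: map_coeffs_def scale_map_def fun_eq_iff)

end

section \<open>Coefficients in a subring, and diagonal changes of coordinates\<close>

context cring
begin

text \<open>A subring is closed under the operations because the inclusion commutes with them.\<close>

lemma conj_map_subring:
  assumes V: "subring V R"
    and \<Phi>: "\<Phi> \<in> fmaps R N d" "\<And>i m. i \<le> N \<Longrightarrow> \<Phi> i m \<in> V"
    and AB: "\<And>i j. i \<le> N \<Longrightarrow> j \<le> N \<Longrightarrow> A i j \<in> V \<and> B i j \<in> V"
    and "i \<le> N"
  shows "conj_map R N A B \<Phi> i m \<in> V"
proof -
  let ?V = "R\<lparr>carrier := V\<rparr>"
  have sub: "V \<subseteq> carrier R" using V by (rule subringE)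
  interpret h: ring_hom_cring ?V R "\<lambda>x. x"
    using sub by (intro ring_hom_cringI subcring_iff[THEN iffD1, OF sub subcringI'[OF V]] cring_axioms) 
      (auto simp: Ring.ring_hom_def)
  have f: "\<Phi> \<in> fmaps ?V N d"
    using \<Phi> unfolding fmaps_def forms_def by (auto simp: MP_carrier h.R.MP_carrier PiE_iff)
  have m: "matc ?V N A" "matc ?V N B" using AB by (auto simp: matc_def)
  have "map_coeffs N (\<lambda>x. x) (conj_map ?V N A B \<Phi>) = conj_map R N A B (map_coeffs N (\<lambda>x. x) \<Phi>)"
    by (rule h.map_conj_map[OF f m])
  moreover have "map_coeffs N (\<lambda>x. x) \<Phi> = \<Phi>"
  proof
    fix i show "map_coeffs N (\<lambda>x. x) \<Phi> i = \<Phi> i"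
      using \<Phi>(1) by (cases "i \<le> N") (auto simp: map_coeffs_def fmaps_def PiE_def extensional_def)
  qed
  ultimately have "conj_map R N A B \<Phi> = map_coeffs N (\<lambda>x. x) (conj_map ?V N A B \<Phi>)" by simp
  then have "conj_map R N A B \<Phi> i m = map_coeffs N (\<lambda>x. x) (conj_map ?V N A B \<Phi>) i m" by (rule fun_cong[THEN fun_cong])
  also have "\<dots> = conj_map ?V N A B \<Phi> i m" using \<open>i \<le> N\<close> by (simp add: map_coeffs_def)
  also have "\<dots> \<in> carrier ?V"
    by (rule h.R.MP_coeff[OF h.R.forms_carrier[OF h.R.fmaps_form[OF h.R.conj_map_fmaps[OF f m] \<open>i \<le> N\<close>]]])
  finally show ?thesis by simp
qed

definition diagm :: "(nat \<Rightarrow> 'a) \<Rightarrow> nat \<Rightarrow> nat \<Rightarrow> 'a" where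
  "diagm b = (\<lambda>i j. if i = j then b i else \<zero>)"

lemma diagm_closed: "(\<And>i. i \<le> N \<Longrightarrow> b i \<in> carrier R) \<Longrightarrow> matc R N (diagm b)"
  by (auto simp: diagm_def matc_def)

lemma linear_map_diagm:
  assumes "\<And>i. i \<le> N \<Longrightarrow> b i \<in> carrier R" "v \<le> N"
  shows "linear_map R N (diagm b) v = term_poly R (b v) {#v#}"
proof
  fix m
  have "linear_map R N (diagm b) v m = (\<Oplus>j\<in>{..N}. if v = j then term_poly R (b j) {#j#} m else \<zero>)"
    using assms unfolding linear_map_def diagm_def term_poly_def by (auto intro!: finsum_cong')
  also have "\<dots> = term_poly R (b v) {#v#} m"
    using assms by (intro finsum_singleton) (auto simp: term_poly_def)
  finally show "linear_map R N (diagm b) v m = term_poly R (b v) {#v#} m" .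
qed

text \<open>The value of a monomial at \<open>b\<close> is multiplicative in the monomial, so
  weighting the coefficient at \<open>m\<close> by this value is compatible with the convolution
  product.\<close>

lemma dilate_hom:
  assumes "\<And>v. b v \<in> carrier R"
  shows "(\<lambda>p m. mon_eval R m b \<otimes> p m) \<in> Ring.ring_hom MP MP"
proof (rule ring_hom_memI)
  have b: "mon_eval R m b \<in> carrier R" for m using assms by (intro mon_eval_closed)
  fix p q :: "'c multiset \<Rightarrow> 'a" assume p: "p \<in> carrier MP" 
  show "(\<lambda>m. mon_eval R m b \<otimes> p m) \<in> carrier MP"
    using p b by (auto simp: MP_carrier elim!: finite_subset[rotated])
  assume q: "q \<in> carrier MP"
  show "(\<lambda>m. mon_eval R m b \<otimes> (p \<oplus>\<^bsub>MP\<^esub> q) m) = (\<lambda>m. mon_eval R m b \<otimes> p m) \<oplus>\<^bsub>MP\<^esub> (\<lambda>m. mon_eval R m b \<otimes> q m)"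
    using p q b by (auto simp: MP_add fun_eq_iff MP_coeff intro!: r_distr)
  show "(\<lambda>m. mon_eval R m b \<otimes> (p \<otimes>\<^bsub>MP\<^esub> q) m) = (\<lambda>m. mon_eval R m b \<otimes> p m) \<otimes>\<^bsub>MP\<^esub> (\<lambda>m. mon_eval R m b \<otimes> q m)"
  proof
    fix m
    have "mon_eval R m b \<otimes> (p \<otimes>\<^bsub>MP\<^esub> q) m = (\<Oplus>a\<in>{a. a \<subseteq># m}. mon_eval R m b \<otimes> (p a \<otimes> q (m - a)))"
      unfolding MP_mult using p q b by (intro finsum_rdistr) (auto simp: finite_submsets MP_coeff)
    also have "\<dots> = (\<Oplus>a\<in>{a. a \<subseteq># m}. (mon_eval R a b \<otimes> p a) \<otimes> (mon_eval R (m - a) b \<otimes> q (m - a)))"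
    proof (intro finsum_cong')
      fix a assume "a \<in> {a. a \<subseteq># m}"
      then have "mon_eval R m b = mon_eval R a b \<otimes> mon_eval R (m - a) b"
        using mon_eval_add[OF assms, of a "m - a"] by simp
      then show "mon_eval R m b \<otimes> (p a \<otimes> q (m - a)) = (mon_eval R a b \<otimes> p a) \<otimes> (mon_eval R (m - a) b \<otimes> q (m - a))"
        using b p q by (simp add: m_ac MP_coeff)
    qed (use b p q in \<open>auto simp: MP_coeff\<close>)
    finally show "mon_eval R m b \<otimes> (p \<otimes>\<^bsub>MP\<^esub> q) m
        = ((\<lambda>m. mon_eval R m b \<otimes> p m) \<otimes>\<^bsub>MP\<^esub> (\<lambda>m. mon_eval R m b \<otimes> q m)) m"
      unfolding MP_mult .
  qed
next
  show "(\<lambda>m. mon_eval R m b \<otimes> \<one>\<^bsub>MP\<^esub> m) = \<one>\<^bsub>MP\<^esub>"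
    using assms mon_eval_closed[of _ b] by (auto simp: MP_one term_poly_def fun_eq_iff)
qed

text \<open>The vanishing of \<open>b\<close> beyond \<open>N\<close> matches the extension by zero
  in \<open>subst_lin\<close>; the two homomorphisms then agree on every variable.\<close>

lemma subst_lin_diagm:
  assumes "\<And>v. b v \<in> carrier R" "\<And>v. \<not> v \<le> N \<Longrightarrow> b v = \<zero>" "p \<in> carrier MP"
  shows "subst_lin R N (diagm b) p = (\<lambda>m. mon_eval R m b \<otimes> p m)"
proof (rule MP_hom_unique[where f = "subst_lin R N (diagm b)" and g = "\<lambda>p m. mon_eval R m b \<otimes> p m"
        and S = MP, OF subst_lin_hom[OF diagm_closed[OF assms(1)]] dilate_hom[OF assms(1)] assms(3)])
  note m = diagm_closed[of N b, OF assms(1)]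
  have b: "mon_eval R m b \<in> carrier R" for m using assms by (intro mon_eval_closed)
  show "subst_lin R N (diagm b) (term_poly R c {#}) = (\<lambda>m. mon_eval R m b \<otimes> term_poly R c {#} m)"
    if "c \<in> carrier R" for c
    using that b unfolding subst_lin_const[OF m that] by (auto simp: term_poly_def fun_eq_iff)
  show "subst_lin R N (diagm b) (term_poly R \<one> {#v#}) = (\<lambda>m. mon_eval R m b \<otimes> term_poly R \<one> {#v#} m)" for v
    using assms b mon_eval_single[of b v] unfolding subst_lin_var[OF m]
    by (auto simp: linear_map_diagm MP_zero) (auto simp: term_poly_def fun_eq_iff)
qed

lemma conj_map_diagm:
  assumes "\<And>v. b v \<in> carrier R" "\<And>v. \<not> v \<le> N \<Longrightarrow> b v = \<zero>"
    and "\<And>v. v \<le> N \<Longrightarrow> a v \<in> carrier R" "\<Phi> \<in> fmaps R N d" "i \<le> N"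
  shows "conj_map R N (diagm a) (diagm b) \<Phi> i m = a i \<otimes> (mon_eval R m b \<otimes> \<Phi> i m)"
proof -
  interpret M: cring MP by (rule MP_cring)
  note c = forms_carrier[OF fmaps_form[OF assms(4)]]
  note mb = diagm_closed[of N b, OF assms(1)]
  have "conj_map R N (diagm a) (diagm b) \<Phi> i
      = (\<Oplus>\<^bsub>MP\<^esub>j\<in>{..N}. term_poly R (diagm a i j) {#} \<otimes>\<^bsub>MP\<^esub> subst_lin R N (diagm b) (\<Phi> j))"
    using assms by (intro conj_map_eq[OF assms(4)] diagm_closed) auto
  also have "\<dots> = (\<Oplus>\<^bsub>MP\<^esub>j\<in>{..N}. if i = j then term_poly R (a j) {#} \<otimes>\<^bsub>MP\<^esub> subst_lin R N (diagm b) (\<Phi> j) else \<zero>\<^bsub>MP\<^esub>)"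
    using c assms(3) subst_lin_closed[OF mb]
    by (intro M.finsum_cong') (auto simp: diagm_def[of a] term_poly_zero)
  also have "\<dots> = term_poly R (a i) {#} \<otimes>\<^bsub>MP\<^esub> subst_lin R N (diagm b) (\<Phi> i)"
    using c assms(3,5) subst_lin_closed[OF mb]
    by (intro M.finsum_singleton) auto
  finally show ?thesis
    using assms subst_lin_closed[OF mb c] c by (simp add: term_poly_mult subst_lin_diagm)
qed

end

section \<open>Integral polynomials in the generic coefficients\<close>

text \<open>A type class ring as a record. Through it \<open>generic_poly\<close> can itself be the
  coefficient ring of polynomial maps, and determinants of matrices over a type become available for
  them.\<close>

definition univ_ring :: "'b :: comm_ring_1 ring" where
  "univ_ring = \<lparr>carrier = UNIV, monoid.mult = (*), one = 1, zero = 0, add = (+)\<rparr>"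

lemma univ_ring_sel [simp]:
  "carrier univ_ring = UNIV" "x \<otimes>\<^bsub>univ_ring\<^esub> y = x * y" "\<one>\<^bsub>univ_ring\<^esub> = 1"
  "\<zero>\<^bsub>univ_ring\<^esub> = 0" "x \<oplus>\<^bsub>univ_ring\<^esub> y = x + y"
  by (simp_all add: univ_ring_def)

lemma univ_ring_cring: "cring (univ_ring :: 'b :: comm_ring_1 ring)"
proof (intro cringI abelian_groupI comm_monoidI)
  fix x :: 'b assume "x \<in> carrier univ_ring"
  then show "\<exists>y\<in>carrier univ_ring. y \<oplus>\<^bsub>univ_ring\<^esub> x = \<zero>\<^bsub>univ_ring\<^esub>"
    by (intro bexI[of _ "- x"]) auto
qed (auto simp: algebra_simps)

interpretation univ: cring univ_ring
  by (rule univ_ring_cring)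

lemma univ_finsum [simp]: "finsum univ_ring f A = sum f A"
  by (induction A rule: infinite_finite_induct) auto

lemma univ_minus [simp]: "(\<ominus>\<^bsub>univ_ring\<^esub> x) = - x"
  by (rule univ.minus_equality) auto

context cring
begin

definition int_const :: "int \<Rightarrow> 'a" where
  "int_const k = [k] \<cdot> \<one>"

lemma int_const_hom: "int_const \<in> Ring.ring_hom \<Z> R"
proof (rule ring_hom_memI)
  fix x y :: int
  show "int_const x \<in> carrier R" by (simp add: int_const_def)
  have "int_const x \<otimes> int_const y = [x] \<cdot> ([y] \<cdot> \<one>)"
    unfolding int_const_def by (subst add_pow_ldistr_int) auto
  also have "\<dots> = int_const (x * y)"
    unfolding int_const_def using add.int_pow_pow[of \<one> x y] by (simp add: mult.commute)
  finally show "int_const (x \<otimes>\<^bsub>\<Z>\<^esub> y) = int_const x \<otimes> int_const y" by simp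
  show "int_const (x \<oplus>\<^bsub>\<Z>\<^esub> y) = int_const x \<oplus> int_const y"
    by (simp add: int_const_def add.int_pow_mult)
qed (simp add: int_const_def)

end

type_synonym 'v zpoly = "'v multiset \<Rightarrow>\<^sub>0 int"

definition Var :: "'v \<Rightarrow> 'v zpoly" where
  "Var v = Poly_Mapping.single {#v#} 1"

lemma zpoly_induct_single [case_names zero single add]:
  fixes p :: "'v zpoly"
  assumes "P 0" "\<And>a c. P (Poly_Mapping.single a c)" "\<And>p q. P p \<Longrightarrow> P q \<Longrightarrow> P (p + q)"
  shows "P p"
proof -
  have "P (\<Sum>k\<in>S. Poly_Mapping.single k (Poly_Mapping.lookup p k))" if "finite S" for S
    using that by (induction S rule: finite_induct) (auto intro: assms)
  moreover have "p = (\<Sum>k\<in>Poly_Mapping.keys p. Poly_Mapping.single k (Poly_Mapping.lookup p k))"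
    by (rule poly_mapping_eqI) (auto simp: lookup_sum lookup_single when_def in_keys_iff)
  ultimately show ?thesis by (metis finite_keys)
qed

interpretation ZM: cring "mpoly_ring \<Z>"
  by (rule cring.MP_cring[OF int_is_cring])

lemma lookup_closed: "Poly_Mapping.lookup p \<in> carrier (mpoly_ring \<Z>)"
  for p :: "'v zpoly"
  using cring.MP_carrier[OF int_is_cring, of "Poly_Mapping.lookup p"] by simp

lemma lookup_single_term: "Poly_Mapping.lookup (Poly_Mapping.single a c) = term_poly \<Z> c a"
  by (auto simp: term_poly_def lookup_single when_def)

lemma lookup_add_MP:
  "Poly_Mapping.lookup (p + q) = Poly_Mapping.lookup p \<oplus>\<^bsub>mpoly_ring \<Z>\<^esub> Poly_Mapping.lookup q"
  for p :: "'v zpoly"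
  by (auto simp: fun_eq_iff lookup_add cring.MP_add[OF int_is_cring])

lemma lookup_zero_MP: "Poly_Mapping.lookup (0 :: 'v zpoly) = \<zero>\<^bsub>mpoly_ring \<Z>\<^esub>"
  by (auto simp: fun_eq_iff cring.MP_zero[OF int_is_cring])

text \<open>\<open>lookup\<close> identifies the type \<open>zpoly\<close> with the polynomial ring
  over \<int> as a record; both products are bilinear, so it suffices to compare them on
  terms.\<close>

lemma lookup_mult_MP:
  "Poly_Mapping.lookup (p * q) = Poly_Mapping.lookup p \<otimes>\<^bsub>mpoly_ring \<Z>\<^esub> Poly_Mapping.lookup q"
  for p :: "'v zpoly"
proof (induction p rule: zpoly_induct_single)
  case zero
  then show ?case by (simp only: mult_zero_left lookup_zero_MP ZM.l_null[OF lookup_closed])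
next
  case (add p p')
  then show ?case
    by (simp only: distrib_right lookup_add_MP ZM.l_distr[OF lookup_closed lookup_closed lookup_closed])
next
  case (single a c)
  show ?case
  proof (induction q rule: zpoly_induct_single)
    case zero
    then show ?case by (simp only: mult_zero_right lookup_zero_MP ZM.r_null[OF lookup_closed])
  next
    case (add p p')
    then show ?case
      by (simp only: distrib_left lookup_add_MP ZM.r_distr[OF lookup_closed lookup_closed lookup_closed])
  next
    case (single b c')
    then show ?case
      by (simp add: mult_single lookup_single_term cring.term_poly_mult_term_poly[OF int_is_cring])
  qed
qed

lemma lookup_one_MP: "Poly_Mapping.lookup (1 :: 'v zpoly) = \<one>\<^bsub>mpoly_ring \<Z>\<^esub>"
  unfolding single_one[symmetric] lookup_single_term cring.MP_one[OF int_is_cring]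
  by simp

definition geval :: "('k, 'm) ring_scheme \<Rightarrow> 'v zpoly \<Rightarrow> ('v \<Rightarrow> 'k) \<Rightarrow> 'k" where
  "geval F p a = mpoly_eval \<Z> F (\<lambda>k. [k] \<cdot>\<^bsub>F\<^esub> \<one>\<^bsub>F\<^esub>) (Poly_Mapping.lookup p) a"

lemma generic_eval_geval: "generic_eval F q \<Phi> = geval F q (\<lambda>(i, m). \<Phi> i m)"
  by (simp add: generic_eval_def geval_def)

context cring
begin

lemma geval_mpoly_hom: "(\<And>v. a v \<in> carrier R) \<Longrightarrow> mpoly_hom \<Z> R (\<lambda>k. [k] \<cdot> \<one>) a"
  using int_const_hom int_is_cring cring_axioms
  by (simp add: mpoly_hom_def mpoly_hom_axioms_def int_const_def[abs_def])

lemma geval_hom: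
  assumes "\<And>v. a v \<in> carrier R"
  shows "(\<lambda>p. geval R p a) \<in> Ring.ring_hom univ_ring R"
proof -
  interpret mpoly_hom \<Z> R "\<lambda>k. [k] \<cdot> \<one>" a by (rule geval_mpoly_hom[OF assms])
  show ?thesis unfolding geval_def
    by (rule ring_hom_memI)
      (auto simp: lookup_add_MP lookup_mult_MP lookup_one_MP lookup_closed ev_closed ev_add ev_mult
         ring_hom_one[OF ev_hom])
qed

lemma geval_closed: "(\<And>v. a v \<in> carrier R) \<Longrightarrow> geval R p a \<in> carrier R"
  using ring_hom_closed[OF geval_hom, of a p] by simp

lemma geval_Var: "(\<And>v. a v \<in> carrier R) \<Longrightarrow> geval R (Var v) a = a v"
  using mpoly_hom.ev_var[OF geval_mpoly_hom, of a v]
  by (simp add: geval_def Var_def lookup_single_term)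

text \<open>The image of every integer is forced by that of 1, so the values at the variables
  determine a homomorphism on the polynomials over \<int>.\<close>

lemma zpoly_hom_unique:
  fixes p :: "'v zpoly"
  assumes f: "f \<in> Ring.ring_hom univ_ring R" and g: "g \<in> Ring.ring_hom univ_ring R"
    and var: "\<And>v. f (Var v) = g (Var v)"
  shows "f p = g p"
proof -
  note fs = ring_hom_mult[OF f, simplified] ring_hom_add[OF f, simplified] ring_hom_one[OF f, simplified]
    ring_hom_closed[OF f, simplified]
  note gs = ring_hom_mult[OF g, simplified] ring_hom_add[OF g, simplified] ring_hom_one[OF g, simplified]
    ring_hom_closed[OF g, simplified]
  have z: "f 0 = \<zero>" "g 0 = \<zero>"
    using fs(2)[of 0 0] gs(2)[of 0 0] fs(4)[of 0] gs(4)[of 0] by simp_all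
  have int: "f (Poly_Mapping.single {#} c) = g (Poly_Mapping.single {#} c)" for c
  proof (induction c rule: int_induct[where k = 0])
    case base
    then show ?case by (simp add: z)
  next
    case (step1 i)
    have *: "Poly_Mapping.single {#} (i + 1) = Poly_Mapping.single {#} i + (1 :: 'v zpoly)"
      by (simp add: single_add)
    show ?case using step1 by (simp only: * fs gs)
  next
    case (step2 i)
    have *: "Poly_Mapping.single {#} i = Poly_Mapping.single {#} (i - 1) + (1 :: 'v zpoly)"
      by (simp add: single_diff)
    have "f (Poly_Mapping.single {#} (i - 1)) \<oplus> \<one> = g (Poly_Mapping.single {#} (i - 1)) \<oplus> \<one>"
      using step2 fs(2)[of "Poly_Mapping.single {#} (i - 1)" 1] gs(2)[of "Poly_Mapping.single {#} (i - 1)" 1]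
      unfolding * by (simp only: fs gs)
    then show ?case using fs(4) gs(4) by simp
  qed
  have mon: "f (Poly_Mapping.single m 1) = g (Poly_Mapping.single m 1)" for m
  proof (induction m)
    case empty
    show ?case by (rule int)
  next
    case (add v m)
    have "Poly_Mapping.single (add_mset v m) (1 :: int) = Var v * Poly_Mapping.single m 1"
      by (simp add: Var_def mult_single)
    then show ?case using add var by (simp add: fs gs)
  qed
  show ?thesis
  proof (induction p rule: zpoly_induct_single)
    case zero
    then show ?case by (simp add: z)
  next
    case (single m c)
    have "Poly_Mapping.single m c = Poly_Mapping.single {#} c * Poly_Mapping.single m (1 :: int)"
      by (simp add: mult_single)
    then show ?case using int mon by (simp only: fs gs)
  qed (simp add: fs gs)
qed

lemma geval_cong:
  assumes "\<And>m v. m \<in> Poly_Mapping.keys p \<Longrightarrow> v \<in># m \<Longrightarrow> a v = b v \<and> b v \<in> carrier R"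
  shows "geval R p a = geval R p b"
  unfolding geval_def using assms
  by (intro mpoly_eval_cong cring_axioms) (auto simp: in_keys_iff)

end

text \<open>Both sides are homomorphisms on the integral polynomials with the same values at the
  variables. This is the principle by which resultants specialise.\<close>

lemma geval_hom_comp:
  fixes p :: "'v zpoly"
  assumes "cring R" "cring S" "h \<in> Ring.ring_hom R S" "\<And>v. a v \<in> carrier R"
  shows "h (geval R p a) = geval S p (\<lambda>v. h (a v))"
proof -
  interpret R: cring R by fact
  interpret S: cring S by fact
  have c: "h (a v) \<in> carrier S" for v using ring_hom_closed[OF assms(3) assms(4)] .
  have "(h \<circ> (\<lambda>p. geval R p a)) p = (\<lambda>p. geval S p (\<lambda>v. h (a v))) p"
  proof (rule S.zpoly_hom_unique)
    show "h \<circ> (\<lambda>p. geval R p a) \<in> Ring.ring_hom univ_ring S"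
      by (rule ring_hom_trans[OF R.geval_hom[OF assms(4)] assms(3)])
    show "(\<lambda>p. geval S p (\<lambda>v. h (a v))) \<in> Ring.ring_hom univ_ring S"
      by (rule S.geval_hom[OF c])
    show "(h \<circ> (\<lambda>p. geval R p a)) (Var v) = geval S (Var v) (\<lambda>v. h (a v))" for v
      using R.geval_Var[of a v, OF assms(4)] S.geval_Var[of "\<lambda>v. h (a v)" v, OF c] by simp
  qed
  then show ?thesis by simp
qed

lemma geval_comm_ring_hom: "comm_ring_hom (\<lambda>p :: 'v zpoly. geval univ_ring p (a :: 'v \<Rightarrow> 'b :: comm_ring_1))"
proof -
  have *: "(\<lambda>p. geval univ_ring p a) \<in> Ring.ring_hom univ_ring univ_ring" by (intro univ.geval_hom) auto
  note h = ring_hom_mult[OF *, simplified] ring_hom_add[OF *, simplified] ring_hom_one[OF *, simplified]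
  have "geval univ_ring 0 a = 0" using h(2)[of 0 0] by (metis add_0 add_cancel_right_right)
  then show ?thesis by unfold_locales (simp_all add: h)
qed

section \<open>Weighted homogeneity\<close>

definition wt :: "('v \<Rightarrow> int) \<Rightarrow> 'v multiset \<Rightarrow> int" where
  "wt w m = sum_mset (image_mset w m)"

text \<open>Weights may be negative, so that passing from \<open>w\<close> to its negative exchanges
  the lowest and the highest part of a polynomial.\<close>

definition homog :: "('v \<Rightarrow> int) \<Rightarrow> int \<Rightarrow> 'v zpoly \<Rightarrow> bool" where
  "homog w k p \<longleftrightarrow> (\<forall>m \<in> Poly_Mapping.keys p. wt w m = k)"

lemma wt_simps [simp]: "wt w {#} = 0" "wt w (add_mset v m) = w v + wt w m" "wt w (m + m') = wt w m + wt w m'"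
  by (simp_all add: wt_def)

lemma wt_uminus: "wt (\<lambda>v. - w v) m = - wt w m"
  by (induction m) auto

lemma homog_zero [simp]: "homog w k 0" by (simp add: homog_def)

lemma homog_add: "homog w k p \<Longrightarrow> homog w k q \<Longrightarrow> homog w k (p + q)"
  unfolding homog_def using keys_add[of p q] by blast

lemma homog_sum: "(\<And>i. i \<in> I \<Longrightarrow> homog w k (f i)) \<Longrightarrow> homog w k (sum f I)"
  by (induction I rule: infinite_finite_induct) (auto intro!: homog_add)

lemma homog_uminus: "homog w k p \<Longrightarrow> homog w k (- p)"
  unfolding homog_def by simp

lemma homog_mult: "homog w k p \<Longrightarrow> homog w l q \<Longrightarrow> homog w (k + l) (p * q)"
  unfolding homog_def using keys_mult[of p q] by fastforce

lemma homog_one [simp]: "homog w 0 1" by (simp add: homog_def)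

lemma homog_prod: "(\<And>i. i \<in> I \<Longrightarrow> homog w (k i) (f i)) \<Longrightarrow> homog w (sum k I) (prod f I)"
  by (induction I rule: infinite_finite_induct) (auto intro!: homog_mult)

text \<open>Split off the parts of highest weight. Their product is nonzero because the polynomial
  ring over \<int> is a domain, for which the linear order on the variables is used, and no other
  product of parts reaches the same weight.\<close>

lemma keys_mult_top:
  fixes p q :: "'v :: linorder zpoly"
  assumes "p \<noteq> 0" "q \<noteq> 0"
  shows "\<exists>m \<in> Poly_Mapping.keys (p * q). wt w m = Max (wt w ` Poly_Mapping.keys p) + Max (wt w ` Poly_Mapping.keys q)"
proof -
  have split: "\<exists>p1 p2. p = p1 + p2 \<and> p1 \<noteq> 0 \<and> homog w A p1 \<and> (\<forall>m\<in>Poly_Mapping.keys p2. wt w m < A)"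
    if p0: "p \<noteq> 0" and A: "A = Max (wt w ` Poly_Mapping.keys p)" for p :: "'v zpoly" and A
  proof -
    \<comment> \<open>\<open>part T\<close> keeps the terms of \<open>p\<close> whose monomials lie
      in \<open>T\<close>.\<close>
    define part where "part T = (\<Sum>k\<in>Poly_Mapping.keys p \<inter> T. Poly_Mapping.single k (Poly_Mapping.lookup p k))" for T
    have l: "Poly_Mapping.lookup (part T) m = (if m \<in> T then Poly_Mapping.lookup p m else 0)" for T m
      by (auto simp: part_def lookup_sum lookup_single when_def in_keys_iff)
    let ?T = "{m. wt w m = A}"
    have "A \<in> wt w ` Poly_Mapping.keys p" unfolding A using p0 by (intro Max_in) auto
    then obtain m where m: "m \<in> Poly_Mapping.keys p" "wt w m = A" by auto
    then have "Poly_Mapping.lookup (part ?T) m \<noteq> 0" by (simp add: l in_keys_iff)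
    then have "part ?T \<noteq> 0" by auto
    moreover have "p = part ?T + part (- ?T)"
      by (rule poly_mapping_eqI) (simp add: lookup_add l)
    moreover have "homog w A (part ?T)"
      by (auto simp: homog_def in_keys_iff l split: if_splits)
    moreover have "wt w m < A" if m: "m \<in> Poly_Mapping.keys (part (- ?T))" for m
    proof -
      have "m \<in> Poly_Mapping.keys p" "wt w m \<noteq> A" using m by (auto simp: in_keys_iff l split: if_splits)
      then show ?thesis using Max_ge[of "wt w ` Poly_Mapping.keys p" "wt w m"] A by (simp add: order_less_le)
    qed
    ultimately show ?thesis by blast
  qed
  define A B where "A = Max (wt w ` Poly_Mapping.keys p)" and "B = Max (wt w ` Poly_Mapping.keys q)"
  obtain p1 p2 where p: "p = p1 + p2" "p1 \<noteq> 0" "homog w A p1" "\<forall>m\<in>Poly_Mapping.keys p2. wt w m < A"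
    using split[OF assms(1) A_def] by blast
  obtain q1 q2 where q: "q = q1 + q2" "q1 \<noteq> 0" "homog w B q1" "\<forall>m\<in>Poly_Mapping.keys q2. wt w m < B"
    using split[OF assms(2) B_def] by blast
  have "p1 * q1 \<noteq> 0" using p q by simp
  then obtain m where m: "m \<in> Poly_Mapping.keys (p1 * q1)" by (metis keys_eq_empty ex_in_conv)
  then have wm: "wt w m = A + B" using homog_mult[OF p(3) q(3)] by (auto simp: homog_def)
  have le: "wt w n \<le> B" if "n \<in> Poly_Mapping.keys q" for n
    unfolding B_def using that by (intro Max_ge) auto
  have "m \<notin> Poly_Mapping.keys (p1 * q2)"
  proof
    assume "m \<in> Poly_Mapping.keys (p1 * q2)"
    then obtain a b where "a \<in> Poly_Mapping.keys p1" "b \<in> Poly_Mapping.keys q2" "m = a + b"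
      using keys_mult[of p1 q2] by blast
    then show False using wm p(3) q(4) by (auto simp: homog_def)
  qed
  moreover have "m \<notin> Poly_Mapping.keys (p2 * q)"
  proof
    assume "m \<in> Poly_Mapping.keys (p2 * q)"
    then obtain a b where "a \<in> Poly_Mapping.keys p2" "b \<in> Poly_Mapping.keys q" "m = a + b"
      using keys_mult[of p2 q] by blast
    then show False using wm p(4) le[of b] by fastforce
  qed
  moreover have "p * q = p1 * q1 + (p1 * q2 + p2 * q)" unfolding p(1) q(1) by (simp add: algebra_simps)
  ultimately have "m \<in> Poly_Mapping.keys (p * q)" using m by (simp add: in_keys_iff lookup_add)
  then show ?thesis using wm A_def B_def by blast
qed

text \<open>The highest weights of the factors add up to \<open>k\<close>, and so do the lowest
  ones; this leaves no gap between lowest and highest weight in either factor.\<close>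

lemma homog_factor:
  fixes p q :: "'v :: linorder zpoly"
  assumes "p * q \<noteq> 0" "homog w k (p * q)"
  obtains l where "homog w l p"
proof -
  have nz: "p \<noteq> 0" "q \<noteq> 0" using assms by auto
  let ?P = "wt w ` Poly_Mapping.keys p" and ?Q = "wt w ` Poly_Mapping.keys q"
  have ne: "?P \<noteq> {}" "?Q \<noteq> {}" "finite ?P" "finite ?Q" using nz by auto
  \<comment> \<open>Lowest weights are highest weights for the negated weight, so
    \<open>keys_mult_top\<close> covers both ends.\<close>
  have neg: "Max (wt (\<lambda>v. - w v) ` Poly_Mapping.keys r) = - Min (wt w ` Poly_Mapping.keys r)"
    if "r \<noteq> 0" for r :: "'v zpoly"
  proof -
    have "wt (\<lambda>v. - w v) ` Poly_Mapping.keys r = uminus ` (wt w ` Poly_Mapping.keys r)"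
      by (auto simp: wt_uminus image_image)
    moreover have "Max (uminus ` (wt w ` Poly_Mapping.keys r)) = - Min (wt w ` Poly_Mapping.keys r)"
      using that by (intro Max_eqI) auto
    ultimately show ?thesis by simp
  qed
  have 1: "Max ?P + Max ?Q = k"
    using keys_mult_top[OF nz, of w] assms(2) by (auto simp: homog_def)
  have 2: "Min ?P + Min ?Q = k"
    using keys_mult_top[OF nz, of "\<lambda>v. - w v"] assms(2) neg[OF nz(1)] neg[OF nz(2)]
    by (force simp: homog_def wt_uminus)
  have 3: "Min ?P \<le> Max ?P" "Min ?Q \<le> Max ?Q" using ne by (auto intro: Min_le_iff[THEN iffD2] simp: Max_ge_iff)
  have "homog w (Max ?P) p"
    unfolding homog_def
  proof
    fix m assume m: "m \<in> Poly_Mapping.keys p"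
    have "wt w m \<le> Max ?P" "Min ?P \<le> wt w m" using m by auto
    then show "wt w m = Max ?P" using 1 2 3 by linarith
  qed
  then show ?thesis using that by blast
qed

context cring
begin

lemma wt_int: "wt (\<lambda>v. int (w v)) m = int (\<Sum>v\<in>#m. w v)"
  by (induction m) auto

lemma mon_eval_weight:
  assumes "\<And>v. a v \<in> carrier R" "s \<in> carrier R"
  shows "mon_eval R m (\<lambda>v. s [^] w v \<otimes> a v) = s [^] (\<Sum>v\<in>#m. w v :: nat) \<otimes> mon_eval R m a"
proof (induction m)
  case empty
  then show ?case by simp
next
  case (add v m)
  have c: "s [^] w v \<otimes> a v \<in> carrier R" for v using assms by simp
  have "mon_eval R (add_mset v m) (\<lambda>v. s [^] w v \<otimes> a v)
      = (s [^] w v \<otimes> a v) \<otimes> (s [^] (\<Sum>v\<in>#m. w v) \<otimes> mon_eval R m a)"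
    using mon_eval_add[of "\<lambda>v. s [^] w v \<otimes> a v" "{#v#}" m, OF c] add
      mon_eval_single[of "\<lambda>v. s [^] w v \<otimes> a v" v] c by simp
  also have "\<dots> = (s [^] w v \<otimes> s [^] (\<Sum>v\<in>#m. w v)) \<otimes> (a v \<otimes> mon_eval R m a)"
    using assms mon_eval_closed[of m a] by (simp add: m_ac)
  also have "\<dots> = s [^] (\<Sum>v\<in>#add_mset v m. w v) \<otimes> mon_eval R (add_mset v m) a"
    using mon_eval_add[of a "{#v#}" m, OF assms(1)] mon_eval_single[of a v] assms
    by (simp add: nat_pow_mult)
  finally show ?case .
qed

text \<open>Every term acquires the same factor \<open>s [^] k\<close>. The weights are naturals
  here, since \<open>s\<close> may fail to be invertible.\<close>

lemma geval_homog:
  assumes "homog (\<lambda>v. int (w v)) (int k) p" "\<And>v. a v \<in> carrier R" "s \<in> carrier R"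
  shows "geval R p (\<lambda>v. s [^] w v \<otimes> a v) = s [^] k \<otimes> geval R p a"
proof -
  interpret h: mpoly_hom \<Z> R "\<lambda>k. [k] \<cdot> \<one>" a by (rule geval_mpoly_hom[OF assms(2)])
  have "geval R p (\<lambda>v. s [^] w v \<otimes> a v)
     = (\<Oplus>m\<in>Poly_Mapping.keys p. s [^] k \<otimes> (([Poly_Mapping.lookup p m] \<cdot> \<one>) \<otimes> mon_eval R m a))"
    unfolding geval_def mpoly_eval_def mon_eval_def[symmetric]
  proof (intro finsum_cong')
    fix m assume "m \<in> Poly_Mapping.keys p"
    then have "int (\<Sum>v\<in>#m. w v) = int k"
      using assms(1) unfolding homog_def wt_int by blast
    then have "(\<Sum>v\<in>#m. w v) = k" by (simp only: of_nat_eq_iff)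
    then show "([Poly_Mapping.lookup p m] \<cdot> \<one>) \<otimes> mon_eval R m (\<lambda>v. s [^] w v \<otimes> a v)
      = s [^] k \<otimes> (([Poly_Mapping.lookup p m] \<cdot> \<one>) \<otimes> mon_eval R m a)"
      using assms h.mon_eval_S[of m] by (simp add: mon_eval_weight m_lcomm)
  qed (use assms h.mon_eval_S in \<open>auto simp: in_keys_iff\<close>)
  also have "\<dots> = s [^] k \<otimes> (\<Oplus>m\<in>Poly_Mapping.keys p. ([Poly_Mapping.lookup p m] \<cdot> \<one>) \<otimes> mon_eval R m a)"
    using assms h.mon_eval_S by (intro finsum_rdistr[symmetric]) auto
  also have "(\<Oplus>m\<in>Poly_Mapping.keys p. ([Poly_Mapping.lookup p m] \<cdot> \<one>) \<otimes> mon_eval R m a) = geval R p a"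
    unfolding geval_def mpoly_eval_def mon_eval_def[symmetric]
    using h.mon_eval_S by (intro finsum_cong') (auto simp: in_keys_iff)
  finally show ?thesis .
qed

end

section \<open>Invariance of the ideal of maximal minors\<close>

text \<open>Multilinearity in the rows, as in the Cauchy-Binet formula: the determinant is a
  combination of determinants whose rows are chosen from \<open>S\<close> by a function
  \<open>f\<close>, possibly with repetitions.\<close>

lemma dvd_det_rows:
  fixes M :: "'r \<Rightarrow> nat \<Rightarrow> 'b :: comm_ring_1"
  assumes S: "finite S"
    and h: "\<And>f. (\<And>i. i < n \<Longrightarrow> f i \<in> S) \<Longrightarrow> h dvd det (mat n n (\<lambda>(i, j). M (f i) j))"
  shows "h dvd det (mat n n (\<lambda>(i, j). \<Sum>\<rho>\<in>S. Y i \<rho> * M \<rho> j))"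
proof -
  let ?I = "{0..<n}" and ?P = "{p. p permutes {0..<n}}"
  \<comment> \<open>Expanding the product of sums gives one summand for each way \<open>f\<close> of
    choosing an index in \<open>S\<close> for every row.\<close>
  have inner: "(\<Prod>i\<in>?I. \<Sum>\<rho>\<in>S. Y i \<rho> * M \<rho> (p i))
      = (\<Sum>f\<in>PiE ?I (\<lambda>_. S). (\<Prod>i\<in>?I. Y i (f i)) * (\<Prod>i\<in>?I. M (f i) (p i)))" for p
    using S by (subst prod_sum_PiE) (auto simp: prod.distrib)
  have "det (mat n n (\<lambda>(i, j). \<Sum>\<rho>\<in>S. Y i \<rho> * M \<rho> j))
      = (\<Sum>p\<in>?P. signof p * (\<Prod>i\<in>?I. \<Sum>\<rho>\<in>S. Y i \<rho> * M \<rho> (p i)))"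
    by (subst det_def'[of _ n]) (auto intro!: sum.cong prod.cong)
  also have "\<dots> = (\<Sum>p\<in>?P. \<Sum>f\<in>PiE ?I (\<lambda>_. S). (\<Prod>i\<in>?I. Y i (f i)) * (signof p * (\<Prod>i\<in>?I. M (f i) (p i))))"
    unfolding inner by (auto simp: sum_distrib_left algebra_simps intro!: sum.cong)
  also have "\<dots> = (\<Sum>f\<in>PiE ?I (\<lambda>_. S). (\<Prod>i\<in>?I. Y i (f i)) * (\<Sum>p\<in>?P. signof p * (\<Prod>i\<in>?I. M (f i) (p i))))"
    by (subst sum.swap) (simp add: sum_distrib_left)
  also have "\<dots> = (\<Sum>f\<in>PiE ?I (\<lambda>_. S). (\<Prod>i\<in>?I. Y i (f i)) * det (mat n n (\<lambda>(i, j). M (f i) j)))"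
  proof (intro sum.cong refl)
    fix f
    have "det (mat n n (\<lambda>(i, j). M (f i) j)) = (\<Sum>p\<in>?P. signof p * (\<Prod>i\<in>?I. M (f i) (p i)))"
      by (subst det_def'[of _ n]) (auto intro!: sum.cong prod.cong)
    then show "(\<Prod>i\<in>?I. Y i (f i)) * (\<Sum>p\<in>?P. signof p * (\<Prod>i\<in>?I. M (f i) (p i)))
      = (\<Prod>i\<in>?I. Y i (f i)) * det (mat n n (\<lambda>(i, j). M (f i) j))" by simp
  qed
  also have "h dvd \<dots>" using h by (intro dvd_sum dvd_mult) (auto simp: PiE_iff)
  finally show ?thesis .
qed

lemma (in abelian_monoid) finsum_cartes:
  assumes "finite I" "finite J" "\<And>i j. i \<in> I \<Longrightarrow> j \<in> J \<Longrightarrow> f (i, j) \<in> carrier G"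
  shows "(\<Oplus>i\<in>I. \<Oplus>j\<in>J. f (i, j)) = (\<Oplus>p\<in>I \<times> J. f p)"
  using assms(1,3)
proof (induction I rule: finite_induct)
  case (insert i I)
  have "(\<Oplus>p\<in>insert i I \<times> J. f p) = (\<Oplus>p\<in>(\<lambda>j. (i, j)) ` J \<union> I \<times> J. f p)"
    by (rule arg_cong[of _ _ "finsum G f"]) auto
  also have "\<dots> = (\<Oplus>p\<in>(\<lambda>j. (i, j)) ` J. f p) \<oplus> (\<Oplus>p\<in>I \<times> J. f p)"
    using insert assms(2) by (intro finsum_Un_disjoint) auto
  also have "(\<Oplus>p\<in>(\<lambda>j. (i, j)) ` J. f p) = (\<Oplus>j\<in>J. f (i, j))"
    using insert by (intro finsum_reindex) (auto simp: inj_on_def)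
  also have "(\<Oplus>p\<in>I \<times> J. f p) = (\<Oplus>i\<in>I. \<Oplus>j\<in>J. f (i, j))"
    using insert by simp
  also have "(\<Oplus>j\<in>J. f (i, j)) \<oplus> (\<Oplus>i\<in>I. \<Oplus>j\<in>J. f (i, j)) = (\<Oplus>i\<in>insert i I. \<Oplus>j\<in>J. f (i, j))"
    using insert by (intro finsum_insert[symmetric]) (auto intro!: finsum_closed)
  finally show ?case ..
qed simp

definition crit :: "nat \<Rightarrow> nat \<Rightarrow> nat" where "crit N d = N * (d - 1) + d"

text \<open>The matrix in \<open>macaulay_minors\<close> with the coefficients of a map over a type
  class ring put in; \<open>geval_minor\<close> makes the link.\<close>

definition macaulay_matrix ::
  "(nat \<times> nat multiset) list \<Rightarrow> nat multiset list \<Rightarrow> 'b :: comm_ring_1 poly_map \<Rightarrow> 'b mat" where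
  "macaulay_matrix rs cs \<Phi> = mat (length cs) (length cs)
     (\<lambda>(r, c). case rs ! r of (i, m) \<Rightarrow> if m \<subseteq># cs ! c then \<Phi> i (cs ! c - m) else 0)"

definition valid_idx :: "nat \<Rightarrow> nat \<Rightarrow> (nat \<times> nat multiset) list \<Rightarrow> nat multiset list \<Rightarrow> bool" where
  "valid_idx N d rs cs \<longleftrightarrow> distinct cs \<and> set cs = monomials N (crit N d) \<and>
     length rs = length cs \<and> set rs \<subseteq> {..N} \<times> monomials N (N * (d - 1))"

text \<open>Monomials of degree \<open>d\<close> come from words of length \<open>d\<close> over
  \<open>{..N}\<close>.\<close>

lemma finite_monomials: "finite (monomials N d)"
proof -
  have "monomials N d \<subseteq> mset ` {xs. set xs \<subseteq> {..N} \<and> length xs = d}"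
  proof
    fix m assume "m \<in> monomials N d"
    moreover obtain xs where "mset xs = m" using ex_mset by blast
    ultimately show "m \<in> mset ` {xs. set xs \<subseteq> {..N} \<and> length xs = d}"
      by (auto simp: monomials_def)
  qed
  then show ?thesis by (rule finite_subset) (intro finite_imageI finite_lists_length_eq, simp)
qed

abbreviation UP :: "(nat multiset \<Rightarrow> 'b :: comm_ring_1) ring" where
  "UP \<equiv> mpoly_ring univ_ring"

interpretation UP: cring UP
  by (rule univ.MP_cring)

text \<open>The summation set depends on the degree alone and not on the support, so the
  coefficients can serve as coordinates in a fixed basis.\<close>

lemma form_expand:
  assumes "p \<in> forms univ_ring N d"
  shows "p = (\<Oplus>\<^bsub>UP\<^esub>m\<in>monomials N d. term_poly univ_ring (p m) {#} \<otimes>\<^bsub>UP\<^esub> term_poly univ_ring 1 m)"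
proof
  fix n
  have "(\<Oplus>\<^bsub>UP\<^esub>m\<in>monomials N d. term_poly univ_ring (p m) {#} \<otimes>\<^bsub>UP\<^esub> term_poly univ_ring 1 m) n
      = (\<Sum>m\<in>monomials N d. term_poly univ_ring (p m) m n)"
    by (subst univ.MP_finsum) (auto simp: finite_monomials univ.term_poly_mult_term_poly)
  also have "\<dots> = (\<Sum>m\<in>monomials N d. if m = n then p n else 0)"
    by (auto simp: term_poly_def intro!: sum.cong)
  also have "\<dots> = p n" using assms by (auto simp: finite_monomials forms_def)
  finally show "p n = (\<Oplus>\<^bsub>UP\<^esub>m\<in>monomials N d. term_poly univ_ring (p m) {#} \<otimes>\<^bsub>UP\<^esub> term_poly univ_ring 1 m) n" ..
qed

lemma macaulay_entry_mult:
  assumes "p \<in> carrier UP"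
  shows "(term_poly univ_ring 1 m \<otimes>\<^bsub>UP\<^esub> p) n = (if m \<subseteq># n then p (n - m) else 0)"
  using assms by (subst univ.term_poly_mult) auto

text \<open>
  Writing \<open>\<Phi>\<close> as the transform of \<open>\<Phi>' = A \<circ> \<Phi> \<circ> B\<close> expresses the rows of the Macaulay matrix of
  \<open>\<Phi>\<close> as combinations of rows of the Macaulay matrix of \<open>\<Phi>'\<close>, followed by the substitution
  \<open>A\<close> acting on forms of the critical degree.
\<close>

lemma dvd_minors_conj_map:
  fixes \<Phi> :: "'b :: comm_ring_1 poly_map"
  assumes inv: "inverse_matrices univ_ring N A B" and \<Phi>: "\<Phi> \<in> fmaps univ_ring N d"
    and h: "\<And>rs. valid_idx N d rs cs \<Longrightarrow> h dvd det (macaulay_matrix rs cs (conj_map univ_ring N A B \<Phi>))"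
    and v: "valid_idx N d rs cs"
  shows "h dvd det (macaulay_matrix rs cs \<Phi>)"
proof -
  define \<Phi>' where "\<Phi>' = conj_map univ_ring N A B \<Phi>"
  define e where "e = N * (d - 1)"
  let ?C = "monomials N (crit N d)" and ?E = "monomials N e"
  have mA: "matc univ_ring N A" and mB: "matc univ_ring N B"
    and BA: "eqm N (mm univ_ring N B A) (idm univ_ring)"
    using inv by (auto simp: inverse_matrices_iff)
  have \<Phi>': "\<Phi>' \<in> fmaps univ_ring N d" unfolding \<Phi>'_def by (intro univ.conj_map_fmaps \<Phi> mA mB)
  note c = univ.forms_carrier[OF univ.fmaps_form[OF \<Phi>]] and c' = univ.forms_carrier[OF univ.fmaps_form[OF \<Phi>']]
  have inv_conj: "conj_map univ_ring N B A \<Phi>' = \<Phi>"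
  proof -
    have "conj_map univ_ring N B A \<Phi>' = conj_map univ_ring N (mm univ_ring N B A) (mm univ_ring N B A) \<Phi>"
      unfolding \<Phi>'_def by (rule univ.conj_map_conj_map[OF \<Phi> mB mA mA mB])
    also have "\<dots> = conj_map univ_ring N (idm univ_ring) (idm univ_ring) \<Phi>"
      by (intro univ.conj_map_cong BA univ.idm_closed)
    finally show ?thesis using univ.conj_map_idm[OF \<Phi>] by simp
  qed
  let ?x = "\<lambda>m. term_poly univ_ring (1 :: 'b) m"
  let ?k = "\<lambda>a. term_poly univ_ring (a :: 'b) {#}"
  \<comment> \<open>\<open>Q\<close> lists the polynomials whose coefficients are the rows for
    \<open>\<Phi>'\<close>. \<open>Y\<close> holds the coefficients with which they enter a row for
    \<open>\<Phi>\<close>: an entry of \<open>B\<close> times a coefficient of the monomial after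
    substituting \<open>B\<close>.\<close>
  define Q where "Q = (\<lambda>(k, m'). ?x m' \<otimes>\<^bsub>UP\<^esub> \<Phi>' k)"
  define Y where "Y = (\<lambda>(i, m) (k, m'). B i k * subst_lin univ_ring N B (?x m) m')"
  have xE: "?x m \<in> forms univ_ring N e" if "m \<in> ?E" for m using that by (intro univ.form_term) auto
  have Qc: "Q \<rho> \<in> carrier UP" if "\<rho> \<in> {..N} \<times> ?E" for \<rho>
    using that c' by (auto simp: Q_def)
  have Qf: "Q \<rho> \<in> forms univ_ring N (crit N d)" if "\<rho> \<in> {..N} \<times> ?E" for \<rho>
    using that univ.form_mult[OF xE univ.fmaps_form[OF \<Phi>']] by (auto simp: Q_def crit_def e_def)
  have SA: "subst_lin univ_ring N A p \<in> carrier UP" if "p \<in> carrier UP" for p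
    by (rule univ.subst_lin_closed[OF mA that])
  have row: "?x m \<otimes>\<^bsub>UP\<^esub> \<Phi> i = (\<Oplus>\<^bsub>UP\<^esub>\<rho>\<in>{..N} \<times> ?E. ?k (Y (i, m) \<rho>) \<otimes>\<^bsub>UP\<^esub> subst_lin univ_ring N A (Q \<rho>))"
    if i: "i \<le> N" and m: "m \<in> ?E" for i m
  proof -
    let ?b = "subst_lin univ_ring N B (?x m)"
    have bf: "?b \<in> forms univ_ring N e" by (intro univ.subst_lin_form mB xE m)
    then have bc: "?b \<in> carrier UP" by (rule univ.forms_carrier)
    \<comment> \<open>The monomial is first moved by \<open>B\<close>, so that the substitution by
      \<open>A\<close>, applied to the whole product with \<open>\<Phi>'\<close>, gives it
      back.\<close>
    have "subst_lin univ_ring N A ?b = subst_lin univ_ring N (mm univ_ring N B A) (?x m)"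
      by (intro univ.subst_lin_subst_lin mA mB) auto
    also have "\<dots> = subst_lin univ_ring N (idm univ_ring) (?x m)"
      unfolding subst_lin_def univ.linear_map_cong[OF BA univ.idm_closed] ..
    also have "\<dots> = ?x m" by (rule univ.subst_lin_idm[OF xE[OF m]])
    finally have Ab: "subst_lin univ_ring N A ?b = ?x m" .
    have hA: "subst_lin univ_ring N A (p \<otimes>\<^bsub>UP\<^esub> q) = subst_lin univ_ring N A p \<otimes>\<^bsub>UP\<^esub> subst_lin univ_ring N A q"
      if "p \<in> carrier UP" "q \<in> carrier UP" for p q
      using ring_hom_mult[OF univ.subst_lin_hom[OF mA]] that .
    have bk: "?b \<otimes>\<^bsub>UP\<^esub> \<Phi>' k = (\<Oplus>\<^bsub>UP\<^esub>m'\<in>?E. ?k (?b m') \<otimes>\<^bsub>UP\<^esub> Q (k, m'))" if k: "k \<le> N" for k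
    proof -
      have "?b \<otimes>\<^bsub>UP\<^esub> \<Phi>' k = (\<Oplus>\<^bsub>UP\<^esub>m'\<in>?E. ?k (?b m') \<otimes>\<^bsub>UP\<^esub> ?x m') \<otimes>\<^bsub>UP\<^esub> \<Phi>' k"
        using form_expand[OF bf] by simp
      also have "\<dots> = (\<Oplus>\<^bsub>UP\<^esub>m'\<in>?E. ?k (?b m') \<otimes>\<^bsub>UP\<^esub> ?x m' \<otimes>\<^bsub>UP\<^esub> \<Phi>' k)"
        using c' k by (intro UP.finsum_ldistr finite_monomials) auto
      also have "\<dots> = (\<Oplus>\<^bsub>UP\<^esub>m'\<in>?E. ?k (?b m') \<otimes>\<^bsub>UP\<^esub> Q (k, m'))"
        using c' k by (intro UP.finsum_cong') (auto simp: Q_def UP.m_assoc)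
      finally show ?thesis .
    qed
    have "?x m \<otimes>\<^bsub>UP\<^esub> \<Phi> i = ?x m \<otimes>\<^bsub>UP\<^esub> (\<Oplus>\<^bsub>UP\<^esub>k\<in>{..N}. ?k (B i k) \<otimes>\<^bsub>UP\<^esub> subst_lin univ_ring N A (\<Phi>' k))"
      using univ.conj_map_eq[OF \<Phi>' mB mA i] inv_conj by simp
    also have "\<dots> = (\<Oplus>\<^bsub>UP\<^esub>k\<in>{..N}. ?x m \<otimes>\<^bsub>UP\<^esub> (?k (B i k) \<otimes>\<^bsub>UP\<^esub> subst_lin univ_ring N A (\<Phi>' k)))"
      using c' SA by (intro UP.finsum_rdistr) auto
    also have "\<dots> = (\<Oplus>\<^bsub>UP\<^esub>k\<in>{..N}. \<Oplus>\<^bsub>UP\<^esub>m'\<in>?E. ?k (Y (i, m) (k, m')) \<otimes>\<^bsub>UP\<^esub> subst_lin univ_ring N A (Q (k, m')))"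
    proof (intro UP.finsum_cong')
      fix k assume "k \<in> {..N}"
      then have k: "k \<le> N" by simp
      have "?x m \<otimes>\<^bsub>UP\<^esub> (?k (B i k) \<otimes>\<^bsub>UP\<^esub> subst_lin univ_ring N A (\<Phi>' k))
          = ?k (B i k) \<otimes>\<^bsub>UP\<^esub> subst_lin univ_ring N A (?b \<otimes>\<^bsub>UP\<^esub> \<Phi>' k)"
        using c'[OF k] bc SA by (simp add: hA Ab UP.m_lcomm)
      also have "\<dots> = ?k (B i k) \<otimes>\<^bsub>UP\<^esub> (\<Oplus>\<^bsub>UP\<^esub>m'\<in>?E. subst_lin univ_ring N A (?k (?b m') \<otimes>\<^bsub>UP\<^esub> Q (k, m')))"
        unfolding bk[OF k] using Qc k
        by (subst univ.subst_lin_finsum[OF mA finite_monomials]) auto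
      also have "\<dots> = (\<Oplus>\<^bsub>UP\<^esub>m'\<in>?E. ?k (B i k) \<otimes>\<^bsub>UP\<^esub> subst_lin univ_ring N A (?k (?b m') \<otimes>\<^bsub>UP\<^esub> Q (k, m')))"
        using Qc k SA by (intro UP.finsum_rdistr finite_monomials) auto
      also have "\<dots> = (\<Oplus>\<^bsub>UP\<^esub>m'\<in>?E. ?k (Y (i, m) (k, m')) \<otimes>\<^bsub>UP\<^esub> subst_lin univ_ring N A (Q (k, m')))"
      proof (intro UP.finsum_cong')
        fix m' assume m': "m' \<in> ?E"
        have "subst_lin univ_ring N A (?k (?b m') \<otimes>\<^bsub>UP\<^esub> Q (k, m')) = ?k (?b m') \<otimes>\<^bsub>UP\<^esub> subst_lin univ_ring N A (Q (k, m'))"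
          using Qc k m' by (intro univ.subst_lin_smult mA) auto
        then have "?k (B i k) \<otimes>\<^bsub>UP\<^esub> subst_lin univ_ring N A (?k (?b m') \<otimes>\<^bsub>UP\<^esub> Q (k, m'))
            = (?k (B i k) \<otimes>\<^bsub>UP\<^esub> ?k (?b m')) \<otimes>\<^bsub>UP\<^esub> subst_lin univ_ring N A (Q (k, m'))"
          using Qc k m' SA by (simp add: UP.m_assoc)
        then show "?k (B i k) \<otimes>\<^bsub>UP\<^esub> subst_lin univ_ring N A (?k (?b m') \<otimes>\<^bsub>UP\<^esub> Q (k, m'))
            = ?k (Y (i, m) (k, m')) \<otimes>\<^bsub>UP\<^esub> subst_lin univ_ring N A (Q (k, m'))"
          by (simp add: univ.term_poly_mult_term_poly Y_def)
      qed (use Qc k SA in auto)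
      finally show "?x m \<otimes>\<^bsub>UP\<^esub> (?k (B i k) \<otimes>\<^bsub>UP\<^esub> subst_lin univ_ring N A (\<Phi>' k))
        = (\<Oplus>\<^bsub>UP\<^esub>m'\<in>?E. ?k (Y (i, m) (k, m')) \<otimes>\<^bsub>UP\<^esub> subst_lin univ_ring N A (Q (k, m')))" .
    qed (use Qc SA in \<open>auto intro!: UP.finsum_closed\<close>)
    also have "\<dots> = (\<Oplus>\<^bsub>UP\<^esub>\<rho>\<in>{..N} \<times> ?E. ?k (Y (i, m) \<rho>) \<otimes>\<^bsub>UP\<^esub> subst_lin univ_ring N A (Q \<rho>))"
      using Qc SA by (intro UP.finsum_cartes) (auto simp: finite_monomials)
    finally show ?thesis .
  qed
  \<comment> \<open>The matrix of the substitution by \<open>A\<close> on forms of the critical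
    degree, in the monomial basis.\<close>
  define S where "S = (\<lambda>n' n. subst_lin univ_ring N A (?x n') n)"
  have subQ: "subst_lin univ_ring N A (Q \<rho>) n = (\<Sum>n'\<in>?C. Q \<rho> n' * S n' n)" if \<rho>: "\<rho> \<in> {..N} \<times> ?E" for \<rho> n
  proof -
    have "subst_lin univ_ring N A (Q \<rho>)
        = subst_lin univ_ring N A (\<Oplus>\<^bsub>UP\<^esub>m\<in>?C. ?k (Q \<rho> m) \<otimes>\<^bsub>UP\<^esub> ?x m)"
      using form_expand[OF Qf[OF \<rho>]] by simp
    also have "\<dots> = (\<Oplus>\<^bsub>UP\<^esub>m\<in>?C. subst_lin univ_ring N A (?k (Q \<rho> m) \<otimes>\<^bsub>UP\<^esub> ?x m))"
      by (intro univ.subst_lin_finsum mA finite_monomials) auto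
    also have "\<dots> = (\<Oplus>\<^bsub>UP\<^esub>m\<in>?C. ?k (Q \<rho> m) \<otimes>\<^bsub>UP\<^esub> subst_lin univ_ring N A (?x m))"
      using SA by (intro UP.finsum_cong') (auto simp: univ.subst_lin_smult[OF mA])
    finally have "subst_lin univ_ring N A (Q \<rho>) n
        = (\<Oplus>\<^bsub>UP\<^esub>m\<in>?C. ?k (Q \<rho> m) \<otimes>\<^bsub>UP\<^esub> subst_lin univ_ring N A (?x m)) n" by simp
    also have "\<dots> = (\<Sum>m\<in>?C. (?k (Q \<rho> m) \<otimes>\<^bsub>UP\<^esub> subst_lin univ_ring N A (?x m)) n)"
      using SA by (subst univ.MP_finsum[OF finite_monomials]) auto
    also have "\<dots> = (\<Sum>n'\<in>?C. Q \<rho> n' * S n' n)"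
      using SA by (intro sum.cong refl) (subst univ.term_poly_mult, auto simp: S_def)
    finally show ?thesis .
  qed
  let ?l = "length cs"
  have cs: "distinct cs" "set cs = ?C" and rs: "length rs = ?l" "set rs \<subseteq> {..N} \<times> ?E"
    using v by (auto simp: valid_idx_def e_def)
  have sumC: "(\<Sum>n'\<in>?C. f n') = (\<Sum>k\<in>{0..<?l}. f (cs ! k))" for f :: "_ \<Rightarrow> 'b"
  proof -
    have "bij_betw (\<lambda>k. cs ! k) {0..<?l} ?C"
      using bij_betw_nth[OF cs(1), of "{0..<?l}" ?C] cs(2) by (auto simp: atLeast0LessThan)
    then show ?thesis by (rule sum.reindex_bij_betw[symmetric])
  qed
  let ?M1 = "mat ?l ?l (\<lambda>(r, k). \<Sum>\<rho>\<in>{..N} \<times> ?E. Y (rs ! r) \<rho> * Q \<rho> (cs ! k))"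
  let ?M2 = "mat ?l ?l (\<lambda>(k, c). S (cs ! k) (cs ! c))"
  \<comment> \<open>Both factors are square, of the size of the monomial basis in the critical
    degree. Hence the determinant is multiplicative, and it suffices that \<open>h\<close> divides
    \<open>det ?M1\<close>.\<close>
  have "macaulay_matrix rs cs \<Phi> = ?M1 * ?M2"
  proof (rule eq_matI)
    fix r c' assume "r < dim_row (?M1 * ?M2)" "c' < dim_col (?M1 * ?M2)"
    then have rc: "r < ?l" "c' < ?l" by simp_all
    obtain i m where im: "rs ! r = (i, m)" by fastforce
    have imE: "i \<le> N" "m \<in> ?E" using rs rc im nth_mem[of r rs] by auto
    have "macaulay_matrix rs cs \<Phi> $$ (r, c') = (?x m \<otimes>\<^bsub>UP\<^esub> \<Phi> i) (cs ! c')"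
      using rc imE c by (simp add: macaulay_matrix_def im macaulay_entry_mult)
    also have "\<dots> = (\<Sum>\<rho>\<in>{..N} \<times> ?E. (?k (Y (i, m) \<rho>) \<otimes>\<^bsub>UP\<^esub> subst_lin univ_ring N A (Q \<rho>)) (cs ! c'))"
      unfolding row[OF imE] using Qc SA
      by (subst univ.MP_finsum) (auto simp: finite_monomials)
    also have "\<dots> = (\<Sum>\<rho>\<in>{..N} \<times> ?E. Y (i, m) \<rho> * (\<Sum>n'\<in>?C. Q \<rho> n' * S n' (cs ! c')))"
    proof (intro sum.cong refl)
      fix \<rho> assume "\<rho> \<in> {..N} \<times> ?E"
      then show "(?k (Y (i, m) \<rho>) \<otimes>\<^bsub>UP\<^esub> subst_lin univ_ring N A (Q \<rho>)) (cs ! c')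
          = Y (i, m) \<rho> * (\<Sum>n'\<in>?C. Q \<rho> n' * S n' (cs ! c'))"
        using Qc SA subQ by (subst univ.term_poly_mult) auto
    qed
    also have "\<dots> = (\<Sum>n'\<in>?C. (\<Sum>\<rho>\<in>{..N} \<times> ?E. Y (i, m) \<rho> * Q \<rho> n') * S n' (cs ! c'))"
      unfolding sum_distrib_left sum_distrib_right by (subst sum.swap) (simp add: mult.assoc)
    also have "\<dots> = (?M1 * ?M2) $$ (r, c')"
      unfolding sumC using rc by (simp add: scalar_prod_def im)
    finally show "macaulay_matrix rs cs \<Phi> $$ (r, c') = (?M1 * ?M2) $$ (r, c')" .
  qed (simp_all add: macaulay_matrix_def)
  then have "det (macaulay_matrix rs cs \<Phi>) = det ?M1 * det ?M2"
    by (simp add: det_mult[of _ ?l])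
  moreover have "h dvd det ?M1"
  proof (rule dvd_det_rows)
    fix f assume f: "\<And>i. i < ?l \<Longrightarrow> f i \<in> {..N} \<times> ?E"
    let ?rs = "map f [0..<?l]"
    have "set ?rs \<subseteq> {..N} \<times> ?E"
      unfolding set_map by (intro image_subsetI f) simp
    then have v': "valid_idx N d ?rs cs" using v by (simp add: valid_idx_def e_def)
    have "macaulay_matrix ?rs cs \<Phi>' = mat ?l ?l (\<lambda>(i, j). Q (f i) (cs ! j))"
    proof (rule eq_matI)
      fix r c'' assume "r < dim_row (mat ?l ?l (\<lambda>(i, j). Q (f i) (cs ! j)))" "c'' < dim_col (mat ?l ?l (\<lambda>(i, j). Q (f i) (cs ! j)))"
      then have rc: "r < ?l" "c'' < ?l" by simp_all
      obtain k m where km: "f r = (k, m)" by fastforce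
      then have "k \<le> N" using f[OF rc(1)] by auto
      then show "macaulay_matrix ?rs cs \<Phi>' $$ (r, c'') = mat ?l ?l (\<lambda>(i, j). Q (f i) (cs ! j)) $$ (r, c'')"
        using rc km c' by (simp add: macaulay_matrix_def Q_def macaulay_entry_mult)
    qed (simp_all add: macaulay_matrix_def)
    then show "h dvd det (mat ?l ?l (\<lambda>(i, j). Q (f i) (cs ! j)))"
      using h[OF v'] unfolding \<Phi>'_def by simp
  qed (simp add: finite_monomials)
  ultimately show ?thesis by simp
qed

section \<open>The resultant\<close>

lemma macaulay_minors_eq:
  "macaulay_minors N d =
    {det (mat (length cs) (length cs) (\<lambda>(r, c). macaulay_entry (rs ! r) (cs ! c))) | rs cs. valid_idx N d rs cs}"
  by (simp add: macaulay_minors_def valid_idx_def crit_def)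

text \<open>Evaluation is a ring homomorphism and therefore commutes with determinants.\<close>

lemma geval_minor:
  "geval univ_ring (det (mat (length cs) (length cs) (\<lambda>(r, c). macaulay_entry (rs ! r) (cs ! c)))) (\<lambda>(i, m). \<Phi> i m)
    = det (macaulay_matrix rs cs (\<Phi> :: 'b :: comm_ring_1 poly_map))"
proof -
  let ?h = "\<lambda>p. geval univ_ring p (\<lambda>(i, m). \<Phi> i m)"
  interpret h: comm_ring_hom ?h by (rule geval_comm_ring_hom)
  have V: "?h (Poly_Mapping.single {#(i, n)#} 1) = \<Phi> i n" for i n
    using univ.geval_Var[of "\<lambda>(i, m). \<Phi> i m" "(i, n)"] by (simp add: Var_def)
  have "map_mat ?h (mat (length cs) (length cs) (\<lambda>(r, c). macaulay_entry (rs ! r) (cs ! c)))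
      = macaulay_matrix rs cs \<Phi>"
    by (rule eq_matI) (auto simp: macaulay_matrix_def macaulay_entry_def V split: prod.splits)
  then show ?thesis using h.hom_det by metis
qed

definition power_map :: "nat \<Rightarrow> int poly_map" where
  "power_map d = (\<lambda>i m. if m = replicate_mset d i then 1 else 0)"

lemma univ_ring_int: "univ_ring = \<Z>"
  by (simp add: univ_ring_def)

text \<open>Pigeonhole: if all exponents were at most \<open>d - 1\<close>, the degree would be at
  most \<open>(N + 1) * (d - 1)\<close>, which is one less than \<open>crit N d\<close>.\<close>

lemma monomial_crit_divisible:
  assumes "n \<in> monomials N (crit N d)" "d \<ge> 1"
  shows "\<exists>i\<le>N. replicate_mset d i \<subseteq># n"
proof (rule ccontr)
  assume *: "\<not> ?thesis"
  have "count n i \<le> d - 1" if "i \<le> N" for i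
  proof (rule ccontr)
    assume "\<not> count n i \<le> d - 1"
    then have "replicate_mset d i \<subseteq># n" by (simp add: count_le_replicate_mset_subset_eq[symmetric])
    with * that show False by blast
  qed
  then have "(\<Sum>i\<in>{..N}. count n i) \<le> (\<Sum>i\<in>{..N}. d - 1)" by (intro sum_mono) auto
  moreover have "size n = (\<Sum>i\<in>{..N}. count n i)"
    unfolding size_multiset_overloaded_eq using assms
    by (intro sum.mono_neutral_left) (auto simp: monomials_def not_in_iff)
  ultimately have "crit N d \<le> (N + 1) * (d - 1)" using assms by (simp add: monomials_def)
  then show False using assms(2) by (simp add: crit_def)
qed

text \<open>For each monomial \<open>n\<close> of critical degree choose an index \<open>j n\<close>
  such that the \<open>d\<close>-th power of that variable divides \<open>n\<close>. At the power
  map, the row for this index and the quotient is the unit vector at \<open>n\<close>, so these rows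
  form the identity matrix.\<close>

lemma power_minor:
  assumes "d \<ge> 1"
  shows "\<exists>D \<in> macaulay_minors N d. geval univ_ring D (\<lambda>(i, m). power_map d i m) = 1"
proof -
  obtain cs where cs: "distinct cs" "set cs = monomials N (crit N d)"
    using finite_distinct_list[OF finite_monomials] by metis
  define j where "j n = (SOME i. i \<le> N \<and> replicate_mset d i \<subseteq># n)" for n
  have j: "j n \<le> N" "replicate_mset d (j n) \<subseteq># n" if "n \<in> set cs" for n
    using someI_ex[OF monomial_crit_divisible[of n N d]] that cs assms by (auto simp: j_def)
  define rs where "rs = map (\<lambda>n. (j n, n - replicate_mset d (j n))) cs"
  have "valid_idx N d rs cs"
  proof -
    have "n - replicate_mset d (j n) \<in> monomials N (N * (d - 1))" if n: "n \<in> set cs" for n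
    proof -
      have "size (n - replicate_mset d (j n)) = size n - d" using j(2)[OF n] by (simp add: size_Diff_submset)
      moreover have "n \<in> monomials N (crit N d)" using n cs by simp
      ultimately show ?thesis by (auto simp: monomials_def crit_def dest: in_diffD)
    qed
    then show ?thesis using cs j by (auto simp: valid_idx_def rs_def)
  qed
  moreover have "macaulay_matrix rs cs (power_map d) = 1\<^sub>m (length cs)"
  proof (rule eq_matI)
    fix r c assume "r < dim_row (1\<^sub>m (length cs) :: int mat)" "c < dim_col (1\<^sub>m (length cs) :: int mat)"
    then have rc: "r < length cs" "c < length cs" by simp_all
    let ?n = "cs ! r" and ?n' = "cs ! c"
    have jr: "replicate_mset d (j ?n) \<subseteq># ?n" using j rc by simp
    have "?n - replicate_mset d (j ?n) \<subseteq># ?n' \<and> ?n' - (?n - replicate_mset d (j ?n)) = replicate_mset d (j ?n) \<longleftrightarrow> ?n' = ?n"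
      using jr by (metis diff_diff_submset diff_subset_eq_self subset_mset.add_diff_inverse)
    also have "\<dots> \<longleftrightarrow> r = c" using cs rc by (auto simp: nth_eq_iff_index_eq)
    finally show "macaulay_matrix rs cs (power_map d) $$ (r, c) = 1\<^sub>m (length cs) $$ (r, c)"
      using rc by (auto simp: macaulay_matrix_def rs_def power_map_def)
  qed (simp_all add: macaulay_matrix_def)
  ultimately show ?thesis
    using geval_minor[of cs rs "power_map d"] unfolding macaulay_minors_eq by fastforce
qed

text \<open>With all weights 1 the highest weight is the total degree, and highest weights add in a
  product.\<close>

lemma total_degree_mult:
  assumes "p * q \<noteq> 0"
  shows "total_degree p \<le> total_degree (p * q)"
proof -
  have "p \<noteq> 0" "q \<noteq> 0" using assms by auto
  have wt1: "wt (\<lambda>_. 1) m = int (size m)" for m :: "(nat \<times> nat multiset) multiset"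
    by (induction m) auto
  obtain m where m: "m \<in> Poly_Mapping.keys (p * q)"
    "wt (\<lambda>_. 1) m = Max (wt (\<lambda>_. 1) ` Poly_Mapping.keys p) + Max (wt (\<lambda>_. 1) ` Poly_Mapping.keys q)"
    using keys_mult_top[OF \<open>p \<noteq> 0\<close> \<open>q \<noteq> 0\<close>] by blast
  obtain n0 where "n0 \<in> Poly_Mapping.keys q" using \<open>q \<noteq> 0\<close> by (metis keys_eq_empty ex_in_conv)
  then have "wt (\<lambda>_. 1) n0 \<le> Max (wt (\<lambda>_. 1) ` Poly_Mapping.keys q)" by (intro Max_ge) auto
  then have nn: "Max (wt (\<lambda>_. 1) ` Poly_Mapping.keys q) \<ge> 0" using wt1[of n0] by linarith
  have "size n \<le> size m" if "n \<in> Poly_Mapping.keys p" for n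
  proof -
    have "wt (\<lambda>_. 1) n \<le> Max (wt (\<lambda>_. 1) ` Poly_Mapping.keys p)" using that by (intro Max_ge) auto
    then show ?thesis using m(2) nn wt1[of m] wt1[of n] by linarith
  qed
  moreover have "size m \<le> total_degree (p * q)" unfolding total_degree_def using m(1) by (intro Max_ge) auto
  ultimately show ?thesis unfolding total_degree_def[of p] by (force intro: Max.boundedI)
qed

text \<open>The choice in \<open>macaulay_resultant\<close> succeeds: total degrees of common
  factors are bounded by that of a nonzero minor, and a factor of highest degree takes a value
  dividing 1 at the power map, so the factor or its negative is normalised.\<close>

lemma resultant_props:
  assumes "d \<ge> 1"
  shows "\<forall>D \<in> macaulay_minors N d. macaulay_resultant N d dvd D"
    and "macaulay_resultant N d \<noteq> 0"
proof -
  define fac where "fac = (\<lambda>g. \<forall>D \<in> macaulay_minors N d. g dvd D)"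
  define val where "val = (\<lambda>g :: generic_poly. geval univ_ring g (\<lambda>(i, m). power_map d i m))"
  interpret h: comm_ring_hom val unfolding val_def by (rule geval_comm_ring_hom)
  obtain D where D: "D \<in> macaulay_minors N d" "val D = 1" using power_minor[OF assms] unfolding val_def by blast
  then have "D \<noteq> 0" by auto
  have bound: "total_degree g \<le> total_degree D" if "fac g" for g
  proof -
    obtain q where "D = g * q" using \<open>fac g\<close> D unfolding fac_def by (meson dvdE)
    then show ?thesis using total_degree_mult[of g q] \<open>D \<noteq> 0\<close> by simp
  qed
  have "fac 1" by (simp add: fac_def)
  have "\<exists>g. fac g \<and> (\<forall>h. fac h \<longrightarrow> total_degree h \<le> total_degree g)"
    by (rule ex_has_greatest_nat[where P = fac and k = 1 and f = total_degree and b = "Suc (total_degree D)"])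
      (use bound \<open>fac 1\<close> in \<open>auto simp: le_imp_less_Suc\<close>)
  then obtain g where g: "fac g" "\<And>h. fac h \<Longrightarrow> total_degree h \<le> total_degree g" by blast
  have "g dvd D" using g(1) D(1) by (simp add: fac_def)
  then have "val g dvd val D" by (rule h.hom_dvd)
  then have "val g dvd 1" by (simp add: D(2))
  then have "val g = 1 \<or> val (- g) = 1" by (auto simp: h.hom_uminus)
  moreover have "fac (- g)" "total_degree (- g) = total_degree g"
    using g(1) by (simp_all add: fac_def total_degree_def)
  ultimately have "(fac g \<and> (\<forall>h. fac h \<longrightarrow> total_degree h \<le> total_degree g) \<and> val g = 1) \<or>
      (fac (- g) \<and> (\<forall>h. fac h \<longrightarrow> total_degree h \<le> total_degree (- g)) \<and> val (- g) = 1)"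
    using g by auto
  then have ex: "\<exists>g. fac g \<and> (\<forall>h. fac h \<longrightarrow> total_degree h \<le> total_degree g) \<and> val g = 1" by (elim disjE exI)
  have val: "val g = generic_eval \<Z> g (\<lambda>i m. if m = replicate_mset d i then 1 else 0)" for g
    unfolding val_def generic_eval_geval univ_ring_int power_map_def ..
  have "macaulay_resultant N d = (SOME g. fac g \<and> (\<forall>h. fac h \<longrightarrow> total_degree h \<le> total_degree g) \<and> val g = 1)"
    unfolding macaulay_resultant_def Let_def val fac_def ..
  then have "fac (macaulay_resultant N d) \<and> val (macaulay_resultant N d) = 1"
    using someI_ex[OF ex] by simp
  then show "\<forall>D \<in> macaulay_minors N d. macaulay_resultant N d dvd D" "macaulay_resultant N d \<noteq> 0"
    unfolding fac_def by auto
qed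

lemma minor_vars:
  assumes "m \<in> monomials N (N * (d - 1))" "n \<in> monomials N (crit N d)" "m \<subseteq># n"
  shows "n - m \<in> monomials N d"
  using assms by (auto simp: monomials_def crit_def size_Diff_submset dest: in_diffD)

lemma homog_single: "homog w (w v) (Poly_Mapping.single {#v#} 1)"
  by (simp add: homog_def)

text \<open>Every summand of the Leibniz expansion uses each row and each column once. Its weight is
  thus the sum of the column weights \<open>\<alpha>\<close> minus the sum of the row weights
  \<open>\<beta>\<close>, whatever the permutation.\<close>

lemma homog_minor:
  assumes "valid_idx N d rs cs"
    and "\<And>i m n. \<lbrakk>i \<le> N; m \<in> monomials N (N * (d - 1)); n \<in> monomials N (crit N d); m \<subseteq># n\<rbrakk>
        \<Longrightarrow> w (i, n - m) = \<alpha> n - \<beta> i m"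
  shows "homog w ((\<Sum>r\<in>{0..<length cs}. \<alpha> (cs ! r)) - (\<Sum>r\<in>{0..<length cs}. case rs ! r of (i, m) \<Rightarrow> \<beta> i m))
     (det (mat (length cs) (length cs) (\<lambda>(r, c). macaulay_entry (rs ! r) (cs ! c))))"
proof -
  let ?l = "length cs"
  let ?b = "\<lambda>r. case rs ! r of (i, m) \<Rightarrow> \<beta> i m"
  have entry: "homog w (\<alpha> (cs ! c) - ?b r) (macaulay_entry (rs ! r) (cs ! c))"
    if rc: "r < ?l" "c < ?l" for r c
  proof -
    obtain i m where im: "rs ! r = (i, m)" by fastforce
    have "(i, m) \<in> set rs" using assms(1) rc im nth_mem[of r rs] by (simp add: valid_idx_def)
    then have v: "i \<le> N" "m \<in> monomials N (N * (d - 1))" "cs ! c \<in> monomials N (crit N d)"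
      using assms(1) rc nth_mem[of c cs] by (auto simp: valid_idx_def)
    show ?thesis using homog_single[of w "(i, cs ! c - m)"] assms(2)[OF v]
      by (auto simp: macaulay_entry_def im)
  qed
  let ?k = "(\<Sum>r\<in>{0..<?l}. \<alpha> (cs ! r)) - (\<Sum>r\<in>{0..<?l}. ?b r)"
  have "homog w ?k (signof p * (\<Prod>r\<in>{0..<?l}. macaulay_entry (rs ! r) (cs ! p r)))"
    if p: "p permutes {0..<?l}" for p
  proof -
    have "homog w (\<Sum>r\<in>{0..<?l}. \<alpha> (cs ! p r) - ?b r) (\<Prod>r\<in>{0..<?l}. macaulay_entry (rs ! r) (cs ! p r))"
      using permutes_in_image[OF p] by (intro homog_prod entry) auto
    also have "(\<Sum>r\<in>{0..<?l}. \<alpha> (cs ! p r) - ?b r) = ?k"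
      using sum.permute[OF p, of "\<lambda>r. \<alpha> (cs ! r)"] by (simp add: sum_subtractf comp_def)
    finally show ?thesis by (auto simp: sign_def intro: homog_uminus)
  qed
  then show ?thesis by (subst det_def'[of _ ?l]) (auto intro!: homog_sum)
qed

text \<open>The entries of the Macaulay matrix are zero or coefficients of the generic forms, so a
  weight that vanishes on these coefficients vanishes on the whole minor.\<close>

lemma homog_zero_minor:
  assumes "valid_idx N d rs cs" "\<And>i m. \<lbrakk>i \<le> N; m \<in> monomials N d\<rbrakk> \<Longrightarrow> w (i, m) = 0"
  shows "homog w 0 (det (mat (length cs) (length cs) (\<lambda>(r, c). macaulay_entry (rs ! r) (cs ! c))))"
  using homog_minor[OF assms(1), where w = w and \<alpha> = "\<lambda>_. 0" and \<beta> = "\<lambda>_ _. 0"]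
    assms(2) minor_vars by simp

lemma homog_nonneg:
  assumes "homog w k p" "p \<noteq> 0" "\<And>v. w v \<ge> 0"
  shows "k \<ge> 0"
proof -
  have wt: "wt w m \<ge> 0" for m by (induction m) (auto simp: assms(3))
  obtain m where "m \<in> Poly_Mapping.keys p" using assms(2) by (metis keys_eq_empty ex_in_conv)
  then show ?thesis using assms(1) wt[of m] by (simp add: homog_def)
qed

text \<open>A sum of nonnegative weights is zero only if each of them is. This is how absence of a
  variable is detected.\<close>

lemma homog_zero_vars:
  assumes "homog w 0 p" "\<And>v. w v \<ge> 0" "m \<in> Poly_Mapping.keys p" "v \<in># m"
  shows "w v = 0"
proof -
  have wt: "wt w m \<ge> 0" for m by (induction m) (auto simp: assms(2))
  obtain m' where m': "m = add_mset v m'" using assms(4) by (metis mset_add)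
  have "wt w m = 0" using assms(1,3) by (simp add: homog_def)
  then have "w v + wt w m' = 0" using m' by simp
  then show ?thesis using assms(2)[of v] wt[of m'] by linarith
qed

text \<open>Both factors are homogeneous, and their weights are nonnegative with sum zero.\<close>

lemma homog_zero_factor:
  fixes p q :: "'v :: linorder zpoly"
  assumes "homog w 0 (p * q)" "p * q \<noteq> 0" "\<And>v. w v \<ge> 0"
  shows "homog w 0 p"
proof -
  have nz: "p \<noteq> 0" "q \<noteq> 0" using assms by auto
  obtain k where k: "homog w k p" using homog_factor[OF assms(2,1)] .
  obtain l where l: "homog w l q"
    using homog_factor[of q p w 0] assms by (metis mult.commute)
  obtain m where "m \<in> Poly_Mapping.keys (p * q)" using assms(2) by (metis keys_eq_empty ex_in_conv)
  then have "k + l = 0" using homog_mult[OF k l] assms(1) by (auto simp: homog_def)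
  moreover have "k \<ge> 0" "l \<ge> 0" using homog_nonneg[OF k nz(1)] homog_nonneg[OF l nz(2)] assms(3) by auto
  ultimately have "k = 0" by linarith
  with k show ?thesis by simp
qed

lemma nonzero_minor:
  assumes "d \<ge> 1"
  obtains rs cs where "valid_idx N d rs cs"
    "det (mat (length cs) (length cs) (\<lambda>(r, c). macaulay_entry (rs ! r) (cs ! c))) \<noteq> 0"
proof -
  obtain D where "D \<in> macaulay_minors N d" "geval univ_ring D (\<lambda>(i, m). power_map d i m) = 1"
    using power_minor[OF assms] by blast
  moreover have "geval univ_ring (0 :: generic_poly) (\<lambda>(i, m). power_map d i m) = 0"
    using comm_ring_hom.axioms(1)[OF geval_comm_ring_hom] by (simp add: geval_def mpoly_eval_def)
  ultimately show ?thesis using that unfolding macaulay_minors_eq by fastforce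
qed

text \<open>The resultant divides a nonzero minor and so inherits its homogeneity. Only the
  existence of the weight \<open>k\<close> is obtained, which leaves the exponents in the
  transformation rules unspecified.\<close>

lemma homog_resultant:
  assumes "d \<ge> 1" "\<And>v. w v \<ge> 0"
    and "\<And>i m n. \<lbrakk>i \<le> N; m \<in> monomials N (N * (d - 1)); n \<in> monomials N (crit N d); m \<subseteq># n\<rbrakk>
        \<Longrightarrow> w (i, n - m) = \<alpha> n - \<beta> i m"
  obtains k :: nat where "homog w (int k) (macaulay_resultant N d)"
proof -
  obtain rs cs where v: "valid_idx N d rs cs"
    and nz: "det (mat (length cs) (length cs) (\<lambda>(r, c). macaulay_entry (rs ! r) (cs ! c))) \<noteq> 0" (is "?D \<noteq> 0")
    using nonzero_minor[OF assms(1)] .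
  obtain k where k: "homog w k ?D" using homog_minor[OF v, where w = w and \<alpha> = \<alpha> and \<beta> = \<beta>, OF assms(3)] by blast
  have "?D \<in> macaulay_minors N d" using v unfolding macaulay_minors_eq by blast
  then obtain q where q: "?D = macaulay_resultant N d * q"
    using resultant_props(1)[OF assms(1)] by (metis dvdE)
  then obtain l where l: "homog w l (macaulay_resultant N d)"
    using homog_factor[of "macaulay_resultant N d" q w k] k nz by metis
  then have "l \<ge> 0" using homog_nonneg resultant_props(2)[OF assms(1)] assms(2) by metis
  then show ?thesis using that[of "nat l"] l by simp
qed

text \<open>Give weight 1 to the indeterminates that are not coefficients of one of the
  \<open>N + 1\<close> forms of degree \<open>d\<close>. A nonzero minor has weight 0, hence so has
  its factor.\<close>

lemma resultant_vars:
  assumes "d \<ge> 1" "M \<in> Poly_Mapping.keys (macaulay_resultant N d)" "(i, m) \<in># M"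
  shows "i \<le> N \<and> m \<in> monomials N d"
proof -
  let ?w = "\<lambda>(i, m). if i \<le> N \<and> m \<in> monomials N d then 0 else (1 :: int)"
  obtain rs cs where v: "valid_idx N d rs cs"
    and nz: "det (mat (length cs) (length cs) (\<lambda>(r, c). macaulay_entry (rs ! r) (cs ! c))) \<noteq> 0" (is "?D \<noteq> 0")
    using nonzero_minor[OF assms(1)] .
  have D: "homog ?w 0 ?D" by (rule homog_zero_minor[OF v]) simp
  have "?D \<in> macaulay_minors N d" using v unfolding macaulay_minors_eq by blast
  then obtain q where q: "?D = macaulay_resultant N d * q"
    using resultant_props(1)[OF assms(1)] by (metis dvdE)
  have "homog ?w 0 (macaulay_resultant N d)"
    by (rule homog_zero_factor[of _ _ q]) (use D nz q in auto)
  moreover have "?w v \<ge> 0" for v by (simp split: prod.split)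
  ultimately have "?w (i, m) = 0" by (rule homog_zero_vars[OF _ _ assms(2,3)])
  then show ?thesis by (simp split: if_splits)
qed

section \<open>Transformation of the resultant\<close>

text \<open>A map is \<open>undefined\<close> at indices beyond \<open>N\<close>, and this value
  need not lie in the ring. Putting zero there gives a point at which evaluation is a
  homomorphism.\<close>

definition coeff_ext :: "('k, 'm) ring_scheme \<Rightarrow> nat \<Rightarrow> nat \<Rightarrow> 'k poly_map \<Rightarrow> nat \<times> nat multiset \<Rightarrow> 'k" where
  "coeff_ext F N d \<Phi> = (\<lambda>(i, m). if i \<le> N \<and> m \<in> monomials N d then \<Phi> i m else \<zero>\<^bsub>F\<^esub>)"

definition elemm :: "('k, 'm) ring_scheme \<Rightarrow> nat \<Rightarrow> nat \<Rightarrow> 'k \<Rightarrow> nat \<Rightarrow> nat \<Rightarrow> 'k" where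
  "elemm F i j s = (\<lambda>a b. if a = b then \<one>\<^bsub>F\<^esub> else if a = i \<and> b = j then s else \<zero>\<^bsub>F\<^esub>)"

context cring
begin

lemma coeff_ext_closed: "\<Phi> \<in> fmaps R N d \<Longrightarrow> coeff_ext R N d \<Phi> v \<in> carrier R"
  using MP_coeff[OF forms_carrier[OF fmaps_form]] by (auto simp: coeff_ext_def split: prod.splits)

text \<open>The two points agree at the indeterminates that occur in the resultant, by
  \<open>resultant_vars\<close>.\<close>

lemma Res_eq:
  assumes "d \<ge> 1" "\<Phi> \<in> fmaps R N d"
  shows "Res R N d \<Phi> = geval R (macaulay_resultant N d) (coeff_ext R N d \<Phi>)"
  unfolding Res_def generic_eval_geval
proof (rule geval_cong)
  fix M v assume "M \<in> Poly_Mapping.keys (macaulay_resultant N d)" "v \<in># M"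
  then have "fst v \<le> N \<and> snd v \<in> monomials N d"
    using resultant_vars[OF assms(1), of M N "fst v" "snd v"] by simp
  then show "(case v of (i, m) \<Rightarrow> \<Phi> i m) = coeff_ext R N d \<Phi> v \<and> coeff_ext R N d \<Phi> v \<in> carrier R"
    using coeff_ext_closed[OF assms(2)] by (auto simp: coeff_ext_def split: prod.splits)
qed

lemma Res_closed: "d \<ge> 1 \<Longrightarrow> \<Phi> \<in> fmaps R N d \<Longrightarrow> Res R N d \<Phi> \<in> carrier R"
  by (simp add: Res_eq geval_closed coeff_ext_closed)

text \<open>With weight 1 for every indeterminate, the nonzero entries of the Macaulay matrix all
  have weight 1. So the resultant is homogeneous in the usual sense, and \<open>e\<close> is its
  degree.\<close>

lemma Res_scale:
  assumes "d \<ge> 1"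
  obtains e :: nat where
    "\<And>c \<Phi>. c \<in> carrier R \<Longrightarrow> \<Phi> \<in> fmaps R N d \<Longrightarrow> Res R N d (scale_map R N c \<Phi>) = c [^] e \<otimes> Res R N d \<Phi>"
proof -
  obtain e :: nat where e: "homog (\<lambda>v. int ((\<lambda>_. 1) v)) (int e) (macaulay_resultant N d)"
    by (rule homog_resultant[OF assms, where w = "\<lambda>_. 1" and \<alpha> = "\<lambda>_. 1" and \<beta> = "\<lambda>_ _. 0" and N = N]) auto
  have "Res R N d (scale_map R N c \<Phi>) = c [^] e \<otimes> Res R N d \<Phi>"
    if c: "c \<in> carrier R" and \<Phi>: "\<Phi> \<in> fmaps R N d" for c \<Phi>
  proof -
    have "coeff_ext R N d (scale_map R N c \<Phi>) = (\<lambda>v. c [^] (1 :: nat) \<otimes> coeff_ext R N d \<Phi> v)"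
      using c by (auto simp: coeff_ext_def scale_map_def fun_eq_iff)
    then show ?thesis
      using geval_homog[OF e, of "coeff_ext R N d \<Phi>" c] coeff_ext_closed[OF \<Phi>] c \<Phi>
      by (simp add: Res_eq[OF assms] scale_map_fmaps)
  qed
  then show ?thesis using that by blast
qed

definition unit_diag :: "nat \<Rightarrow> nat \<Rightarrow> 'a \<Rightarrow> nat \<Rightarrow> nat \<Rightarrow> 'a" where
  "unit_diag N i s = diagm (\<lambda>v. if v = i then s else if v \<le> N then \<one> else \<zero>)"

text \<open>The left factor multiplies the \<open>i\<close>-th form by \<open>s\<close>, the right
  one multiplies the coefficient of \<open>m\<close> by \<open>s' [^] count m i\<close>. The weights
  \<open>w1\<close> and \<open>w2\<close> record these exponents. Powers of \<open>s\<close> on both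
  sides avoid negative exponents.\<close>

lemma Res_unit_diag:
  assumes "d \<ge> 1" "i \<le> N"
  obtains e1 e2 :: nat where
    "\<And>s s' \<Phi>. \<lbrakk>s \<in> carrier R; s' \<in> carrier R; s \<otimes> s' = \<one>; \<Phi> \<in> fmaps R N d\<rbrakk> \<Longrightarrow>
      s [^] e2 \<otimes> Res R N d (conj_map R N (unit_diag N i s) (unit_diag N i s') \<Phi>) = s [^] e1 \<otimes> Res R N d \<Phi>"
proof -
  define w1 w2 :: "nat \<times> nat multiset \<Rightarrow> nat"
    where "w1 = (\<lambda>(j, m). if j = i then 1 else 0)" and "w2 = (\<lambda>(j, m). count m i)"
  \<comment> \<open>The row weight is \<open>- 1\<close> because the weight of an entry is
    \<open>\<alpha>\<close> minus \<open>\<beta>\<close>.\<close>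
  obtain e1 :: nat where e1: "homog (\<lambda>v. int (w1 v)) (int e1) (macaulay_resultant N d)"
    by (rule homog_resultant[OF assms(1), where w = "\<lambda>v. int (w1 v)" and \<alpha> = "\<lambda>_. 0" and N = N
        and \<beta> = "\<lambda>j _. if j = i then - 1 else 0"]) (auto simp: w1_def)
  \<comment> \<open>The entry in a row with monomial \<open>m\<close> and a column \<open>n\<close>
    is the coefficient of \<open>n - m\<close>, and its exponent at \<open>i\<close> is a column
    contribution minus a row contribution.\<close>
  obtain e2 :: nat where e2: "homog (\<lambda>v. int (w2 v)) (int e2) (macaulay_resultant N d)"
  proof (rule homog_resultant[OF assms(1), where w = "\<lambda>v. int (w2 v)" and \<alpha> = "\<lambda>n. int (count n i)" and N = N
        and \<beta> = "\<lambda>_ m. int (count m i)"])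
    fix m n :: "nat multiset" assume "m \<subseteq># n"
    then show "int (w2 (j, n - m)) = int (count n i) - int (count m i)" for j
      by (simp add: w2_def of_nat_diff mset_subset_eq_count)
  qed auto
  have "s [^] e2 \<otimes> Res R N d (conj_map R N (unit_diag N i s) (unit_diag N i s') \<Phi>) = s [^] e1 \<otimes> Res R N d \<Phi>"
    if s: "s \<in> carrier R" "s' \<in> carrier R" "s \<otimes> s' = \<one>" and \<Phi>: "\<Phi> \<in> fmaps R N d" for s s' \<Phi>
  proof -
    let ?\<Phi> = "conj_map R N (unit_diag N i s) (unit_diag N i s') \<Phi>"
    have c: "\<Phi> j m \<in> carrier R" if "j \<le> N" for j m
      using MP_coeff[OF forms_carrier[OF fmaps_form[OF \<Phi> that]]] .
    have \<Phi>': "?\<Phi> \<in> fmaps R N d"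
      unfolding unit_diag_def using s by (intro conj_map_fmaps[OF \<Phi>] diagm_closed) auto
    have mon: "mon_eval R m (\<lambda>v. if v = i then s' else if v \<le> N then \<one> else \<zero>) = s' [^] count m i"
      if "set_mset m \<subseteq> {..N}" for m
    proof -
      have "mon_eval R m (\<lambda>v. if v = i then s' else if v \<le> N then \<one> else \<zero>)
        = (\<Otimes>v\<in>{..N}. (if v = i then s' else if v \<le> N then \<one> else \<zero>) [^] count m v)"
        using that s by (intro mon_eval_superset) auto
      also have "\<dots> = (\<Otimes>v\<in>{..N}. if i = v then s' [^] count m v else \<one>)"
        using s by (intro finprod_cong') auto
      also have "\<dots> = s' [^] count m i" using s assms(2) by (intro finprod_singleton) auto
      finally show ?thesis .
    qed
    \<comment> \<open>The identity for single coefficients: \<open>s [^] count m i\<close> cancels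
      the power of \<open>s'\<close> brought in by the substitution.\<close>
    have "s [^] w2 v \<otimes> coeff_ext R N d ?\<Phi> v = s [^] w1 v \<otimes> coeff_ext R N d \<Phi> v" for v
    proof (cases v)
      case (Pair j m)
      show ?thesis
      proof (cases "j \<le> N \<and> m \<in> monomials N d")
        case True
        have "?\<Phi> j m = (if j = i then s else \<one>) \<otimes> (s' [^] count m i \<otimes> \<Phi> j m)"
          unfolding unit_diag_def using True mon[of m] s assms(2)
          by (subst conj_map_diagm[OF _ _ _ \<Phi>]) (auto simp: monomials_def)
        moreover have "s [^] count m i \<otimes> s' [^] count m i = \<one>"
          using s by (simp add: pow_mult_distrib[symmetric] m_comm)
        ultimately have "s [^] count m i \<otimes> ?\<Phi> j m = (if j = i then s else \<one>) \<otimes> \<Phi> j m"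
          using s c[of j m] True
          by (smt (verit) l_one m_assoc m_comm m_closed nat_pow_closed one_closed)
        then show ?thesis using Pair True s c[of j m] by (auto simp: coeff_ext_def w1_def w2_def)
      next
        case False
        then show ?thesis using Pair s by (auto simp: coeff_ext_def)
      qed
    qed
    then have "geval R (macaulay_resultant N d) (\<lambda>v. s [^] w2 v \<otimes> coeff_ext R N d ?\<Phi> v)
        = geval R (macaulay_resultant N d) (\<lambda>v. s [^] w1 v \<otimes> coeff_ext R N d \<Phi> v)" by simp
    then show ?thesis
      using geval_homog[OF e2 coeff_ext_closed[OF \<Phi>'] s(1)] geval_homog[OF e1 coeff_ext_closed[OF \<Phi>] s(1)]
      by (simp add: Res_eq[OF assms(1) \<Phi>] Res_eq[OF assms(1) \<Phi>'])
  qed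
  then show ?thesis using that by blast
qed

end

text \<open>The resultant is the value of one polynomial over \<int>, and such values commute with
  homomorphisms.\<close>

lemma (in ring_hom_cring) Res_map:
  assumes "d \<ge> 1" "\<Phi> \<in> fmaps R N d"
  shows "h (Res R N d \<Phi>) = Res S N d (map_coeffs N h \<Phi>)"
proof -
  have "h (geval R (macaulay_resultant N d) (coeff_ext R N d \<Phi>))
      = geval S (macaulay_resultant N d) (\<lambda>v. h (coeff_ext R N d \<Phi> v))"
    by (rule geval_hom_comp[OF R.cring_axioms S.cring_axioms homh R.coeff_ext_closed[OF assms(2)]])
  also have "(\<lambda>v. h (coeff_ext R N d \<Phi> v)) = coeff_ext S N d (map_coeffs N h \<Phi>)"
    by (auto simp: coeff_ext_def map_coeffs_def fun_eq_iff)
  finally show ?thesis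
    using assms by (simp add: R.Res_eq S.Res_eq map_coeffs_fmaps)
qed

section \<open>Elementary and diagonal matrices as row and column operations\<close>

context cring
begin

lemma elemm_closed: "s \<in> carrier R \<Longrightarrow> matc R N (elemm R i j s)"
  by (auto simp: elemm_def matc_def)

lemma mm_elemm_left:
  assumes "matc R N C" "s \<in> carrier R" "i \<le> N" "j \<le> N" "i \<noteq> j" "a \<le> N" "b \<le> N"
  shows "mm R N (elemm R i j s) C a b = (if a = i then C i b \<oplus> s \<otimes> C j b else C a b)"
proof -
  have c: "C k b \<in> carrier R" if "k \<le> N" for k using assms that by (auto simp: matc_def)
  have 1: "(\<Oplus>k\<in>{..N}. if a = k then C k b else \<zero>) = C a b"
    using c assms by (intro finsum_singleton) auto
  have 2: "(\<Oplus>k\<in>{..N}. if j = k then s \<otimes> C k b else \<zero>) = s \<otimes> C j b"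
    using c assms by (intro finsum_singleton) auto
  show ?thesis
  proof (cases "a = i")
    case True
    have "mm R N (elemm R i j s) C a b
      = (\<Oplus>k\<in>{..N}. (if a = k then C k b else \<zero>) \<oplus> (if j = k then s \<otimes> C k b else \<zero>))"
      unfolding mm_def elemm_def using True c assms by (intro finsum_cong') auto
    also have "\<dots> = C a b \<oplus> s \<otimes> C j b"
      using c assms by (subst finsum_addf) (auto simp: 1 2)
    finally show ?thesis using True by simp
  next
    case False
    have "mm R N (elemm R i j s) C a b = (\<Oplus>k\<in>{..N}. if a = k then C k b else \<zero>)"
      unfolding mm_def elemm_def using False c assms by (intro finsum_cong') auto
    then show ?thesis using 1 False by simp
  qed
qed

lemma mm_elemm_right:
  assumes "matc R N C" "s \<in> carrier R" "i \<le> N" "j \<le> N" "i \<noteq> j" "a \<le> N" "b \<le> N"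
  shows "mm R N C (elemm R i j s) a b = (if b = j then C a j \<oplus> C a i \<otimes> s else C a b)"
proof -
  have c: "C a k \<in> carrier R" if "k \<le> N" for k using assms that by (auto simp: matc_def)
  have 1: "(\<Oplus>k\<in>{..N}. if b = k then C a k else \<zero>) = C a b"
    using c assms by (intro finsum_singleton) auto
  have 2: "(\<Oplus>k\<in>{..N}. if i = k then C a k \<otimes> s else \<zero>) = C a i \<otimes> s"
    using c assms by (intro finsum_singleton) auto
  show ?thesis
  proof (cases "b = j")
    case True
    have "mm R N C (elemm R i j s) a b
      = (\<Oplus>k\<in>{..N}. (if b = k then C a k else \<zero>) \<oplus> (if i = k then C a k \<otimes> s else \<zero>))"
      unfolding mm_def elemm_def using True c assms by (intro finsum_cong') auto
    also have "\<dots> = C a b \<oplus> C a i \<otimes> s"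
      using c assms by (subst finsum_addf) (auto simp: 1 2)
    finally show ?thesis using True by simp
  next
    case False
    have "mm R N C (elemm R i j s) a b = (\<Oplus>k\<in>{..N}. if b = k then C a k else \<zero>)"
      unfolding mm_def elemm_def using False c assms by (intro finsum_cong') auto
    then show ?thesis using 1 False by simp
  qed
qed

lemma mm_diagm_left:
  assumes "matc R N C" "\<And>v. v \<le> N \<Longrightarrow> b v \<in> carrier R" "i \<le> N" "j \<le> N"
  shows "mm R N (diagm b) C i j = b i \<otimes> C i j"
proof -
  have c: "C k j \<in> carrier R" if "k \<le> N" for k using assms that by (auto simp: matc_def)
  have "mm R N (diagm b) C i j = (\<Oplus>k\<in>{..N}. if i = k then b k \<otimes> C k j else \<zero>)"
    unfolding mm_def diagm_def using c assms by (intro finsum_cong') auto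
  also have "\<dots> = b i \<otimes> C i j" using c assms by (intro finsum_singleton) auto
  finally show ?thesis .
qed

lemma mm_diagm_right:
  assumes "matc R N C" "\<And>v. v \<le> N \<Longrightarrow> b v \<in> carrier R" "i \<le> N" "j \<le> N"
  shows "mm R N C (diagm b) i j = C i j \<otimes> b j"
proof -
  have c: "C i k \<in> carrier R" if "k \<le> N" for k using assms that by (auto simp: matc_def)
  have "mm R N C (diagm b) i j = (\<Oplus>k\<in>{..N}. if j = k then C i k \<otimes> b k else \<zero>)"
    unfolding mm_def diagm_def using c assms by (intro finsum_cong') auto
  also have "\<dots> = C i j \<otimes> b j" using c assms by (intro finsum_singleton) auto
  finally show ?thesis .
qed

lemma elemm_inverse:
  assumes "s \<in> carrier R" "i \<le> N" "j \<le> N" "i \<noteq> j"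
  shows "inverse_matrices R N (elemm R i j s) (elemm R i j (\<ominus> s))"
proof -
  have *: "eqm N (mm R N (elemm R i j s) (elemm R i j (\<ominus> s))) (idm R)" if "s \<in> carrier R" for s
    unfolding eqm_def using that assms
    by (auto simp: mm_elemm_left elemm_closed) (auto simp: elemm_def idm_def r_neg l_neg)
  show ?thesis
    unfolding inverse_matrices_iff
    using *[OF assms(1)] *[of "\<ominus> s"] assms by (auto simp: elemm_closed)
qed

lemma unit_diag_inverse:
  assumes "s \<in> carrier R" "s' \<in> carrier R" "s \<otimes> s' = \<one>"
  shows "inverse_matrices R N (unit_diag N i s) (unit_diag N i s')"
proof -
  have *: "eqm N (mm R N (unit_diag N i s) (unit_diag N i s')) (idm R)"
    if "s \<in> carrier R" "s' \<in> carrier R" "s \<otimes> s' = \<one>" for s s'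
    unfolding eqm_def unit_diag_def using that
    by (auto simp: mm_diagm_left diagm_closed) (auto simp: diagm_def idm_def)
  show ?thesis
    unfolding inverse_matrices_iff
    using *[OF assms] *[OF assms(2,1)] assms by (auto simp: m_comm unit_diag_def diagm_closed)
qed

end

text \<open>The resultant of the transform divides all maximal minors of the transform, and
  \<open>dvd_minors_conj_map\<close> hands this on to the minors of \<open>\<Phi>\<close>.
  Coefficients in \<open>generic_poly\<close> leave room for a matrix entry that is an
  indeterminate.\<close>

lemma Res_univ_dvd_minor:
  fixes \<Phi> :: "generic_poly poly_map"
  assumes "d \<ge> 1" "\<Phi> \<in> fmaps univ_ring N d" "inverse_matrices univ_ring N A B" "valid_idx N d rs cs"
  shows "Res univ_ring N d (conj_map univ_ring N A B \<Phi>) dvd det (macaulay_matrix rs cs \<Phi>)"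
proof (rule dvd_minors_conj_map[OF assms(3,2) _ assms(4)])
  fix rs assume v: "valid_idx N d rs cs"
  let ?\<Phi> = "conj_map univ_ring N A B \<Phi>"
  let ?D = "det (mat (length cs) (length cs) (\<lambda>(r, c). macaulay_entry (rs ! r) (cs ! c)))"
  interpret h: comm_ring_hom "\<lambda>p :: generic_poly. geval univ_ring p (\<lambda>(i, m). ?\<Phi> i m)"
    by (rule geval_comm_ring_hom)
  have "macaulay_resultant N d dvd ?D"
    using resultant_props(1)[OF assms(1)] v unfolding macaulay_minors_eq by blast
  then show "Res univ_ring N d ?\<Phi> dvd det (macaulay_matrix rs cs ?\<Phi>)"
    using h.hom_dvd geval_minor[of cs rs ?\<Phi>] unfolding Res_def generic_eval_geval by metis
qed

text \<open>
  For generic \<open>\<Phi>\<close> and a further indeterminate \<open>t\<close>, the resultant of the transform of \<open>\<Phi>\<close> under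
  the elementary matrix with entry \<open>t\<close> divides a nonzero minor not involving \<open>t\<close>, so it does not
  involve \<open>t\<close> either. Thus \<open>t\<close> may be replaced by \<open>0\<close>.
\<close>

lemma (in cring) Res_elemm:
  assumes d: "d \<ge> 1" and \<Phi>: "\<Phi> \<in> fmaps R N d" and s: "s \<in> carrier R"
    and ij: "i \<le> N" "j \<le> N" "i \<noteq> j"
  shows "Res R N d (conj_map R N (elemm R i j s) (elemm R i j (\<ominus> s)) \<Phi>) = Res R N d \<Phi>"
proof -
  let ?U = "univ_ring :: generic_poly ring"
  \<comment> \<open>There is no form with index \<open>N + 1\<close>, so this indeterminate is
    distinct from all generic coefficients.\<close>
  define t :: "nat \<times> nat multiset" where "t = (Suc N, {#})"
  \<comment> \<open>The generic map: its coefficients are the indeterminates themselves.\<close>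
  define \<Gamma> :: "generic_poly poly_map" where
    "\<Gamma> = (\<lambda>i\<in>{..N}. \<lambda>m. if m \<in> monomials N d then Var (i, m) else 0)"
  have \<Gamma>: "\<Gamma> \<in> fmaps ?U N d"
  proof -
    have "\<Gamma> i \<in> forms ?U N d" if "i \<le> N" for i
      using that
      by (auto simp: \<Gamma>_def forms_def univ.MP_carrier intro!: finite_subset[OF _ finite_monomials[of N d]])
    then show ?thesis by (auto simp: fmaps_def \<Gamma>_def)
  qed
  define T where "T = elemm ?U i j (Var t)"
  define T' where "T' = elemm ?U i j (- Var t)"
  have inv: "inverse_matrices ?U N T T'"
    using univ.elemm_inverse[of "Var t" i N j] ij unfolding T_def T'_def by simp
  then have mT: "matc ?U N T" "matc ?U N T'" by (auto simp: inverse_matrices_iff)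
  define f where "f = Res ?U N d (conj_map ?U N T T' \<Gamma>)"
  obtain rs cs where v: "valid_idx N d rs cs"
    and nz: "det (mat (length cs) (length cs) (\<lambda>(r, c). macaulay_entry (rs ! r) (cs ! c))) \<noteq> 0" (is "?D \<noteq> 0")
    using nonzero_minor[OF d] .
  \<comment> \<open>For the generic map the Macaulay matrix is the symbolic one, so \<open>f\<close>
    divides a nonzero minor that is free of \<open>t\<close>.\<close>
  have "macaulay_matrix rs cs \<Gamma> = mat (length cs) (length cs) (\<lambda>(r, c). macaulay_entry (rs ! r) (cs ! c))"
  proof (rule eq_matI)
    fix r c assume "r < dim_row (mat (length cs) (length cs) (\<lambda>(r, c). macaulay_entry (rs ! r) (cs ! c)))"
      "c < dim_col (mat (length cs) (length cs) (\<lambda>(r, c). macaulay_entry (rs ! r) (cs ! c)))"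
    then have rc: "r < length cs" "c < length cs" by simp_all
    obtain k m where km: "rs ! r = (k, m)" by fastforce
    have "(k, m) \<in> set rs" using v rc km nth_mem[of r rs] by (simp add: valid_idx_def)
    then have "k \<le> N" "m \<in> monomials N (N * (d - 1))" "cs ! c \<in> monomials N (crit N d)"
      using v rc nth_mem[of c cs] by (auto simp: valid_idx_def)
    then show "macaulay_matrix rs cs \<Gamma> $$ (r, c) = mat (length cs) (length cs) (\<lambda>(r, c). macaulay_entry (rs ! r) (cs ! c)) $$ (r, c)"
      using rc km minor_vars by (auto simp: macaulay_matrix_def macaulay_entry_def \<Gamma>_def Var_def)
  qed (simp_all add: macaulay_matrix_def)
  then have "f dvd ?D" using Res_univ_dvd_minor[OF d \<Gamma> inv v] unfolding f_def by simp
  then obtain q where q: "?D = f * q" by (elim dvdE)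
  let ?w = "\<lambda>v. if v = t then 1 else (0 :: int)"
  have "homog ?w 0 ?D" by (rule homog_zero_minor[OF v]) (simp add: t_def)
  then have hf: "homog ?w 0 f" using homog_zero_factor[of ?w f q] nz q by auto
  \<comment> \<open>Specialises the generic coefficients to those of \<open>\<Phi>\<close> and the
    indeterminate \<open>t\<close> to \<open>s\<close>.\<close>
  define env where "env s = (coeff_ext R N d \<Phi>)(t := s)" for s
  have env: "env s v \<in> carrier R" if "s \<in> carrier R" for s v
    using that coeff_ext_closed[OF \<Phi>] by (simp add: env_def)
  have spec: "geval R f (env s) = Res R N d (conj_map R N (elemm R i j s) (elemm R i j (\<ominus> s)) \<Phi>)"
    if s: "s \<in> carrier R" for s
  proof -
    interpret \<eta>: ring_hom_cring ?U R "\<lambda>p. geval R p (env s)"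
      by (intro ring_hom_cringI univ_ring_cring cring_axioms geval_hom env s)
    have var: "geval R (Var v) (env s) = env s v" for v by (intro geval_Var env s)
    have zero: "geval R 0 (env s) = \<zero>" using \<eta>.hom_zero by simp
    have one: "geval R 1 (env s) = \<one>" using \<eta>.hom_one by simp
    have t: "env s t = s" by (simp add: env_def)
    have neg: "geval R (- Var t) (env s) = \<ominus> s" using \<eta>.hom_a_inv[of "Var t"] var[of t] t by simp
    have "map_coeffs N (\<lambda>p. geval R p (env s)) \<Gamma> = \<Phi>"
    proof (intro ext)
      fix k m
      show "map_coeffs N (\<lambda>p. geval R p (env s)) \<Gamma> k m = \<Phi> k m"
      proof (cases "k \<le> N")
        case True
        have "\<Phi> k m = \<zero>" if "m \<notin> monomials N d"
          using fmaps_form[OF \<Phi> True] that by (auto simp: forms_def)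
        moreover have "env s (k, m) = \<Phi> k m" if "m \<in> monomials N d"
          using True that by (simp add: env_def t_def coeff_ext_def)
        ultimately show ?thesis using True by (auto simp: map_coeffs_def \<Gamma>_def var zero)
      next
        case False
        then show ?thesis using \<Phi> by (auto simp: map_coeffs_def fmaps_def PiE_def extensional_def)
      qed
    qed
    moreover have "(\<lambda>a b. geval R (T a b) (env s)) = elemm R i j s"
      using var[of t] t by (auto simp: T_def elemm_def fun_eq_iff zero one)
    moreover have "(\<lambda>a b. geval R (T' a b) (env s)) = elemm R i j (\<ominus> s)"
      by (auto simp: T'_def elemm_def fun_eq_iff zero one neg)
    ultimately have "map_coeffs N (\<lambda>p. geval R p (env s)) (conj_map ?U N T T' \<Gamma>)
        = conj_map R N (elemm R i j s) (elemm R i j (\<ominus> s)) \<Phi>"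
      using \<eta>.map_conj_map[OF \<Gamma> mT] by simp
    then show ?thesis
      using \<eta>.Res_map[OF d univ.conj_map_fmaps[OF \<Gamma> mT]] unfolding f_def by simp
  qed
  have "geval R f (env s) = geval R f (env \<zero>)"
  proof (rule geval_cong)
    fix m v assume mv: "m \<in> Poly_Mapping.keys f" "v \<in># m"
    have "?w v = 0" by (rule homog_zero_vars[OF hf _ mv]) simp
    then have "v \<noteq> t" by (simp split: if_splits)
    then show "env s v = env \<zero> v \<and> env \<zero> v \<in> carrier R" using env[OF zero_closed, of v] by (simp add: env_def)
  qed
  \<comment> \<open>At the value 0 of \<open>t\<close> the two elementary matrices become the
    identity.\<close>
  moreover have "elemm R i j \<zero> = idm R" "elemm R i j (\<ominus> \<zero>) = idm R"
    by (auto simp: elemm_def idm_def fun_eq_iff)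
  ultimately show ?thesis using spec[OF s] spec[OF zero_closed] conj_map_idm[OF \<Phi>] by simp
qed

section \<open>Elementary reduction of invertible matrices\<close>

text \<open>In the application \<open>L\<close> is the completion of \<open>K\<close> at the prime
  generated by \<open>\<pi>\<close>, \<open>V\<close> is its valuation ring and \<open>S\<close> is
  the ring R[1/\<pi>]. The assumption \<open>factor\<close> decomposes nonzero elements into a unit
  and a power of \<open>\<pi>\<close>, with positive and negative exponents listed separately; it
  also stands in for inverses in \<open>L\<close>. The assumption \<open>split\<close> is
  approximation by R[1/\<pi>].\<close>

locale local_field = K: field K + L: cring L + \<iota>: ring_hom_cring K L \<iota>
  for K :: "('k, 'm) ring_scheme" (structure) and L :: "('l, 'n) ring_scheme" (structure) and \<iota> +
  fixes V :: "'l set" and S :: "'k set" and \<pi> :: 'k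
  assumes V: "subring V L" and S: "subring S K"
    and \<pi>: "\<pi> \<in> S" "inv\<^bsub>K\<^esub> \<pi> \<in> S" "\<pi> \<noteq> \<zero>\<^bsub>K\<^esub>" and \<pi>_V: "\<iota> \<pi> \<in> V"
    and one_not_zero_L: "\<one>\<^bsub>L\<^esub> \<noteq> \<zero>\<^bsub>L\<^esub>"
    and factor: "\<And>x. x \<in> carrier L \<Longrightarrow> x \<noteq> \<zero>\<^bsub>L\<^esub> \<Longrightarrow>
      \<exists>u\<in>V. \<exists>u'\<in>V. \<exists>n :: nat. u \<otimes>\<^bsub>L\<^esub> u' = \<one>\<^bsub>L\<^esub> \<and>
        (x = u \<otimes>\<^bsub>L\<^esub> \<iota> (\<pi> [^]\<^bsub>K\<^esub> n) \<or> x = u \<otimes>\<^bsub>L\<^esub> \<iota> ((inv\<^bsub>K\<^esub> \<pi>) [^]\<^bsub>K\<^esub> n))"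
    and split: "\<And>x. x \<in> carrier L \<Longrightarrow> \<exists>s\<in>S. \<exists>r\<in>V. x = \<iota> s \<oplus>\<^bsub>L\<^esub> r"
begin

text \<open>The group of integral powers of \<open>\<pi>\<close>, written with natural
  exponents.\<close>

definition pows :: "'k set" where
  "pows = {p. \<exists>n :: nat. p = \<pi> [^]\<^bsub>K\<^esub> n \<or> p = (inv\<^bsub>K\<^esub> \<pi>) [^]\<^bsub>K\<^esub> n}"

lemma V_carrier: "x \<in> V \<Longrightarrow> x \<in> carrier L"
  using subringE(1)[OF V] by blast

lemma S_carrier: "x \<in> S \<Longrightarrow> x \<in> carrier K"
  using subringE(1)[OF S] by blast

lemma pow_sub: "x \<in> S \<Longrightarrow> x [^]\<^bsub>K\<^esub> (n :: nat) \<in> S"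
  by (induction n) (auto intro: subringE(3,6)[OF S])

lemma \<pi>_unit: "\<pi> \<in> Units K" "\<pi> \<otimes>\<^bsub>K\<^esub> inv\<^bsub>K\<^esub> \<pi> = \<one>\<^bsub>K\<^esub>" "inv\<^bsub>K\<^esub> \<pi> \<in> carrier K" "\<pi> \<in> carrier K"
  using \<pi> S_carrier K.field_Units by auto

lemma pows_S: "p \<in> pows \<Longrightarrow> p \<in> S"
  using \<pi> by (auto simp: pows_def intro: pow_sub)

lemma pows_inverse:
  assumes "p \<in> pows"
  obtains p' where "p' \<in> pows" "p \<otimes>\<^bsub>K\<^esub> p' = \<one>\<^bsub>K\<^esub>"
proof -
  have *: "\<pi> [^]\<^bsub>K\<^esub> (n :: nat) \<otimes>\<^bsub>K\<^esub> (inv\<^bsub>K\<^esub> \<pi>) [^]\<^bsub>K\<^esub> n = \<one>\<^bsub>K\<^esub>" for n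
    using \<pi>_unit by (simp add: K.pow_mult_distrib[symmetric] K.m_comm)
  then show ?thesis using that assms \<pi>_unit K.m_comm K.nat_pow_closed unfolding pows_def
    by (smt (verit, best) mem_Collect_eq)
qed

lemma factor': "x \<in> carrier L \<Longrightarrow> x \<noteq> \<zero>\<^bsub>L\<^esub> \<Longrightarrow>
      \<exists>u\<in>V. \<exists>u'\<in>V. \<exists>p\<in>pows. u \<otimes>\<^bsub>L\<^esub> u' = \<one>\<^bsub>L\<^esub> \<and> x = u \<otimes>\<^bsub>L\<^esub> \<iota> p"
  using factor[of x] unfolding pows_def by blast

text \<open>The difference of two integral exponents is nonnegative in one of the two orders; the
  cases come from the signs of the exponents.\<close>

lemma pows_ratio:
  assumes "p \<in> pows" "q \<in> pows"
  shows "\<exists>n :: nat. p = \<pi> [^]\<^bsub>K\<^esub> n \<otimes>\<^bsub>K\<^esub> q \<or> q = \<pi> [^]\<^bsub>K\<^esub> n \<otimes>\<^bsub>K\<^esub> p"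
proof -
  have inv: "\<pi> [^]\<^bsub>K\<^esub> (n :: nat) \<otimes>\<^bsub>K\<^esub> (inv\<^bsub>K\<^esub> \<pi>) [^]\<^bsub>K\<^esub> n = \<one>\<^bsub>K\<^esub>" for n
    using \<pi>_unit by (simp add: K.pow_mult_distrib[symmetric] K.m_comm)
  have add: "\<pi> [^]\<^bsub>K\<^esub> (n + k) = \<pi> [^]\<^bsub>K\<^esub> n \<otimes>\<^bsub>K\<^esub> \<pi> [^]\<^bsub>K\<^esub> k"
    "(inv\<^bsub>K\<^esub> \<pi>) [^]\<^bsub>K\<^esub> (n + k) = (inv\<^bsub>K\<^esub> \<pi>) [^]\<^bsub>K\<^esub> n \<otimes>\<^bsub>K\<^esub> (inv\<^bsub>K\<^esub> \<pi>) [^]\<^bsub>K\<^esub> k" for n k :: nat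
    using \<pi>_unit by (simp_all add: K.nat_pow_mult)
  have c: "\<pi> [^]\<^bsub>K\<^esub> n \<in> carrier K" "(inv\<^bsub>K\<^esub> \<pi>) [^]\<^bsub>K\<^esub> n \<in> carrier K" for n :: nat
    using \<pi>_unit by auto
  have up: "\<pi> [^]\<^bsub>K\<^esub> n = \<pi> [^]\<^bsub>K\<^esub> (n - k) \<otimes>\<^bsub>K\<^esub> \<pi> [^]\<^bsub>K\<^esub> k" if "k \<le> n" for n k :: nat
    using add(1)[of "n - k" k] that by simp
  have down: "(inv\<^bsub>K\<^esub> \<pi>) [^]\<^bsub>K\<^esub> k = \<pi> [^]\<^bsub>K\<^esub> (n - k) \<otimes>\<^bsub>K\<^esub> (inv\<^bsub>K\<^esub> \<pi>) [^]\<^bsub>K\<^esub> n" if "k \<le> n" for n k :: nat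
    using add(2)[of "n - k" k] that inv[of "n - k"] c by (simp add: K.m_assoc[symmetric])
  have mixed: "\<pi> [^]\<^bsub>K\<^esub> n = \<pi> [^]\<^bsub>K\<^esub> (n + k) \<otimes>\<^bsub>K\<^esub> (inv\<^bsub>K\<^esub> \<pi>) [^]\<^bsub>K\<^esub> k" for n k :: nat
    using add(1)[of n k] inv[of k] c by (simp add: K.m_assoc)
  show ?thesis using assms up down mixed unfolding pows_def
    by (auto; metis nat_le_linear)
qed

lemma \<pi>_pow_V: "\<iota> (\<pi> [^]\<^bsub>K\<^esub> (n :: nat)) \<in> V"
  using \<pi>_unit by (induction n) (auto intro: subringE(3,6)[OF V] \<pi>_V)

text \<open>Up to units of \<open>V\<close> every nonzero element is a power of
  \<open>\<pi>\<close>, and \<open>\<pi>\<close> lies in \<open>V\<close>; so divisibility by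
  elements of \<open>V\<close> is total, as in a valuation ring.\<close>

lemma V_total:
  assumes "x \<in> carrier L" "y \<in> carrier L"
  shows "\<exists>c\<in>V. x = c \<otimes>\<^bsub>L\<^esub> y \<or> y = c \<otimes>\<^bsub>L\<^esub> x"
proof (cases "x = \<zero>\<^bsub>L\<^esub> \<or> y = \<zero>\<^bsub>L\<^esub>")
  case True
  then show ?thesis using assms subringE(2)[OF V] by (intro bexI[of _ "\<zero>\<^bsub>L\<^esub>"]) auto
next
  case False
  obtain u u' p where u: "u \<in> V" "u' \<in> V" "p \<in> pows" "u \<otimes>\<^bsub>L\<^esub> u' = \<one>\<^bsub>L\<^esub>" "x = u \<otimes>\<^bsub>L\<^esub> \<iota> p"
    using factor'[OF assms(1)] False by blast
  obtain w w' q where w: "w \<in> V" "w' \<in> V" "q \<in> pows" "w \<otimes>\<^bsub>L\<^esub> w' = \<one>\<^bsub>L\<^esub>" "y = w \<otimes>\<^bsub>L\<^esub> \<iota> q"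
    using factor'[OF assms(2)] False by blast
  have *: "\<exists>c\<in>V. x = c \<otimes>\<^bsub>L\<^esub> y"
    if "u \<in> V" "p \<in> pows" "x = u \<otimes>\<^bsub>L\<^esub> \<iota> p" "w \<in> V" "w' \<in> V" "q \<in> pows" "w \<otimes>\<^bsub>L\<^esub> w' = \<one>\<^bsub>L\<^esub>" "y = w \<otimes>\<^bsub>L\<^esub> \<iota> q"
      "p = \<pi> [^]\<^bsub>K\<^esub> n \<otimes>\<^bsub>K\<^esub> q" for u p x w w' q y and n :: nat
  proof (rule bexI)
    have c: "u \<in> carrier L" "w \<in> carrier L" "w' \<in> carrier L" "q \<in> carrier K" "\<pi> [^]\<^bsub>K\<^esub> n \<in> carrier K"
      using that V_carrier S_carrier pows_S \<pi>_unit by auto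
    have "u \<otimes>\<^bsub>L\<^esub> w' \<otimes>\<^bsub>L\<^esub> \<iota> (\<pi> [^]\<^bsub>K\<^esub> n) \<otimes>\<^bsub>L\<^esub> (w \<otimes>\<^bsub>L\<^esub> \<iota> q)
      = (w \<otimes>\<^bsub>L\<^esub> w') \<otimes>\<^bsub>L\<^esub> (u \<otimes>\<^bsub>L\<^esub> (\<iota> (\<pi> [^]\<^bsub>K\<^esub> n) \<otimes>\<^bsub>L\<^esub> \<iota> q))"
      using c by (simp add: L.m_ac)
    also have "\<dots> = x" using that c by simp
    finally show "x = u \<otimes>\<^bsub>L\<^esub> w' \<otimes>\<^bsub>L\<^esub> \<iota> (\<pi> [^]\<^bsub>K\<^esub> n) \<otimes>\<^bsub>L\<^esub> y" using that by simp
    show "u \<otimes>\<^bsub>L\<^esub> w' \<otimes>\<^bsub>L\<^esub> \<iota> (\<pi> [^]\<^bsub>K\<^esub> n) \<in> V"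
      using that \<pi>_pow_V by (intro subringE(6)[OF V])
  qed
  from pows_ratio[OF u(3) w(3)] obtain n :: nat
    where "p = \<pi> [^]\<^bsub>K\<^esub> n \<otimes>\<^bsub>K\<^esub> q \<or> q = \<pi> [^]\<^bsub>K\<^esub> n \<otimes>\<^bsub>K\<^esub> p" by blast
  then show ?thesis using *[OF u(1,3,5) w] *[OF w(1,3,5) u] by blast
qed

text \<open>The entry \<open>x p\<close> plays the part of one of smallest valuation; it is found
  from total divisibility by adding one index at a time.\<close>

lemma V_pivot:
  assumes "finite T" "T \<noteq> {}" "\<And>i. i \<in> T \<Longrightarrow> x i \<in> carrier L"
  shows "\<exists>p\<in>T. \<forall>i\<in>T. \<exists>c\<in>V. x i = c \<otimes>\<^bsub>L\<^esub> x p"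
  using assms
proof (induction T rule: finite_ne_induct)
  case (singleton i)
  then show ?case using subringE(3)[OF V] by (auto intro!: bexI[of _ "\<one>\<^bsub>L\<^esub>"])
next
  case (insert i T)
  then obtain p where p: "p \<in> T" "\<forall>i\<in>T. \<exists>c\<in>V. x i = c \<otimes>\<^bsub>L\<^esub> x p" by auto
  have xc: "x i \<in> carrier L" "x p \<in> carrier L" using insert.prems p by auto
  obtain c where c: "c \<in> V" "x i = c \<otimes>\<^bsub>L\<^esub> x p \<or> x p = c \<otimes>\<^bsub>L\<^esub> x i" using V_total[OF xc] by blast
  show ?case
  proof (cases "x i = c \<otimes>\<^bsub>L\<^esub> x p")
    case True
    then have "\<exists>c\<in>V. x i = c \<otimes>\<^bsub>L\<^esub> x p" using c(1) ..
    then show ?thesis using p by (intro bexI[of _ p]) simp_all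
  next
    case False
    then have xp: "x p = c \<otimes>\<^bsub>L\<^esub> x i" using c by simp
    have "\<exists>c\<in>V. x j = c \<otimes>\<^bsub>L\<^esub> x i" if "j \<in> T" for j
    proof -
      from bspec[OF p(2) that] obtain e where e: "e \<in> V" "x j = e \<otimes>\<^bsub>L\<^esub> x p" ..
      have "x j = e \<otimes>\<^bsub>L\<^esub> (c \<otimes>\<^bsub>L\<^esub> x i)" unfolding e(2) by (subst xp) (rule refl)
      also have "\<dots> = (e \<otimes>\<^bsub>L\<^esub> c) \<otimes>\<^bsub>L\<^esub> x i"
        by (rule L.m_assoc[symmetric]) (use V_carrier e c xc in auto)
      finally have "x j = (e \<otimes>\<^bsub>L\<^esub> c) \<otimes>\<^bsub>L\<^esub> x i" .
      moreover have "e \<otimes>\<^bsub>L\<^esub> c \<in> V" using e c subringE(6)[OF V] by simp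
      ultimately show ?thesis ..
    qed
    moreover have "\<exists>c\<in>V. x i = c \<otimes>\<^bsub>L\<^esub> x i" using subringE(3)[OF V] xc by (intro bexI[of _ "\<one>\<^bsub>L\<^esub>"]) auto
    ultimately show ?thesis by (intro bexI[of _ i]) auto
  qed
qed

end

text \<open>An induction principle for matrices: \<open>Q\<close> is inherited backwards along row
  operations over \<open>V\<close> and column operations over \<open>S\<close>. It encodes that an
  invertible matrix over \<open>L\<close> is a product of one over \<open>V\<close> and one over
  \<open>S\<close>, without naming the factors. Singular matrices satisfy \<open>Q\<close> by
  assumption, so no operation has to carry invertibility along.\<close>

locale reduction = local_field K L \<iota> V S \<pi>
  for K :: "('k, 'm) ring_scheme" (structure) and L :: "('l, 'n) ring_scheme" (structure)
    and \<iota> V S \<pi> +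
  fixes N :: nat and Q :: "(nat \<Rightarrow> nat \<Rightarrow> 'l) \<Rightarrow> bool"
  assumes Q_cong: "\<And>A A'. \<lbrakk>matc L N A; matc L N A'; eqm N A A'; Q A'\<rbrakk> \<Longrightarrow> Q A"
    and Q_singular: "\<And>A. \<nexists>B. inverse_matrices L N A B \<Longrightarrow> Q A"
    and Q_idm: "Q (idm L)"
    and Q_row: "\<And>A i j r. \<lbrakk>matc L N A; r \<in> V; i \<le> N; j \<le> N; i \<noteq> j; Q (mm L N (elemm L i j r) A)\<rbrakk> \<Longrightarrow> Q A"
    and Q_row_unit: "\<And>A i u u'. \<lbrakk>matc L N A; u \<in> V; u' \<in> V; u \<otimes>\<^bsub>L\<^esub> u' = \<one>\<^bsub>L\<^esub>; i \<le> N;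
        Q (mm L N (L.unit_diag N i u) A)\<rbrakk> \<Longrightarrow> Q A"
    and Q_col: "\<And>A i j s. \<lbrakk>matc L N A; s \<in> S; i \<le> N; j \<le> N; i \<noteq> j; Q (mm L N A (elemm L i j (\<iota> s)))\<rbrakk> \<Longrightarrow> Q A"
    and Q_col_unit: "\<And>A i p. \<lbrakk>matc L N A; p \<in> pows; i \<le> N; Q (mm L N A (L.unit_diag N i (\<iota> p)))\<rbrakk> \<Longrightarrow> Q A"
begin

lemma add_cancel_outer:
  assumes "x \<in> carrier L" "y \<in> carrier L"
  shows "x \<oplus>\<^bsub>L\<^esub> y \<oplus>\<^bsub>L\<^esub> \<ominus>\<^bsub>L\<^esub> x = y"
proof -
  have "x \<oplus>\<^bsub>L\<^esub> y \<oplus>\<^bsub>L\<^esub> \<ominus>\<^bsub>L\<^esub> x = y \<oplus>\<^bsub>L\<^esub> (x \<oplus>\<^bsub>L\<^esub> \<ominus>\<^bsub>L\<^esub> x)" using assms by (simp add: L.a_ac)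
  then show ?thesis using assms by (simp add: L.r_neg)
qed

text \<open>Row \<open>k\<close> stays fixed throughout, so the operations on the rows in
  \<open>T\<close> do not interfere.\<close>

lemma Q_rows:
  assumes "finite T" "T \<subseteq> {..N} - {k}" "k \<le> N" "matc L N A" "\<And>i. i \<in> T \<Longrightarrow> c i \<in> V"
    and "Q (\<lambda>a b. if a \<in> T then A a b \<oplus>\<^bsub>L\<^esub> c a \<otimes>\<^bsub>L\<^esub> A k b else A a b)"
  shows "Q A"
  using assms
proof (induction T rule: finite_induct)
  case empty
  then show ?case by simp
next
  case (insert i T)
  let ?A = "\<lambda>T a b. if a \<in> T then A a b \<oplus>\<^bsub>L\<^esub> c a \<otimes>\<^bsub>L\<^esub> A k b else A a b"
  have c: "c a \<in> carrier L" if "a \<in> insert i T" for a using insert.prems(4)[OF that] V_carrier by blast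
  have A: "A a b \<in> carrier L" if "a \<le> N" "b \<le> N" for a b using insert.prems(3) that by (auto simp: matc_def)
  have m: "matc L N (?A T)" "matc L N (?A (insert i T))"
    using A c insert.prems(1,2) by (auto simp: matc_def)
  have ik: "i \<le> N" "i \<noteq> k" "k \<notin> T" using insert.prems(1) by auto
  have "Q (mm L N (elemm L i k (c i)) (?A T))"
  proof (rule Q_cong[OF _ m(2) _ insert.prems(5)])
    show "matc L N (mm L N (elemm L i k (c i)) (?A T))"
      using c by (intro L.mm_closed L.elemm_closed m) auto
    show "eqm N (mm L N (elemm L i k (c i)) (?A T)) (?A (insert i T))"
      unfolding eqm_def using c ik insert.hyps insert.prems(2)
      by (auto simp: L.mm_elemm_left[OF m(1)])
  qed
  then have "Q (?A T)" using insert.prems(2,4) ik m by (intro Q_row[OF m(1), of "c i" i k]) auto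
  then show ?case using insert by auto
qed

text \<open>A finished column \<open>i\<close> is a unit vector, so adding a multiple of it to
  column \<open>k\<close> changes only the entry in row \<open>i\<close>.\<close>

lemma Q_cols:
  assumes "finite T" "T \<subseteq> {..<k}" "k \<le> N" "matc L N A" "\<And>i. i \<in> T \<Longrightarrow> s i \<in> S"
    and "\<And>a b. \<lbrakk>a \<le> N; b < k\<rbrakk> \<Longrightarrow> A a b = idm L a b"
    and "Q (\<lambda>a b. if b = k \<and> a \<in> T then A a k \<oplus>\<^bsub>L\<^esub> \<iota> (s a) else A a b)"
  shows "Q A"
  using assms
proof (induction T rule: finite_induct)
  case empty
  then show ?case by simp
next
  case (insert i T)
  let ?A = "\<lambda>T a b. if b = k \<and> a \<in> T then A a k \<oplus>\<^bsub>L\<^esub> \<iota> (s a) else A a b"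
  have c: "\<iota> (s a) \<in> carrier L" if "a \<in> insert i T" for a using insert.prems(4)[OF that] S_carrier by auto
  have A: "A a b \<in> carrier L" if "a \<le> N" "b \<le> N" for a b using insert.prems(3) that by (auto simp: matc_def)
  have m: "matc L N (?A T)" "matc L N (?A (insert i T))"
    using A c insert.prems(1,2) by (auto simp: matc_def)
  have ik: "i \<le> N" "i \<noteq> k" "i < k" using insert.prems(1,2) by auto
  have "Q (mm L N (?A T) (elemm L i k (\<iota> (s i))))"
  proof (rule Q_cong[OF _ m(2) _ insert.prems(6)])
    show "matc L N (mm L N (?A T) (elemm L i k (\<iota> (s i))))"
      using c by (intro L.mm_closed L.elemm_closed m) auto
    show "eqm N (mm L N (?A T) (elemm L i k (\<iota> (s i)))) (?A (insert i T))"
      unfolding eqm_def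
    proof (intro allI impI)
      fix a b assume ab: "a \<le> N" "b \<le> N"
      have "A a i = (if a = i then \<one>\<^bsub>L\<^esub> else \<zero>\<^bsub>L\<^esub>)" using insert.prems(5)[of a i] ab ik by (simp add: idm_def)
      then show "mm L N (?A T) (elemm L i k (\<iota> (s i))) a b = ?A (insert i T) a b"
        using c ik insert.hyps insert.prems(2) ab A
        by (auto simp: L.mm_elemm_right[OF m(1)])
    qed
  qed
  then have "Q (?A T)" using insert.prems(2,4) ik m by (intro Q_col[OF m(1), of "s i" i k]) auto
  then show ?case using insert by auto
qed

text \<open>The exchange of two rows with a sign is a product of three elementary matrices with
  entries 1 and -1.\<close>

lemma Q_swap:
  assumes "matc L N A" "k \<le> N" "p \<le> N" "k \<noteq> p"
    and "Q (\<lambda>a b. if a = k then A p b else if a = p then \<ominus>\<^bsub>L\<^esub> A k b else A a b)"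
  shows "Q A"
proof -
  have A: "A a b \<in> carrier L" if "a \<le> N" "b \<le> N" for a b using assms that by (auto simp: matc_def)
  have one: "\<one>\<^bsub>L\<^esub> \<in> V" "\<ominus>\<^bsub>L\<^esub> \<one>\<^bsub>L\<^esub> \<in> V" using subringE(3,5)[OF V] by auto
  let ?A1 = "mm L N (elemm L k p \<one>\<^bsub>L\<^esub>) A"
  let ?A2 = "mm L N (elemm L p k (\<ominus>\<^bsub>L\<^esub> \<one>\<^bsub>L\<^esub>)) ?A1"
  let ?A3 = "mm L N (elemm L k p \<one>\<^bsub>L\<^esub>) ?A2"
  have m1: "matc L N ?A1" by (intro L.mm_closed L.elemm_closed assms) auto
  have m2: "matc L N ?A2" by (intro L.mm_closed L.elemm_closed m1) auto
  have m3: "matc L N ?A3" by (intro L.mm_closed L.elemm_closed m2) auto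
  have "Q ?A3"
  proof (rule Q_cong[OF m3 _ _ assms(5)])
    show "matc L N (\<lambda>a b. if a = k then A p b else if a = p then \<ominus>\<^bsub>L\<^esub> A k b else A a b)"
      using A assms by (auto simp: matc_def)
    show "eqm N ?A3 (\<lambda>a b. if a = k then A p b else if a = p then \<ominus>\<^bsub>L\<^esub> A k b else A a b)"
      unfolding eqm_def
    proof (intro allI impI)
      fix a b assume ab: "a \<le> N" "b \<le> N"
      have x: "A k b \<in> carrier L" "A p b \<in> carrier L" using A ab assms by auto
      have "A p b \<oplus>\<^bsub>L\<^esub> \<ominus>\<^bsub>L\<^esub> \<one>\<^bsub>L\<^esub> \<otimes>\<^bsub>L\<^esub> (A k b \<oplus>\<^bsub>L\<^esub> A p b) = \<ominus>\<^bsub>L\<^esub> A k b \<oplus>\<^bsub>L\<^esub> (A p b \<oplus>\<^bsub>L\<^esub> \<ominus>\<^bsub>L\<^esub> A p b)"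
        using x by (simp add: L.l_minus L.minus_add L.a_lcomm)
      then have e1: "A p b \<oplus>\<^bsub>L\<^esub> \<ominus>\<^bsub>L\<^esub> \<one>\<^bsub>L\<^esub> \<otimes>\<^bsub>L\<^esub> (A k b \<oplus>\<^bsub>L\<^esub> A p b) = \<ominus>\<^bsub>L\<^esub> A k b"
        using x by (simp add: L.r_neg)
      have e2: "A k b \<oplus>\<^bsub>L\<^esub> A p b \<oplus>\<^bsub>L\<^esub> \<ominus>\<^bsub>L\<^esub> A k b = A p b"
        by (rule add_cancel_outer[OF x])
      show "?A3 a b = (if a = k then A p b else if a = p then \<ominus>\<^bsub>L\<^esub> A k b else A a b)"
        using assms ab x e1 e2
        by (auto simp: L.mm_elemm_left[OF m2] L.mm_elemm_left[OF m1] L.mm_elemm_left[OF assms(1)])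
    qed
  qed
  then have "Q ?A2" using one assms by (intro Q_row[OF m2, of "\<one>\<^bsub>L\<^esub>" k p]) auto
  then have "Q ?A1" using one assms by (intro Q_row[OF m1, of "\<ominus>\<^bsub>L\<^esub> \<one>\<^bsub>L\<^esub>" p k]) auto
  then show "Q A" using one assms by (intro Q_row[OF assms(1), of "\<one>\<^bsub>L\<^esub>" k p]) auto
qed

text \<open>The pivot is an entry that divides the others at or below row \<open>k\<close>. After it
  is normalised to 1, column operations over \<open>S\<close> bring the entries above it into
  \<open>V\<close>, and row operations over \<open>V\<close> then clear the whole column.\<close>

lemma Q_column:
  assumes k: "k \<le> N" and A: "matc L N A"
    and std: "\<And>a b. \<lbrakk>a \<le> N; b < k\<rbrakk> \<Longrightarrow> A a b = idm L a b"
    and nz: "\<exists>i. k \<le> i \<and> i \<le> N \<and> A i k \<noteq> \<zero>\<^bsub>L\<^esub>"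
    and Q: "\<And>A'. \<lbrakk>matc L N A'; \<And>a b. \<lbrakk>a \<le> N; b \<le> k\<rbrakk> \<Longrightarrow> A' a b = idm L a b\<rbrakk> \<Longrightarrow> Q A'"
  shows "Q A"
proof -
  have pivot: "Q A" if A: "matc L N A"
    and std: "\<And>a b. \<lbrakk>a \<le> N; b < k\<rbrakk> \<Longrightarrow> A a b = idm L a b"
    and nz: "A k k \<noteq> \<zero>\<^bsub>L\<^esub>" and dv: "\<And>i. \<lbrakk>k \<le> i; i \<le> N\<rbrakk> \<Longrightarrow> \<exists>c\<in>V. A i k = c \<otimes>\<^bsub>L\<^esub> A k k" for A
  proof -
    have Ac: "A a b \<in> carrier L" if "a \<le> N" "b \<le> N" for a b using A that by (auto simp: matc_def)
    obtain u u' p where u: "u \<in> V" "u' \<in> V" "p \<in> pows" "u \<otimes>\<^bsub>L\<^esub> u' = \<one>\<^bsub>L\<^esub>" "A k k = u \<otimes>\<^bsub>L\<^esub> \<iota> p"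
      using factor'[OF Ac[OF k k] nz] by blast
    obtain p' where p': "p' \<in> pows" "p \<otimes>\<^bsub>K\<^esub> p' = \<one>\<^bsub>K\<^esub>" using pows_inverse[OF u(3)] .
    have uc: "u \<in> carrier L" "u' \<in> carrier L" "p \<in> carrier K" "p' \<in> carrier K"
      using u p' V_carrier pows_S S_carrier by auto
    then have pc: "\<iota> p \<in> carrier L" "\<iota> p' \<in> carrier L" "\<iota> p \<otimes>\<^bsub>L\<^esub> \<iota> p' = \<one>\<^bsub>L\<^esub>"
      using p'(2) \<iota>.hom_mult[of p p'] by auto
    \<comment> \<open>The pivot is a unit times a power of \<open>\<pi>\<close>: the unit is removed
      by a row operation over \<open>V\<close>, the power by a column operation over
      \<open>S\<close>.\<close>
    let ?A1 = "mm L N (L.unit_diag N k u') A"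
    let ?A2 = "mm L N ?A1 (L.unit_diag N k (\<iota> p'))"
    have m1: "matc L N ?A1" unfolding L.unit_diag_def by (intro L.mm_closed L.diagm_closed A) (use uc in auto)
    have m2: "matc L N ?A2" unfolding L.unit_diag_def[of N k "\<iota> p'"] by (intro L.mm_closed L.diagm_closed m1) (use pc in auto)
    have e1: "?A1 a b = (if a = k then u' \<otimes>\<^bsub>L\<^esub> A a b else A a b)" if "a \<le> N" "b \<le> N" for a b
      unfolding L.unit_diag_def using that uc Ac by (subst L.mm_diagm_left[OF A]) auto
    have e2: "?A2 a b = (if b = k then ?A1 a b \<otimes>\<^bsub>L\<^esub> \<iota> p' else ?A1 a b)" if "a \<le> N" "b \<le> N" for a b
      unfolding L.unit_diag_def[of N k "\<iota> p'"] using that pc m1 by (subst L.mm_diagm_right[OF m1]) (auto simp: matc_def)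
    have kk: "?A2 k k = \<one>\<^bsub>L\<^esub>"
    proof -
      have "?A2 k k = u' \<otimes>\<^bsub>L\<^esub> (u \<otimes>\<^bsub>L\<^esub> \<iota> p) \<otimes>\<^bsub>L\<^esub> \<iota> p'" using k u by (simp add: e1 e2)
      also have "\<dots> = (u \<otimes>\<^bsub>L\<^esub> u') \<otimes>\<^bsub>L\<^esub> (\<iota> p \<otimes>\<^bsub>L\<^esub> \<iota> p')" using uc pc(1,2) by (simp add: L.m_ac)
      finally show ?thesis using u pc by simp
    qed
    \<comment> \<open>Below the pivot, the multiple \<open>c\<close> of the old pivot becomes
      \<open>c\<close> times the unit \<open>u\<close>.\<close>
    have below: "?A2 i k \<in> V" if i: "k < i" "i \<le> N" for i
    proof -
      obtain c where c: "c \<in> V" "A i k = c \<otimes>\<^bsub>L\<^esub> A k k" using dv[of i] i by auto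
      have "?A2 i k = c \<otimes>\<^bsub>L\<^esub> (u \<otimes>\<^bsub>L\<^esub> \<iota> p) \<otimes>\<^bsub>L\<^esub> \<iota> p'" using k i c u by (simp add: e1 e2)
      also have "\<dots> = c \<otimes>\<^bsub>L\<^esub> u \<otimes>\<^bsub>L\<^esub> (\<iota> p \<otimes>\<^bsub>L\<^esub> \<iota> p')" using uc pc(1,2) V_carrier[OF c(1)] by (simp add: L.m_ac)
      also have "\<dots> = c \<otimes>\<^bsub>L\<^esub> u" using pc uc V_carrier[OF c(1)] by simp
      finally show ?thesis using c u subringE(6)[OF V] by simp
    qed
    \<comment> \<open>Row \<open>k\<close> has zeros in the finished columns, so rescaling it leaves
      them unchanged.\<close>
    have std2: "?A2 a b = idm L a b" if "a \<le> N" "b < k" for a b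
      using that k std[OF that] std[OF k that(2)] uc by (auto simp: e1 e2 idm_def)
    \<comment> \<open>Above the pivot the entries may lie outside \<open>V\<close>. Their part in
      \<open>S\<close> is removed with the help of the finished columns, and a remainder in
      \<open>V\<close> is left.\<close>
    have "\<forall>i\<in>{..<k}. \<exists>s\<in>S. \<exists>r\<in>V. ?A2 i k = \<iota> s \<oplus>\<^bsub>L\<^esub> r"
      using split m2 k by (auto simp: matc_def)
    then obtain s where s: "\<And>i. i < k \<Longrightarrow> s i \<in> S" "\<And>i. i < k \<Longrightarrow> \<exists>r\<in>V. ?A2 i k = \<iota> (s i) \<oplus>\<^bsub>L\<^esub> r"
      by (metis lessThan_iff)
    define A3 where "A3 = (\<lambda>a b. if b = k \<and> a \<in> {..<k} then ?A2 a k \<oplus>\<^bsub>L\<^esub> \<iota> (\<ominus>\<^bsub>K\<^esub> s a) else ?A2 a b)"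
    have sc: "s i \<in> carrier K" if "i < k" for i using s(1)[OF that] S_carrier by blast
    have m3: "matc L N A3" using m2 sc by (auto simp: matc_def A3_def)
    have above: "A3 i k \<in> V" if i: "i < k" for i
    proof -
      obtain r where r: "r \<in> V" "?A2 i k = \<iota> (s i) \<oplus>\<^bsub>L\<^esub> r" using s(2)[OF i] by blast
      have "A3 i k = \<iota> (s i) \<oplus>\<^bsub>L\<^esub> r \<oplus>\<^bsub>L\<^esub> \<ominus>\<^bsub>L\<^esub> \<iota> (s i)" using r i sc by (simp add: A3_def)
      also have "\<dots> = r" using V_carrier[OF r(1)] \<iota>.hom_closed[OF sc[OF i]]
        add_cancel_outer by blast
      finally show ?thesis using r by simp
    qed
    have colk: "A3 i k \<in> V" if "i \<le> N" "i \<noteq> k" for i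
    proof (cases "i < k")
      case False
      then show ?thesis using below[of i] that by (simp add: A3_def)
    qed (rule above)
    \<comment> \<open>Outside the pivot, column \<open>k\<close> now has entries in \<open>V\<close>
      and is cleared with the pivot row, whose zeros protect the finished columns.\<close>
    let ?A4 = "\<lambda>a b. if a \<in> {..N} - {k} then A3 a b \<oplus>\<^bsub>L\<^esub> (\<ominus>\<^bsub>L\<^esub> A3 a k) \<otimes>\<^bsub>L\<^esub> A3 k b else A3 a b"
    have m3c: "A3 a b \<in> carrier L" if "a \<le> N" "b \<le> N" for a b using m3 that unfolding matc_def by blast
    have m4: "matc L N ?A4" unfolding matc_def using m3c k by auto
    have kk3: "A3 k k = \<one>\<^bsub>L\<^esub>" using kk by (simp add: A3_def)
    have std3: "A3 a b = idm L a b" if "a \<le> N" "b < k" for a b using std2[OF that] that by (simp add: A3_def)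
    have "Q ?A4"
    proof (rule Q[OF m4])
      fix a b assume ab: "a \<le> N" "b \<le> k"
      show "?A4 a b = idm L a b"
      proof (cases "b = k")
        case True
        then show ?thesis using ab kk3 m3c[of a k] k by (auto simp: idm_def L.r_neg)
      next
        case False
        then have b: "b < k" using ab by simp
        have "A3 k b = \<zero>\<^bsub>L\<^esub>" using std3[OF k b] b by (simp add: idm_def)
        moreover have "A3 a b = idm L a b" by (rule std3[OF ab(1) b])
        moreover have "idm L a b \<in> carrier L" by (simp add: idm_def)
        ultimately show ?thesis using m3c[of a k] ab k by auto
      qed
    qed
    then have "Q A3"
      using colk k m3 subringE(5)[OF V] by (intro Q_rows[of "{..N} - {k}" k A3 "\<lambda>a. \<ominus>\<^bsub>L\<^esub> A3 a k"]) auto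
    then have "Q ?A2"
      unfolding A3_def using s(1) k m2 std2 subringE(5)[OF S] by (intro Q_cols[of "{..<k}" k ?A2 "\<lambda>a. \<ominus>\<^bsub>K\<^esub> s a"]) auto
    then have "Q ?A1" by (rule Q_col_unit[OF m1 p'(1) k])
    moreover have "u' \<otimes>\<^bsub>L\<^esub> u = \<one>\<^bsub>L\<^esub>" using u uc L.m_comm by simp
    ultimately show "Q A" using Q_row_unit[OF A u(2,1) _ k] by blast
  qed
  have Ac: "A a b \<in> carrier L" if "a \<le> N" "b \<le> N" for a b using A that by (auto simp: matc_def)
  have "\<exists>p\<in>{k..N}. \<forall>i\<in>{k..N}. \<exists>c\<in>V. A i k = c \<otimes>\<^bsub>L\<^esub> A p k"
    using Ac k by (intro V_pivot) auto
  then obtain p where p: "k \<le> p" "p \<le> N" "\<And>i. \<lbrakk>k \<le> i; i \<le> N\<rbrakk> \<Longrightarrow> \<exists>c\<in>V. A i k = c \<otimes>\<^bsub>L\<^esub> A p k" by auto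
  have pnz: "A p k \<noteq> \<zero>\<^bsub>L\<^esub>"
  proof
    assume z: "A p k = \<zero>\<^bsub>L\<^esub>"
    obtain i where i: "k \<le> i" "i \<le> N" "A i k \<noteq> \<zero>\<^bsub>L\<^esub>" using nz by blast
    then obtain c where "c \<in> V" "A i k = c \<otimes>\<^bsub>L\<^esub> A p k" using p(3) by blast
    then show False using z i V_carrier by simp
  qed
  show "Q A"
  proof (cases "p = k")
    case True
    then show ?thesis using pivot[OF A std] pnz p(3) by auto
  next
    case False
    \<comment> \<open>The sign of the exchanged row is harmless, because \<open>V\<close> is closed
      under negation.\<close>
    let ?B = "\<lambda>a b. if a = k then A p b else if a = p then \<ominus>\<^bsub>L\<^esub> A k b else A a b"
    have "Q ?B"
    proof (rule pivot)
      show "matc L N ?B" using Ac k p by (auto simp: matc_def)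
      show "?B a b = idm L a b" if "a \<le> N" "b < k" for a b
        using std[OF that] std[OF k that(2)] std[OF p(2) that(2)] that p False by (auto simp: idm_def)
      show "?B k k \<noteq> \<zero>\<^bsub>L\<^esub>" using pnz by simp
      fix i assume i: "k \<le> i" "i \<le> N"
      show "\<exists>c\<in>V. ?B i k = c \<otimes>\<^bsub>L\<^esub> ?B k k"
      proof -
        consider "i = k" | "i = p" "i \<noteq> k" | "i \<noteq> k" "i \<noteq> p" by blast
        then show ?thesis
        proof cases
          case 1
          then show ?thesis using Ac k p subringE(3)[OF V] by (intro bexI[of _ "\<one>\<^bsub>L\<^esub>"]) auto
        next
          case 2
          obtain c where "c \<in> V" "A k k = c \<otimes>\<^bsub>L\<^esub> A p k" using p(3)[of k] k by auto
          then show ?thesis using 2 Ac k p subringE(5)[OF V] V_carrier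
            by (intro bexI[of _ "\<ominus>\<^bsub>L\<^esub> c"]) (auto simp: L.l_minus)
        next
          case 3
          then show ?thesis using p(3)[OF i] by simp
        qed
      qed
    qed
    then show ?thesis using Q_swap[OF A k p(2)] False by blast
  qed
qed

text \<open>Induction on the number of unfinished columns. Each matrix reached is tested for
  invertibility anew, and singular ones are settled by \<open>Q_singular\<close>.\<close>

lemma Q_all:
  assumes "matc L N A"
  shows "Q A"
proof -
  have "Q A" if "k \<le> Suc N" "matc L N A" "\<And>a b. \<lbrakk>a \<le> N; b < k\<rbrakk> \<Longrightarrow> A a b = idm L a b" for k A
    using that
  proof (induction "Suc N - k" arbitrary: k A)
    case 0
    then have "eqm N A (idm L)" by (auto simp: eqm_def)
    then show ?case using Q_cong[OF 0(3) L.idm_closed _ Q_idm] by blast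
  next
    case (Suc n)
    then have k: "k \<le> N" by simp
    show ?case
    proof (cases "\<exists>B. inverse_matrices L N A B")
      case False
      then show ?thesis by (rule Q_singular)
    next
      case True
      then obtain B where B: "matc L N B" "eqm N (mm L N B A) (idm L)" by (auto simp: inverse_matrices_iff)
      have Bc: "B a b \<in> carrier L" if "a \<le> N" "b \<le> N" for a b using B that by (auto simp: matc_def)
      have Ac: "A a b \<in> carrier L" if "a \<le> N" "b \<le> N" for a b using Suc.prems(2) that by (auto simp: matc_def)
      \<comment> \<open>Suppose column \<open>k\<close> vanished from row \<open>k\<close> on. The
        finished columns are unit vectors, so row \<open>k\<close> of the left inverse
        \<open>B\<close> has zeros at the finished indices, and the entry of \<open>B A\<close> at
        \<open>(k, k)\<close> would be 0 instead of 1.\<close>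
      have nz: "\<exists>i. k \<le> i \<and> i \<le> N \<and> A i k \<noteq> \<zero>\<^bsub>L\<^esub>"
      proof (rule ccontr)
        assume *: "\<not> ?thesis"
        have B0: "B k i = \<zero>\<^bsub>L\<^esub>" if i: "i < k" for i
        proof -
          have "mm L N B A k i = (\<Oplus>\<^bsub>L\<^esub>l\<in>{..N}. if i = l then B k l else \<zero>\<^bsub>L\<^esub>)"
            unfolding mm_def using i k Bc Suc.prems(3) by (intro L.finsum_cong') (auto simp: idm_def)
          also have "\<dots> = B k i" using i k Bc by (intro L.finsum_singleton) auto
          finally show ?thesis using B(2) i k by (simp add: eqm_def idm_def)
        qed
        have "mm L N B A k k = \<zero>\<^bsub>L\<^esub>"
          unfolding mm_def
        proof (rule L.add.finprod_one_eqI)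
          fix i assume "i \<in> {..N}"
          then show "B k i \<otimes>\<^bsub>L\<^esub> A i k = \<zero>\<^bsub>L\<^esub>"
            using * B0[of i] Bc[OF k, of i] Ac[of i k] k by (cases "i < k") auto
        qed
        then show False using B(2) k one_not_zero_L by (simp add: eqm_def idm_def)
      qed
      show ?thesis
      proof (rule Q_column[OF k Suc.prems(2,3) nz])
        fix A' assume A': "matc L N A'" "\<And>a b. \<lbrakk>a \<le> N; b \<le> k\<rbrakk> \<Longrightarrow> A' a b = idm L a b"
        show "Q A'" by (rule Suc.hyps(1)[of "Suc k"]) (use Suc.hyps(2) k A' in auto)
      qed
    qed
  qed
  from this[of 0 A] assms show ?thesis by simp
qed

end

section \<open>Descent of models along the elementary steps\<close>

context local_field
begin

definition Vunit :: "'l \<Rightarrow> bool" where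
  "Vunit u \<longleftrightarrow> u \<in> V \<and> (\<exists>u'\<in>V. u \<otimes>\<^bsub>L\<^esub> u' = \<one>\<^bsub>L\<^esub>)"

definition integral :: "nat \<Rightarrow> 'l poly_map \<Rightarrow> bool" where
  "integral N \<Psi> \<longleftrightarrow> (\<forall>i\<le>N. \<forall>m. \<Psi> i m \<in> V)"

definition S_integral :: "nat \<Rightarrow> 'k poly_map \<Rightarrow> bool" where
  "S_integral N \<Psi> \<longleftrightarrow> (\<forall>i\<le>N. \<forall>m. \<Psi> i m \<in> S)"

text \<open>Equality up to an integral power of \<open>\<pi>\<close>, cleared of
  denominators.\<close>

definition pi_equiv :: "'k \<Rightarrow> 'k \<Rightarrow> bool" where
  "pi_equiv x y \<longleftrightarrow> (\<exists>(a :: nat) (b :: nat). \<pi> [^]\<^bsub>K\<^esub> a \<otimes>\<^bsub>K\<^esub> x = \<pi> [^]\<^bsub>K\<^esub> b \<otimes>\<^bsub>K\<^esub> y)"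

lemma Vunit_carrier: "Vunit u \<Longrightarrow> u \<in> carrier L"
  by (auto simp: Vunit_def V_carrier)

lemma Vunit_one: "Vunit \<one>\<^bsub>L\<^esub>"
  using subringE(3)[OF V] by (auto simp: Vunit_def intro!: bexI[of _ "\<one>\<^bsub>L\<^esub>"])

lemma Vunit_mult: "Vunit u \<Longrightarrow> Vunit w \<Longrightarrow> Vunit (u \<otimes>\<^bsub>L\<^esub> w)"
proof -
  assume "Vunit u" "Vunit w"
  then obtain u' w' where *: "u \<in> V" "w \<in> V" "u' \<in> V" "w' \<in> V" "u \<otimes>\<^bsub>L\<^esub> u' = \<one>\<^bsub>L\<^esub>" "w \<otimes>\<^bsub>L\<^esub> w' = \<one>\<^bsub>L\<^esub>"
    by (auto simp: Vunit_def)
  note c = *(1-4)[THEN V_carrier]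
  have "(u \<otimes>\<^bsub>L\<^esub> w) \<otimes>\<^bsub>L\<^esub> (u' \<otimes>\<^bsub>L\<^esub> w') = (u \<otimes>\<^bsub>L\<^esub> u') \<otimes>\<^bsub>L\<^esub> (w \<otimes>\<^bsub>L\<^esub> w')"
    using c by (simp add: L.m_ac)
  then show ?thesis unfolding Vunit_def using * c subringE(6)[OF V]
    by (auto intro!: bexI[of _ "u' \<otimes>\<^bsub>L\<^esub> w'"])
qed

lemma Vunit_pow: "Vunit u \<Longrightarrow> Vunit (u [^]\<^bsub>L\<^esub> (n :: nat))"
  by (induction n) (auto simp: Vunit_one Vunit_mult)

lemma Vunit_inverse:
  assumes "Vunit u"
  obtains u' where "Vunit u'" "u \<otimes>\<^bsub>L\<^esub> u' = \<one>\<^bsub>L\<^esub>"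
proof -
  obtain u' where u': "u \<in> V" "u' \<in> V" "u \<otimes>\<^bsub>L\<^esub> u' = \<one>\<^bsub>L\<^esub>"
    using assms by (auto simp: Vunit_def)
  then have "u' \<otimes>\<^bsub>L\<^esub> u = \<one>\<^bsub>L\<^esub>" using L.m_comm[OF V_carrier V_carrier] by simp
  then have "Vunit u'" using u'(1,2) unfolding Vunit_def by (intro conjI bexI[of _ u])
  then show ?thesis by (rule that[OF _ u'(3)])
qed

lemma Vunit_cancel:
  assumes "Vunit u" "x \<in> carrier L" "y \<in> carrier L" "u \<otimes>\<^bsub>L\<^esub> x = y"
  shows "\<exists>w. Vunit w \<and> x = w \<otimes>\<^bsub>L\<^esub> y"
proof -
  obtain u' where u': "Vunit u'" "u \<otimes>\<^bsub>L\<^esub> u' = \<one>\<^bsub>L\<^esub>" using Vunit_inverse[OF assms(1)] .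
  have c: "u \<in> carrier L" "u' \<in> carrier L" using u' assms Vunit_carrier by auto
  have "(u \<otimes>\<^bsub>L\<^esub> u') \<otimes>\<^bsub>L\<^esub> x = u' \<otimes>\<^bsub>L\<^esub> (u \<otimes>\<^bsub>L\<^esub> x)" using assms(2) c by (simp add: L.m_ac)
  then have "x = u' \<otimes>\<^bsub>L\<^esub> y" using assms(2) by (simp add: u'(2) assms(4))
  then show ?thesis using u'(1) by (intro exI[of _ u'] conjI)
qed

lemma pi_pow_closed: "\<pi> [^]\<^bsub>K\<^esub> (a :: nat) \<in> carrier K"
  using \<pi>_unit by auto

lemma pi_equiv_refl: "pi_equiv x x"
  unfolding pi_equiv_def by (intro exI[of _ 0]) (rule refl)

lemma pi_equiv_trans:
  assumes "pi_equiv x y" "pi_equiv y z" "x \<in> carrier K" "y \<in> carrier K" "z \<in> carrier K"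
  shows "pi_equiv x z"
proof -
  obtain a b a' b' :: nat where *: "\<pi> [^]\<^bsub>K\<^esub> a \<otimes>\<^bsub>K\<^esub> x = \<pi> [^]\<^bsub>K\<^esub> b \<otimes>\<^bsub>K\<^esub> y" "\<pi> [^]\<^bsub>K\<^esub> a' \<otimes>\<^bsub>K\<^esub> y = \<pi> [^]\<^bsub>K\<^esub> b' \<otimes>\<^bsub>K\<^esub> z"
    using assms by (auto simp: pi_equiv_def)
  note c = pi_pow_closed[of a] pi_pow_closed[of b] pi_pow_closed[of a'] pi_pow_closed[of b']
  have "\<pi> [^]\<^bsub>K\<^esub> (a' + a) \<otimes>\<^bsub>K\<^esub> x = \<pi> [^]\<^bsub>K\<^esub> a' \<otimes>\<^bsub>K\<^esub> (\<pi> [^]\<^bsub>K\<^esub> b \<otimes>\<^bsub>K\<^esub> y)"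
    using c assms by (simp add: K.nat_pow_mult[symmetric] \<pi>_unit K.m_assoc *)
  also have "\<dots> = \<pi> [^]\<^bsub>K\<^esub> b \<otimes>\<^bsub>K\<^esub> (\<pi> [^]\<^bsub>K\<^esub> a' \<otimes>\<^bsub>K\<^esub> y)" using c assms by (intro K.m_lcomm) auto
  also have "\<dots> = \<pi> [^]\<^bsub>K\<^esub> (b + b') \<otimes>\<^bsub>K\<^esub> z"
    using c assms by (simp add: K.nat_pow_mult[symmetric] \<pi>_unit K.m_assoc *)
  finally show ?thesis unfolding pi_equiv_def by blast
qed

text \<open>Converts the rules for diagonal matrices and scalars, which speak of powers of an
  element of \<open>pows\<close>, into a relation between powers of \<open>\<pi>\<close>.\<close>

lemma pi_equiv_pows:
  assumes "p \<in> pows" "p [^]\<^bsub>K\<^esub> (e :: nat) \<otimes>\<^bsub>K\<^esub> x = p [^]\<^bsub>K\<^esub> (e' :: nat) \<otimes>\<^bsub>K\<^esub> y" "x \<in> carrier K" "y \<in> carrier K"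
  shows "pi_equiv x y"
proof -
  obtain n :: nat where n: "p = \<pi> [^]\<^bsub>K\<^esub> n \<or> p = (inv\<^bsub>K\<^esub> \<pi>) [^]\<^bsub>K\<^esub> n" using assms by (auto simp: pows_def)
  show ?thesis
  proof (cases "p = \<pi> [^]\<^bsub>K\<^esub> n")
    case True
    then show ?thesis using assms(2) \<pi>_unit unfolding pi_equiv_def by (auto simp: K.nat_pow_pow)
  next
    case False
    then have p: "p = (inv\<^bsub>K\<^esub> \<pi>) [^]\<^bsub>K\<^esub> n" using n by simp
    let ?r = "inv\<^bsub>K\<^esub> \<pi>"
    have inv: "\<pi> [^]\<^bsub>K\<^esub> (k :: nat) \<otimes>\<^bsub>K\<^esub> ?r [^]\<^bsub>K\<^esub> k = \<one>\<^bsub>K\<^esub>" for k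
      using \<pi>_unit by (simp add: K.pow_mult_distrib[symmetric] K.m_comm)
    have rc: "?r [^]\<^bsub>K\<^esub> (k :: nat) \<in> carrier K" for k using \<pi>_unit by auto
    have eq: "?r [^]\<^bsub>K\<^esub> (n * e) \<otimes>\<^bsub>K\<^esub> x = ?r [^]\<^bsub>K\<^esub> (n * e') \<otimes>\<^bsub>K\<^esub> y"
      using assms(2) \<pi>_unit by (simp add: p K.nat_pow_pow)
    \<comment> \<open>For negative exponents both sides are multiplied by the positive powers of
      \<open>\<pi>\<close> that cancel them; this exchanges the two sides.\<close>
    let ?A = "\<pi> [^]\<^bsub>K\<^esub> (n * e)" and ?B = "\<pi> [^]\<^bsub>K\<^esub> (n * e')"
    have c: "?A \<in> carrier K" "?B \<in> carrier K" by (rule pi_pow_closed)+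
    have "?B \<otimes>\<^bsub>K\<^esub> x = ?B \<otimes>\<^bsub>K\<^esub> ((?A \<otimes>\<^bsub>K\<^esub> ?r [^]\<^bsub>K\<^esub> (n * e)) \<otimes>\<^bsub>K\<^esub> x)" using inv[of "n * e"] assms by simp
    also have "\<dots> = ?A \<otimes>\<^bsub>K\<^esub> (?B \<otimes>\<^bsub>K\<^esub> (?r [^]\<^bsub>K\<^esub> (n * e) \<otimes>\<^bsub>K\<^esub> x))" using c rc assms by (simp add: K.m_ac)
    also have "\<dots> = ?A \<otimes>\<^bsub>K\<^esub> ((?B \<otimes>\<^bsub>K\<^esub> ?r [^]\<^bsub>K\<^esub> (n * e')) \<otimes>\<^bsub>K\<^esub> y)" unfolding eq using c rc assms by (simp add: K.m_assoc)
    also have "\<dots> = ?A \<otimes>\<^bsub>K\<^esub> y" using inv[of "n * e'"] assms by simp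
    finally show ?thesis unfolding pi_equiv_def by blast
  qed
qed

abbreviation lift where "lift N \<Psi> \<equiv> map_coeffs N \<iota> \<Psi>"

text \<open>The equivalence over \<open>V\<close> between \<open>\<Theta>\<close> and the transform
  of \<open>\<Psi>\<close> by \<open>T\<close> is remembered only through two consequences:
  integrality passes over, and the resultants differ by a unit of \<open>V\<close>. Integrality is
  required for every scalar \<open>c\<close>, because a model carries a scalar besides its
  matrix.\<close>

definition descent :: "nat \<Rightarrow> nat \<Rightarrow> 'l poly_map \<Rightarrow> 'k poly_map \<Rightarrow> (nat \<Rightarrow> nat \<Rightarrow> 'k) \<Rightarrow> (nat \<Rightarrow> nat \<Rightarrow> 'k) \<Rightarrow> bool" where
  "descent N d \<Theta> \<Psi> T T' \<longleftrightarrow> inverse_matrices K N T T' \<and> S_integral N (conj_map K N T T' \<Psi>) \<and>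
     pi_equiv (Res K N d (conj_map K N T T' \<Psi>)) (Res K N d \<Psi>) \<and>
     (\<forall>c \<in> carrier L. integral N (scale_map L N c \<Theta>) \<longrightarrow>
        integral N (scale_map L N c (lift N (conj_map K N T T' \<Psi>)))) \<and>
     (\<exists>u. Vunit u \<and> Res L N d \<Theta> = u \<otimes>\<^bsub>L\<^esub> Res L N d (lift N (conj_map K N T T' \<Psi>)))"

text \<open>The map \<open>\<Psi>\<close> is quantified here because a column operation replaces it
  by another map with coefficients in \<open>S\<close>.\<close>

definition descends :: "nat \<Rightarrow> nat \<Rightarrow> (nat \<Rightarrow> nat \<Rightarrow> 'l) \<Rightarrow> bool" where
  "descends N d A \<longleftrightarrow> (\<forall>B \<Psi>. inverse_matrices L N A B \<longrightarrow> \<Psi> \<in> fmaps K N d \<longrightarrow> S_integral N \<Psi> \<longrightarrow>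
     (\<exists>T T'. descent N d (conj_map L N A B (lift N \<Psi>)) \<Psi> T T'))"

lemma descendsD:
  assumes "descends N d A" "inverse_matrices L N A B" "\<Psi> \<in> fmaps K N d" "S_integral N \<Psi>"
  obtains T T' where "descent N d (conj_map L N A B (lift N \<Psi>)) \<Psi> T T'"
  using assms unfolding descends_def by blast

lemma integral_conj_map:
  assumes "\<Phi> \<in> fmaps L N d" "integral N \<Phi>" "\<And>i j. i \<le> N \<Longrightarrow> j \<le> N \<Longrightarrow> E i j \<in> V \<and> E' i j \<in> V"
  shows "integral N (conj_map L N E E' \<Phi>)"
  unfolding integral_def using L.conj_map_subring[OF V assms(1)] assms(2,3) unfolding integral_def by blast

lemma S_integral_conj_map:
  assumes "\<Phi> \<in> fmaps K N d" "S_integral N \<Phi>" "\<And>i j. i \<le> N \<Longrightarrow> j \<le> N \<Longrightarrow> E i j \<in> S \<and> E' i j \<in> S"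
  shows "S_integral N (conj_map K N E E' \<Phi>)"
  unfolding S_integral_def using K.conj_map_subring[OF S assms(1)] assms(2,3) unfolding S_integral_def by blast

text \<open>A row operation \<open>E\<close> over \<open>V\<close> replaces the transform of
  \<open>\<Psi>\<close> by an equivalent one over \<open>V\<close> and leaves \<open>\<Psi>\<close>
  alone, so the same \<open>T\<close> works.\<close>

lemma descends_row:
  assumes d: "d \<ge> 1" and E: "inverse_matrices L N E E'" "\<And>i j. i \<le> N \<Longrightarrow> j \<le> N \<Longrightarrow> E i j \<in> V \<and> E' i j \<in> V"
    and Res: "\<And>Z. Z \<in> fmaps L N d \<Longrightarrow> \<exists>u. Vunit u \<and> Res L N d (conj_map L N E E' Z) = u \<otimes>\<^bsub>L\<^esub> Res L N d Z"
    and g: "descends N d (mm L N E A)"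
  shows "descends N d A"
  unfolding descends_def
proof (intro allI impI)
  fix B \<Psi> assume A: "inverse_matrices L N A B" and \<Psi>: "\<Psi> \<in> fmaps K N d" "S_integral N \<Psi>"
  have m: "matc L N A" "matc L N B" "matc L N E" "matc L N E'" using A E(1) by (auto simp: inverse_matrices_iff)
  have l: "lift N \<Psi> \<in> fmaps L N d" by (rule \<iota>.map_coeffs_fmaps[OF \<Psi>(1)])
  let ?X = "conj_map L N A B (lift N \<Psi>)"
  have Z: "?X \<in> fmaps L N d" by (rule L.conj_map_fmaps[OF l m(1,2)])
  have EX: "conj_map L N E E' ?X = conj_map L N (mm L N E A) (mm L N B E') (lift N \<Psi>)"
    by (rule L.conj_map_conj_map[OF l m(3,4,1,2)])
  obtain T T' where D: "descent N d (conj_map L N E E' ?X) \<Psi> T T'"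
    unfolding EX by (rule descendsD[OF g L.inverse_matrices_mm[OF E(1) A] \<Psi>])
  then have T: "inverse_matrices K N T T'" "S_integral N (conj_map K N T T' \<Psi>)"
    "pi_equiv (Res K N d (conj_map K N T T' \<Psi>)) (Res K N d \<Psi>)"
    and T4: "\<And>c. c \<in> carrier L \<Longrightarrow> integral N (scale_map L N c (conj_map L N E E' ?X)) \<Longrightarrow>
           integral N (scale_map L N c (lift N (conj_map K N T T' \<Psi>)))"
    and R: "\<exists>u. Vunit u \<and> Res L N d (conj_map L N E E' ?X) = u \<otimes>\<^bsub>L\<^esub> Res L N d (lift N (conj_map K N T T' \<Psi>))"
    by (auto simp: descent_def)
  obtain u where u: "Vunit u" "Res L N d (conj_map L N E E' ?X) = u \<otimes>\<^bsub>L\<^esub> Res L N d (lift N (conj_map K N T T' \<Psi>))"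
    using R by blast
  obtain w where w: "Vunit w" "Res L N d (conj_map L N E E' ?X) = w \<otimes>\<^bsub>L\<^esub> Res L N d ?X"
    using Res[OF Z] by blast
  have mT: "matc K N T" "matc K N T'" using T(1) by (auto simp: inverse_matrices_iff)
  have rc: "Res L N d ?X \<in> carrier L" "Res L N d (lift N (conj_map K N T T' \<Psi>)) \<in> carrier L"
    using Z \<iota>.map_coeffs_fmaps[OF K.conj_map_fmaps[OF \<Psi>(1) mT]] d by (auto intro: L.Res_closed)
  obtain w' where w': "Vunit w'" "Res L N d ?X = w' \<otimes>\<^bsub>L\<^esub> (u \<otimes>\<^bsub>L\<^esub> Res L N d (lift N (conj_map K N T T' \<Psi>)))"
    using Vunit_cancel[OF w(1) rc(1) _ w(2)[symmetric, unfolded u(2)]] rc u(1) Vunit_carrier by auto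
  have "integral N (scale_map L N c (lift N (conj_map K N T T' \<Psi>)))"
    if c: "c \<in> carrier L" and i: "integral N (scale_map L N c ?X)" for c
  proof (rule T4[OF c])
    show "integral N (scale_map L N c (conj_map L N E E' ?X))"
      unfolding L.conj_map_scale[OF Z m(3,4) c, symmetric]
      by (rule integral_conj_map[OF L.scale_map_fmaps[OF c Z] i]) (use E(2) in blast)
  qed
  moreover have "\<exists>u. Vunit u \<and> Res L N d ?X = u \<otimes>\<^bsub>L\<^esub> Res L N d (lift N (conj_map K N T T' \<Psi>))"
    using w' u(1) rc Vunit_carrier Vunit_mult by (intro exI[of _ "w' \<otimes>\<^bsub>L\<^esub> u"]) (auto simp: L.m_assoc)
  ultimately have "descent N d ?X \<Psi> T T'" using T by (simp add: descent_def)
  then show "\<exists>T T'. descent N d ?X \<Psi> T T'" by blast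
qed

text \<open>A column operation \<open>E\<close> over \<open>S\<close> is absorbed into
  \<open>\<Psi>\<close>, which is replaced by its transform under the inverse of \<open>E\<close>.
  The matrix found for the new map is then multiplied on the right by this inverse.\<close>

lemma descends_col:
  assumes d: "d \<ge> 1" and E: "inverse_matrices K N E E'" "\<And>i j. i \<le> N \<Longrightarrow> j \<le> N \<Longrightarrow> E i j \<in> S \<and> E' i j \<in> S"
    and Res: "\<And>Z. Z \<in> fmaps K N d \<Longrightarrow> pi_equiv (Res K N d (conj_map K N E' E Z)) (Res K N d Z)"
    and g: "descends N d (mm L N A (\<lambda>i j. \<iota> (E i j)))"
  shows "descends N d A"
  unfolding descends_def
proof (intro allI impI)
  fix B \<Psi> assume A: "inverse_matrices L N A B" and \<Psi>: "\<Psi> \<in> fmaps K N d" "S_integral N \<Psi>"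
  have m: "matc L N A" "matc L N B" and mE: "matc K N E" "matc K N E'"
    using A E(1) by (auto simp: inverse_matrices_iff)
  let ?E = "\<lambda>i j. \<iota> (E i j)" and ?E' = "\<lambda>i j. \<iota> (E' i j)"
  have iE: "inverse_matrices L N ?E ?E'" by (rule \<iota>.inverse_matrices_map[OF E(1)])
  then have mE': "matc L N ?E" "matc L N ?E'" by (auto simp: inverse_matrices_iff)
  let ?P = "conj_map K N E' E \<Psi>"
  have P: "?P \<in> fmaps K N d" by (rule K.conj_map_fmaps[OF \<Psi>(1) mE(2,1)])
  have PS: "S_integral N ?P" using E(2) by (intro S_integral_conj_map[OF \<Psi>]) blast
  have "conj_map K N E E' ?P = conj_map K N (idm K) (idm K) \<Psi>"
    using E(1) unfolding K.conj_map_conj_map[OF \<Psi>(1) mE mE(2,1)]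
    by (intro K.conj_map_cong K.idm_closed) (auto simp: inverse_matrices_iff)
  then have "conj_map K N E E' ?P = \<Psi>" using K.conj_map_idm[OF \<Psi>(1)] by simp
  then have l: "lift N \<Psi> = conj_map L N ?E ?E' (lift N ?P)" using \<iota>.map_conj_map[OF P mE] by simp
  have lP: "lift N ?P \<in> fmaps L N d" by (rule \<iota>.map_coeffs_fmaps[OF P])
  have Z: "conj_map L N A B (lift N \<Psi>) = conj_map L N (mm L N A ?E) (mm L N ?E' B) (lift N ?P)"
    unfolding l by (rule L.conj_map_conj_map[OF lP m mE'])
  obtain T T' where D: "descent N d (conj_map L N A B (lift N \<Psi>)) ?P T T'"
    unfolding Z by (rule descendsD[OF g L.inverse_matrices_mm[OF A iE] P PS])
  then have T: "inverse_matrices K N T T'" "S_integral N (conj_map K N T T' ?P)"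
    "pi_equiv (Res K N d (conj_map K N T T' ?P)) (Res K N d ?P)"
    by (auto simp: descent_def)
  have mT: "matc K N T" "matc K N T'" using T(1) by (auto simp: inverse_matrices_iff)
  have TE: "conj_map K N T T' ?P = conj_map K N (mm K N T E') (mm K N E T') \<Psi>"
    by (rule K.conj_map_conj_map[OF \<Psi>(1) mT mE(2,1)])
  have rc: "Res K N d (conj_map K N T T' ?P) \<in> carrier K" "Res K N d ?P \<in> carrier K" "Res K N d \<Psi> \<in> carrier K"
    using d P \<Psi> K.conj_map_fmaps[OF P mT] by (auto intro: K.Res_closed)
  have "pi_equiv (Res K N d (conj_map K N T T' ?P)) (Res K N d \<Psi>)"
    by (rule pi_equiv_trans[OF T(3) Res[OF \<Psi>(1)] rc])
  moreover have "inverse_matrices K N (mm K N T E') (mm K N E T')"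
    by (rule K.inverse_matrices_mm[OF T(1) inverse_matrices_sym[OF E(1)]])
  ultimately have "descent N d (conj_map L N A B (lift N \<Psi>)) \<Psi> (mm K N T E') (mm K N E T')"
    using D unfolding descent_def TE by simp
  then show "\<exists>T T'. descent N d (conj_map L N A B (lift N \<Psi>)) \<Psi> T T'" by blast
qed

lemma descends_cong:
  assumes "matc L N A" "matc L N A'" "eqm N A A'" "descends N d A'"
  shows "descends N d A"
  unfolding descends_def
proof (intro allI impI)
  fix B \<Psi> assume A: "inverse_matrices L N A B" and \<Psi>: "\<Psi> \<in> fmaps K N d" "S_integral N \<Psi>"
  have B: "matc L N B" using A by (simp add: inverse_matrices_iff)
  have "eqm N B B" by (simp add: eqm_def)
  have "inverse_matrices L N A' B"
    using A L.mm_cong[OF assms(3) \<open>eqm N B B\<close> assms(1) B] L.mm_cong[OF \<open>eqm N B B\<close> assms(3) B assms(1)] assms(2)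
    by (auto simp: inverse_matrices_iff eqm_def)
  moreover have "conj_map L N A B Z = conj_map L N A' B Z" for Z
    by (rule L.conj_map_cong[OF assms(3) \<open>eqm N B B\<close> assms(2) B])
  ultimately show "\<exists>T T'. descent N d (conj_map L N A B (lift N \<Psi>)) \<Psi> T T'"
    using assms(4) \<Psi> unfolding descends_def by simp
qed

lemma descends_idm:
  assumes d: "d \<ge> 1"
  shows "descends N d (idm L)"
  unfolding descends_def
proof (intro allI impI)
  fix B \<Psi> assume A: "inverse_matrices L N (idm L) B" and \<Psi>: "\<Psi> \<in> fmaps K N d" "S_integral N \<Psi>"
  have B: "matc L N B" using A by (simp add: inverse_matrices_iff)
  have l: "lift N \<Psi> \<in> fmaps L N d" by (rule \<iota>.map_coeffs_fmaps[OF \<Psi>(1)])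
  have "eqm N B (idm L)" using L.mm_idm_left[OF B] A by (auto simp: inverse_matrices_iff eqm_def)
  then have "conj_map L N (idm L) B (lift N \<Psi>) = conj_map L N (idm L) (idm L) (lift N \<Psi>)"
    by (intro L.conj_map_cong L.idm_closed) (simp add: eqm_def)
  then have Z: "conj_map L N (idm L) B (lift N \<Psi>) = lift N \<Psi>" using L.conj_map_idm[OF l] by simp
  have "Res L N d (lift N \<Psi>) = \<one>\<^bsub>L\<^esub> \<otimes>\<^bsub>L\<^esub> Res L N d (lift N \<Psi>)" using L.Res_closed[OF d l] by simp
  then have "descent N d (lift N \<Psi>) \<Psi> (idm K) (idm K)"
    using \<Psi>(2) Vunit_one by (auto simp: descent_def K.conj_map_idm[OF \<Psi>(1)] K.inverse_matrices_idm pi_equiv_refl)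
  then show "\<exists>T T'. descent N d (conj_map L N (idm L) B (lift N \<Psi>)) \<Psi> T T'" unfolding Z by blast
qed

text \<open>Each operation of the reduction changes the resultant in a controlled way: elementary
  matrices fix it, unit entries multiply it by a unit of \<open>V\<close>, and powers of
  \<open>\<pi>\<close> multiply it by a power of \<open>\<pi>\<close>.\<close>

lemma descends_all:
  assumes d: "d \<ge> 1" and A: "inverse_matrices L N A B"
  shows "descends N d A"
proof -
  have V01: "\<zero>\<^bsub>L\<^esub> \<in> V" "\<one>\<^bsub>L\<^esub> \<in> V" using subringE(2,3)[OF V] by auto
  have S01: "\<zero>\<^bsub>K\<^esub> \<in> S" "\<one>\<^bsub>K\<^esub> \<in> S" using subringE(2,3)[OF S] by auto
  interpret reduction K L \<iota> V S \<pi> N "descends N d"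
  proof unfold_locales
    show "descends N d A" if "matc L N A" "matc L N A'" "eqm N A A'" "descends N d A'" for A A'
      using that by (rule descends_cong)
    show "descends N d A" if "\<nexists>B. inverse_matrices L N A B" for A
      using that by (auto simp: descends_def)
    show "descends N d (idm L)" by (rule descends_idm[OF d])
    show "descends N d A" if "matc L N A" "r \<in> V" and ij: "i \<le> N" "j \<le> N" "i \<noteq> j"
      and g: "descends N d (mm L N (elemm L i j r) A)" for A i j r
    proof (rule descends_row[OF d _ _ _ g])
      have r: "r \<in> carrier L" using that V_carrier by blast
      show "inverse_matrices L N (elemm L i j r) (elemm L i j (\<ominus>\<^bsub>L\<^esub> r))" by (rule L.elemm_inverse[OF r ij])
      show "elemm L i j r a b \<in> V \<and> elemm L i j (\<ominus>\<^bsub>L\<^esub> r) a b \<in> V" for a b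
        using that V01 subringE(5)[OF V] by (auto simp: elemm_def)
      show "\<exists>u. Vunit u \<and> Res L N d (conj_map L N (elemm L i j r) (elemm L i j (\<ominus>\<^bsub>L\<^esub> r)) Z) = u \<otimes>\<^bsub>L\<^esub> Res L N d Z"
        if Z: "Z \<in> fmaps L N d" for Z
        using L.Res_elemm[OF d Z r ij] Vunit_one L.Res_closed[OF d Z] by (intro exI[of _ "\<one>\<^bsub>L\<^esub>"]) simp
    qed
    show "descends N d A" if "matc L N A" and u: "u \<in> V" "u' \<in> V" "u \<otimes>\<^bsub>L\<^esub> u' = \<one>\<^bsub>L\<^esub>" and i: "i \<le> N"
      and g: "descends N d (mm L N (L.unit_diag N i u) A)" for A i u u'
    proof (rule descends_row[OF d _ _ _ g])
      have uc: "u \<in> carrier L" "u' \<in> carrier L" using u V_carrier by auto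
      show "inverse_matrices L N (L.unit_diag N i u) (L.unit_diag N i u')" by (rule L.unit_diag_inverse[OF uc u(3)])
      show "L.unit_diag N i u a b \<in> V \<and> L.unit_diag N i u' a b \<in> V" for a b
        using u V01 by (auto simp: L.unit_diag_def L.diagm_def)
      have U: "Vunit u" using u by (auto simp: Vunit_def)
      obtain e1 e2 :: nat where e: "\<And>s s' \<Phi>. \<lbrakk>s \<in> carrier L; s' \<in> carrier L; s \<otimes>\<^bsub>L\<^esub> s' = \<one>\<^bsub>L\<^esub>; \<Phi> \<in> fmaps L N d\<rbrakk> \<Longrightarrow>
        s [^]\<^bsub>L\<^esub> e2 \<otimes>\<^bsub>L\<^esub> Res L N d (conj_map L N (L.unit_diag N i s) (L.unit_diag N i s') \<Phi>) = s [^]\<^bsub>L\<^esub> e1 \<otimes>\<^bsub>L\<^esub> Res L N d \<Phi>"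
        by (rule L.Res_unit_diag[OF d i], rule that)
      show "\<exists>w. Vunit w \<and> Res L N d (conj_map L N (L.unit_diag N i u) (L.unit_diag N i u') Z) = w \<otimes>\<^bsub>L\<^esub> Res L N d Z"
        if Z: "Z \<in> fmaps L N d" for Z
      proof -
        let ?Y = "conj_map L N (L.unit_diag N i u) (L.unit_diag N i u') Z"
        have "?Y \<in> fmaps L N d"
          using L.unit_diag_inverse[OF uc u(3), of N i] Z by (intro L.conj_map_fmaps) (auto simp: inverse_matrices_iff)
        then have rc: "Res L N d ?Y \<in> carrier L" "Res L N d Z \<in> carrier L" using Z d by (auto intro: L.Res_closed)
        \<comment> \<open>Powers of the unit \<open>u\<close> stand on both sides of the rule; the
          left one is inverted and the two are merged into one unit.\<close>
        obtain w where w: "Vunit w" "Res L N d ?Y = w \<otimes>\<^bsub>L\<^esub> (u [^]\<^bsub>L\<^esub> e1 \<otimes>\<^bsub>L\<^esub> Res L N d Z)"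
          using Vunit_cancel[OF Vunit_pow[OF U, of e2] rc(1) _ e[OF uc u(3) Z]] rc uc by auto
        then show ?thesis
          using Vunit_mult[OF w(1) Vunit_pow[OF U, of e1]] rc uc Vunit_carrier
          by (intro exI[of _ "w \<otimes>\<^bsub>L\<^esub> u [^]\<^bsub>L\<^esub> e1"]) (simp add: L.m_assoc)
      qed
    qed
    show "descends N d A" if "matc L N A" "s \<in> S" and ij: "i \<le> N" "j \<le> N" "i \<noteq> j"
      and g: "descends N d (mm L N A (elemm L i j (\<iota> s)))" for A i j s
    proof -
      have s: "s \<in> carrier K" "\<ominus>\<^bsub>K\<^esub> s \<in> carrier K" using that S_carrier by auto
      have E: "(\<lambda>a b. \<iota> (elemm K i j s a b)) = elemm L i j (\<iota> s)" by (auto simp: elemm_def fun_eq_iff)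
      show ?thesis
      proof (rule descends_col[OF d])
        show "inverse_matrices K N (elemm K i j s) (elemm K i j (\<ominus>\<^bsub>K\<^esub> s))" by (rule K.elemm_inverse[OF s(1) ij])
        show "elemm K i j s a b \<in> S \<and> elemm K i j (\<ominus>\<^bsub>K\<^esub> s) a b \<in> S" for a b
          using that S01 subringE(5)[OF S] by (auto simp: elemm_def)
        show "pi_equiv (Res K N d (conj_map K N (elemm K i j (\<ominus>\<^bsub>K\<^esub> s)) (elemm K i j s) Z)) (Res K N d Z)"
          if Z: "Z \<in> fmaps K N d" for Z
          using K.Res_elemm[OF d Z s(2) ij] s pi_equiv_refl by simp
        show "descends N d (mm L N A (\<lambda>a b. \<iota> (elemm K i j s a b)))" unfolding E by (rule g)
      qed
    qed
    show "descends N d A" if "matc L N A" and p: "p \<in> pows" and i: "i \<le> N"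
      and g: "descends N d (mm L N A (L.unit_diag N i (\<iota> p)))" for A i p
    proof -
      obtain p' where p': "p' \<in> pows" "p \<otimes>\<^bsub>K\<^esub> p' = \<one>\<^bsub>K\<^esub>" using pows_inverse[OF p] .
      have pc: "p \<in> carrier K" "p' \<in> carrier K" using p p' pows_S S_carrier by auto
      have p'p: "p' \<otimes>\<^bsub>K\<^esub> p = \<one>\<^bsub>K\<^esub>" using p' pc K.m_comm by simp
      have E: "(\<lambda>a b. \<iota> (K.unit_diag N i p a b)) = L.unit_diag N i (\<iota> p)"
        by (auto simp: K.unit_diag_def L.unit_diag_def K.diagm_def L.diagm_def fun_eq_iff)
      obtain e1 e2 :: nat where e: "\<And>s s' \<Phi>. \<lbrakk>s \<in> carrier K; s' \<in> carrier K; s \<otimes>\<^bsub>K\<^esub> s' = \<one>\<^bsub>K\<^esub>; \<Phi> \<in> fmaps K N d\<rbrakk> \<Longrightarrow>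
        s [^]\<^bsub>K\<^esub> e2 \<otimes>\<^bsub>K\<^esub> Res K N d (conj_map K N (K.unit_diag N i s) (K.unit_diag N i s') \<Phi>) = s [^]\<^bsub>K\<^esub> e1 \<otimes>\<^bsub>K\<^esub> Res K N d \<Phi>"
        by (rule K.Res_unit_diag[OF d i], rule that)
      have inv: "inverse_matrices K N (K.unit_diag N i p) (K.unit_diag N i p')" by (rule K.unit_diag_inverse[OF pc p'(2)])
      show ?thesis
      proof (rule descends_col[OF d inv])
        show "K.unit_diag N i p a b \<in> S \<and> K.unit_diag N i p' a b \<in> S" for a b
          using pows_S p p' S01 by (auto simp: K.unit_diag_def K.diagm_def)
        show "pi_equiv (Res K N d (conj_map K N (K.unit_diag N i p') (K.unit_diag N i p) Z)) (Res K N d Z)"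
          if Z: "Z \<in> fmaps K N d" for Z
          using e[OF pc(2,1) p'p Z] Z d inv
          by (intro pi_equiv_pows[OF p'(1)] K.Res_closed K.conj_map_fmaps) (auto simp: inverse_matrices_iff)
        show "descends N d (mm L N A (\<lambda>a b. \<iota> (K.unit_diag N i p a b)))" unfolding E by (rule g)
      qed
    qed
  qed
  show ?thesis using A by (intro Q_all) (simp add: inverse_matrices_iff)
qed

end

section \<open>Completion of a discretely valued field\<close>

locale discretely_valued = field K for K :: "'a ring" (structure) +
  fixes v :: "'a \<Rightarrow> ereal"
  assumes v_zero: "v \<zero> = \<infinity>"
    and v_int: "x \<in> carrier K \<Longrightarrow> x \<noteq> \<zero> \<Longrightarrow> \<exists>k :: int. v x = ereal (of_int k)"
    and v_mult: "x \<in> carrier K \<Longrightarrow> y \<in> carrier K \<Longrightarrow> v (x \<otimes> y) = v x + v y"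
    and v_add: "x \<in> carrier K \<Longrightarrow> y \<in> carrier K \<Longrightarrow> min (v x) (v y) \<le> v (x \<oplus> y)"
begin

lemma v_one: "v \<one> = 0"
proof -
  obtain k :: int where k: "v \<one> = ereal (of_int k)" using v_int[of \<one>] by auto
  then show ?thesis using v_mult[of \<one> \<one>] by (simp add: zero_ereal_def)
qed

lemma v_uminus: "x \<in> carrier K \<Longrightarrow> v (\<ominus> x) = v x"
proof -
  assume x: "x \<in> carrier K"
  have "v (\<ominus> \<one>) + v (\<ominus> \<one>) = 0" using v_mult[of "\<ominus> \<one>" "\<ominus> \<one>"] v_one by (simp add: l_minus)
  moreover obtain k :: int where k: "v (\<ominus> \<one>) = ereal (of_int k)"
    using v_int[of "\<ominus> \<one>"] by (auto simp: minus_equality)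
  ultimately have "v (\<ominus> \<one>) = 0" by (simp add: zero_ereal_def)
  moreover have "\<ominus> x = \<ominus> \<one> \<otimes> x" using x by (simp add: l_minus)
  ultimately show ?thesis using v_mult[of "\<ominus> \<one>" x] x by simp
qed

lemma v_minus: "x \<in> carrier K \<Longrightarrow> y \<in> carrier K \<Longrightarrow> min (v x) (v y) \<le> v (x \<ominus> y)"
  using v_add[of x "\<ominus> y"] v_uminus[of y] by (simp add: a_minus_def)

text \<open>The ultrametric inequality in both directions: the difference is too small to alter the
  valuation.\<close>

lemma v_eq_of_diff:
  assumes "x \<in> carrier K" "y \<in> carrier K" "v y < v (x \<ominus> y)"
  shows "v x = v y"
proof -
  have "x = (x \<ominus> y) \<oplus> y" using assms by (simp add: a_minus_def a_assoc l_neg)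
  then have "min (v (x \<ominus> y)) (v y) \<le> v x" using v_add[of "x \<ominus> y" y] assms by simp
  then have 1: "v y \<le> v x" using assms(3) by (simp add: min_def split: if_splits)
  have "y = x \<ominus> (x \<ominus> y)" using assms by (simp add: a_minus_def minus_add a_assoc[symmetric] r_neg)
  then have "min (v x) (v (x \<ominus> y)) \<le> v y" using v_minus[of x "x \<ominus> y"] assms by simp
  then have "v x \<le> v y" using assms(3) by (auto simp: min_def split: if_splits)
  with 1 show ?thesis by simp
qed

abbreviation CR where "CR \<equiv> cauchy_ring K v"
abbreviation NS where "NS \<equiv> null_seqs K v"

text \<open>An eventual lower bound for the valuations. Convergence to infinity is this bound for
  every \<open>C\<close>, see \<open>null_iff\<close>.\<close>

definition evge :: "real \<Rightarrow> (nat \<Rightarrow> 'a) \<Rightarrow> bool" where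
  "evge C s \<longleftrightarrow> (\<exists>n\<^sub>0. \<forall>n\<ge>n\<^sub>0. ereal C \<le> v (s n))"

lemma CR_carrier: "s \<in> carrier CR \<longleftrightarrow> (\<forall>n. s n \<in> carrier K) \<and>
    (\<forall>C::nat. \<exists>n\<^sub>0. \<forall>m\<ge>n\<^sub>0. \<forall>n\<ge>n\<^sub>0. ereal (real C) \<le> v (s m \<ominus> s n))"
  by (simp add: cauchy_ring_def)

lemma CR_simps [simp]: "s \<otimes>\<^bsub>CR\<^esub> t = (\<lambda>n. s n \<otimes> t n)" "\<one>\<^bsub>CR\<^esub> = (\<lambda>n. \<one>)" "\<zero>\<^bsub>CR\<^esub> = (\<lambda>n. \<zero>)"
  "s \<oplus>\<^bsub>CR\<^esub> t = (\<lambda>n. s n \<oplus> t n)"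
  by (simp_all add: cauchy_ring_def)

lemma CR_elem: "s \<in> carrier CR \<Longrightarrow> s n \<in> carrier K"
  by (simp add: CR_carrier)

lemma CR_cauchy:
  assumes "s \<in> carrier CR"
  obtains n0 where "\<And>m n. n0 \<le> m \<Longrightarrow> n0 \<le> n \<Longrightarrow> ereal C \<le> v (s m \<ominus> s n)"
proof -
  obtain k :: nat where k: "C \<le> real k" using real_arch_simple by blast
  obtain n0 where n0: "\<forall>m\<ge>n0. \<forall>n\<ge>n0. ereal (real k) \<le> v (s m \<ominus> s n)"
    using assms unfolding CR_carrier by blast
  have "ereal C \<le> v (s m \<ominus> s n)" if "n0 \<le> m" "n0 \<le> n" for m n
    using n0 that k order_trans[of "ereal C" "ereal (real k)"] by simp
  then show ?thesis using that by blast
qed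

lemma CR_I:
  assumes "\<And>n. s n \<in> carrier K" "\<And>C :: real. \<exists>n0. \<forall>m\<ge>n0. \<forall>n\<ge>n0. ereal C \<le> v (s m \<ominus> s n)"
  shows "s \<in> carrier CR"
  unfolding CR_carrier using assms by blast

lemma const_CR: "x \<in> carrier K \<Longrightarrow> (\<lambda>n. x) \<in> carrier CR"
  by (rule CR_I) (auto simp: a_minus_def r_neg v_zero)

lemma null_iff: "s \<in> NS \<longleftrightarrow> s \<in> carrier CR \<and> (\<forall>C. evge C s)"
proof -
  have "(\<lambda>n. v (s n)) \<longlonglongrightarrow> \<infinity> \<longleftrightarrow> (\<forall>C. evge C s)"
    unfolding tendsto_PInfty evge_def eventually_sequentially
  proof (intro iffI allI)
    fix C assume *: "\<forall>r. \<exists>N. \<forall>n\<ge>N. ereal r < v (s n)"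
    show "\<exists>n\<^sub>0. \<forall>n\<ge>n\<^sub>0. ereal C \<le> v (s n)" using *[rule_format, of C] less_imp_le by blast
  next
    fix r assume *: "\<forall>C. \<exists>n\<^sub>0. \<forall>n\<ge>n\<^sub>0. ereal C \<le> v (s n)"
    obtain N where "\<forall>n\<ge>N. ereal (r + 1) \<le> v (s n)" using *[rule_format, of "r + 1"] by blast
    moreover have "ereal r < ereal (r + 1)" by simp
    ultimately show "\<exists>N. \<forall>n\<ge>N. ereal r < v (s n)" using less_le_trans by blast
  qed
  then show ?thesis by (simp add: null_seqs_def)
qed

lemma null_lim: "s \<in> NS \<Longrightarrow> (\<lambda>n. v (s n)) \<longlonglongrightarrow> \<infinity>"
  unfolding null_seqs_def by blast

text \<open>Beyond some index all differences have valuation at least \<open>C\<close>, and some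
  later term has valuation below \<open>C\<close>; by \<open>v_eq_of_diff\<close> all terms beyond
  the index share its valuation.\<close>

lemma nonnull_const:
  assumes s: "s \<in> carrier CR" "s \<notin> NS"
  obtains n0 and k :: int where "\<And>n. n0 \<le> n \<Longrightarrow> v (s n) = ereal (of_int k)"
proof -
  obtain C where C: "\<not> evge C s" using s by (auto simp: null_iff)
  obtain n0 where n0: "\<And>m n. n0 \<le> m \<Longrightarrow> n0 \<le> n \<Longrightarrow> ereal C \<le> v (s m \<ominus> s n)"
    using CR_cauchy[OF s(1)] by blast
  obtain n where n: "n0 \<le> n" "v (s n) < ereal C" using C unfolding evge_def by (meson not_le)
  have "v (s m) = v (s n)" if "n0 \<le> m" for m
    using v_eq_of_diff[of "s m" "s n"] n0[OF that n(1)] n(2) CR_elem[OF s(1)] by auto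
  moreover have "s n \<noteq> \<zero>" using n(2) v_zero by auto
  then obtain k :: int where "v (s n) = ereal (of_int k)" using v_int CR_elem[OF s(1)] by blast
  ultimately show ?thesis using that[of n0 k] by simp
qed

text \<open>Null sequences satisfy every bound eventually; the others have eventually constant
  valuation.\<close>

lemma CR_bounded:
  assumes "s \<in> carrier CR"
  obtains n0 and B :: real where "\<And>n. n0 \<le> n \<Longrightarrow> ereal B \<le> v (s n)"
proof (cases "s \<in> NS")
  case True
  then show ?thesis using that unfolding null_iff evge_def by blast
next
  case False
  obtain n0 and k :: int where "\<And>n. n0 \<le> n \<Longrightarrow> v (s n) = ereal (of_int k)"
    using nonnull_const[OF assms False] by blast
  then show ?thesis using that[of n0 "of_int k"] by simp
qed

lemma min_le_v: "ereal C \<le> a \<Longrightarrow> ereal C \<le> b \<Longrightarrow> min a b \<le> c \<Longrightarrow> ereal C \<le> c"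
  by (metis min.boundedI order_trans)

lemma CR_add: "s \<in> carrier CR \<Longrightarrow> t \<in> carrier CR \<Longrightarrow> (\<lambda>n. s n \<oplus> t n) \<in> carrier CR"
proof (rule CR_I)
  assume st: "s \<in> carrier CR" "t \<in> carrier CR"
  note e = CR_elem[OF st(1)] CR_elem[OF st(2)]
  show "s n \<oplus> t n \<in> carrier K" for n using e by simp
  fix C
  obtain n0 where n0: "\<And>m n. n0 \<le> m \<Longrightarrow> n0 \<le> n \<Longrightarrow> ereal C \<le> v (s m \<ominus> s n)" using CR_cauchy[OF st(1)] by blast
  obtain n1 where n1: "\<And>m n. n1 \<le> m \<Longrightarrow> n1 \<le> n \<Longrightarrow> ereal C \<le> v (t m \<ominus> t n)" using CR_cauchy[OF st(2)] by blast
  have "ereal C \<le> v ((s m \<oplus> t m) \<ominus> (s n \<oplus> t n))" if "max n0 n1 \<le> m" "max n0 n1 \<le> n" for m n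
  proof -
    have "(s m \<oplus> t m) \<ominus> (s n \<oplus> t n) = (s m \<ominus> s n) \<oplus> (t m \<ominus> t n)"
      using e by (simp add: a_minus_def minus_add a_ac)
    then show ?thesis
      using min_le_v[OF n0[of m n] n1[of m n] v_add] that e by simp
  qed
  then show "\<exists>n0. \<forall>m\<ge>n0. \<forall>n\<ge>n0. ereal C \<le> v ((s m \<oplus> t m) \<ominus> (s n \<oplus> t n))" by blast
qed

lemma CR_uminus: "s \<in> carrier CR \<Longrightarrow> (\<lambda>n. \<ominus> s n) \<in> carrier CR"
proof (rule CR_I)
  assume s: "s \<in> carrier CR"
  note e = CR_elem[OF s]
  show "\<ominus> s n \<in> carrier K" for n using e by simp
  fix C
  obtain n0 where n0: "\<And>m n. n0 \<le> m \<Longrightarrow> n0 \<le> n \<Longrightarrow> ereal C \<le> v (s m \<ominus> s n)" using CR_cauchy[OF s] by blast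
  have "(\<ominus> s m) \<ominus> (\<ominus> s n) = \<ominus> (s m \<ominus> s n)" for m n using e by (simp add: a_minus_def minus_add)
  then show "\<exists>n0. \<forall>m\<ge>n0. \<forall>n\<ge>n0. ereal C \<le> v ((\<ominus> s m) \<ominus> (\<ominus> s n))"
    using n0 e v_uminus by (intro exI[of _ n0]) simp
qed

lemma v_mult_ge:
  assumes "ereal B \<le> v x" "ereal (C - B) \<le> v y" "x \<in> carrier K" "y \<in> carrier K"
  shows "ereal C \<le> v (x \<otimes> y)"
proof -
  have "ereal B + ereal (C - B) \<le> v x + v y" using assms by (intro add_mono)
  then show ?thesis using v_mult assms by simp
qed

text \<open>The usual splitting of a difference of products. The eventual lower bounds
  \<open>B\<close> and \<open>D\<close> of the two factors are compensated in the choice of the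
  indices.\<close>

lemma CR_mult: "s \<in> carrier CR \<Longrightarrow> t \<in> carrier CR \<Longrightarrow> (\<lambda>n. s n \<otimes> t n) \<in> carrier CR"
proof (rule CR_I)
  assume st: "s \<in> carrier CR" "t \<in> carrier CR"
  note e = CR_elem[OF st(1)] CR_elem[OF st(2)]
  show "s n \<otimes> t n \<in> carrier K" for n using e by simp
  fix C
  obtain ns B where B: "\<And>n. ns \<le> n \<Longrightarrow> ereal B \<le> v (s n)" using CR_bounded[OF st(1)] by blast
  obtain nt D where D: "\<And>n. nt \<le> n \<Longrightarrow> ereal D \<le> v (t n)" using CR_bounded[OF st(2)] by blast
  obtain n0 where n0: "\<And>m n. n0 \<le> m \<Longrightarrow> n0 \<le> n \<Longrightarrow> ereal (C - D) \<le> v (s m \<ominus> s n)" using CR_cauchy[OF st(1)] by blast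
  obtain n1 where n1: "\<And>m n. n1 \<le> m \<Longrightarrow> n1 \<le> n \<Longrightarrow> ereal (C - B) \<le> v (t m \<ominus> t n)" using CR_cauchy[OF st(2)] by blast
  have "ereal C \<le> v ((s m \<otimes> t m) \<ominus> (s n \<otimes> t n))"
    if "max (max ns nt) (max n0 n1) \<le> m" "max (max ns nt) (max n0 n1) \<le> n" for m n
  proof -
    have g: "ns \<le> m" "nt \<le> n" "n0 \<le> m" "n0 \<le> n" "n1 \<le> m" "n1 \<le> n" using that by auto
    have "(s m \<otimes> t m) \<ominus> (s n \<otimes> t n) = s m \<otimes> (t m \<ominus> t n) \<oplus> t n \<otimes> (s m \<ominus> s n)"
      using e by (simp add: a_minus_def r_distr r_minus a_assoc[symmetric] m_comm[of "t n"])
        (simp add: a_assoc l_neg)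
    moreover have "ereal C \<le> v (s m \<otimes> (t m \<ominus> t n))" using v_mult_ge[OF B[OF g(1)] n1[OF g(5,6)]] e by simp
    moreover have "ereal C \<le> v (t n \<otimes> (s m \<ominus> s n))" using v_mult_ge[OF D[OF g(2)] n0[OF g(3,4)]] e by simp
    ultimately show ?thesis using min_le_v[OF _ _ v_add] e by simp
  qed
  then show "\<exists>n0. \<forall>m\<ge>n0. \<forall>n\<ge>n0. ereal C \<le> v ((s m \<otimes> t m) \<ominus> (s n \<otimes> t n))" by blast
qed

lemma CR_cring: "cring CR"
proof (intro cringI abelian_groupI comm_monoidI)
  fix s assume s: "s \<in> carrier CR"
  then show "\<exists>t\<in>carrier CR. t \<oplus>\<^bsub>CR\<^esub> s = \<zero>\<^bsub>CR\<^esub>"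
    using CR_elem[OF s] by (intro bexI[OF _ CR_uminus[OF s]]) (simp add: l_neg)
qed (auto simp: CR_add CR_mult const_CR CR_elem a_assoc m_assoc l_distr,
     auto simp: fun_eq_iff CR_elem intro: a_comm m_comm)

sublocale C: cring CR by (rule CR_cring)

lemma C_uminus: "s \<in> carrier CR \<Longrightarrow> (\<ominus>\<^bsub>CR\<^esub> s) = (\<lambda>n. \<ominus> s n)"
  by (rule C.minus_equality) (auto simp: CR_uminus CR_elem l_neg)

lemma evge_add: "evge C s \<Longrightarrow> evge C t \<Longrightarrow> (\<And>n. s n \<in> carrier K) \<Longrightarrow> (\<And>n. t n \<in> carrier K) \<Longrightarrow> evge C (\<lambda>n. s n \<oplus> t n)"
proof -
  assume *: "evge C s" "evge C t" and e: "\<And>n. s n \<in> carrier K" "\<And>n. t n \<in> carrier K"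
  obtain n0 n1 where "\<forall>n\<ge>n0. ereal C \<le> v (s n)" "\<forall>n\<ge>n1. ereal C \<le> v (t n)" using * unfolding evge_def by blast
  then show ?thesis unfolding evge_def using min_le_v[OF _ _ v_add[OF e]] by (intro exI[of _ "max n0 n1"]) auto
qed

lemma NS_ideal: "ideal NS CR"
proof (rule idealI)
  show "ring CR" by (rule C.ring_axioms)
  show "subgroup NS (add_monoid CR)"
  proof
    show "NS \<subseteq> carrier (add_monoid CR)" by (auto simp: null_iff)
    show "s \<otimes>\<^bsub>add_monoid CR\<^esub> t \<in> NS" if "s \<in> NS" "t \<in> NS" for s t
      using that by (auto simp: null_iff CR_add CR_elem intro!: evge_add)
    show "\<one>\<^bsub>add_monoid CR\<^esub> \<in> NS" by (auto simp: null_iff const_CR evge_def v_zero)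
    show "inv\<^bsub>add_monoid CR\<^esub> s \<in> NS" if "s \<in> NS" for s
    proof -
      have "inv\<^bsub>add_monoid CR\<^esub> s = (\<lambda>n. \<ominus> s n)" using C_uminus[of s] that by (simp add: a_inv_def null_iff)
      then show ?thesis using that by (auto simp: null_iff CR_uminus CR_elem evge_def v_uminus)
    qed
  qed
  show l: "t \<otimes>\<^bsub>CR\<^esub> s \<in> NS" if sN: "s \<in> NS" and tC: "t \<in> carrier CR" for s t
  proof -
    have s: "s \<in> carrier CR" "\<And>C. evge C s" using sN by (auto simp: null_iff)
    obtain n0 B where B: "\<And>n. n0 \<le> n \<Longrightarrow> ereal B \<le> v (t n)" using CR_bounded[OF tC] by blast
    have "evge C (\<lambda>n. t n \<otimes> s n)" for C
    proof -
      obtain n1 where "\<forall>n\<ge>n1. ereal (C - B) \<le> v (s n)" using s(2)[of "C - B"] unfolding evge_def by blast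
      then show ?thesis unfolding evge_def
        using v_mult_ge[OF B] CR_elem[OF s(1)] CR_elem[OF tC] by (intro exI[of _ "max n0 n1"]) auto
    qed
    then show ?thesis using CR_mult[OF tC s(1)] by (simp add: null_iff)
  qed
  show "s \<otimes>\<^bsub>CR\<^esub> t \<in> NS" if "s \<in> NS" "t \<in> carrier CR" for s t
    using l[OF that] that C.m_comm[of s t] by (simp add: null_iff)
qed

section \<open>The completion as a quotient of the ring of Cauchy sequences\<close>

sublocale N: ideal NS CR by (rule NS_ideal)

abbreviation cl :: "(nat \<Rightarrow> 'a) \<Rightarrow> (nat \<Rightarrow> 'a) set" where "cl s \<equiv> NS +>\<^bsub>CR\<^esub> s"
abbreviation KC where "KC \<equiv> completion K v"
abbreviation emb where "emb \<equiv> to_completion K v"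

lemma KC_cring: "cring KC"
  unfolding completion_def by (rule N.quotient_is_cring[OF CR_cring])

lemma cl_hom: "cl \<in> Ring.ring_hom CR KC"
  unfolding completion_def by (rule N.rcos_ring_hom)

sublocale cl: ring_hom_cring CR KC cl
  by (intro ring_hom_cringI CR_cring KC_cring cl_hom)

lemma KC_carrier: "\<xi> \<in> carrier KC \<longleftrightarrow> (\<exists>s\<in>carrier CR. \<xi> = cl s)"
  by (auto simp: completion_def FactRing_def A_RCOSETS_def')

lemma cl_zero_iff: "s \<in> carrier CR \<Longrightarrow> cl s = \<zero>\<^bsub>KC\<^esub> \<longleftrightarrow> s \<in> NS"
  using N.a_rcos_const[of s] N.a_rcos_self[of s] by (auto simp: completion_def FactRing_def)

lemma emb_eq: "emb x = cl (\<lambda>n. x)"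
  by (simp add: to_completion_def)

lemma emb_hom: "emb \<in> Ring.ring_hom K KC"
proof -
  have "(\<lambda>x n. x) \<in> Ring.ring_hom K CR"
    by (rule ring_hom_memI) (auto simp: const_CR)
  then have "cl \<circ> (\<lambda>x n. x) \<in> Ring.ring_hom K KC" using cl_hom by (rule ring_hom_trans)
  then show ?thesis by (simp add: emb_eq[abs_def] comp_def)
qed

lemma emb_ring_hom_cring: "ring_hom_cring K KC emb"
  by (intro ring_hom_cringI cring_axioms KC_cring emb_hom)

lemma mem_cl: "s \<in> carrier CR \<Longrightarrow> t \<in> cl s \<longleftrightarrow> (\<exists>z\<in>NS. t = (\<lambda>n. z n \<oplus> s n))"
  by (auto simp: a_r_coset_def')

text \<open>This makes the description in \<open>completion_ord\<close> independent of the
  representative. For a class that is not zero the valuations are eventually a constant, which the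
  valuations of the null summand eventually exceed.\<close>

lemma lim_cl:
  assumes s: "s \<in> carrier CR" and lim: "(\<lambda>n. v (s n)) \<longlonglongrightarrow> l" and t: "t \<in> cl s"
  shows "(\<lambda>n. v (t n)) \<longlonglongrightarrow> l"
proof -
  obtain z where z: "z \<in> NS" "t = (\<lambda>n. z n \<oplus> s n)" using t mem_cl[OF s] by blast
  have zc: "z \<in> carrier CR" and ze: "\<And>C. evge C z" using z by (auto simp: null_iff)
  show ?thesis
  proof (cases "s \<in> NS")
    case True
    then have "t \<in> NS" using z by (auto simp: null_iff CR_add CR_elem intro!: evge_add)
    then have "(\<lambda>n. v (t n)) \<longlonglongrightarrow> \<infinity>" by (rule null_lim)
    moreover have "l = \<infinity>" by (rule LIMSEQ_unique[OF lim null_lim[OF True]])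
    ultimately show ?thesis by simp
  next
    case False
    obtain n0 and k :: int where k: "\<And>n. n0 \<le> n \<Longrightarrow> v (s n) = ereal (of_int k)" using nonnull_const[OF s False] by blast
    obtain n1 where n1: "\<forall>n\<ge>n1. ereal (of_int k + 1) \<le> v (z n)" using ze[of "of_int k + 1"] unfolding evge_def by blast
    have "v (t n) = v (s n)" if "max n0 n1 \<le> n" for n
    proof -
      have "t n \<ominus> s n = z n" unfolding z(2) using CR_elem[OF s] CR_elem[OF zc] by (simp add: a_minus_def a_assoc r_neg)
      moreover have "v (s n) < v (z n)"
        using k[of n] n1 that less_le_trans[of "ereal (of_int k)" "ereal (of_int k + 1)" "v (z n)"] by simp
      ultimately show ?thesis using v_eq_of_diff[of "t n" "s n"] CR_elem[OF s] CR_elem[OF zc] by (simp add: z(2))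
    qed
    then show ?thesis using lim tendsto_cong[of "\<lambda>n. v (t n)" "\<lambda>n. v (s n)" sequentially l]
      eventually_sequentiallyI[of "max n0 n1" "\<lambda>n. v (t n) = v (s n)"] by simp
  qed
qed

lemma ord_cl:
  assumes s: "s \<in> carrier CR" and lim: "(\<lambda>n. v (s n)) \<longlonglongrightarrow> l"
  shows "completion_ord v (cl s) = l"
  unfolding completion_def completion_ord_def
proof (rule the_equality)
  show "\<forall>t\<in>cl s. (\<lambda>n. v (t n)) \<longlonglongrightarrow> l" using lim_cl[OF s lim] by blast
  fix l' assume "\<forall>t\<in>cl s. (\<lambda>n. v (t n)) \<longlonglongrightarrow> l'"
  then have "(\<lambda>n. v (s n)) \<longlonglongrightarrow> l'" using N.a_rcos_self[OF s] by blast
  then show "l' = l" using LIMSEQ_unique[OF _ lim] by blast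
qed

lemma emb_ord: "x \<in> carrier K \<Longrightarrow> completion_ord v (emb x) = v x"
  unfolding emb_eq by (rule ord_cl[OF const_CR]) auto

text \<open>Minus infinity is excluded so that limits of valuations can be added in
  \<open>ereal\<close>.\<close>

lemma lim_exists:
  assumes "s \<in> carrier CR"
  obtains l where "(\<lambda>n. v (s n)) \<longlonglongrightarrow> l" "l \<noteq> - \<infinity>"
proof (cases "s \<in> NS")
  case True
  show ?thesis by (rule that[OF null_lim[OF True]]) simp
next
  case False
  obtain n0 and k :: int where k: "\<And>n. n0 \<le> n \<Longrightarrow> v (s n) = ereal (of_int k)" using nonnull_const[OF assms False] by blast
  have "(\<lambda>n. v (s n)) \<longlonglongrightarrow> ereal (of_int k)"
    by (rule tendsto_eventually) (use k in \<open>auto intro: eventually_sequentiallyI\<close>)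
  then show ?thesis using that by simp
qed

lemma ord_mult:
  assumes "\<xi> \<in> carrier KC" "\<eta> \<in> carrier KC"
  shows "completion_ord v (\<xi> \<otimes>\<^bsub>KC\<^esub> \<eta>) = completion_ord v \<xi> + completion_ord v \<eta>"
proof -
  obtain s t where st: "s \<in> carrier CR" "\<xi> = cl s" "t \<in> carrier CR" "\<eta> = cl t" using assms unfolding KC_carrier by blast
  obtain l where l: "(\<lambda>n. v (s n)) \<longlonglongrightarrow> l" "l \<noteq> - \<infinity>" using lim_exists[OF st(1)] .
  obtain l' where l': "(\<lambda>n. v (t n)) \<longlonglongrightarrow> l'" "l' \<noteq> - \<infinity>" using lim_exists[OF st(3)] .
  have "(\<lambda>n. v (s n \<otimes> t n)) \<longlonglongrightarrow> l + l'"
  \<comment> \<open>If one class is zero, so is the product, and the infinite limit absorbs the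
    other one, which is not minus infinity.\<close>
  proof (cases "s \<in> NS \<or> t \<in> NS")
    case True
    then have "(\<lambda>n. s n \<otimes> t n) \<in> NS" using N.I_l_closed[OF _ st(1), of t] N.I_r_closed[OF _ st(3), of s] by auto
    from null_lim[OF this] have "(\<lambda>n. v (s n \<otimes> t n)) \<longlonglongrightarrow> \<infinity>" .
    moreover have "l = \<infinity> \<or> l' = \<infinity>"
      using True LIMSEQ_unique[OF l(1) null_lim] LIMSEQ_unique[OF l'(1) null_lim] by blast
    then have "l + l' = \<infinity>" using l(2) l'(2) by (cases l; cases l') auto
    ultimately show ?thesis by (simp only:)
  next
    case False
    obtain n0 and k :: int where k: "\<And>n. n0 \<le> n \<Longrightarrow> v (s n) = ereal (of_int k)" using nonnull_const[OF st(1)] False by blast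
    obtain n1 and k' :: int where k': "\<And>n. n1 \<le> n \<Longrightarrow> v (t n) = ereal (of_int k')" using nonnull_const[OF st(3)] False by blast
    have "(\<lambda>n. v (s n)) \<longlonglongrightarrow> ereal (of_int k)"
      by (rule tendsto_eventually) (use k in \<open>auto intro: eventually_sequentiallyI\<close>)
    then have l_eq: "l = ereal (of_int k)" using LIMSEQ_unique[OF l(1)] by blast
    have "(\<lambda>n. v (t n)) \<longlonglongrightarrow> ereal (of_int k')"
      by (rule tendsto_eventually) (use k' in \<open>auto intro: eventually_sequentiallyI\<close>)
    then have l'_eq: "l' = ereal (of_int k')" using LIMSEQ_unique[OF l'(1)] by blast
    show ?thesis unfolding l_eq l'_eq
      by (rule tendsto_eventually, rule eventually_sequentiallyI[of "max n0 n1"])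
        (use k k' v_mult CR_elem[OF st(1)] CR_elem[OF st(3)] in auto)
  qed
  then have "completion_ord v (cl (\<lambda>n. s n \<otimes> t n)) = l + l'" by (rule ord_cl[OF CR_mult[OF st(1,3)]])
  moreover have "\<xi> \<otimes>\<^bsub>KC\<^esub> \<eta> = cl (\<lambda>n. s n \<otimes> t n)" using cl.hom_mult[OF st(1,3)] st by simp
  ultimately show ?thesis using ord_cl[OF st(1) l(1)] ord_cl[OF st(3) l'(1)] st by simp
qed

abbreviation VR where "VR \<equiv> valuation_ring K v"

lemma VR_iff: "\<xi> \<in> VR \<longleftrightarrow> \<xi> \<in> carrier KC \<and> 0 \<le> completion_ord v \<xi>"
  by (simp add: valuation_ring_def)

lemma cl_VR:
  assumes "s \<in> carrier CR" "evge 0 s"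
  shows "cl s \<in> VR"
proof -
  obtain l where l: "(\<lambda>n. v (s n)) \<longlonglongrightarrow> l" "l \<noteq> - \<infinity>" using lim_exists[OF assms(1)] .
  obtain n0 where "\<forall>n\<ge>n0. 0 \<le> v (s n)" using assms(2) unfolding evge_def by (auto simp: zero_ereal_def)
  then have "0 \<le> l" by (intro LIMSEQ_le_const[OF l(1)]) blast
  then show ?thesis using ord_cl[OF assms(1) l(1)] assms(1) KC_carrier by (auto simp: VR_iff)
qed

text \<open>Any representative serves: if it is not null, its valuations are eventually equal to the
  order of the class.\<close>

lemma VR_E:
  assumes "\<xi> \<in> VR"
  obtains s where "s \<in> carrier CR" "\<xi> = cl s" "evge 0 s"
proof -
  obtain s where s: "s \<in> carrier CR" "\<xi> = cl s" using assms unfolding VR_iff KC_carrier by blast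
  have "evge 0 s"
  proof (cases "s \<in> NS")
    case True
    then show ?thesis by (simp add: null_iff)
  next
    case False
    obtain n0 and k :: int where k: "\<And>n. n0 \<le> n \<Longrightarrow> v (s n) = ereal (of_int k)" using nonnull_const[OF s(1) False] by blast
    have "(\<lambda>n. v (s n)) \<longlonglongrightarrow> ereal (of_int k)"
      by (rule tendsto_eventually) (use k in \<open>auto intro: eventually_sequentiallyI\<close>)
    then have "0 \<le> ereal (of_int k)" using ord_cl[OF s(1)] assms s(2) by (simp add: VR_iff)
    then show ?thesis unfolding evge_def using k by (intro exI[of _ n0]) (auto simp: zero_ereal_def)
  qed
  then show ?thesis using that s by blast
qed

lemma VR_subring: "subring VR KC"
proof (rule ring.subringI)
  show "ring KC" by (rule cl.S.ring_axioms)
  show "VR \<subseteq> carrier KC" by (auto simp: VR_iff)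
  show "\<one>\<^bsub>KC\<^esub> \<in> VR"
    using cl_VR[OF const_CR[OF one_closed]] cl.hom_one by (simp add: evge_def v_one zero_ereal_def)
  show "\<ominus>\<^bsub>KC\<^esub> \<xi> \<in> VR" if \<xi>: "\<xi> \<in> VR" for \<xi>
  proof -
    obtain s where s: "s \<in> carrier CR" "\<xi> = cl s" "evge 0 s" using VR_E[OF \<xi>] .
    have "\<ominus>\<^bsub>KC\<^esub> \<xi> = cl (\<lambda>n. \<ominus> s n)" using cl.hom_a_inv[OF s(1)] s C_uminus[OF s(1)] by simp
    then show ?thesis using cl_VR[OF CR_uminus[OF s(1)]] s CR_elem[OF s(1)] by (simp add: evge_def v_uminus)
  qed
  show "\<xi> \<otimes>\<^bsub>KC\<^esub> \<eta> \<in> VR" if "\<xi> \<in> VR" "\<eta> \<in> VR" for \<xi> \<eta>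
    using that ord_mult[of \<xi> \<eta>] by (auto simp: VR_iff)
  show "\<xi> \<oplus>\<^bsub>KC\<^esub> \<eta> \<in> VR" if \<xi>: "\<xi> \<in> VR" and \<eta>: "\<eta> \<in> VR" for \<xi> \<eta>
  proof -
    obtain s where s: "s \<in> carrier CR" "\<xi> = cl s" "evge 0 s" using VR_E[OF \<xi>] .
    obtain t where t: "t \<in> carrier CR" "\<eta> = cl t" "evge 0 t" using VR_E[OF \<eta>] .
    have "\<xi> \<oplus>\<^bsub>KC\<^esub> \<eta> = cl (\<lambda>n. s n \<oplus> t n)" using cl.hom_add[OF s(1) t(1)] s t by simp
    then show ?thesis using cl_VR[OF CR_add[OF s(1) t(1)]] evge_add[OF s(3) t(3)] CR_elem s(1) t(1) by simp
  qed
qed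

text \<open>A Cauchy sequence differs from one of its late terms by a sequence of eventually
  nonnegative valuation.\<close>

lemma KC_dense:
  assumes "\<xi> \<in> carrier KC"
  shows "\<exists>x\<in>carrier K. \<exists>r\<in>VR. \<xi> = emb x \<oplus>\<^bsub>KC\<^esub> r"
proof -
  obtain s where s: "s \<in> carrier CR" "\<xi> = cl s" using assms unfolding KC_carrier by blast
  note e = CR_elem[OF s(1)]
  obtain n0 where n0: "\<And>m n. n0 \<le> m \<Longrightarrow> n0 \<le> n \<Longrightarrow> ereal 0 \<le> v (s m \<ominus> s n)" using CR_cauchy[OF s(1)] by blast
  let ?t = "\<lambda>n. s n \<oplus> \<ominus> s n0"
  have t: "?t \<in> carrier CR" using e by (intro CR_add s const_CR) auto
  have "evge 0 ?t" unfolding evge_def using n0 by (auto simp: a_minus_def)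
  then have "cl ?t \<in> VR" by (rule cl_VR[OF t])
  moreover have "\<xi> = emb (s n0) \<oplus>\<^bsub>KC\<^esub> cl ?t"
  proof -
    have "emb (s n0) \<oplus>\<^bsub>KC\<^esub> cl ?t = cl (\<lambda>n. s n0 \<oplus> (s n \<oplus> \<ominus> s n0))"
      using cl.hom_add[OF const_CR[OF e] t] by (simp add: emb_eq)
    also have "(\<lambda>n. s n0 \<oplus> (s n \<oplus> \<ominus> s n0)) = s"
      using e by (auto simp: fun_eq_iff a_lcomm r_neg)
    finally show ?thesis using s by simp
  qed
  ultimately show ?thesis using e by blast
qed

text \<open>Terms are inverted one by one. Beyond some index the valuations equal a constant
  \<open>k\<close>, so no term vanishes and differences of inverses stay controlled.\<close>

lemma KC_inverse:
  assumes "\<xi> \<in> carrier KC" "\<xi> \<noteq> \<zero>\<^bsub>KC\<^esub>"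
  obtains \<eta> and k :: int where "\<eta> \<in> carrier KC" "\<xi> \<otimes>\<^bsub>KC\<^esub> \<eta> = \<one>\<^bsub>KC\<^esub>"
    "completion_ord v \<xi> = ereal (of_int k)" "completion_ord v \<eta> = ereal (- of_int k)"
proof -
  obtain s where s: "s \<in> carrier CR" "\<xi> = cl s" using assms unfolding KC_carrier by blast
  have nn: "s \<notin> NS" using cl_zero_iff[OF s(1)] s assms by simp
  note e = CR_elem[OF s(1)]
  obtain n0 and k :: int where k: "\<And>n. n0 \<le> n \<Longrightarrow> v (s n) = ereal (of_int k)" using nonnull_const[OF s(1) nn] by blast
  \<comment> \<open>Terms before \<open>n0\<close> may vanish, so zero is put there; finitely many
    terms do not affect the class.\<close>
  define t where "t = (\<lambda>n. if n0 \<le> n then inv s n else \<zero>)"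
  have nz: "s n \<noteq> \<zero>" if "n0 \<le> n" for n using k[OF that] v_zero by auto
  have inv: "inv s n \<in> carrier K" "s n \<otimes> inv s n = \<one>" if "n0 \<le> n" for n
    using nz[OF that] e[of n] field_Units by (auto simp: Units_inv_closed Units_r_inv)
  have te: "t n \<in> carrier K" for n using inv by (simp add: t_def)
  have vi: "v (inv s n) = ereal (- of_int k)" if "n0 \<le> n" for n
  proof -
    have "ereal (of_int k) + v (inv s n) = 0" using v_mult[OF e inv(1)[OF that], of n] inv(2)[OF that] v_one k[OF that] by simp
    then show ?thesis by (cases "v (inv s n)") (auto simp: zero_ereal_def)
  qed
  have t: "t \<in> carrier CR"
  proof (rule CR_I[OF te])
    fix C
    \<comment> \<open>The difference of two inverses is a difference of terms divided by two terms
      of valuation \<open>k\<close>; hence the shift by \<open>2 * k\<close>.\<close>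
    obtain n1 where n1: "\<And>m n. n1 \<le> m \<Longrightarrow> n1 \<le> n \<Longrightarrow> ereal (2 * of_int k + C) \<le> v (s m \<ominus> s n)" using CR_cauchy[OF s(1)] by blast
    have "ereal C \<le> v (t m \<ominus> t n)" if "max n0 n1 \<le> m" "max n0 n1 \<le> n" for m n
    proof -
      have g: "n0 \<le> m" "n0 \<le> n" "n1 \<le> m" "n1 \<le> n" using that by auto
      note im = inv[OF g(1)] and inn = inv[OF g(2)]
      have "inv s m \<otimes> (inv s n \<otimes> (s n \<ominus> s m)) = inv s m \<otimes> (s n \<otimes> inv s n) \<ominus> inv s n \<otimes> (s m \<otimes> inv s m)"
        using im(1) inn(1) e by (simp add: a_minus_def r_distr r_minus m_ac)
      then have eq: "t m \<ominus> t n = inv s m \<otimes> (inv s n \<otimes> (s n \<ominus> s m))"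
        using im inn g by (simp add: t_def)
      have "ereal (C - - of_int k - - of_int k) \<le> v (s n \<ominus> s m)" using n1[OF g(4,3)] by simp
      then have "ereal (C - - of_int k) \<le> v (inv s n \<otimes> (s n \<ominus> s m))"
        using im inn e vi[OF g(2)] by (intro v_mult_ge[where B = "- of_int k"]) auto
      moreover have "ereal (- of_int k) \<le> v (inv s m)" using vi[OF g(1)] by simp
      ultimately show ?thesis unfolding eq
        using im inn e by (intro v_mult_ge[of "- of_int k" "inv s m" C "inv s n \<otimes> (s n \<ominus> s m)"] m_closed minus_closed)
    qed
    then show "\<exists>n0. \<forall>m\<ge>n0. \<forall>n\<ge>n0. ereal C \<le> v (t m \<ominus> t n)" by blast
  qed
  have ls: "(\<lambda>n. v (s n)) \<longlonglongrightarrow> ereal (of_int k)"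
    by (rule tendsto_eventually) (use k in \<open>auto intro: eventually_sequentiallyI\<close>)
  have lt: "(\<lambda>n. v (t n)) \<longlonglongrightarrow> ereal (- of_int k)"
    by (rule tendsto_eventually, rule eventually_sequentiallyI[of n0]) (use vi in \<open>auto simp: t_def\<close>)
  have "\<xi> \<otimes>\<^bsub>KC\<^esub> cl t = cl (\<lambda>n. s n \<otimes> t n)" using cl.hom_mult[OF s(1) t] s by simp
  also have "\<dots> = cl (\<lambda>n. \<one>)"
  proof -
    \<comment> \<open>The product is 1 only from \<open>n0\<close> on, so it differs from the
      constant sequence by a null sequence.\<close>
    let ?z = "\<lambda>n. s n \<otimes> t n \<oplus> \<ominus> \<one>"
    have st: "(\<lambda>n. s n \<otimes> t n) \<in> carrier CR" by (rule CR_mult[OF s(1) t])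
    have zc: "?z \<in> carrier CR" by (intro CR_add st const_CR) auto
    have "evge C ?z" for C
      unfolding evge_def using inv by (intro exI[of _ n0]) (auto simp: t_def r_neg v_zero)
    then have z: "?z \<in> NS" using zc by (simp add: null_iff)
    have "cl (\<lambda>n. s n \<otimes> t n) = cl (?z \<oplus>\<^bsub>CR\<^esub> (\<lambda>n. \<one>))"
      using CR_elem[OF st] by (simp add: a_assoc l_neg)
    also have "\<dots> = cl ?z \<oplus>\<^bsub>KC\<^esub> cl (\<lambda>n. \<one>)" by (rule cl.hom_add[OF zc const_CR]) simp
    also have "\<dots> = cl (\<lambda>n. \<one>)" using z cl_zero_iff[OF zc] cl.hom_closed[OF const_CR[OF one_closed]] by simp
    finally show ?thesis .
  qed
  finally have "\<xi> \<otimes>\<^bsub>KC\<^esub> cl t = \<one>\<^bsub>KC\<^esub>" using cl.hom_one by simp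
  then show ?thesis using that[of "cl t" k] ord_cl[OF s(1) ls] ord_cl[OF t lt] cl.hom_closed[OF t] s by simp
qed

lemma KC_one_not_zero: "\<one>\<^bsub>KC\<^esub> \<noteq> \<zero>\<^bsub>KC\<^esub>"
proof
  assume "\<one>\<^bsub>KC\<^esub> = \<zero>\<^bsub>KC\<^esub>"
  then have "(\<lambda>n. \<one>) \<in> NS" using cl_zero_iff[OF const_CR[OF one_closed]] cl.hom_one by simp
  then have "evge 1 (\<lambda>n. \<one>)" by (simp add: null_iff)
  then show False by (auto simp: evge_def v_one zero_ereal_def)
qed

end

section \<open>The valuation of a prime of a principal ideal domain\<close>

text \<open>Collects what is used of a prime of a principal ideal domain: a generator
  \<open>\<pi>\<close>, finite divisibility of nonzero elements by its powers, and a Bezout relation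
  with every element outside \<open>P\<close>.\<close>

locale frac_prime = field K for K :: "'a ring" (structure) +
  fixes R :: "'a set" and P :: "'a set" and \<pi> :: 'a
  assumes R: "subring R K"
    and frac: "\<forall>x \<in> carrier K. \<exists>a \<in> R. \<exists>b \<in> R - {\<zero>}. x = a \<otimes> inv b"
    and \<pi>: "\<pi> \<in> R" "\<pi> \<noteq> \<zero>"
    and P: "P = {\<pi> \<otimes> r | r. r \<in> R}"
    and prime: "\<And>a b. a \<in> R \<Longrightarrow> b \<in> R \<Longrightarrow> a \<otimes> b \<in> P \<Longrightarrow> a \<in> P \<or> b \<in> P"
    and one_P: "\<one> \<notin> P"
    and bounded: "\<And>a. a \<in> R \<Longrightarrow> a \<noteq> \<zero> \<Longrightarrow> \<exists>n :: nat. \<not> (\<exists>r \<in> R. a = \<pi> [^] n \<otimes> r)"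
    and bezout: "\<And>b. b \<in> R \<Longrightarrow> b \<notin> P \<Longrightarrow> \<exists>\<alpha> \<in> R. \<exists>\<beta> \<in> R. \<one> = \<alpha> \<otimes> \<pi> \<oplus> \<beta> \<otimes> b"
begin

abbreviation D where "D \<equiv> K\<lparr>carrier := R\<rparr>"
abbreviation v where "v \<equiv> ord_at K R P"

lemma Rc: "a \<in> R \<Longrightarrow> a \<in> carrier K" using subringE(1)[OF R] by blast

lemma R_mult: "a \<in> R \<Longrightarrow> b \<in> R \<Longrightarrow> a \<otimes> b \<in> R" by (rule subringE(6)[OF R])
lemma R_add: "a \<in> R \<Longrightarrow> b \<in> R \<Longrightarrow> a \<oplus> b \<in> R" by (rule subringE(7)[OF R])
lemma R_one: "\<one> \<in> R" by (rule subringE(3)[OF R])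
lemma R_zero: "\<zero> \<in> R" by (rule subringE(2)[OF R])
lemma R_pow: "a \<in> R \<Longrightarrow> a [^] (n :: nat) \<in> R" by (induction n) (auto simp: R_one R_mult)

lemma pc: "\<pi> \<in> carrier K" "\<pi> [^] (n :: nat) \<in> carrier K" "\<pi> [^] n \<noteq> \<zero>"
proof -
  show c: "\<pi> \<in> carrier K" using \<pi> Rc by blast
  then show "\<pi> [^] (n :: nat) \<in> carrier K" by simp
  show "\<pi> [^] n \<noteq> \<zero>" using c \<pi>(2) by (induction n) (auto simp: integral_iff)
qed

text \<open>These elements are the denominators of the localisation of \<open>R\<close> at
  \<open>P\<close>.\<close>

definition NP :: "'a \<Rightarrow> bool" where "NP b \<longleftrightarrow> b \<in> R \<and> b \<notin> P"

lemma NP_mult: "NP a \<Longrightarrow> NP b \<Longrightarrow> NP (a \<otimes> b)"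
  using prime R_mult by (auto simp: NP_def)

lemma NP_one: "NP \<one>" using R_one one_P by (simp add: NP_def)

lemma NP_c: "NP b \<Longrightarrow> b \<in> carrier K" "NP b \<Longrightarrow> b \<in> R" by (auto simp: NP_def Rc)

lemma NP_nonzero: "NP b \<Longrightarrow> b \<noteq> \<zero>"
proof
  assume b: "NP b" "b = \<zero>"
  then have "b = \<pi> \<otimes> \<zero>" using pc by simp
  then have "b \<in> P" unfolding P using R_zero by blast
  then show False using b by (simp add: NP_def)
qed

lemma decomp:
  assumes "a \<in> R" "a \<noteq> \<zero>"
  obtains n :: nat and a' where "NP a'" "a = \<pi> [^] n \<otimes> a'"
proof -
  \<comment> \<open>The least exponent that fails; \<open>bounded\<close> provides one, it is not 0,
    and its predecessor is the multiplicity of \<open>\<pi>\<close> in \<open>a\<close>.\<close>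
  define n where "n = (LEAST n :: nat. \<not> (\<exists>r \<in> R. a = \<pi> [^] n \<otimes> r))"
  have n: "\<not> (\<exists>r \<in> R. a = \<pi> [^] n \<otimes> r)" unfolding n_def by (rule LeastI_ex[OF bounded[OF assms]])
  have "n \<noteq> 0"
  proof
    assume "n = 0"
    then have "a = \<pi> [^] n \<otimes> a" using assms Rc by simp
    then show False using n assms by blast
  qed
  then obtain m where m: "n = Suc m" by (cases n) auto
  have "m < n" using m by simp
  then obtain r where r: "r \<in> R" "a = \<pi> [^] m \<otimes> r" using not_less_Least unfolding n_def by blast
  have "r \<notin> P"
  proof
    assume "r \<in> P"
    then obtain s where "s \<in> R" "r = \<pi> \<otimes> s" by (auto simp: P)
    then have "a = \<pi> [^] n \<otimes> s" using r pc Rc m by (simp add: m_assoc)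
    then show False using n \<open>s \<in> R\<close> by blast
  qed
  then show ?thesis using that[of r m] r by (simp add: NP_def)
qed

text \<open>The iterated ideal products in \<open>ring_ord\<close> start from the whole ring; for a
  principal ideal they are generated by the powers of the generator.\<close>

lemma P_pow: "(ideal_prod D P ^^ n) (carrier D) = {\<pi> [^] n \<otimes> r | r. r \<in> R}"
proof (induction n)
  case 0
  have "R = {\<one> \<otimes> r | r. r \<in> R}" using Rc by force
  then show ?case by simp
next
  case (Suc n)
  have "ideal_prod D P {\<pi> [^] n \<otimes> r | r. r \<in> R} = {\<pi> [^] Suc n \<otimes> r | r. r \<in> R}"
  proof (intro equalityI subsetI)
    fix x assume "x \<in> ideal_prod D P {\<pi> [^] n \<otimes> r | r. r \<in> R}"
    then show "x \<in> {\<pi> [^] Suc n \<otimes> r | r. r \<in> R}"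
    proof (induction x rule: ideal_prod.induct)
      case (prod i j)
      then obtain r s where rs: "r \<in> R" "s \<in> R" "i = \<pi> \<otimes> r" "j = \<pi> [^] n \<otimes> s" by (auto simp: P)
      then have "i \<otimes>\<^bsub>D\<^esub> j = \<pi> [^] Suc n \<otimes> (r \<otimes> s)" using Rc pc by (simp add: m_ac)
      then show ?case using R_mult rs by blast
    next
      case (sum s1 s2)
      then obtain r s where rs: "r \<in> R" "s \<in> R" "s1 = \<pi> [^] Suc n \<otimes> r" "s2 = \<pi> [^] Suc n \<otimes> s" by blast
      then have "s1 \<oplus>\<^bsub>D\<^esub> s2 = \<pi> [^] Suc n \<otimes> (r \<oplus> s)" using Rc pc(2)[of "Suc n"] by (simp add: r_distr del: nat_pow_Suc)
      then show ?case using R_add rs by blast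
    qed
  next
    fix x assume "x \<in> {\<pi> [^] Suc n \<otimes> r | r. r \<in> R}"
    then obtain r where r: "r \<in> R" "x = \<pi> [^] Suc n \<otimes> r" by blast
    have "\<pi> \<otimes>\<^bsub>D\<^esub> (\<pi> [^] n \<otimes> r) \<in> ideal_prod D P {\<pi> [^] n \<otimes> r | r. r \<in> R}"
    proof (rule ideal_prod.prod)
      have "\<pi> = \<pi> \<otimes> \<one>" using pc by simp
      then show "\<pi> \<in> P" unfolding P using R_one by blast
    qed (use r in blast)
    moreover have "x = \<pi> \<otimes> (\<pi> [^] n \<otimes> r)" using r Rc pc by (simp add: m_ac)
    ultimately show "x \<in> ideal_prod D P {\<pi> [^] n \<otimes> r | r. r \<in> R}" by simp
  qed
  then show ?case using Suc by simp
qed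

text \<open>Otherwise a factor \<open>\<pi>\<close> would remain in \<open>c\<close> after
  \<open>\<pi> [^] i\<close> is cancelled.\<close>

lemma pow_le:
  assumes "NP c" "e \<in> R" "\<pi> [^] (i :: nat) \<otimes> c = \<pi> [^] (j :: nat) \<otimes> e"
  shows "j \<le> i"
proof (rule ccontr)
  assume "\<not> j \<le> i"
  then obtain k where k: "j = i + Suc k" by (metis add_Suc_right less_imp_Suc_add not_le)
  have "\<pi> [^] j = \<pi> [^] i \<otimes> (\<pi> \<otimes> \<pi> [^] k)"
    unfolding k using pc(1,2) by (simp add: nat_pow_mult[symmetric] m_ac)
  then have "\<pi> [^] i \<otimes> c = \<pi> [^] i \<otimes> (\<pi> \<otimes> (\<pi> [^] k \<otimes> e))"
    using assms pc Rc by (simp add: m_assoc)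
  then have "c = \<pi> \<otimes> (\<pi> [^] k \<otimes> e)"
    using m_lcancel[of "\<pi> [^] i"] pc assms Rc NP_c by simp
  then have "c \<in> P" unfolding P using R_mult[OF R_pow[OF \<pi>(1)] assms(2)] by blast
  then show False using assms by (simp add: NP_def)
qed

lemma ring_ord_eq:
  assumes "NP a'" "a = \<pi> [^] n \<otimes> a'"
  shows "ring_ord D P a = n"
  unfolding ring_ord_def
proof (rule Greatest_equality)
  show "a \<in> (ideal_prod D P ^^ n) (carrier D)" unfolding P_pow using assms NP_c by blast
  fix m assume "a \<in> (ideal_prod D P ^^ m) (carrier D)"
  then obtain r where "r \<in> R" "a = \<pi> [^] m \<otimes> r" unfolding P_pow by blast
  then show "m \<le> n" using pow_le[OF assms(1)] assms(2) by metis
qed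

text \<open>States that \<open>x\<close> is a power of \<open>\<pi>\<close> with exponent
  \<open>m - n\<close> times a fraction prime to \<open>\<pi>\<close>. Denominators are cleared and
  the exponent is kept as a pair of naturals, so the products below are computed without
  inverses.\<close>

definition V :: "'a \<Rightarrow> nat \<Rightarrow> nat \<Rightarrow> bool" where
  "V x m n \<longleftrightarrow> (\<exists>a b. NP a \<and> NP b \<and> x \<otimes> (\<pi> [^] n \<otimes> b) = \<pi> [^] m \<otimes> a)"

lemma V_unique:
  assumes "x \<in> carrier K" "V x m n" "V x m' n'"
  shows "m + n' = m' + n"
proof -
  obtain a b where ab: "NP a" "NP b" "x \<otimes> (\<pi> [^] n \<otimes> b) = \<pi> [^] m \<otimes> a" using assms by (auto simp: V_def)
  obtain c d where cd: "NP c" "NP d" "x \<otimes> (\<pi> [^] n' \<otimes> d) = \<pi> [^] m' \<otimes> c" using assms by (auto simp: V_def)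
  note cl = NP_c(1)[OF ab(1)] NP_c(1)[OF ab(2)] NP_c(1)[OF cd(1)] NP_c(1)[OF cd(2)] pc assms(1)
  have "\<pi> [^] (m + n') \<otimes> (a \<otimes> d) = (\<pi> [^] m \<otimes> a) \<otimes> (\<pi> [^] n' \<otimes> d)"
    using cl by (simp add: nat_pow_mult[symmetric] m_ac)
  also have "\<dots> = (x \<otimes> (\<pi> [^] n' \<otimes> d)) \<otimes> (\<pi> [^] n \<otimes> b)" unfolding ab(3)[symmetric] using cl by (simp add: m_ac)
  also have "\<dots> = \<pi> [^] (m' + n) \<otimes> (c \<otimes> b)" unfolding cd(3) using cl by (simp add: nat_pow_mult[symmetric] m_ac)
  finally have eq: "\<pi> [^] (m + n') \<otimes> (a \<otimes> d) = \<pi> [^] (m' + n) \<otimes> (c \<otimes> b)" .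
  have "NP (a \<otimes> d)" "NP (c \<otimes> b)" using ab cd NP_mult by auto
  then show ?thesis using pow_le[OF _ _ eq] pow_le[OF _ _ eq[symmetric]] NP_c by (meson le_antisym)
qed

lemma V_rep:
  assumes "a \<in> R - {\<zero>}" "b \<in> R - {\<zero>}" "x = a \<otimes> inv b"
  shows "V x (ring_ord D P a) (ring_ord D P b)"
proof -
  obtain n a' where a: "NP a'" "a = \<pi> [^] (n :: nat) \<otimes> a'" using decomp assms by blast
  obtain m b' where b: "NP b'" "b = \<pi> [^] (m :: nat) \<otimes> b'" using decomp assms by blast
  have bu: "b \<in> Units K" using assms Rc field_Units by auto
  have "x \<otimes> b = a" using assms bu Rc by (simp add: m_assoc Units_l_inv)
  then show ?thesis unfolding V_def ring_ord_eq[OF a] ring_ord_eq[OF b] using a b by auto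
qed

lemma V_ex:
  assumes "x \<in> carrier K" "x \<noteq> \<zero>"
  obtains a b where "a \<in> R - {\<zero>}" "b \<in> R - {\<zero>}" "x = a \<otimes> inv b"
proof -
  obtain a b where ab: "a \<in> R" "b \<in> R - {\<zero>}" "x = a \<otimes> inv b" using frac assms by blast
  moreover have "b \<in> Units K" using ab Rc field_Units by auto
  then have "a \<noteq> \<zero>" using ab assms by auto
  ultimately show ?thesis using that by blast
qed

text \<open>Shows that the description in \<open>ord_at\<close> has a unique solution: all fractions
  representing \<open>x\<close> give the same difference of multiplicities, by
  \<open>V_unique\<close>.\<close>

lemma ord_eq:
  assumes "x \<in> carrier K" "V x m n"
  shows "x \<noteq> \<zero>" "v x = ereal (real m - real n)"
proof -
  obtain a b where ab: "NP a" "NP b" "x \<otimes> (\<pi> [^] n \<otimes> b) = \<pi> [^] m \<otimes> a" using assms by (auto simp: V_def)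
  show nz: "x \<noteq> \<zero>"
  proof
    assume "x = \<zero>"
    then have "\<pi> [^] m \<otimes> a = \<zero>" using ab(3) NP_c(1)[OF ab(2)] pc(2) by simp
    then show False using integral[of "\<pi> [^] m" a] NP_nonzero[OF ab(1)] NP_c(1)[OF ab(1)] pc(2,3) by blast
  qed
  have key: "ereal (real (ring_ord D P a) - real (ring_ord D P b)) = ereal (real m - real n)"
    if "a \<in> R - {\<zero>}" "b \<in> R - {\<zero>}" "x = a \<otimes> inv b" for a b
    using V_unique[OF assms(1,2) V_rep[OF that]] by simp
  obtain a b where r: "a \<in> R - {\<zero>}" "b \<in> R - {\<zero>}" "x = a \<otimes> inv b" using V_ex[OF assms(1) nz] .
  have "(THE k. \<exists>a \<in> R - {\<zero>}. \<exists>b \<in> R - {\<zero>}. x = a \<otimes> inv b \<and>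
        k = ereal (real (ring_ord D P a) - real (ring_ord D P b))) = ereal (real m - real n)"
  proof (rule the_equality)
    show "\<exists>a \<in> R - {\<zero>}. \<exists>b \<in> R - {\<zero>}. x = a \<otimes> inv b \<and>
        ereal (real m - real n) = ereal (real (ring_ord D P a) - real (ring_ord D P b))"
      using r key[OF r] by (intro bexI[of _ a] bexI[of _ b]) simp_all
  qed (use key in blast)
  then show "v x = ereal (real m - real n)" using nz by (simp add: ord_at_def)
qed

lemma V_of:
  assumes "x \<in> carrier K" "x \<noteq> \<zero>"
  shows "\<exists>m n. V x m n"
proof -
  obtain a b where "a \<in> R - {\<zero>}" "b \<in> R - {\<zero>}" "x = a \<otimes> inv b" using V_ex[OF assms] .
  then have "V x (ring_ord D P a) (ring_ord D P b)" by (rule V_rep)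
  then show ?thesis by (intro exI)
qed

lemma V_mult:
  assumes "x \<in> carrier K" "y \<in> carrier K" "V x m n" "V y m' n'"
  shows "V (x \<otimes> y) (m + m') (n + n')"
proof -
  obtain a b where ab: "NP a" "NP b" "x \<otimes> (\<pi> [^] n \<otimes> b) = \<pi> [^] m \<otimes> a" using assms by (auto simp: V_def)
  obtain c d where cd: "NP c" "NP d" "y \<otimes> (\<pi> [^] n' \<otimes> d) = \<pi> [^] m' \<otimes> c" using assms by (auto simp: V_def)
  note cl = NP_c(1)[OF ab(1)] NP_c(1)[OF ab(2)] NP_c(1)[OF cd(1)] NP_c(1)[OF cd(2)] pc assms(1,2)
  have "(x \<otimes> y) \<otimes> (\<pi> [^] (n + n') \<otimes> (b \<otimes> d)) = (x \<otimes> (\<pi> [^] n \<otimes> b)) \<otimes> (y \<otimes> (\<pi> [^] n' \<otimes> d))"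
    using cl by (simp add: nat_pow_mult[symmetric] m_ac)
  also have "\<dots> = \<pi> [^] (m + m') \<otimes> (a \<otimes> c)" unfolding ab(3) cd(3) using cl by (simp add: nat_pow_mult[symmetric] m_ac)
  finally show ?thesis unfolding V_def using NP_mult ab cd by blast
qed

text \<open>Turns a lower bound for the valuation into a divisibility statement in \<open>R\<close>
  that also covers zero. Sums and integrality are handled in this form.\<close>

lemma ge_iff:
  assumes "x \<in> carrier K"
  shows "ereal (real m - real n) \<le> v x \<longleftrightarrow> (\<exists>a\<in>R. \<exists>b. NP b \<and> x \<otimes> (\<pi> [^] n \<otimes> b) = \<pi> [^] m \<otimes> a)"
proof (cases "x = \<zero>")
  case True
  then show ?thesis using R_zero NP_one pc by (auto simp: ord_at_def intro!: bexI[of _ \<zero>] exI[of _ \<one>])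
next
  case False
  obtain m' n' where V': "V x m' n'" using V_of[OF assms False] by blast
  then obtain a b where ab: "NP a" "NP b" "x \<otimes> (\<pi> [^] n' \<otimes> b) = \<pi> [^] m' \<otimes> a" by (auto simp: V_def)
  note cl = NP_c(1)[OF ab(1)] NP_c(1)[OF ab(2)] pc assms
  have vx: "v x = ereal (real m' - real n')" by (rule ord_eq(2)[OF assms V'])
  have un: "\<pi> [^] n' \<otimes> (\<pi> [^] m \<otimes> y) = \<pi> [^] (n' + m) \<otimes> y" if "y \<in> carrier K" for y and n' m :: nat
    using that pc by (simp add: nat_pow_mult[symmetric] m_assoc)
  show ?thesis
  proof
    assume "ereal (real m - real n) \<le> v x"
    then have le: "m + n' \<le> m' + n" unfolding vx by simp
    then obtain k where k: "m' + n = n' + m + k" by (metis add.commute le_iff_add)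
    have "\<pi> [^] n' \<otimes> (x \<otimes> (\<pi> [^] n \<otimes> b)) = \<pi> [^] n \<otimes> (x \<otimes> (\<pi> [^] n' \<otimes> b))" using cl by (simp add: m_ac)
    also have "\<dots> = \<pi> [^] (m' + n) \<otimes> a" unfolding ab(3) using cl by (simp add: un add.commute)
    also have "\<dots> = \<pi> [^] n' \<otimes> (\<pi> [^] m \<otimes> (\<pi> [^] k \<otimes> a))" unfolding k using cl by (simp add: un add.assoc)
    finally have "x \<otimes> (\<pi> [^] n \<otimes> b) = \<pi> [^] m \<otimes> (\<pi> [^] k \<otimes> a)"
      using m_lcancel[of "\<pi> [^] n'"] cl by simp
    then show "\<exists>a\<in>R. \<exists>b. NP b \<and> x \<otimes> (\<pi> [^] n \<otimes> b) = \<pi> [^] m \<otimes> a"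
      using ab(2) R_mult[OF R_pow[OF \<pi>(1)] NP_c(2)[OF ab(1)], of k] by blast
  next
    assume "\<exists>a\<in>R. \<exists>b. NP b \<and> x \<otimes> (\<pi> [^] n \<otimes> b) = \<pi> [^] m \<otimes> a"
    then obtain c d where cd: "c \<in> R" "NP d" "x \<otimes> (\<pi> [^] n \<otimes> d) = \<pi> [^] m \<otimes> c" by blast
    have cl': "c \<in> carrier K" "d \<in> carrier K" using cd Rc NP_c by auto
    have "\<pi> [^] (n + m') \<otimes> (a \<otimes> d) = (x \<otimes> (\<pi> [^] n' \<otimes> b)) \<otimes> (\<pi> [^] n \<otimes> d)"
      unfolding ab(3) using cl cl' by (simp add: nat_pow_mult[symmetric] m_ac)
    also have "\<dots> = (x \<otimes> (\<pi> [^] n \<otimes> d)) \<otimes> (\<pi> [^] n' \<otimes> b)" using cl cl' by (simp add: m_ac)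
    also have "\<dots> = \<pi> [^] (m + n') \<otimes> (c \<otimes> b)" unfolding cd(3) using cl cl' by (simp add: nat_pow_mult[symmetric] m_ac)
    finally have "m + n' \<le> n + m'" using pow_le NP_mult[OF ab(1) cd(2)] R_mult[OF cd(1) NP_c(2)[OF ab(2)]] by blast
    then show "ereal (real m - real n) \<le> v x" unfolding vx by simp
  qed
qed

lemma discrete: "discretely_valued K v"
proof (intro discretely_valued.intro discretely_valued_axioms.intro field_axioms)
  show v0: "v \<zero> = \<infinity>" by (simp add: ord_at_def)
  show "\<exists>k :: int. v x = ereal (of_int k)" if x: "x \<in> carrier K" "x \<noteq> \<zero>" for x
  proof -
    obtain m n where "V x m n" using V_of[OF x] by blast
    then have "v x = ereal (real m - real n)" by (rule ord_eq(2)[OF x(1)])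
    then show ?thesis by (intro exI[of _ "int m - int n"]) simp
  qed
  show "v (x \<otimes> y) = v x + v y" if xy: "x \<in> carrier K" "y \<in> carrier K" for x y
  proof (cases "x = \<zero> \<or> y = \<zero>")
    case True
    \<comment> \<open>Minus infinity has to be excluded before an infinite summand can absorb the
      other one.\<close>
    have mi: "v z \<noteq> - \<infinity>" if z: "z \<in> carrier K" for z
    proof (cases "z = \<zero>")
      case False
      obtain m n where "V z m n" using V_of[OF z False] by blast
      then have "v z = ereal (real m - real n)" by (rule ord_eq(2)[OF z])
      then show ?thesis by simp
    qed (simp add: v0)
    have "v x + v y = \<infinity>"
    proof (cases "x = \<zero>")
      case True
      then show ?thesis using mi[OF xy(2)] by (simp add: v0)
    next
      case False
      then have "y = \<zero>" using True by simp
      then show ?thesis using mi[OF xy(1)] by (simp add: v0)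
    qed
    moreover have "x \<otimes> y = \<zero>" using True xy by auto
    ultimately show ?thesis by (simp add: v0)
  next
    case False
    obtain m n where V1: "V x m n" using V_of[OF xy(1)] False by blast
    obtain m' n' where V2: "V y m' n'" using V_of[OF xy(2)] False by blast
    show ?thesis
      unfolding ord_eq(2)[OF xy(1) V1] ord_eq(2)[OF xy(2) V2] ord_eq(2)[OF m_closed[OF xy] V_mult[OF xy V1 V2]]
      by simp
  qed
  show "min (v x) (v y) \<le> v (x \<oplus> y)" if xy: "x \<in> carrier K" "y \<in> carrier K" for x y
  proof (cases "x = \<zero> \<or> y = \<zero>")
    case True
    then show ?thesis using xy by (auto simp: v0)
  next
    case False
    \<comment> \<open>By symmetry the smaller valuation is at \<open>x\<close>. Then both elements
      can be written with the same exponents \<open>m\<close> and \<open>n\<close>, and the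
      fractions are added.\<close>
    have *: "v x \<le> v (x \<oplus> y)" if xy: "x \<in> carrier K" "y \<in> carrier K" "x \<noteq> \<zero>" and le: "v x \<le> v y" for x y
    proof -
      obtain m n where V1: "V x m n" using V_of[OF xy(1,3)] by blast
      have vx: "v x = ereal (real m - real n)" by (rule ord_eq(2)[OF xy(1) V1])
      obtain a b where ab: "a \<in> R" "NP b" "x \<otimes> (\<pi> [^] n \<otimes> b) = \<pi> [^] m \<otimes> a"
        using ge_iff[OF xy(1), of m n] vx by auto
      obtain c d where cd: "c \<in> R" "NP d" "y \<otimes> (\<pi> [^] n \<otimes> d) = \<pi> [^] m \<otimes> c"
        using ge_iff[OF xy(2), of m n] vx le by auto
      note cl = Rc[OF ab(1)] NP_c(1)[OF ab(2)] Rc[OF cd(1)] NP_c(1)[OF cd(2)] pc xy(1,2)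
      have "(x \<oplus> y) \<otimes> (\<pi> [^] n \<otimes> (b \<otimes> d)) = (x \<otimes> (\<pi> [^] n \<otimes> b)) \<otimes> d \<oplus> (y \<otimes> (\<pi> [^] n \<otimes> d)) \<otimes> b"
        using cl l_distr[of x y "\<pi> [^] n \<otimes> (b \<otimes> d)"] by (simp add: m_ac)
      also have "\<dots> = \<pi> [^] m \<otimes> (a \<otimes> d \<oplus> c \<otimes> b)" unfolding ab(3) cd(3) using cl by (simp add: r_distr m_assoc)
      finally show ?thesis unfolding vx
        using ge_iff[of "x \<oplus> y" m n] xy NP_mult[OF ab(2) cd(2)] R_add[OF R_mult[OF ab(1) NP_c(2)[OF cd(2)]] R_mult[OF cd(1) NP_c(2)[OF ab(2)]]]
        by auto
    qed
    show ?thesis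
    proof (cases "v x \<le> v y")
      case True
      then show ?thesis using *[OF xy] False by (simp add: min_def)
    next
      case F: False
      then show ?thesis using *[OF xy(2,1)] False xy by (simp add: min_def a_comm)
    qed
  qed
qed

sublocale discretely_valued K v by (rule discrete)

lemma v_pi: "v \<pi> = 1"
proof -
  have "V \<pi> 1 0" unfolding V_def using NP_one pc by (intro exI[of _ \<one>]) simp
  then show ?thesis using ord_eq(2)[OF pc(1)] by (simp add: one_ereal_def)
qed

text \<open>Identifies the valuation ring inside \<open>K\<close> with the localisation of
  \<open>R\<close> at \<open>P\<close>.\<close>

lemma v_nonneg_iff:
  assumes "x \<in> carrier K"
  shows "0 \<le> v x \<longleftrightarrow> (\<exists>b. NP b \<and> x \<otimes> b \<in> R)"
proof -
  have "0 \<le> v x \<longleftrightarrow> (\<exists>a\<in>R. \<exists>b. NP b \<and> x \<otimes> b = a)"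
    using ge_iff[OF assms, of 0 0] by (simp add: zero_ereal_def Rc NP_c(1) cong: bex_cong conj_cong)
  then show ?thesis by blast
qed

lemma v_R: "r \<in> R \<Longrightarrow> 0 \<le> v r"
  using v_nonneg_iff[of r] Rc NP_one by (auto intro!: exI[of _ \<one>])

text \<open>The ring R[1/\<pi>].\<close>

definition S :: "'a set" where "S = {x \<in> carrier K. \<exists>n :: nat. \<pi> [^] n \<otimes> x \<in> R}"

text \<open>The relation for exponent 1 is inserted behind the power of \<open>\<pi>\<close> in the
  relation for \<open>n\<close>, which raises the exponent by one.\<close>

lemma bezout_pow: "NP b \<Longrightarrow> \<exists>\<alpha> \<in> R. \<exists>\<beta> \<in> R. \<one> = \<alpha> \<otimes> \<pi> [^] (n :: nat) \<oplus> \<beta> \<otimes> b"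
proof (induction n)
  case 0
  then show ?case using R_one R_zero NP_c(1) by (intro bexI[of _ \<one>] bexI[of _ \<zero>]) auto
next
  case (Suc n)
  then obtain \<alpha> \<beta> where 1: "\<alpha> \<in> R" "\<beta> \<in> R" "\<one> = \<alpha> \<otimes> \<pi> [^] n \<oplus> \<beta> \<otimes> b" by blast
  obtain \<gamma> \<delta> where 2: "\<gamma> \<in> R" "\<delta> \<in> R" "\<one> = \<gamma> \<otimes> \<pi> \<oplus> \<delta> \<otimes> b" using bezout[of b] Suc.prems unfolding NP_def by blast
  note cl = Rc[OF 1(1)] Rc[OF 1(2)] Rc[OF 2(1)] Rc[OF 2(2)] NP_c(1)[OF Suc.prems] pc
  have "\<alpha> \<otimes> \<pi> [^] n = \<alpha> \<otimes> \<pi> [^] n \<otimes> (\<gamma> \<otimes> \<pi> \<oplus> \<delta> \<otimes> b)"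
    unfolding 2(3)[symmetric] using cl by simp
  then have "\<one> = \<alpha> \<otimes> \<pi> [^] n \<otimes> (\<gamma> \<otimes> \<pi> \<oplus> \<delta> \<otimes> b) \<oplus> \<beta> \<otimes> b" using 1(3) by simp
  also have "\<dots> = (\<alpha> \<otimes> \<gamma>) \<otimes> \<pi> [^] Suc n \<oplus> (\<alpha> \<otimes> \<pi> [^] n \<otimes> \<delta> \<oplus> \<beta>) \<otimes> b"
    using cl by (simp add: r_distr l_distr m_ac a_assoc)
  finally have one: "\<one> = (\<alpha> \<otimes> \<gamma>) \<otimes> \<pi> [^] Suc n \<oplus> (\<alpha> \<otimes> \<pi> [^] n \<otimes> \<delta> \<oplus> \<beta>) \<otimes> b" .
  show ?case
    by (intro bexI[of _ "\<alpha> \<otimes> \<gamma>"] bexI[of _ "\<alpha> \<otimes> \<pi> [^] n \<otimes> \<delta> \<oplus> \<beta>"])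
      (rule one, (intro R_mult R_add R_pow 1 2 \<pi>(1))+)
qed

text \<open>R[1/\<pi>] meets the localisation at \<open>P\<close> in \<open>R\<close>: multiplying a
  Bezout relation for \<open>\<pi> [^] n\<close> and \<open>b\<close> by \<open>x\<close> writes
  \<open>x\<close> as a combination of \<open>\<pi> [^] n \<otimes> x\<close> and
  \<open>x \<otimes> b\<close>, both of which lie in \<open>R\<close>.\<close>

lemma S_integral_R:
  assumes "x \<in> S" "0 \<le> v x"
  shows "x \<in> R"
proof -
  obtain n :: nat where n: "x \<in> carrier K" "\<pi> [^] n \<otimes> x \<in> R" using assms by (auto simp: S_def)
  obtain b where b: "NP b" "x \<otimes> b \<in> R" using v_nonneg_iff[OF n(1)] assms(2) by auto
  obtain \<alpha> \<beta> where 1: "\<alpha> \<in> R" "\<beta> \<in> R" "\<one> = \<alpha> \<otimes> \<pi> [^] n \<oplus> \<beta> \<otimes> b" using bezout_pow[OF b(1)] by blast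
  have "x = (\<alpha> \<otimes> \<pi> [^] n \<oplus> \<beta> \<otimes> b) \<otimes> x" using n by (simp flip: 1(3))
  also have "\<dots> = \<alpha> \<otimes> (\<pi> [^] n \<otimes> x) \<oplus> \<beta> \<otimes> (x \<otimes> b)"
    using Rc[OF 1(1)] Rc[OF 1(2)] NP_c(1)[OF b(1)] pc n(1) by (simp add: l_distr m_assoc m_comm[of b x])
  finally have x: "x = \<alpha> \<otimes> (\<pi> [^] n \<otimes> x) \<oplus> \<beta> \<otimes> (x \<otimes> b)" .
  show ?thesis by (subst x) (intro R_add R_mult 1(1,2) n(2) b(2))
qed

text \<open>Partial fractions: \<open>x\<close> has a denominator
  \<open>\<pi> [^] n \<otimes> b\<close> with \<open>b\<close> prime to \<open>\<pi>\<close>, and a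
  Bezout relation for the two factors splits \<open>x\<close> into a part with denominator
  \<open>\<pi> [^] n\<close> and a part with denominator \<open>b\<close>.\<close>

lemma K_split:
  assumes "x \<in> carrier K"
  shows "\<exists>s\<in>S. \<exists>r\<in>carrier K. 0 \<le> v r \<and> x = s \<oplus> r"
proof (cases "x = \<zero>")
  case True
  then show ?thesis using R_zero by (intro bexI[of _ \<zero>]) (auto simp: S_def v_zero intro!: exI[of _ 0])
next
  case False
  obtain m n where "V x m n" using V_of[OF assms False] by blast
  then obtain a b where ab: "NP a" "NP b" "x \<otimes> (\<pi> [^] n \<otimes> b) = \<pi> [^] m \<otimes> a" by (auto simp: V_def)
  define c where "c = \<pi> [^] m \<otimes> a"
  have c: "c \<in> R" unfolding c_def using R_mult R_pow[OF \<pi>(1)] NP_c(2)[OF ab(1)] by blast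
  obtain \<alpha> \<beta> where 1: "\<alpha> \<in> R" "\<beta> \<in> R" "\<one> = \<alpha> \<otimes> \<pi> [^] n \<oplus> \<beta> \<otimes> b" using bezout_pow[OF ab(2)] by blast
  note cl = Rc[OF 1(1)] Rc[OF 1(2)] NP_c(1)[OF ab(2)] pc assms
  have "x = (\<alpha> \<otimes> \<pi> [^] n \<oplus> \<beta> \<otimes> b) \<otimes> x" using assms by (simp flip: 1(3))
  also have "\<dots> = \<beta> \<otimes> b \<otimes> x \<oplus> \<alpha> \<otimes> \<pi> [^] n \<otimes> x" using cl by (simp add: l_distr a_comm)
  finally have x: "x = \<beta> \<otimes> b \<otimes> x \<oplus> \<alpha> \<otimes> \<pi> [^] n \<otimes> x" .
  have "\<pi> [^] n \<otimes> (\<beta> \<otimes> b \<otimes> x) = \<beta> \<otimes> (x \<otimes> (\<pi> [^] n \<otimes> b))" using cl by (simp add: m_ac)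
  also have "\<dots> \<in> R" unfolding ab(3) c_def[symmetric] using R_mult 1 c by blast
  finally have "\<beta> \<otimes> b \<otimes> x \<in> S" unfolding S_def using cl by (intro CollectI conjI exI) simp_all
  moreover have "\<alpha> \<otimes> \<pi> [^] n \<otimes> x \<otimes> b = \<alpha> \<otimes> (x \<otimes> (\<pi> [^] n \<otimes> b))" using cl by (simp add: m_ac)
  then have "\<alpha> \<otimes> \<pi> [^] n \<otimes> x \<otimes> b \<in> R" unfolding ab(3) c_def[symmetric] using R_mult 1 c by simp
  then have "0 \<le> v (\<alpha> \<otimes> \<pi> [^] n \<otimes> x)" by (subst v_nonneg_iff) (use cl ab(2) in \<open>auto intro!: exI[of _ b]\<close>)
  ultimately show ?thesis
    using x cl by (intro bexI[of _ "\<beta> \<otimes> b \<otimes> x"] bexI[of _ "\<alpha> \<otimes> \<pi> [^] n \<otimes> x"] conjI m_closed) simp_all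
qed

lemma R_S: "R \<subseteq> S"
  using Rc by (auto simp: S_def intro!: exI[of _ 0])

lemma S_subring: "subring S K"
proof (rule subringI)
  show "S \<subseteq> carrier K" by (auto simp: S_def)
  show "\<one> \<in> S" using R_S R_one by blast
  show "\<ominus> x \<in> S" if "x \<in> S" for x
  proof -
    obtain n :: nat where n: "x \<in> carrier K" "\<pi> [^] n \<otimes> x \<in> R" using \<open>x \<in> S\<close> by (auto simp: S_def)
    then have "\<pi> [^] n \<otimes> (\<ominus> x) \<in> R" using subringE(5)[OF R n(2)] pc by (simp add: r_minus)
    then show ?thesis using n by (auto simp: S_def)
  qed
  fix x y assume xy: "x \<in> S" "y \<in> S"
  obtain n :: nat where n: "x \<in> carrier K" "\<pi> [^] n \<otimes> x \<in> R" using xy by (auto simp: S_def)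
  obtain m :: nat where m: "y \<in> carrier K" "\<pi> [^] m \<otimes> y \<in> R" using xy by (auto simp: S_def)
  have "\<pi> [^] (n + m) \<otimes> (x \<otimes> y) = (\<pi> [^] n \<otimes> x) \<otimes> (\<pi> [^] m \<otimes> y)"
    using n m pc by (simp add: nat_pow_mult[symmetric] m_ac)
  then have "\<pi> [^] (n + m) \<otimes> (x \<otimes> y) \<in> R" using R_mult[OF n(2) m(2)] by simp
  then show "x \<otimes> y \<in> S" using n m unfolding S_def by blast
  have "\<pi> [^] (n + m) \<otimes> (x \<oplus> y) = \<pi> [^] m \<otimes> (\<pi> [^] n \<otimes> x) \<oplus> \<pi> [^] n \<otimes> (\<pi> [^] m \<otimes> y)"
    using n m pc by (simp add: nat_pow_mult[symmetric] m_ac r_distr)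
  then have "\<pi> [^] (n + m) \<otimes> (x \<oplus> y) \<in> R"
    using R_add[OF R_mult[OF R_pow[OF \<pi>(1)] n(2)] R_mult[OF R_pow[OF \<pi>(1)] m(2)]] by simp
  then show "x \<oplus> y \<in> S" using n m unfolding S_def by blast
qed

lemma pi_inv: "inv \<pi> \<in> carrier K" "\<pi> \<otimes> inv \<pi> = \<one>" "inv \<pi> \<otimes> \<pi> = \<one>"
  using pc \<pi> field_Units by (auto simp: Units_r_inv Units_l_inv)

lemma v_pow: "v (\<pi> [^] (n :: nat)) = ereal (real n)" "v (inv \<pi> [^] (n :: nat)) = ereal (- real n)"
proof -
  show *: "v (\<pi> [^] n) = ereal (real n)" for n :: nat
  proof (induction n)
    case (Suc n)
    then show ?case using v_mult[OF pc(2) pc(1), of n] v_pi by (simp add: one_ereal_def)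
  qed (simp add: v_one zero_ereal_def)
  have "\<pi> [^] n \<otimes> inv \<pi> [^] n = \<one>" using pi_inv pc by (simp add: pow_mult_distrib[symmetric] m_comm)
  then have "ereal (real n) + v (inv \<pi> [^] n) = 0" using v_mult[of "\<pi> [^] n" "inv \<pi> [^] n"] pi_inv pc * v_one by simp
  then show "v (inv \<pi> [^] n) = ereal (- real n)" by (cases "v (inv \<pi> [^] n)") (auto simp: zero_ereal_def)
qed

lemma emb_VR: "x \<in> carrier K \<Longrightarrow> emb x \<in> VR \<longleftrightarrow> 0 \<le> v x"
  using ring_hom_closed[OF emb_hom] by (simp add: VR_iff emb_ord)

lemma local_field: "local_field K KC emb VR S \<pi>"
proof -
  interpret e: ring_hom_cring K KC emb by (rule emb_ring_hom_cring)
  \<comment> \<open>Dividing by a power of \<open>\<pi>\<close> of the same order leaves an element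
    of order 0; its inverse is made from \<open>\<eta>\<close> in the same way.\<close>
  have fac: "\<exists>u\<in>VR. \<exists>u'\<in>VR. u \<otimes>\<^bsub>KC\<^esub> u' = \<one>\<^bsub>KC\<^esub> \<and> \<xi> = u \<otimes>\<^bsub>KC\<^esub> emb p"
    if \<xi>: "\<xi> \<in> carrier KC" and \<eta>: "\<eta> \<in> carrier KC" "\<xi> \<otimes>\<^bsub>KC\<^esub> \<eta> = \<one>\<^bsub>KC\<^esub>"
      "completion_ord v \<xi> = ereal k" "completion_ord v \<eta> = ereal (- k)"
      and p: "p \<in> carrier K" "q \<in> carrier K" "p \<otimes> q = \<one>" "v p = ereal k" "v q = ereal (- k)" for \<xi> \<eta> p q k
  proof (intro bexI conjI)
    have pq: "emb p \<in> carrier KC" "emb q \<in> carrier KC" "emb p \<otimes>\<^bsub>KC\<^esub> emb q = \<one>\<^bsub>KC\<^esub>"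
      using p e.hom_mult[of p q] by auto
    have "(\<xi> \<otimes>\<^bsub>KC\<^esub> emb q) \<otimes>\<^bsub>KC\<^esub> (\<eta> \<otimes>\<^bsub>KC\<^esub> emb p) = (\<xi> \<otimes>\<^bsub>KC\<^esub> \<eta>) \<otimes>\<^bsub>KC\<^esub> (emb p \<otimes>\<^bsub>KC\<^esub> emb q)"
      using \<xi> \<eta>(1) pq(1,2) by (simp add: cl.S.m_ac)
    then show "(\<xi> \<otimes>\<^bsub>KC\<^esub> emb q) \<otimes>\<^bsub>KC\<^esub> (\<eta> \<otimes>\<^bsub>KC\<^esub> emb p) = \<one>\<^bsub>KC\<^esub>" using \<eta>(2) pq(3) by simp
    have "(\<xi> \<otimes>\<^bsub>KC\<^esub> emb q) \<otimes>\<^bsub>KC\<^esub> emb p = \<xi> \<otimes>\<^bsub>KC\<^esub> (emb p \<otimes>\<^bsub>KC\<^esub> emb q)"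
      using \<xi> pq(1,2) by (simp add: cl.S.m_ac)
    then show "\<xi> = (\<xi> \<otimes>\<^bsub>KC\<^esub> emb q) \<otimes>\<^bsub>KC\<^esub> emb p" using \<xi> pq(3) by simp
    show "\<eta> \<otimes>\<^bsub>KC\<^esub> emb p \<in> VR"
      using \<eta> pq p ord_mult[OF \<eta>(1) pq(1)] by (simp add: VR_iff emb_ord zero_ereal_def)
    show "\<xi> \<otimes>\<^bsub>KC\<^esub> emb q \<in> VR"
      using \<eta> \<xi> pq p ord_mult[OF \<xi> pq(2)] by (simp add: VR_iff emb_ord zero_ereal_def)
  qed
  have inv: "\<pi> [^] n \<otimes> inv \<pi> [^] n = \<one>" "inv \<pi> [^] n \<otimes> \<pi> [^] n = \<one>" for n :: nat
    using pi_inv pc by (simp_all add: pow_mult_distrib[symmetric] m_comm)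
  show ?thesis
  proof (intro local_field.intro local_field_axioms.intro field_axioms KC_cring emb_ring_hom_cring)
    show "subring VR KC" by (rule VR_subring)
    show "subring S K" by (rule S_subring)
    show "\<pi> \<in> S" using R_S \<pi> by blast
    show "inv \<pi> \<in> S" unfolding S_def using pi_inv R_one pc by (auto intro!: exI[of _ 1])
    show "\<pi> \<noteq> \<zero>" by (rule \<pi>(2))
    show "emb \<pi> \<in> VR" using pc v_pi by (simp add: emb_VR)
    show "\<one>\<^bsub>KC\<^esub> \<noteq> \<zero>\<^bsub>KC\<^esub>" by (rule KC_one_not_zero)
    show "\<exists>u\<in>VR. \<exists>u'\<in>VR. \<exists>n :: nat. u \<otimes>\<^bsub>KC\<^esub> u' = \<one>\<^bsub>KC\<^esub> \<and>
        (\<xi> = u \<otimes>\<^bsub>KC\<^esub> emb (\<pi> [^] n) \<or> \<xi> = u \<otimes>\<^bsub>KC\<^esub> emb (inv \<pi> [^] n))"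
      if \<xi>: "\<xi> \<in> carrier KC" "\<xi> \<noteq> \<zero>\<^bsub>KC\<^esub>" for \<xi>
    proof -
      obtain \<eta> k where \<eta>: "\<eta> \<in> carrier KC" "\<xi> \<otimes>\<^bsub>KC\<^esub> \<eta> = \<one>\<^bsub>KC\<^esub>"
        "completion_ord v \<xi> = ereal (of_int k)" "completion_ord v \<eta> = ereal (- of_int k)"
        using KC_inverse[OF \<xi>] by blast
      show ?thesis
      \<comment> \<open>The locale asks for natural exponents, so the sign of the order decides
        between \<open>\<pi>\<close> and its inverse.\<close>
      proof (cases "0 \<le> k")
        case True
        define n where "n = nat k"
        have k: "(of_int k :: real) = real n" using True by (simp add: n_def)
        show ?thesis
          using fac[OF \<xi>(1) \<eta>(1,2) \<eta>(3,4)[unfolded k] pc(2) nat_pow_closed[OF pi_inv(1)] inv(1) v_pow] by blast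
      next
        case False
        define n where "n = nat (- k)"
        have k: "(of_int k :: real) = - real n" using False by (simp add: n_def)
        have \<eta>4: "completion_ord v \<eta> = ereal (- (- real n))" using \<eta>(4) k by simp
        have p4: "v (\<pi> [^] n) = ereal (- (- real n))" using v_pow(1) by simp
        show ?thesis
          using fac[OF \<xi>(1) \<eta>(1,2) \<eta>(3)[unfolded k] \<eta>4 nat_pow_closed[OF pi_inv(1)] pc(2) inv(2) v_pow(2) p4] by blast
      qed
    qed
    \<comment> \<open>First approximate by an element of \<open>K\<close> up to an integral error,
      then split this element by partial fractions.\<close>
    show "\<exists>s\<in>S. \<exists>r\<in>VR. \<xi> = emb s \<oplus>\<^bsub>KC\<^esub> r" if \<xi>: "\<xi> \<in> carrier KC" for \<xi>
    proof -
      obtain y r where y: "y \<in> carrier K" "r \<in> VR" "\<xi> = emb y \<oplus>\<^bsub>KC\<^esub> r" using KC_dense[OF \<xi>] by blast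
      obtain s z where s: "s \<in> S" "z \<in> carrier K" "0 \<le> v z" "y = s \<oplus> z" using K_split[OF y(1)] by blast
      have sc: "s \<in> carrier K" using s by (simp add: S_def)
      have rc: "r \<in> carrier KC" using y by (simp add: VR_iff)
      have "\<xi> = emb s \<oplus>\<^bsub>KC\<^esub> (emb z \<oplus>\<^bsub>KC\<^esub> r)" using y s sc rc by (simp add: cl.S.a_assoc)
      moreover have "emb z \<oplus>\<^bsub>KC\<^esub> r \<in> VR" using subringE(7)[OF VR_subring] emb_VR[OF s(2)] s y by blast
      ultimately show ?thesis using s by blast
    qed
  qed
qed

end

text \<open>A generator of \<open>P\<close> serves as \<open>\<pi>\<close>. The Bezout relations
  hold because ideals are principal, the bound on powers because ascending chains of ideals become
  stationary.\<close>

lemma frac_prime_exists: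
  fixes K :: "'a ring"
  assumes K: "field K" and R: "subring R K" and pid: "principal_domain (K\<lparr>carrier := R\<rparr>)"
    and frac: "\<forall>x \<in> carrier K. \<exists>a \<in> R. \<exists>b \<in> R - {\<zero>\<^bsub>K\<^esub>}. x = a \<otimes>\<^bsub>K\<^esub> inv\<^bsub>K\<^esub> b"
    and P: "primeideal P (K\<lparr>carrier := R\<rparr>)" "P \<noteq> {\<zero>\<^bsub>K\<^esub>}"
  obtains \<pi> where "frac_prime K R P \<pi>"
proof -
  interpret K: field K by fact
  let ?D = "K\<lparr>carrier := R\<rparr>"
  interpret D: principal_domain ?D by fact
  interpret P: primeideal P ?D by fact
  have Rc: "a \<in> R \<Longrightarrow> a \<in> carrier K" for a using subringE(1)[OF R] by blast
  obtain p where p: "p \<in> R" "P = PIdl\<^bsub>?D\<^esub> p" using D.exists_gen[OF P.ideal_axioms] by auto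
  have P_eq: "P = {p \<otimes>\<^bsub>K\<^esub> r | r. r \<in> R}"
    unfolding p(2) cgenideal_def using K.m_comm[OF Rc[OF p(1)] Rc] by auto metis+
  have one: "\<one>\<^bsub>K\<^esub> \<in> R" using subringE(3)[OF R] .
  have p0: "p \<noteq> \<zero>\<^bsub>K\<^esub>"
  proof
    assume "p = \<zero>\<^bsub>K\<^esub>"
    then have "P = {\<zero>\<^bsub>K\<^esub>}" unfolding P_eq using one Rc by (auto intro!: exI[of _ "\<one>\<^bsub>K\<^esub>"])
    then show False using P by simp
  qed
  have one_P: "\<one>\<^bsub>K\<^esub> \<notin> P" using P.I_notcarr P.one_imp_carrier by auto
  have pc: "p [^]\<^bsub>K\<^esub> (n :: nat) \<in> carrier K" "p [^]\<^bsub>K\<^esub> n \<noteq> \<zero>\<^bsub>K\<^esub>" for n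
  proof -
    show c: "p [^]\<^bsub>K\<^esub> (n :: nat) \<in> carrier K" for n using p Rc by simp
    show "p [^]\<^bsub>K\<^esub> n \<noteq> \<zero>\<^bsub>K\<^esub>" using p0 p Rc c by (induction n) (auto simp: K.integral_iff)
  qed
  have "frac_prime K R P p"
  proof (intro frac_prime.intro frac_prime_axioms.intro K.field_axioms)
    show "subring R K" by fact
    show "\<forall>x \<in> carrier K. \<exists>a \<in> R. \<exists>b \<in> R - {\<zero>\<^bsub>K\<^esub>}. x = a \<otimes>\<^bsub>K\<^esub> inv\<^bsub>K\<^esub> b" by fact
    show "p \<in> R" "p \<noteq> \<zero>\<^bsub>K\<^esub>" "P = {p \<otimes>\<^bsub>K\<^esub> r | r. r \<in> R}" "\<one>\<^bsub>K\<^esub> \<notin> P" by (fact p p0 P_eq one_P)+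
    show "a \<in> P \<or> b \<in> P" if "a \<in> R" "b \<in> R" "a \<otimes>\<^bsub>K\<^esub> b \<in> P" for a b
      using P.I_prime[of a b] that by simp
    show "\<exists>\<alpha> \<in> R. \<exists>\<beta> \<in> R. \<one>\<^bsub>K\<^esub> = \<alpha> \<otimes>\<^bsub>K\<^esub> p \<oplus>\<^bsub>K\<^esub> \<beta> \<otimes>\<^bsub>K\<^esub> b" if b: "b \<in> R" "b \<notin> P" for b
    proof -
      \<comment> \<open>Let \<open>g\<close> generate the ideal of \<open>p\<close> and
        \<open>b\<close>, with \<open>p = r g\<close>. If \<open>g\<close> were in \<open>P\<close>,
        so would be \<open>b\<close>; hence \<open>r\<close> is a multiple of \<open>p\<close>, and
        cancelling \<open>p\<close> shows that \<open>g\<close> is a unit.\<close>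
      let ?I = "PIdl\<^bsub>?D\<^esub> p <+>\<^bsub>?D\<^esub> PIdl\<^bsub>?D\<^esub> b"
      have iI: "ideal ?I ?D" using p b by (intro D.add_ideals D.cgenideal_ideal) auto
      obtain g where g: "g \<in> R" "?I = PIdl\<^bsub>?D\<^esub> g" using D.exists_gen[OF iI] by auto
      have I: "?I = {\<alpha> \<otimes>\<^bsub>K\<^esub> p \<oplus>\<^bsub>K\<^esub> \<beta> \<otimes>\<^bsub>K\<^esub> b | \<alpha> \<beta>. \<alpha> \<in> R \<and> \<beta> \<in> R}"
        by (auto simp: set_add_def' cgenideal_def)
      have z: "\<zero>\<^bsub>K\<^esub> \<in> R" using subringE(2)[OF R] .
      have "p = \<one>\<^bsub>K\<^esub> \<otimes>\<^bsub>K\<^esub> p \<oplus>\<^bsub>K\<^esub> \<zero>\<^bsub>K\<^esub> \<otimes>\<^bsub>K\<^esub> b" "b = \<zero>\<^bsub>K\<^esub> \<otimes>\<^bsub>K\<^esub> p \<oplus>\<^bsub>K\<^esub> \<one>\<^bsub>K\<^esub> \<otimes>\<^bsub>K\<^esub> b"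
        using p b Rc by auto
      then have "p \<in> ?I" "b \<in> ?I" unfolding I using one z by blast+
      then obtain r s where rs: "r \<in> R" "s \<in> R" "p = r \<otimes>\<^bsub>K\<^esub> g" "b = s \<otimes>\<^bsub>K\<^esub> g"
        unfolding g(2) by (auto simp: cgenideal_def)
      have "p \<in> P" unfolding P_eq using one p Rc by force
      then have "r \<in> P \<or> g \<in> P" using P.I_prime[of r g] rs g by simp
      moreover have "g \<notin> P"
      proof
        assume "g \<in> P"
        then have "s \<otimes>\<^bsub>K\<^esub> g \<in> P" using P.I_l_closed[of g s] rs by simp
        then show False using b rs by simp
      qed
      ultimately obtain t where t: "t \<in> R" "r = p \<otimes>\<^bsub>K\<^esub> t" unfolding P_eq by blast
      have "p \<otimes>\<^bsub>K\<^esub> (t \<otimes>\<^bsub>K\<^esub> g) = p \<otimes>\<^bsub>K\<^esub> \<one>\<^bsub>K\<^esub>" using rs(3) t g p Rc by (simp add: K.m_assoc)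
      then have "t \<otimes>\<^bsub>K\<^esub> g = \<one>\<^bsub>K\<^esub>" using K.m_lcancel[of p "t \<otimes>\<^bsub>K\<^esub> g" "\<one>\<^bsub>K\<^esub>"] p0 p t g Rc by simp
      then have "\<one>\<^bsub>K\<^esub> \<in> ?I" unfolding g(2) using t by (auto simp: cgenideal_def intro!: exI[of _ t])
      then show ?thesis unfolding I by blast
    qed
    show "\<exists>n :: nat. \<not> (\<exists>r\<in>R. a = p [^]\<^bsub>K\<^esub> n \<otimes>\<^bsub>K\<^esub> r)" if a: "a \<in> R" "a \<noteq> \<zero>\<^bsub>K\<^esub>" for a
    \<comment> \<open>If all powers of \<open>p\<close> divided \<open>a\<close>, the cofactors
      \<open>b n\<close> would generate an ascending chain of ideals. Where it is stationary,
      \<open>b (Suc n)\<close> is a multiple of \<open>b n\<close>, which is \<open>p\<close> times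
      \<open>b (Suc n)\<close>; so \<open>p\<close> would be a unit.\<close>
    proof (rule ccontr)
      assume "\<not> ?thesis"
      then have "\<forall>n :: nat. \<exists>r. r \<in> R \<and> a = p [^]\<^bsub>K\<^esub> n \<otimes>\<^bsub>K\<^esub> r" by blast
      then obtain b where b: "\<And>n. b n \<in> R" "\<And>n. a = p [^]\<^bsub>K\<^esub> (n :: nat) \<otimes>\<^bsub>K\<^esub> b n" by metis
      have step: "b n = p \<otimes>\<^bsub>K\<^esub> b (Suc n)" for n
      proof -
        have "p [^]\<^bsub>K\<^esub> n \<otimes>\<^bsub>K\<^esub> b n = p [^]\<^bsub>K\<^esub> n \<otimes>\<^bsub>K\<^esub> (p \<otimes>\<^bsub>K\<^esub> b (Suc n))"
          using b(2)[of n] b(2)[of "Suc n"] pc p Rc b(1) by (simp add: K.m_assoc)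
        then show ?thesis using K.m_lcancel[of "p [^]\<^bsub>K\<^esub> n"] pc p b(1) Rc by simp
      qed
      let ?C = "range (\<lambda>n. PIdl\<^bsub>?D\<^esub> (b n))"
      have sub: "PIdl\<^bsub>?D\<^esub> (b n) \<subseteq> PIdl\<^bsub>?D\<^esub> (b (n + k))" for n k
      proof (induction k)
        case (Suc k)
        have "b (n + k) \<in> PIdl\<^bsub>?D\<^esub> (b (Suc (n + k)))"
          using step[of "n + k"] p by (auto simp: cgenideal_def)
        then have "PIdl\<^bsub>?D\<^esub> (b (n + k)) \<subseteq> PIdl\<^bsub>?D\<^esub> (b (Suc (n + k)))"
          using b(1) by (intro D.cgenideal_minimal D.cgenideal_ideal) auto
        then show ?case using Suc by auto
      qed simp
      have "\<Union>?C \<in> ?C"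
      proof (rule D.ideal_chain_is_trivial)
        have "PIdl\<^bsub>?D\<^esub> (b m) \<subseteq> PIdl\<^bsub>?D\<^esub> (b n) \<or> PIdl\<^bsub>?D\<^esub> (b n) \<subseteq> PIdl\<^bsub>?D\<^esub> (b m)" for m n
          using sub[of m "n - m"] sub[of n "m - n"] by (cases "m \<le> n") auto
        moreover have "ideal (PIdl\<^bsub>?D\<^esub> (b n)) ?D" for n using b(1) by (intro D.cgenideal_ideal) simp
        ultimately show "subset.chain {I. ideal I ?D} ?C" unfolding subset.chain_def by blast
      qed auto
      then obtain n where n: "\<Union>?C = PIdl\<^bsub>?D\<^esub> (b n)" by auto
      have "b (Suc n) \<in> PIdl\<^bsub>?D\<^esub> (b (Suc n))" using D.cgenideal_self[of "b (Suc n)"] b(1) by simp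
      then have "b (Suc n) \<in> PIdl\<^bsub>?D\<^esub> (b n)" using n by blast
      then obtain r where r: "r \<in> R" "b (Suc n) = r \<otimes>\<^bsub>K\<^esub> b n" by (auto simp: cgenideal_def)
      have bn: "b n \<noteq> \<zero>\<^bsub>K\<^esub>" using b(2)[of n] a pc by auto
      have "\<one>\<^bsub>K\<^esub> \<otimes>\<^bsub>K\<^esub> b n = (p \<otimes>\<^bsub>K\<^esub> r) \<otimes>\<^bsub>K\<^esub> b n" using step[of n] r p b(1)[of n] Rc by (simp add: K.m_assoc)
      then have "\<one>\<^bsub>K\<^esub> = p \<otimes>\<^bsub>K\<^esub> r" using K.m_rcancel[of "b n" "\<one>\<^bsub>K\<^esub>" "p \<otimes>\<^bsub>K\<^esub> r"] bn b(1) p r Rc by simp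
      then show False using one_P r unfolding P_eq by blast
    qed
  qed
  then show ?thesis using that by blast
qed

section \<open>Models of maximal resultant ideal\<close>

text \<open>\<open>is_model\<close> with the choice of a lift turned into a scalar in front. In this
  form it is an equivalence relation, so two models of the same morphism can be compared
  directly.\<close>

definition twist :: "('k, 'm) ring_scheme \<Rightarrow> nat \<Rightarrow> 'k poly_map \<Rightarrow> 'k poly_map \<Rightarrow> bool" where
  "twist F N \<Phi> \<Psi> \<longleftrightarrow> (\<exists>c A B. c \<in> carrier F - {\<zero>\<^bsub>F\<^esub>} \<and> inverse_matrices F N A B \<and>
     \<Psi> = scale_map F N c (conj_map F N A B \<Phi>))"

context field
begin

lemma twist_fmaps:
  assumes "\<Phi> \<in> fmaps R N d" "twist R N \<Phi> \<Psi>"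
  shows "\<Psi> \<in> fmaps R N d"
proof -
  obtain c A B where *: "c \<in> carrier R - {\<zero>}" "inverse_matrices R N A B" "\<Psi> = scale_map R N c (conj_map R N A B \<Phi>)"
    using assms(2) unfolding twist_def by blast
  then have "matc R N A" "matc R N B" by (simp_all add: inverse_matrices_iff)
  then show ?thesis unfolding *(3) using *(1) by (intro scale_map_fmaps conj_map_fmaps[OF assms(1)]) simp_all
qed

lemma twist_trans:
  assumes \<Phi>: "\<Phi> \<in> fmaps R N d" and "twist R N \<Phi> \<Psi>" "twist R N \<Psi> \<Theta>"
  shows "twist R N \<Phi> \<Theta>"
proof -
  obtain c A B where 1: "c \<in> carrier R - {\<zero>}" "inverse_matrices R N A B" "\<Psi> = scale_map R N c (conj_map R N A B \<Phi>)"
    using assms(2) unfolding twist_def by blast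
  obtain c' A' B' where 2: "c' \<in> carrier R - {\<zero>}" "inverse_matrices R N A' B'"
    "\<Theta> = scale_map R N c' (conj_map R N A' B' \<Psi>)"
    using assms(3) unfolding twist_def by blast
  have m: "matc R N A" "matc R N B" "matc R N A'" "matc R N B'" using 1 2 by (simp_all add: inverse_matrices_iff)
  have c: "c \<in> carrier R" "c' \<in> carrier R" using 1 2 by simp_all
  note f = conj_map_fmaps[OF \<Phi> m(1,2)] conj_map_fmaps[OF conj_map_fmaps[OF \<Phi> m(1,2)] m(3,4)]
  have "\<Theta> = scale_map R N (c' \<otimes> c) (conj_map R N A' B' (conj_map R N A B \<Phi>))"
    unfolding 2(3) 1(3) conj_map_scale[OF f(1) m(3,4) c(1)] by (rule scale_map_scale_map[OF c(2,1) f(2)])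
  also have "conj_map R N A' B' (conj_map R N A B \<Phi>) = conj_map R N (mm R N A' A) (mm R N B B') \<Phi>"
    by (rule conj_map_conj_map[OF \<Phi> m(3,4,1,2)])
  finally have "\<Theta> = scale_map R N (c' \<otimes> c) (conj_map R N (mm R N A' A) (mm R N B B') \<Phi>)" .
  moreover have "c' \<otimes> c \<in> carrier R - {\<zero>}" using 1 2 by (simp add: integral_iff)
  ultimately show ?thesis unfolding twist_def using inverse_matrices_mm[OF 2(2) 1(2)] by blast
qed

lemma twist_sym:
  assumes \<Phi>: "\<Phi> \<in> fmaps R N d" and "twist R N \<Phi> \<Psi>"
  shows "twist R N \<Psi> \<Phi>"
proof -
  obtain c A B where 1: "c \<in> carrier R - {\<zero>}" "inverse_matrices R N A B" "\<Psi> = scale_map R N c (conj_map R N A B \<Phi>)"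
    using assms(2) unfolding twist_def by blast
  have m: "matc R N A" "matc R N B" and e: "eqm N (mm R N B A) (idm R)" using 1 by (simp_all add: inverse_matrices_iff)
  have c: "c \<in> carrier R" "inv c \<in> carrier R" "inv c \<noteq> \<zero>" "inv c \<otimes> c = \<one>"
    using 1 field_Units by (auto simp: Units_l_inv dest: nonzero_imp_inverse_nonzero)
  note f = conj_map_fmaps[OF \<Phi> m]
  have "conj_map R N B A \<Psi> = scale_map R N c (conj_map R N B A (conj_map R N A B \<Phi>))"
    unfolding 1(3) by (rule conj_map_scale[OF f m(2,1) c(1)])
  also have "conj_map R N B A (conj_map R N A B \<Phi>) = conj_map R N (mm R N B A) (mm R N B A) \<Phi>"
    by (rule conj_map_conj_map[OF \<Phi> m(2,1,1,2)])
  also have "\<dots> = conj_map R N (idm R) (idm R) \<Phi>" by (rule conj_map_cong[OF e e idm_closed idm_closed])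
  also have "\<dots> = \<Phi>" by (rule conj_map_idm[OF \<Phi>])
  finally have "scale_map R N (inv c) (conj_map R N B A \<Psi>) = scale_map R N (inv c) (scale_map R N c \<Phi>)" by simp
  also have "\<dots> = \<Phi>" using scale_map_scale_map[OF c(2,1) \<Phi>] c(4) scale_map_one[OF \<Phi>] by simp
  finally have "\<Phi> = scale_map R N (inv c) (conj_map R N B A \<Psi>)" by simp
  then show ?thesis unfolding twist_def
    using c(2,3) inverse_matrices_sym[OF 1(2)] by (intro exI[of _ "inv c"] exI[of _ B] exI[of _ A]) simp
qed

lemma twist_scale:
  assumes "\<Phi> \<in> fmaps R N d" "c \<in> carrier R - {\<zero>}"
  shows "twist R N \<Phi> (scale_map R N c \<Phi>)"
  unfolding twist_def
  using assms inverse_matrices_idm conj_map_idm[OF assms(1)]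
  by (intro exI[of _ c] exI[of _ "idm R"]) simp

lemma is_model_iff_twist:
  assumes \<Phi>: "\<Phi> \<in> fmaps R N d"
  shows "is_model R N {scale_map R N c \<Phi> | c. c \<in> carrier R - {\<zero>}} \<Psi> \<longleftrightarrow> twist R N \<Phi> \<Psi>"
proof -
  have *: "conj_map R N A B (scale_map R N c \<Phi>) = scale_map R N c (conj_map R N A B \<Phi>)"
    if "inverse_matrices R N A B" "c \<in> carrier R - {\<zero>}" for A B c
    using that by (intro conj_map_scale[OF \<Phi>]) (simp_all add: inverse_matrices_iff)
  show ?thesis
  proof
    assume "is_model R N {scale_map R N c \<Phi> | c. c \<in> carrier R - {\<zero>}} \<Psi>"
    then obtain c A B where "c \<in> carrier R - {\<zero>}" "inverse_matrices R N A B"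
      "\<Psi> = conj_map R N A B (scale_map R N c \<Phi>)"
      unfolding is_model_def conj_map_def[symmetric] by blast
    then show "twist R N \<Phi> \<Psi>" unfolding twist_def using * by blast
  next
    assume "twist R N \<Phi> \<Psi>"
    then obtain c A B where "c \<in> carrier R - {\<zero>}" "inverse_matrices R N A B"
      "\<Psi> = conj_map R N A B (scale_map R N c \<Phi>)"
      unfolding twist_def using * by force
    then show "is_model R N {scale_map R N c \<Phi> | c. c \<in> carrier R - {\<zero>}} \<Psi>"
      unfolding is_model_def conj_map_def[symmetric] by blast
  qed
qed

end

text \<open>The resultant commutes with the inclusion of the subring, being an integral polynomial
  in the coefficients.\<close>

lemma (in cring) Res_subring:
  assumes V: "subring V R" and d: "d \<ge> 1"
    and \<Phi>: "\<Phi> \<in> fmaps R N d" "\<And>i m. i \<le> N \<Longrightarrow> \<Phi> i m \<in> V"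
  shows "Res R N d \<Phi> \<in> V"
proof -
  let ?V = "R\<lparr>carrier := V\<rparr>"
  have sub: "V \<subseteq> carrier R" using V by (rule subringE)
  interpret h: ring_hom_cring ?V R "\<lambda>x. x"
    using sub by (intro ring_hom_cringI subcring_iff[THEN iffD1, OF sub subcringI'[OF V]] cring_axioms)
      (auto simp: Ring.ring_hom_def)
  have f: "\<Phi> \<in> fmaps ?V N d"
    using \<Phi> unfolding fmaps_def forms_def by (auto simp: MP_carrier h.R.MP_carrier PiE_iff)
  have "map_coeffs N (\<lambda>x. x) \<Phi> = \<Phi>"
  proof
    fix i show "map_coeffs N (\<lambda>x. x) \<Phi> i = \<Phi> i"
      using \<Phi>(1) by (cases "i \<le> N") (auto simp: map_coeffs_def fmaps_def PiE_def extensional_def)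
  qed
  then show ?thesis using h.Res_map[OF d f] h.R.Res_closed[OF d f] by simp
qed

section \<open>Comparison of a model over \<open>R\<close> with the integral models over the
  completion\<close>

context frac_prime
begin

text \<open>The orders of a unit and of its inverse are nonnegative with sum zero.\<close>

lemma ord_Vunit:
  assumes "local_field.Vunit KC VR u"
  shows "completion_ord v u = 0"
proof -
  interpret lf: local_field K KC emb VR S \<pi> by (rule local_field)
  obtain u' where u: "u \<in> VR" "u' \<in> VR" "u \<otimes>\<^bsub>KC\<^esub> u' = \<one>\<^bsub>KC\<^esub>"
    using assms unfolding lf.Vunit_def by blast
  have "completion_ord v \<one>\<^bsub>KC\<^esub> = 0"
    using emb_ord[OF one_closed] ring_hom_one[OF emb_hom] v_one by simp
  then have "completion_ord v u + completion_ord v u' = 0"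
    using u ord_mult[of u u'] by (simp add: VR_iff)
  moreover have nn: "0 \<le> completion_ord v u" "0 \<le> completion_ord v u'" using u by (simp_all add: VR_iff)
  ultimately have "completion_ord v u \<le> 0" using add_left_mono[OF nn(2), of "completion_ord v u"] by simp
  then show ?thesis using nn(1) by (rule antisym)
qed

text \<open>The assumption \<open>max\<close> is maximality of the resultant ideal of
  \<open>\<Psi>\<close> among models over \<open>R\<close>, put as divisibility. It is applied to a
  single model, the map \<open>\<Psi>2\<close> that the descent produces from the local one.\<close>

lemma ord_Res_le_twist:
  assumes d: "d \<ge> 1" and \<Psi>: "\<Psi> \<in> fmaps K N d" "\<And>i m. i \<le> N \<Longrightarrow> \<Psi> i m \<in> R"
    and max: "\<And>\<Psi>' r. twist K N \<Psi> \<Psi>' \<Longrightarrow> (\<And>i m. i \<le> N \<Longrightarrow> \<Psi>' i m \<in> R) \<Longrightarrow> r \<in> R \<Longrightarrow>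
      Res K N d \<Psi> = r \<otimes> Res K N d \<Psi>' \<Longrightarrow> \<exists>r' \<in> R. Res K N d \<Psi>' = r' \<otimes> Res K N d \<Psi>"
    and AB: "inverse_matrices KC N A B" and c: "c \<in> carrier KC" "c \<noteq> \<zero>\<^bsub>KC\<^esub>"
    and int: "\<And>i m. i \<le> N \<Longrightarrow> scale_map KC N c (conj_map KC N A B (map_coeffs N emb \<Psi>)) i m \<in> VR"
  shows "completion_ord v (Res KC N d (map_coeffs N emb \<Psi>))
    \<le> completion_ord v (Res KC N d (scale_map KC N c (conj_map KC N A B (map_coeffs N emb \<Psi>))))"
proof -
  interpret lf: local_field K KC emb VR S \<pi> by (rule local_field)
  have S\<Psi>: "lf.S_integral N \<Psi>" using \<Psi>(2) R_S unfolding lf.S_integral_def by blast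
  let ?\<Theta> = "conj_map KC N A B (map_coeffs N emb \<Psi>)"
  \<comment> \<open>The descent moves the coordinates to \<open>K\<close>; the scalar
    \<open>c\<close> still belongs to the completion.\<close>
  obtain T T' where desc: "lf.descent N d ?\<Theta> \<Psi> T T'"
    by (rule lf.descendsD[OF lf.descends_all[OF d AB] AB \<Psi>(1) S\<Psi>])
  define \<Psi>1 where "\<Psi>1 = conj_map K N T T' \<Psi>"
  have T: "inverse_matrices K N T T'" "lf.S_integral N \<Psi>1" "lf.pi_equiv (Res K N d \<Psi>1) (Res K N d \<Psi>)"
    using desc unfolding lf.descent_def \<Psi>1_def by blast+
  have Tint: "lf.integral N (scale_map KC N c (map_coeffs N emb \<Psi>1))"
    using desc c int unfolding lf.descent_def \<Psi>1_def lf.integral_def by blast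
  obtain w where w: "lf.Vunit w" "Res KC N d ?\<Theta> = w \<otimes>\<^bsub>KC\<^esub> Res KC N d (map_coeffs N emb \<Psi>1)"
    using desc unfolding lf.descent_def \<Psi>1_def by blast
  have mT: "matc K N T" "matc K N T'" using T(1) by (simp_all add: inverse_matrices_iff)
  have f1: "\<Psi>1 \<in> fmaps K N d" unfolding \<Psi>1_def by (rule conj_map_fmaps[OF \<Psi>(1) mT])
  \<comment> \<open>The scalar is treated like a matrix of size one: the unit stays in the
    completion, and the power of \<open>\<pi>\<close> is applied over \<open>K\<close>.\<close>
  obtain u u' p where u: "u \<in> VR" "u' \<in> VR" "p \<in> lf.pows" "u \<otimes>\<^bsub>KC\<^esub> u' = \<one>\<^bsub>KC\<^esub>" "c = u \<otimes>\<^bsub>KC\<^esub> emb p"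
    using lf.factor'[OF c] by blast
  have pS: "p \<in> S" and pK: "p \<in> carrier K" using lf.pows_S[OF u(3)] by (auto simp: S_def)
  have uc: "u \<in> carrier KC" "u' \<in> carrier KC" "emb p \<in> carrier KC"
    using u pK by (auto simp: VR_iff intro: ring_hom_closed[OF emb_hom])
  have Vu: "lf.Vunit u" using u unfolding lf.Vunit_def by blast
  have p0: "p \<noteq> \<zero>"
  proof
    assume "p = \<zero>"
    then have "emb p = \<zero>\<^bsub>KC\<^esub>" using lf.\<iota>.hom_zero by simp
    then show False using c u uc by simp
  qed
  define \<Psi>2 where "\<Psi>2 = scale_map K N p \<Psi>1"
  have f2: "\<Psi>2 \<in> fmaps K N d" unfolding \<Psi>2_def by (rule scale_map_fmaps[OF pK f1])
  have tw: "twist K N \<Psi> \<Psi>2" unfolding twist_def \<Psi>2_def \<Psi>1_def using pK p0 T(1) by blast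
  have l1: "map_coeffs N emb \<Psi>1 \<in> fmaps KC N d" by (rule lf.\<iota>.map_coeffs_fmaps[OF f1])
  have l2: "map_coeffs N emb \<Psi>2 = scale_map KC N (emb p) (map_coeffs N emb \<Psi>1)"
    unfolding \<Psi>2_def by (rule lf.\<iota>.map_scale_map[OF f1 pK])
  \<comment> \<open>The coefficients of \<open>\<Psi>2\<close> lie in R[1/\<pi>], and removing the
    unit \<open>u\<close> shows that they have nonnegative valuation; hence they lie in
    \<open>R\<close>.\<close>
  have R2: "\<Psi>2 i m \<in> R" if i: "i \<le> N" for i m
  proof (rule S_integral_R)
    have "\<Psi>1 i m \<in> S" using T(2) i unfolding lf.S_integral_def by blast
    then show "\<Psi>2 i m \<in> S" using subringE(6)[OF S_subring pS] i by (simp add: \<Psi>2_def scale_map_def)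
    have xc: "\<Psi>1 i m \<in> carrier K" using MP_coeff[OF forms_carrier[OF fmaps_form[OF f1 i]]] .
    then have ec: "emb (\<Psi>1 i m) \<in> carrier KC" by (rule ring_hom_closed[OF emb_hom])
    have "c \<otimes>\<^bsub>KC\<^esub> emb (\<Psi>1 i m) \<in> VR"
      using Tint i unfolding lf.integral_def by (auto simp: scale_map_def map_coeffs_def)
    then have "u' \<otimes>\<^bsub>KC\<^esub> (c \<otimes>\<^bsub>KC\<^esub> emb (\<Psi>1 i m)) \<in> VR" by (rule subringE(6)[OF VR_subring u(2)])
    also have "u' \<otimes>\<^bsub>KC\<^esub> (c \<otimes>\<^bsub>KC\<^esub> emb (\<Psi>1 i m)) = (u \<otimes>\<^bsub>KC\<^esub> u') \<otimes>\<^bsub>KC\<^esub> (emb p \<otimes>\<^bsub>KC\<^esub> emb (\<Psi>1 i m))"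
      unfolding u(5) using uc ec by (simp add: cl.S.m_ac)
    also have "\<dots> = emb (\<Psi>2 i m)"
      using u(4) uc ec i xc pK lf.\<iota>.hom_mult[of p "\<Psi>1 i m"] by (simp add: \<Psi>2_def scale_map_def)
    finally have "emb (\<Psi>2 i m) \<in> VR" .
    moreover have "\<Psi>2 i m \<in> carrier K" using MP_coeff[OF forms_carrier[OF fmaps_form[OF f2 i]]] .
    ultimately show "0 \<le> v (\<Psi>2 i m)" by (simp add: emb_VR)
  qed
  let ?\<rho> = "Res K N d \<Psi>" and ?\<rho>1 = "Res K N d \<Psi>1" and ?\<rho>2 = "Res K N d \<Psi>2"
  have \<rho>: "?\<rho> \<in> carrier K" "?\<rho>1 \<in> carrier K" "?\<rho>2 \<in> carrier K" using Res_closed[OF d] \<Psi>(1) f1 f2 by blast+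
  obtain e :: nat where e: "\<And>c \<Phi>. c \<in> carrier K \<Longrightarrow> \<Phi> \<in> fmaps K N d \<Longrightarrow>
      Res K N d (scale_map K N c \<Phi>) = c [^] e \<otimes> Res K N d \<Phi>" by (rule Res_scale[OF d, where N = N], rule that)
  have "p [^] (0 :: nat) \<otimes> ?\<rho>2 = p [^] e \<otimes> ?\<rho>1" using e[OF pK f1] \<rho> unfolding \<Psi>2_def[symmetric] by simp
  then have "lf.pi_equiv ?\<rho>2 ?\<rho>1" by (rule lf.pi_equiv_pows[OF u(3) _ \<rho>(3,2)])
  then have "lf.pi_equiv ?\<rho>2 ?\<rho>" by (rule lf.pi_equiv_trans[OF _ T(3) \<rho>(3,2,1)])
  \<comment> \<open>The resultants of \<open>\<Psi>2\<close> and \<open>\<Psi>\<close> differ by a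
    power of \<open>\<pi>\<close>; the sign of its exponent separates the two cases below.\<close>
  then obtain a b :: nat where ab: "\<pi> [^] a \<otimes> ?\<rho>2 = \<pi> [^] b \<otimes> ?\<rho>" unfolding lf.pi_equiv_def by blast
  have cancel: "x = \<pi> [^] (j - i) \<otimes> y"
    if "i \<le> j" "\<pi> [^] i \<otimes> x = \<pi> [^] j \<otimes> y" "x \<in> carrier K" "y \<in> carrier K" for i j :: nat and x y
  proof -
    have "\<pi> [^] j = \<pi> [^] i \<otimes> \<pi> [^] (j - i)" using that(1) pc by (simp add: nat_pow_mult)
    then have "\<pi> [^] i \<otimes> x = \<pi> [^] i \<otimes> (\<pi> [^] (j - i) \<otimes> y)" using that \<pi> Rc by (simp add: m_assoc)
    then show ?thesis using m_lcancel[of "\<pi> [^] i" x "\<pi> [^] (j - i) \<otimes> y"] that \<pi> Rc pc(3) by simp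
  qed
  have "\<exists>r \<in> R. ?\<rho>2 = r \<otimes> ?\<rho>"
  proof (cases "a \<le> b")
    case True
    show ?thesis by (intro bexI[of _ "\<pi> [^] (b - a)"] cancel[OF True ab \<rho>(3,1)] R_pow[OF \<pi>(1)])
  next
    \<comment> \<open>Here the resultant ideal of \<open>\<Psi>\<close> is contained in that of
      \<open>\<Psi>2\<close>, and maximality gives the divisibility in the other direction.\<close>
    case False
    then have "b \<le> a" by simp
    show ?thesis
    proof (rule max[OF tw])
      show "\<Psi>2 i m \<in> R" if "i \<le> N" for i m by (rule R2[OF that])
      show "\<pi> [^] (a - b) \<in> R" by (rule R_pow[OF \<pi>(1)])
      show "?\<rho> = \<pi> [^] (a - b) \<otimes> ?\<rho>2" by (rule cancel[OF \<open>b \<le> a\<close> ab[symmetric] \<rho>(1,3)])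
    qed
  qed
  then obtain r where r: "r \<in> R" "?\<rho>2 = r \<otimes> ?\<rho>" by blast
  have le: "v ?\<rho> \<le> v ?\<rho>2"
    unfolding r(2) v_mult[OF Rc[OF r(1)] \<rho>(1)] using add_right_mono[OF v_R[OF r(1)], of "v ?\<rho>"] by simp
  \<comment> \<open>The exponent over the completion is obtained independently of \<open>e\<close>.
    Its power of \<open>emb p\<close> is absorbed into the resultant of \<open>\<Psi>2\<close>, and
    the power of \<open>u\<close> has order 0.\<close>
  obtain k :: nat where k: "\<And>c \<Phi>. c \<in> carrier KC \<Longrightarrow> \<Phi> \<in> fmaps KC N d \<Longrightarrow>
      Res KC N d (scale_map KC N c \<Phi>) = c [^]\<^bsub>KC\<^esub> k \<otimes>\<^bsub>KC\<^esub> Res KC N d \<Phi>" by (rule cl.S.Res_scale[OF d, where N = N], rule that)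
  let ?x = "Res KC N d (map_coeffs N emb \<Psi>1)"
  have xc: "?x \<in> carrier KC" by (rule cl.S.Res_closed[OF d l1])
  have wc: "w \<in> carrier KC" by (rule lf.Vunit_carrier[OF w(1)])
  have mAB: "matc KC N A" "matc KC N B" using AB by (simp_all add: inverse_matrices_iff)
  have "?\<Theta> \<in> fmaps KC N d" by (rule cl.S.conj_map_fmaps[OF lf.\<iota>.map_coeffs_fmaps[OF \<Psi>(1)] mAB])
  then have "Res KC N d (scale_map KC N c ?\<Theta>) = (u \<otimes>\<^bsub>KC\<^esub> emb p) [^]\<^bsub>KC\<^esub> k \<otimes>\<^bsub>KC\<^esub> (w \<otimes>\<^bsub>KC\<^esub> ?x)"
    using k[OF c(1)] w(2) u(5) by simp
  also have "\<dots> = (u [^]\<^bsub>KC\<^esub> k \<otimes>\<^bsub>KC\<^esub> w) \<otimes>\<^bsub>KC\<^esub> (emb p [^]\<^bsub>KC\<^esub> k \<otimes>\<^bsub>KC\<^esub> ?x)"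
    using uc wc xc by (simp add: cl.S.pow_mult_distrib[OF cl.S.m_comm] cl.S.m_ac)
  also have "emb p [^]\<^bsub>KC\<^esub> k \<otimes>\<^bsub>KC\<^esub> ?x = Res KC N d (map_coeffs N emb \<Psi>2)"
    unfolding l2 by (rule k[OF uc(3) l1, symmetric])
  also have "\<dots> = emb ?\<rho>2" by (rule lf.\<iota>.Res_map[OF d f2, symmetric])
  finally have "Res KC N d (scale_map KC N c ?\<Theta>) = (u [^]\<^bsub>KC\<^esub> k \<otimes>\<^bsub>KC\<^esub> w) \<otimes>\<^bsub>KC\<^esub> emb ?\<rho>2" .
  moreover have "completion_ord v (u [^]\<^bsub>KC\<^esub> k \<otimes>\<^bsub>KC\<^esub> w) = 0"
    by (intro ord_Vunit lf.Vunit_mult lf.Vunit_pow Vu w(1))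
  ultimately have "completion_ord v (Res KC N d (scale_map KC N c ?\<Theta>)) = v ?\<rho>2"
    using ord_mult[of "u [^]\<^bsub>KC\<^esub> k \<otimes>\<^bsub>KC\<^esub> w" "emb ?\<rho>2"] uc wc ring_hom_closed[OF emb_hom \<rho>(3)] emb_ord[OF \<rho>(3)] by simp
  moreover have "completion_ord v (Res KC N d (map_coeffs N emb \<Psi>)) = v ?\<rho>"
    unfolding lf.\<iota>.Res_map[OF d \<Psi>(1), symmetric] by (rule emb_ord[OF \<rho>(1)])
  ultimately show ?thesis using le by simp
qed

text \<open>A local integral model comes from a lift of \<open>\<phi>\<close>, and so does
  \<open>\<Psi>\<close>. Over the completion the local model is therefore a twist of
  \<open>\<Psi>\<close>, and \<open>ord_Res_le_twist\<close> applies.\<close>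

lemma minimal_modelI:
  assumes d: "d \<ge> 1" and \<Phi>: "\<Phi> \<in> fmaps K N d" and \<phi>: "\<phi> = {scale_map K N c \<Phi> | c. c \<in> carrier K - {\<zero>}}"
    and model: "is_model K N \<phi> \<Psi>" and \<Psi>R: "\<And>i m. i \<le> N \<Longrightarrow> \<Psi> i m \<in> R"
    and max: "\<And>\<Psi>' r. is_model K N \<phi> \<Psi>' \<Longrightarrow> (\<And>i m. i \<le> N \<Longrightarrow> \<Psi>' i m \<in> R) \<Longrightarrow> r \<in> R \<Longrightarrow>
      Res K N d \<Psi> = r \<otimes> Res K N d \<Psi>' \<Longrightarrow> \<exists>r' \<in> R. Res K N d \<Psi>' = r' \<otimes> Res K N d \<Psi>"
  shows "minimal_model K v N d \<phi> (map_coeffs N emb \<Psi>)"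
proof -
  interpret e: ring_hom_cring K KC emb by (rule emb_ring_hom_cring)
  have iff: "is_model K N \<phi> Z \<longleftrightarrow> twist K N \<Phi> Z" for Z unfolding \<phi> by (rule is_model_iff_twist[OF \<Phi>])
  have tw: "twist K N \<Phi> \<Psi>" using model iff by simp
  have \<Psi>: "\<Psi> \<in> fmaps K N d" by (rule twist_fmaps[OF \<Phi> tw])
  show ?thesis
    unfolding minimal_model_def
  proof (intro conjI allI impI)
    show "integral_model K v N \<phi> (map_coeffs N emb \<Psi>)"
      unfolding integral_model_def
    proof (intro conjI allI impI)
      obtain \<Phi>' A B where m: "\<Phi>' \<in> \<phi>" "inverse_matrices K N A B" "\<Psi> = conj_map K N A B \<Phi>'"
        using model unfolding is_model_def conj_map_def[symmetric] by blast
      have f: "\<Phi>' \<in> fmaps K N d" using m(1) scale_map_fmaps[OF _ \<Phi>] unfolding \<phi> by blast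
      \<comment> \<open>The lift itself occurs in the base change, with the scalar 1.\<close>
      have "map_coeffs N emb \<Phi>' = scale_map KC N \<one>\<^bsub>KC\<^esub> (map_coeffs N emb \<Phi>')"
        by (rule cl.S.scale_map_one[OF e.map_coeffs_fmaps[OF f], symmetric])
      then have "map_coeffs N emb \<Phi>' \<in> base_change KC N emb \<phi>"
        unfolding base_change_def using m(1) KC_one_not_zero cl.S.one_closed by blast
      moreover have "map_coeffs N emb \<Psi> = conj_map KC N (\<lambda>i j. emb (A i j)) (\<lambda>i j. emb (B i j)) (map_coeffs N emb \<Phi>')"
        unfolding m(3) using m(2) by (intro e.map_conj_map[OF f]) (simp_all add: inverse_matrices_iff)
      ultimately show "is_model KC N (base_change KC N emb \<phi>) (map_coeffs N emb \<Psi>)"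
        unfolding is_model_def conj_map_def[symmetric] using e.inverse_matrices_map[OF m(2)] by blast
      show "map_coeffs N emb \<Psi> i m \<in> VR" if "i \<le> N" for i m
        using emb_VR[OF Rc] v_R \<Psi>R that by (simp add: map_coeffs_def)
    qed
    fix \<Psi>' assume "integral_model K v N \<phi> \<Psi>'"
    then obtain \<Phi>' c A B where \<Psi>': "\<Phi>' \<in> \<phi>" "c \<in> carrier KC" "c \<noteq> \<zero>\<^bsub>KC\<^esub>" "inverse_matrices KC N A B"
      "\<Psi>' = conj_map KC N A B (scale_map KC N c (map_coeffs N emb \<Phi>'))"
      and int: "\<And>i m. i \<le> N \<Longrightarrow> \<Psi>' i m \<in> VR"
      unfolding integral_model_def is_model_def conj_map_def[symmetric] base_change_def by blast
    have "twist K N \<Phi> \<Phi>'" using \<Psi>'(1) twist_scale[OF \<Phi>] unfolding \<phi> by blast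
    then have "twist K N \<Psi> \<Phi>'" by (rule twist_trans[OF \<Psi> twist_sym[OF \<Phi> tw]])
    then obtain s C D where s: "s \<in> carrier K" "s \<noteq> \<zero>" "inverse_matrices K N C D"
      "\<Phi>' = scale_map K N s (conj_map K N C D \<Psi>)"
      unfolding twist_def by blast
    have m: "matc K N C" "matc K N D" "matc KC N A" "matc KC N B"
      using s(3) \<Psi>'(4) by (simp_all add: inverse_matrices_iff)
    let ?L = "map_coeffs N emb \<Psi>"
    let ?C = "\<lambda>i j. emb (C i j)" and ?D = "\<lambda>i j. emb (D i j)"
    note mL = e.matc_map[OF m(1)] e.matc_map[OF m(2)]
    have fL: "?L \<in> fmaps KC N d" by (rule e.map_coeffs_fmaps[OF \<Psi>])
    note fCD = cl.S.conj_map_fmaps[OF fL mL]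
    have sc: "emb s \<in> carrier KC" using s by simp
    have "map_coeffs N emb \<Phi>' = scale_map KC N (emb s) (conj_map KC N ?C ?D ?L)"
      unfolding s(4) e.map_scale_map[OF conj_map_fmaps[OF \<Psi> m(1,2)] s(1)] e.map_conj_map[OF \<Psi> m(1,2)] ..
    then have "scale_map KC N c (map_coeffs N emb \<Phi>') = scale_map KC N (c \<otimes>\<^bsub>KC\<^esub> emb s) (conj_map KC N ?C ?D ?L)"
      using cl.S.scale_map_scale_map[OF \<Psi>'(2) sc fCD] by simp
    then have "\<Psi>' = scale_map KC N (c \<otimes>\<^bsub>KC\<^esub> emb s) (conj_map KC N A B (conj_map KC N ?C ?D ?L))"
      unfolding \<Psi>'(5) using cl.S.conj_map_scale[OF fCD m(3,4) cl.S.m_closed[OF \<Psi>'(2) sc]] by simp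
    also have "conj_map KC N A B (conj_map KC N ?C ?D ?L) = conj_map KC N (mm KC N A ?C) (mm KC N ?D B) ?L"
      by (rule cl.S.conj_map_conj_map[OF fL m(3,4) mL])
    finally have eq: "\<Psi>' = scale_map KC N (c \<otimes>\<^bsub>KC\<^esub> emb s) (conj_map KC N (mm KC N A ?C) (mm KC N ?D B) ?L)" .
    \<comment> \<open>Multiplication by \<open>emb s\<close> is undone by
      \<open>emb (inv s)\<close>, so it cannot send the nonzero \<open>c\<close> to zero.\<close>
    have nz: "c \<otimes>\<^bsub>KC\<^esub> emb s \<noteq> \<zero>\<^bsub>KC\<^esub>"
    proof
      assume z: "c \<otimes>\<^bsub>KC\<^esub> emb s = \<zero>\<^bsub>KC\<^esub>"
      have i: "inv s \<in> carrier K" "s \<otimes> inv s = \<one>" using s field_Units by (auto simp: Units_r_inv)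
      have ei: "emb (inv s) \<in> carrier KC" "emb s \<otimes>\<^bsub>KC\<^esub> emb (inv s) = \<one>\<^bsub>KC\<^esub>"
        using i s e.hom_mult[of s "inv s"] by simp_all
      have "c = c \<otimes>\<^bsub>KC\<^esub> emb s \<otimes>\<^bsub>KC\<^esub> emb (inv s)" using \<Psi>'(2) sc ei by (simp add: cl.S.m_assoc)
      also have "\<dots> = \<zero>\<^bsub>KC\<^esub>" unfolding z using ei by simp
      finally show False using \<Psi>'(3) by simp
    qed
    show "completion_ord v (Res KC N d ?L) \<le> completion_ord v (Res KC N d \<Psi>')"
      unfolding eq
    proof (rule ord_Res_le_twist[OF d \<Psi> \<Psi>R])
      fix \<Psi>'' r
      assume *: "twist K N \<Psi> \<Psi>''" "\<And>i m. i \<le> N \<Longrightarrow> \<Psi>'' i m \<in> R" "r \<in> R" "Res K N d \<Psi> = r \<otimes> Res K N d \<Psi>''"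
      have "is_model K N \<phi> \<Psi>''" unfolding iff by (rule twist_trans[OF \<Phi> tw *(1)])
      then show "\<exists>r' \<in> R. Res K N d \<Psi>'' = r' \<otimes> Res K N d \<Psi>" using max *(2,3,4) by blast
    next
      show "inverse_matrices KC N (mm KC N A ?C) (mm KC N ?D B)"
        by (rule cl.S.inverse_matrices_mm[OF \<Psi>'(4) e.inverse_matrices_map[OF s(3)]])
      show "c \<otimes>\<^bsub>KC\<^esub> emb s \<in> carrier KC" "c \<otimes>\<^bsub>KC\<^esub> emb s \<noteq> \<zero>\<^bsub>KC\<^esub>" using \<Psi>'(2) sc nz by simp_all
      show "scale_map KC N (c \<otimes>\<^bsub>KC\<^esub> emb s) (conj_map KC N (mm KC N A ?C) (mm KC N ?D B) ?L) i m \<in> VR"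
        if "i \<le> N" for i m
        unfolding eq[symmetric] by (rule int[OF that])
    qed simp_all
  qed
qed

end

section \<open>Existence of a model with coefficients in \<open>R\<close>, and the choice of a
  maximal one\<close>

lemma (in field) common_denominator:
  assumes V: "subring V R"
    and frac: "\<forall>x \<in> carrier R. \<exists>a \<in> V. \<exists>b \<in> V - {\<zero>}. x = a \<otimes> inv b"
    and "finite Z" "Z \<subseteq> carrier R"
  shows "\<exists>c \<in> V - {\<zero>}. \<forall>x \<in> Z. c \<otimes> x \<in> V"
  using assms(3,4)
proof (induction Z)
  case empty
  then show ?case using subringE(3)[OF V] one_not_zero by blast
next
  case (insert x Z)
  then obtain c where c: "c \<in> V" "c \<noteq> \<zero>" "\<And>x. x \<in> Z \<Longrightarrow> c \<otimes> x \<in> V" by blast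
  obtain a b where ab: "a \<in> V" "b \<in> V" "b \<noteq> \<zero>" "x = a \<otimes> inv b" using frac insert.prems by blast
  have Vc: "y \<in> V \<Longrightarrow> y \<in> carrier R" for y using subringE(1)[OF V] by blast
  note Vm = subringE(6)[OF V]
  have cl: "a \<in> carrier R" "b \<in> carrier R" "c \<in> carrier R" "inv b \<in> carrier R" "b \<otimes> inv b = \<one>"
    using ab c Vc field_Units by (auto simp: Units_r_inv)
  show ?case
  proof (intro bexI[of _ "b \<otimes> c"] ballI)
    fix y assume "y \<in> insert x Z"
    then consider "y = x" | "y \<in> Z" by blast
    then show "(b \<otimes> c) \<otimes> y \<in> V"
    proof cases
      case 1
      have "(b \<otimes> c) \<otimes> y = (c \<otimes> a) \<otimes> (b \<otimes> inv b)" unfolding 1 ab(4) using cl(1-4) by (simp add: m_ac)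
      also have "\<dots> = c \<otimes> a" using cl by simp
      finally show ?thesis using Vm[OF c(1) ab(1)] by simp
    next
      case 2
      then have "y \<in> carrier R" using insert.prems by blast
      then have "(b \<otimes> c) \<otimes> y = b \<otimes> (c \<otimes> y)" using cl by (simp add: m_assoc)
      then show ?thesis using Vm[OF ab(2) c(3)[OF 2]] by simp
    qed
  next
    show "b \<otimes> c \<in> V - {\<zero>}" using Vm[OF ab(2) c(1)] integral[of b c] ab c cl by blast
  qed
qed

text \<open>A scalar that clears denominators is enough, since only the finitely many monomials of
  degree \<open>d\<close> can carry nonzero coefficients.\<close>

lemma (in field) integral_model_exists:
  assumes V: "subring V R"
    and frac: "\<forall>x \<in> carrier R. \<exists>a \<in> V. \<exists>b \<in> V - {\<zero>}. x = a \<otimes> inv b"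
    and \<Phi>: "\<Phi> \<in> fmaps R N d"
  shows "\<exists>\<Psi>. twist R N \<Phi> \<Psi> \<and> (\<forall>i\<le>N. \<forall>m. \<Psi> i m \<in> V)"
proof -
  let ?Z = "(\<lambda>(i, m). \<Phi> i m) ` ({..N} \<times> monomials N d)"
  have \<Phi>c: "\<Phi> i m \<in> carrier R" if "i \<le> N" for i m using MP_coeff[OF forms_carrier[OF fmaps_form[OF \<Phi> that]]] .
  have "finite ?Z" by (simp add: finite_monomials)
  moreover have "?Z \<subseteq> carrier R" using \<Phi>c by auto
  ultimately have "\<exists>c \<in> V - {\<zero>}. \<forall>x \<in> ?Z. c \<otimes> x \<in> V" by (rule common_denominator[OF V frac])
  then obtain c where c: "c \<in> V - {\<zero>}" and cZ: "\<forall>x \<in> ?Z. c \<otimes> x \<in> V" ..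
  have cc: "c \<in> carrier R - {\<zero>}" using c subringE(1)[OF V] by blast
  have "scale_map R N c \<Phi> i m \<in> V" if i: "i \<le> N" for i m
  proof (cases "m \<in> monomials N d")
    case True
    then have "c \<otimes> \<Phi> i m \<in> V" using cZ i by simp
    then show ?thesis using i by (simp add: scale_map_def)
  next
    case False
    then have "\<Phi> i m = \<zero>" using fmaps_form[OF \<Phi> i] by (auto simp: forms_def)
    then show ?thesis using subringE(2)[OF V] i cc by (simp add: scale_map_def)
  qed
  then show ?thesis using twist_scale[OF \<Phi> cc] by blast
qed

theorem theorem1:
  fixes K :: "'a ring" and R :: "'a set" and N d :: nat and \<phi> :: "'a poly_map set"
  assumes "field K"
    and "subring R K"
    and "principal_domain (K\<lparr>carrier := R\<rparr>)"
    and "\<forall>x \<in> carrier K. \<exists>a \<in> R. \<exists>b \<in> R - {\<zero>\<^bsub>K\<^esub>}. x = a \<otimes>\<^bsub>K\<^esub> inv\<^bsub>K\<^esub> b"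
    and "N \<ge> 1" and "d \<ge> 1"
    and "\<phi> \<in> proj_morphisms K N d"
  shows "\<exists>\<Psi>. is_model K N \<phi> \<Psi> \<and>
    (\<forall>i\<le>N. \<forall>m. \<Psi> i m \<in> R) \<and>
    (\<forall>P. primeideal P (K\<lparr>carrier := R\<rparr>) \<and> P \<noteq> {\<zero>\<^bsub>K\<^esub>} \<longrightarrow>
       minimal_model K (ord_at K R P) N d \<phi>
         (map_coeffs N (to_completion K (ord_at K R P)) \<Psi>))"
proof -
  interpret K: field K by fact
  let ?D = "K\<lparr>carrier := R\<rparr>"
  interpret D: principal_domain ?D by fact
  note R = assms(2) and frac = assms(4) and d = assms(6)
  obtain \<Phi> where \<Phi>: "\<Phi> \<in> fmaps K N d" and \<phi>: "\<phi> = {scale_map K N c \<Phi> | c. c \<in> carrier K - {\<zero>\<^bsub>K\<^esub>}}"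
    using assms(7) unfolding proj_morphisms_def nondegenerate_def fmaps_def by blast
  have iff: "is_model K N \<phi> Z \<longleftrightarrow> twist K N \<Phi> Z" for Z unfolding \<phi> by (rule K.is_model_iff_twist[OF \<Phi>])
  \<comment> \<open>This family does not refer to any prime, so the \<open>\<Psi>\<close> chosen
    from it is the same for all of them.\<close>
  define M where "M = {\<Psi>. is_model K N \<phi> \<Psi> \<and> (\<forall>i\<le>N. \<forall>m. \<Psi> i m \<in> R)}"
  have Res_R: "Res K N d Z \<in> R" if "Z \<in> M" for Z
    using that K.twist_fmaps[OF \<Phi>] unfolding M_def iff by (intro K.Res_subring[OF R d]) blast+
  let ?I = "\<lambda>Z. PIdl\<^bsub>?D\<^esub> (Res K N d Z)"
  have I: "?I Z = {r \<otimes>\<^bsub>K\<^esub> Res K N d Z | r. r \<in> R}" for Z by (simp add: cgenideal_def)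
  \<comment> \<open>Zorn's lemma applies to the resultant ideals because a nonempty chain of ideals
    contains its own union.\<close>
  have "\<exists>J \<in> ?I ` M. \<forall>J' \<in> ?I ` M. J \<subseteq> J' \<longrightarrow> J' = J"
  proof (rule subset_Zorn_nonempty)
    show "?I ` M \<noteq> {}" using K.integral_model_exists[OF R frac \<Phi>] unfolding M_def iff by blast
    fix C assume C: "C \<noteq> {}" "subset.chain (?I ` M) C"
    have "?I Z \<in> {J. ideal J ?D}" if "Z \<in> M" for Z using D.cgenideal_ideal Res_R[OF that] by simp
    then have "subset.chain {J. ideal J ?D} C" using C(2) unfolding subset.chain_def by blast
    then have "\<Union>C \<in> C" by (rule D.ideal_chain_is_trivial[OF C(1)])
    then show "\<Union>C \<in> ?I ` M" using C(2) unfolding subset.chain_def by blast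
  qed
  then obtain \<Psi> where \<Psi>: "\<Psi> \<in> M" and max: "\<And>Z. Z \<in> M \<Longrightarrow> ?I \<Psi> \<subseteq> ?I Z \<Longrightarrow> ?I Z = ?I \<Psi>" by blast
  have model: "is_model K N \<phi> \<Psi>" and \<Psi>R: "\<And>i m. i \<le> N \<Longrightarrow> \<Psi> i m \<in> R" using \<Psi> unfolding M_def by blast+
  show ?thesis
  proof (intro exI[of _ \<Psi>] conjI allI impI)
    show "is_model K N \<phi> \<Psi>" by (rule model)
    show "\<Psi> i m \<in> R" if "i \<le> N" for i m by (rule \<Psi>R[OF that])
    fix P assume P: "primeideal P ?D \<and> P \<noteq> {\<zero>\<^bsub>K\<^esub>}"
    obtain \<pi> where "frac_prime K R P \<pi>"
      using frac_prime_exists[OF assms(1-4)] P by blast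
    then interpret frac_prime K R P \<pi> .
    show "minimal_model K (ord_at K R P) N d \<phi> (map_coeffs N (to_completion K (ord_at K R P)) \<Psi>)"
    proof (rule minimal_modelI[OF d \<Phi> \<phi> model \<Psi>R])
      fix Z r
      assume Z: "is_model K N \<phi> Z" "\<And>i m. i \<le> N \<Longrightarrow> Z i m \<in> R" and r: "r \<in> R"
        and eq: "Res K N d \<Psi> = r \<otimes>\<^bsub>K\<^esub> Res K N d Z"
      have ZM: "Z \<in> M" using Z unfolding M_def by blast
      \<comment> \<open>Maximality of the ideal is translated into the divisibility that
        \<open>minimal_modelI\<close> asks for.\<close>
      have "Res K N d \<Psi> \<in> ?I Z" unfolding I using eq r by blast
      then have "?I \<Psi> \<subseteq> ?I Z" using D.cgenideal_minimal D.cgenideal_ideal[of "Res K N d Z"] Res_R[OF ZM] by simp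
      then have "?I Z = ?I \<Psi>" by (rule max[OF ZM])
      moreover have "Res K N d Z \<in> ?I Z" using D.cgenideal_self[of "Res K N d Z"] Res_R[OF ZM] by simp
      ultimately have "Res K N d Z \<in> ?I \<Psi>" by simp
      then show "\<exists>r' \<in> R. Res K N d Z = r' \<otimes>\<^bsub>K\<^esub> Res K N d \<Psi>" unfolding I by blast
    qed
  qed
qed

end
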